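(* Let $m,\ell\in\mathbb{N}$ with $m\geq 5$ and $1\le \ell\leq m$, and let $\alpha\in(0,\frac{\pi}{2})$ satisfy $$\sin^2\alpha=\frac{\ell(\ell+m-2)+2m-8}{2\ell(\ell+m-2)},$$ so that $q:=\big(\sin\alpha\cdot u^{(\ell)},\cos\alpha\big)\colon B^m\to\mathbb{S}^{m^{\ell}}\subset\mathbb{R}^{m^\ell}\times\mathbb{R}$ is a proper weak biharmonic map. If $$m> 2\left(\sqrt{12\ell^2+30\ell+12}+3\ell+6\right),$$ then $q$ is strictly stable.
   Context: $B^m\subset\mathbb{R}^m$ is the Euclidean unit ball, $\mathbb{S}^n\subset\mathbb{R}^{n+1}$ the Euclidean unit sphere, $r=\|x\|$, $y_i=x_i/r$. Generalized radial projection: $u^{(\ell)}=(u^{(\ell)}_{i_1\dots i_\ell})_{1\le i_1,\dots,i_\ell\le m}\colon\mathbb{R}^m\setminus\{0\}\to\mathbb{S}^{m^\ell-1}\subset\mathbb{R}^{m^\ell}$ is defined recursively by $u^{(1)}_{i_1}(x)=y_{i_1}$ and, for $\ell\ge2$, $$u^{(\ell)}_{i_1\ldots i_\ell}(x)=C_{\ell,m}\Big(y_{i_\ell}u^{(\ell-1)}_{i_1\ldots i_{\ell-1}}(x)-\frac{1}{\ell+m-3}\,r\,\frac{\partial}{\partial x_{i_\ell}}u^{(\ell-1)}_{i_1\ldots i_{\ell-1}}(x)\Big),\qquad C_{\ell,m}=\sqrt{\frac{\ell+m-3}{2\ell+m-4}}.$$ $W^{2,2}(B^m,\mathbb{S}^n)=\{u\in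 W^{2,2}(B^m,\mathbb{R}^{n+1}): u(x)\in\mathbb{S}^n \text{ a.e.}\}$. The bienergy of a map $u$ into $\mathbb{S}^n\subset\mathbb{R}^{n+1}$ is $$E_2(u)=\frac12\int_{B^m}\big(|\Delta u|^2-|\nabla u|^4\big)\,dx .$$ A map $u\in W^{2,2}(B^m,\mathbb{S}^n)$ is a weak biharmonic map if it solves, in the sense of distributions, $\Delta^2u+2\operatorname{div}(|\nabla u|^2\nabla u)-(\langle\Delta^2u,u\rangle-2|\nabla u|^4)u=0$. It is proper if it is not harmonic, i.e. does not solve $\Delta u+|\nabla u|^2u=0$. A variation of $u$ is a family $(u_t)_{|t|<\varepsilon}$ of maps in $W^{2,2}(B^m,\mathbb{S}^n)$ with $u_0=u$ and $u_t-u\in W^{2,2}_0(B^m,\mathbb{R}^{n+1})$, twice continuously differentiable in $t$ with respect to the norm of $W^{2,2}\cap L^\infty$; its variational field is $\eta=\frac{d u_t}{dt}|_{t=0}$. A biharmonic map $u$ is strictly stable if $\frac{d^2}{dt^2}E_2(u_t)|_{t=0}>0$ for all variations $u_t$ of $u$ with $\eta\not\equiv0$. *)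

theory Defs
  imports "HOL-Analysis.Analysis" "HOL-Probability.Essential_Supremum"
begin

section \<open>Classical derivatives and test functions\<close>

text \<open>The vector \<open>e\<close> ranges over coordinate directions, i.e. elements of \<^const>\<open>Basis\<close>.\<close>

definition partial_deriv ::
    "'a::euclidean_space \<Rightarrow> ('a \<Rightarrow> 'b::real_normed_vector) \<Rightarrow> 'a \<Rightarrow> 'b" where
  "partial_deriv e f x = vector_derivative (\<lambda>t. f (x + t *\<^sub>R e)) (at 0)"

definition laplacian ::
    "('a::euclidean_space \<Rightarrow> 'b::real_normed_vector) \<Rightarrow> 'a \<Rightarrow> 'b" where
  "laplacian f x = (\<Sum>e\<in>Basis. partial_deriv e (partial_deriv e f) x)"

fun C_k :: "nat \<Rightarrow> ('a::euclidean_space \<Rightarrow> 'b::real_normed_vector) \<Rightarrow> bool" where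
  "C_k 0 f \<longleftrightarrow> continuous_on UNIV f"
| "C_k (Suc k) f \<longleftrightarrow> f differentiable_on UNIV \<and> (\<forall>e\<in>Basis. C_k k (partial_deriv e f))"

text \<open>Elements of $C_c^\infty(\Omega)$, extended by zero to the whole space.\<close>

definition test_function ::
    "'a::euclidean_space set \<Rightarrow> ('a \<Rightarrow> 'b::real_normed_vector) \<Rightarrow> bool" where
  "test_function \<Omega> \<phi> \<longleftrightarrow>
     (\<forall>k. C_k k \<phi>) \<and> compact (closure {x. \<phi> x \<noteq> 0}) \<and> closure {x. \<phi> x \<noteq> 0} \<subseteq> \<Omega>"


section \<open>Weak derivatives\<close>

definition locally_integrable ::
    "'a::euclidean_space set \<Rightarrow> ('a \<Rightarrow> 'b::euclidean_space) \<Rightarrow> bool" where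
  "locally_integrable \<Omega> f \<longleftrightarrow> (\<forall>K. compact K \<and> K \<subseteq> \<Omega> \<longrightarrow> integrable (lebesgue_on K) f)"

definition has_weak_deriv ::
    "'a::euclidean_space set \<Rightarrow> 'a \<Rightarrow> ('a \<Rightarrow> 'b::euclidean_space) \<Rightarrow> ('a \<Rightarrow> 'b) \<Rightarrow> bool" where
  "has_weak_deriv \<Omega> e f g \<longleftrightarrow>
     locally_integrable \<Omega> f \<and> locally_integrable \<Omega> g \<and>
     (\<forall>\<phi>::'a \<Rightarrow> real. test_function \<Omega> \<phi> \<longrightarrow>
        (LINT x|lebesgue_on \<Omega>. partial_deriv e \<phi> x *\<^sub>R f x)
          = - (LINT x|lebesgue_on \<Omega>. \<phi> x *\<^sub>R g x))"

text \<open>Weak derivatives are unique only up to null sets; \<open>weak_deriv\<close> picks a representative.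
  It is used below only inside integrals and almost-everywhere statements.\<close>

definition weak_deriv ::
    "'a::euclidean_space set \<Rightarrow> 'a \<Rightarrow> ('a \<Rightarrow> 'b::euclidean_space) \<Rightarrow> 'a \<Rightarrow> 'b" where
  "weak_deriv \<Omega> e f = (SOME g. has_weak_deriv \<Omega> e f g)"

definition weak_laplacian ::
    "'a::euclidean_space set \<Rightarrow> ('a \<Rightarrow> 'b::euclidean_space) \<Rightarrow> 'a \<Rightarrow> 'b" where
  "weak_laplacian \<Omega> f x = (\<Sum>e\<in>Basis. weak_deriv \<Omega> e (weak_deriv \<Omega> e f) x)"

text \<open>$|\nabla f|^2$ (Hilbert--Schmidt norm of the weak gradient).\<close>

definition grad_sq ::
    "'a::euclidean_space set \<Rightarrow> ('a \<Rightarrow> 'b::euclidean_space) \<Rightarrow> 'a \<Rightarrow> real" where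
  "grad_sq \<Omega> f x = (\<Sum>e\<in>Basis. (norm (weak_deriv \<Omega> e f x))\<^sup>2)"


section \<open>Function spaces\<close>

definition L2 :: "'a::euclidean_space set \<Rightarrow> ('a \<Rightarrow> 'b::euclidean_space) \<Rightarrow> bool" where
  "L2 \<Omega> f \<longleftrightarrow> f \<in> borel_measurable (lebesgue_on \<Omega>) \<and>
     integrable (lebesgue_on \<Omega>) (\<lambda>x. (norm (f x))\<^sup>2)"

definition L2_norm_sq :: "'a::euclidean_space set \<Rightarrow> ('a \<Rightarrow> 'b::euclidean_space) \<Rightarrow> real" where
  "L2_norm_sq \<Omega> f = (LINT x|lebesgue_on \<Omega>. (norm (f x))\<^sup>2)"

definition Linf :: "'a::euclidean_space set \<Rightarrow> ('a \<Rightarrow> 'b::euclidean_space) \<Rightarrow> bool" where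
  "Linf \<Omega> f \<longleftrightarrow> f \<in> borel_measurable (lebesgue_on \<Omega>) \<and>
     esssup (lebesgue_on \<Omega>) (\<lambda>x. ereal (norm (f x))) < \<infinity>"

definition Linf_norm :: "'a::euclidean_space set \<Rightarrow> ('a \<Rightarrow> 'b::euclidean_space) \<Rightarrow> real" where
  "Linf_norm \<Omega> f = real_of_ereal (esssup (lebesgue_on \<Omega>) (\<lambda>x. ereal (norm (f x))))"

text \<open>\<open>sobolev k \<Omega> f\<close> means $f\in W^{k,2}(\Omega)$.\<close>

fun sobolev :: "nat \<Rightarrow> 'a::euclidean_space set \<Rightarrow> ('a \<Rightarrow> 'b::euclidean_space) \<Rightarrow> bool" where
  "sobolev 0 \<Omega> f \<longleftrightarrow> L2 \<Omega> f"
| "sobolev (Suc k) \<Omega> f \<longleftrightarrow>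
     L2 \<Omega> f \<and> (\<forall>e\<in>Basis. \<exists>g. has_weak_deriv \<Omega> e f g \<and> sobolev k \<Omega> g)"

definition W22_norm :: "'a::euclidean_space set \<Rightarrow> ('a \<Rightarrow> 'b::euclidean_space) \<Rightarrow> real" where
  "W22_norm \<Omega> f = sqrt (L2_norm_sq \<Omega> f
     + (\<Sum>e\<in>Basis. L2_norm_sq \<Omega> (weak_deriv \<Omega> e f))
     + (\<Sum>e\<in>Basis. \<Sum>e'\<in>Basis. L2_norm_sq \<Omega> (weak_deriv \<Omega> e' (weak_deriv \<Omega> e f))))"

text \<open>$W^{2,2}_0(\Omega)$: the closure of $C_c^\infty(\Omega)$ in $W^{2,2}(\Omega)$.\<close>

definition W22_0 :: "'a::euclidean_space set \<Rightarrow> ('a \<Rightarrow> 'b::euclidean_space) \<Rightarrow> bool" where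
  "W22_0 \<Omega> f \<longleftrightarrow> sobolev 2 \<Omega> f \<and>
     (\<exists>\<phi>::nat \<Rightarrow> 'a \<Rightarrow> 'b. (\<forall>n. test_function \<Omega> (\<phi> n)) \<and>
        (\<lambda>n. W22_norm \<Omega> (\<lambda>x. \<phi> n x - f x)) \<longlonglongrightarrow> 0)"

definition W22_sphere :: "'a::euclidean_space set \<Rightarrow> ('a \<Rightarrow> 'b::euclidean_space) \<Rightarrow> bool" where
  "W22_sphere \<Omega> u \<longleftrightarrow> sobolev 2 \<Omega> u \<and> (AE x in lebesgue_on \<Omega>. u x \<in> sphere 0 1)"

definition W22_Linf :: "'a::euclidean_space set \<Rightarrow> ('a \<Rightarrow> 'b::euclidean_space) \<Rightarrow> bool" where
  "W22_Linf \<Omega> f \<longleftrightarrow> sobolev 2 \<Omega> f \<and> Linf \<Omega> f"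

definition W22_Linf_norm :: "'a::euclidean_space set \<Rightarrow> ('a \<Rightarrow> 'b::euclidean_space) \<Rightarrow> real" where
  "W22_Linf_norm \<Omega> f = W22_norm \<Omega> f + Linf_norm \<Omega> f"


section \<open>Biharmonic maps into spheres\<close>

definition bienergy :: "'a::euclidean_space set \<Rightarrow> ('a \<Rightarrow> 'b::euclidean_space) \<Rightarrow> real" where
  "bienergy \<Omega> u = 1/2 * (LINT x|lebesgue_on \<Omega>.
     (norm (weak_laplacian \<Omega> u x))\<^sup>2 - (grad_sq \<Omega> u x)\<^sup>2)"

text \<open>The distributional equation
  $\Delta^2u+2\,\mathrm{div}(|\nabla u|^2\nabla u)-(\langle\Delta^2u,u\rangle-2|\nabla u|^4)u=0$,
  tested with vector-valued $\varphi\in C_c^\infty(\Omega)$.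
  The distribution $\langle\Delta^2u,u\rangle u$ is the product of $\Delta^2u\in W^{-2,2}$ with
  functions in $W^{2,2}\cap L^\infty$: applied to $\varphi$ it is
  $\Delta^2u$ applied to $\langle u,\varphi\rangle u$, which is the third integral below.
  All integrals converge, because $\nabla u\in L^4_{loc}$ for $u\in W^{2,2}\cap L^\infty$.\<close>

definition weak_biharmonic_map ::
    "'a::euclidean_space set \<Rightarrow> ('a \<Rightarrow> 'b::euclidean_space) \<Rightarrow> bool" where
  "weak_biharmonic_map \<Omega> u \<longleftrightarrow> W22_sphere \<Omega> u \<and>
     (\<forall>\<phi>::'a \<Rightarrow> 'b. test_function \<Omega> \<phi> \<longrightarrow>
        (LINT x|lebesgue_on \<Omega>. weak_laplacian \<Omega> u x \<bullet> laplacian \<phi> x)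
        - 2 * (LINT x|lebesgue_on \<Omega>.
            grad_sq \<Omega> u x * (\<Sum>e\<in>Basis. weak_deriv \<Omega> e u x \<bullet> partial_deriv e \<phi> x))
        - (LINT x|lebesgue_on \<Omega>.
            weak_laplacian \<Omega> u x \<bullet> weak_laplacian \<Omega> (\<lambda>y. (u y \<bullet> \<phi> y) *\<^sub>R u y) x)
        + 2 * (LINT x|lebesgue_on \<Omega>. (grad_sq \<Omega> u x)\<^sup>2 * (u x \<bullet> \<phi> x)) = 0)"

text \<open>For $u\in W^{2,2}$ both terms of $\Delta u+|\nabla u|^2u$ are functions, so that the
  equation may be read almost everywhere.\<close>

definition harmonic_map ::
    "'a::euclidean_space set \<Rightarrow> ('a \<Rightarrow> 'b::euclidean_space) \<Rightarrow> bool" where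
  "harmonic_map \<Omega> u \<longleftrightarrow> W22_sphere \<Omega> u \<and>
     (AE x in lebesgue_on \<Omega>. weak_laplacian \<Omega> u x + grad_sq \<Omega> u x *\<^sub>R u x = 0)"

definition proper_weak_biharmonic_map ::
    "'a::euclidean_space set \<Rightarrow> ('a \<Rightarrow> 'b::euclidean_space) \<Rightarrow> bool" where
  "proper_weak_biharmonic_map \<Omega> u \<longleftrightarrow> weak_biharmonic_map \<Omega> u \<and> \<not> harmonic_map \<Omega> u"


section \<open>Variations and stability\<close>

text \<open>\<open>V\<close> is the derivative of the curve \<open>U\<close> on $(-\varepsilon,\varepsilon)$ with respect to the norm
  of $W^{2,2}\cap L^\infty$.\<close>

definition W22_Linf_curve_deriv ::
    "'a::euclidean_space set \<Rightarrow> real \<Rightarrow> (real \<Rightarrow> 'a \<Rightarrow> 'b::euclidean_space) \<Rightarrow>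
     (real \<Rightarrow> 'a \<Rightarrow> 'b) \<Rightarrow> bool" where
  "W22_Linf_curve_deriv \<Omega> \<epsilon> U V \<longleftrightarrow>
     (\<forall>t. \<bar>t\<bar> < \<epsilon> \<longrightarrow> W22_Linf \<Omega> (U t) \<and> W22_Linf \<Omega> (V t) \<and>
        ((\<lambda>h. W22_Linf_norm \<Omega> (\<lambda>x. (U (t + h) x - U t x) /\<^sub>R h - V t x)) \<longlongrightarrow> 0) (at 0))"

definition W22_Linf_curve_continuous ::
    "'a::euclidean_space set \<Rightarrow> real \<Rightarrow> (real \<Rightarrow> 'a \<Rightarrow> 'b::euclidean_space) \<Rightarrow> bool" where
  "W22_Linf_curve_continuous \<Omega> \<epsilon> U \<longleftrightarrow>
     (\<forall>t. \<bar>t\<bar> < \<epsilon> \<longrightarrow> W22_Linf \<Omega> (U t) \<and>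
        ((\<lambda>h. W22_Linf_norm \<Omega> (\<lambda>x. U (t + h) x - U t x)) \<longlongrightarrow> 0) (at 0))"

text \<open>\<open>U\<close> is a variation of \<open>u\<close> with variational field \<open>\<eta>\<close>. Only the values \<open>U t\<close> with
  $|t|<\varepsilon$ matter.\<close>

definition variation_with_field ::
    "'a::euclidean_space set \<Rightarrow> ('a \<Rightarrow> 'b::euclidean_space) \<Rightarrow> real \<Rightarrow> (real \<Rightarrow> 'a \<Rightarrow> 'b) \<Rightarrow>
     ('a \<Rightarrow> 'b) \<Rightarrow> bool" where
  "variation_with_field \<Omega> u \<epsilon> U \<eta> \<longleftrightarrow>
     0 < \<epsilon> \<and>
     (\<forall>t. \<bar>t\<bar> < \<epsilon> \<longrightarrow> W22_sphere \<Omega> (U t) \<and> W22_0 \<Omega> (\<lambda>x. U t x - u x)) \<and>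
     (AE x in lebesgue_on \<Omega>. U 0 x = u x) \<and>
     (\<exists>U' U''. W22_Linf_curve_deriv \<Omega> \<epsilon> U U' \<and> W22_Linf_curve_deriv \<Omega> \<epsilon> U' U'' \<and>
        W22_Linf_curve_continuous \<Omega> \<epsilon> U'' \<and> \<eta> = U' 0)"

definition has_second_deriv :: "(real \<Rightarrow> real) \<Rightarrow> real \<Rightarrow> real \<Rightarrow> bool" where
  "has_second_deriv f D t \<longleftrightarrow>
     (\<exists>f'. (\<forall>\<^sub>F s in nhds t. (f has_real_derivative f' s) (at s)) \<and>
           (f' has_real_derivative D) (at t))"

definition strictly_stable ::
    "'a::euclidean_space set \<Rightarrow> ('a \<Rightarrow> 'b::euclidean_space) \<Rightarrow> bool" where
  "strictly_stable \<Omega> u \<longleftrightarrow> weak_biharmonic_map \<Omega> u \<and>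
     (\<forall>\<epsilon> U \<eta>. variation_with_field \<Omega> u \<epsilon> U \<eta> \<and> \<not> (AE x in lebesgue_on \<Omega>. \<eta> x = 0) \<longrightarrow>
        (\<exists>D. has_second_deriv (\<lambda>t. bienergy \<Omega> (U t)) D 0 \<and> D > 0))"


section \<open>The generalized radial projection\<close>

text \<open>\<open>radial_proj l i\<close> is the component $u^{(l)}_{i_1\dots i_l}$; it depends only on the values
  of \<open>i\<close> on \<open>{1..l}\<close>. The clause for \<open>0\<close> is a dummy. At the origin, where
  the map is undefined, it takes some arbitrary value.\<close>

fun radial_proj :: "nat \<Rightarrow> (nat \<Rightarrow> 'm::finite) \<Rightarrow> real^'m \<Rightarrow> real" where
  "radial_proj 0 i = (\<lambda>x. 1)"
| "radial_proj (Suc 0) i = (\<lambda>x. x $ i 1 / norm x)"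
| "radial_proj (Suc (Suc k)) i = (\<lambda>x.
     let l = real (Suc (Suc k)); m = real CARD('m); j = i (Suc (Suc k)) in
       sqrt ((l + m - 3) / (2 * l + m - 4)) *
       (x $ j / norm x * radial_proj (Suc k) i x
        - 1 / (l + m - 3) * norm x * partial_deriv (axis j 1) (radial_proj (Suc k) i) x))"

text \<open>$\mathbb{R}^{m^l}$ is realized as \<open>real^'k\<close>, where \<open>\<iota>\<close> enumerates the multi-indices
  $(i_1,\dots,i_l)$ by \<open>'k\<close>.\<close>

definition multi_index_enum :: "nat \<Rightarrow> ('k::finite \<Rightarrow> nat \<Rightarrow> 'm::finite) \<Rightarrow> bool" where
  "multi_index_enum l \<iota> \<longleftrightarrow> bij_betw \<iota> UNIV ({1..l} \<rightarrow>\<^sub>E UNIV)"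

definition radial_proj_vec ::
    "nat \<Rightarrow> ('k::finite \<Rightarrow> nat \<Rightarrow> 'm::finite) \<Rightarrow> real^'m \<Rightarrow> real^'k" where
  "radial_proj_vec l \<iota> x = (\<chi> k. radial_proj l (\<iota> k) x)"

definition q_map ::
    "nat \<Rightarrow> ('k::finite \<Rightarrow> nat \<Rightarrow> 'm::finite) \<Rightarrow> real \<Rightarrow> real^'m \<Rightarrow> (real^'k) \<times> real" where
  "q_map l \<iota> \<alpha> x = (sin \<alpha> *\<^sub>R radial_proj_vec l \<iota> x, cos \<alpha>)"

end

theory Submission
  imports Defs "HOL-Computational_Algebra.Polynomial"
begin

text \<open>
  Write $u=u^{(\ell)}$, $\lambda=\ell(\ell+m-2)$ and $r=|x|$. The components of $u$ are homogeneous of degree 0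
  and satisfy $\Delta u=-\lambda r^{-2}u$, and $|u|=1$ (\<open>radial_expr_properties\<close>, \<open>radial_expr_unit\<close>). Therefore
  $|\nabla q|^2=g\,r^{-2}$ with $g=\lambda\sin^2\alpha$, and the choice of $\alpha$ says $2g=\lambda+2m-8$. Two consequences
  carry everything: $q$ solves the \<^emph>\<open>linear\<close> equation $\Delta^2q+2\operatorname{div}(|\nabla q|^2\nabla q)=0$, and
  $\langle\Delta^2q,q\rangle=2|\nabla q|^4$, so that the multiplier of the biharmonic map equation vanishes. Both hold
  pointwise off the origin, and the singularity at the origin is too weak to be seen by test functions
  (\<open>linear_equation\<close>, \<open>second_equation\<close>). The constant last component of $q$ violates the harmonic map
  equation.

  Let $\eta$ and $\zeta$ be the first and second derivatives of a variation. Because of the linear equation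
  all terms with $\zeta$ disappear from the second variation, which is
  \[ \int|\Delta\eta|^2-2|\nabla q|^2|\nabla\eta|^2-4\langle\nabla q,\nabla\eta\rangle^2
     \ge\int|\Delta\eta|^2-6g\,r^{-2}|\nabla\eta|^2. \]
  The Hardy--Rellich inequality $\int r^{-2}|\nabla\eta|^2\le\frac{4}{m^2}\int|\Delta\eta|^2$ on $W^{2,2}_0$
  (\<open>hardy_rellich\<close>) bounds this below by $(1-24g/m^2)\int|\Delta\eta|^2$, and $24g<m^2$ is a quadratic
  inequality in $m$ that is equivalent to the hypothesis on $m$ and $\ell$ (\<open>dimension_bound\<close>).

  Three devices keep the analysis elementary. Singular functions are written as expressions in
  the coordinates and $1/r$, and $1/r$ is regularized to $1/\sqrt{r^2+\varepsilon}$; weak derivatives follow by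
  dominated convergence (\<open>hwd_ev\<close>). The Hardy--Rellich inequality in dimension at least 8 comes from one
  pointwise inequality up to a divergence (\<open>hardy_rellich_test\<close>). Finally $|U|=1$ implies
  $|\nabla U|^2=-\langle U,\Delta U\rangle$, so the bienergy is $\frac12\int|\Delta U|^2-\langle U,\Delta U\rangle^2$; this is built from a curve in
  $L^\infty$ and a curve in $L^2$ and is twice differentiable by the product rule
  (\<open>second_variation_positive\<close>).
\<close>

section \<open>Calculus of smooth maps\<close>

definition smooth :: "('a::euclidean_space \<Rightarrow> 'b::real_normed_vector) \<Rightarrow> bool" where
  "smooth f \<longleftrightarrow> (\<forall>k. C_k k f)"

lemma partial_deriv_eqI:
  assumes "(f has_derivative F) (at x)"
  shows "partial_deriv e f x = F e"
proof -
  have "((\<lambda>t. f (x + t *\<^sub>R e)) has_derivative (\<lambda>t. F (t *\<^sub>R e))) (at 0)"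
    by (rule has_derivative_compose[of "\<lambda>t. x + t *\<^sub>R e" _ 0 UNIV f F, simplified])
       (auto intro!: derivative_eq_intros assms)
  moreover have "F (t *\<^sub>R e) = t *\<^sub>R F e" for t
    using assms has_derivative_bounded_linear linear_simps(5) by blast
  ultimately have "((\<lambda>t. f (x + t *\<^sub>R e)) has_vector_derivative F e) (at 0)"
    by (simp add: has_vector_derivative_def)
  then show ?thesis
    unfolding partial_deriv_def by (rule vector_derivative_at)
qed

lemma differentiable_has_partial:
  assumes "f differentiable (at x)"
  shows "((\<lambda>t. f (x + t *\<^sub>R e)) has_vector_derivative partial_deriv e f x) (at 0)"
proof -
  obtain F where F: "(f has_derivative F) (at x)"
    using assms differentiable_def by blast
  have "((\<lambda>t. f (x + t *\<^sub>R e)) has_derivative (\<lambda>t. F (t *\<^sub>R e))) (at 0)"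
    by (rule has_derivative_compose[of "\<lambda>t. x + t *\<^sub>R e" _ 0 UNIV f F, simplified])
       (auto intro!: derivative_eq_intros F)
  moreover have "F (t *\<^sub>R e) = t *\<^sub>R F e" for t
    using F has_derivative_bounded_linear linear_simps(5) by blast
  ultimately show ?thesis
    by (simp add: has_vector_derivative_def partial_deriv_eqI[OF F])
qed

lemma differentiable_has_partial_along:
  assumes "f differentiable (at (x + s *\<^sub>R e))"
  shows "((\<lambda>t. f (x + t *\<^sub>R e)) has_vector_derivative partial_deriv e f (x + s *\<^sub>R e)) (at s)"
proof -
  have "((\<lambda>t. f (x + s *\<^sub>R e + t *\<^sub>R e)) has_vector_derivative partial_deriv e f (x + s *\<^sub>R e)) (at 0)"
    by (rule differentiable_has_partial[OF assms])
  then have "((\<lambda>t. f (x + s *\<^sub>R e + t *\<^sub>R e)) \<circ> (\<lambda>t. t - s) has_vector_derivative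
      (1 *\<^sub>R partial_deriv e f (x + s *\<^sub>R e))) (at s)"
    by (intro vector_diff_chain_at) (auto intro!: derivative_eq_intros)
  then show ?thesis
    by (simp add: o_def algebra_simps)
qed

lemma C_k_mono_Suc: "C_k (Suc k) f \<Longrightarrow> C_k k f"
proof (induction k arbitrary: f)
  case 0
  then show ?case
    by (auto intro: differentiable_imp_continuous_on)
next
  case (Suc k)
  then show ?case by (metis C_k.simps(2))
qed

lemma smooth_iff:
  "smooth f \<longleftrightarrow> f differentiable_on UNIV \<and> (\<forall>e\<in>Basis. smooth (partial_deriv e f))"
proof
  assume "smooth f"
  then show "f differentiable_on UNIV \<and> (\<forall>e\<in>Basis. smooth (partial_deriv e f))"
    by (metis C_k.simps(2) smooth_def)
next
  assume *: "f differentiable_on UNIV \<and> (\<forall>e\<in>Basis. smooth (partial_deriv e f))"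
  show "smooth f"
    unfolding smooth_def
  proof
    fix k show "C_k k f"
      using * by (cases k) (auto simp: smooth_def intro: differentiable_imp_continuous_on)
  qed
qed

lemma smooth_differentiable: "smooth f \<Longrightarrow> f differentiable (at x)"
  using smooth_iff[of f] by (simp add: differentiable_on_eq_differentiable_at)

lemma smooth_partial: "smooth f \<Longrightarrow> e \<in> Basis \<Longrightarrow> smooth (partial_deriv e f)"
  using smooth_iff[of f] by blast

lemma smooth_continuous: "smooth f \<Longrightarrow> continuous_on A f"
  using continuous_on_subset[of UNIV f A] C_k.simps(1)[of f] smooth_def[of f] by blast

text \<open>Smoothness asks for partial derivatives of every order, so it is a greatest fixed point: a class
  of differentiable functions that is closed under partial derivatives consists of smooth functions,
  without any counting of orders.\<close>

lemma smooth_coinduct: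
  assumes "P f"
    and step: "\<And>f. P f \<Longrightarrow> f differentiable_on UNIV \<and> (\<forall>e\<in>Basis. P (partial_deriv e f))"
  shows "smooth f"
proof -
  have "C_k k f" if "P f" for k f
    using that
  proof (induction k arbitrary: f)
    case 0
    then show ?case using step[OF 0] by (auto intro: differentiable_imp_continuous_on)
  next
    case (Suc k)
    then show ?case using step[OF Suc.prems] by auto
  qed
  then show ?thesis using assms(1) by (simp add: smooth_def)
qed

lemma partial_deriv_const [simp]: "partial_deriv e (\<lambda>x. c) = (\<lambda>x. 0)"
  by (auto intro!: partial_deriv_eqI derivative_eq_intros)

lemma smooth_const: "smooth (\<lambda>x. c)"
  by (rule smooth_coinduct[where P="\<lambda>f. \<exists>c. f = (\<lambda>x. c)"]) auto

lemma partial_deriv_add: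
  assumes "f differentiable (at x)" "g differentiable (at x)"
  shows "partial_deriv e (\<lambda>x. f x + g x) x = partial_deriv e f x + partial_deriv e g x"
proof -
  obtain F G where F: "(f has_derivative F) (at x)" "(g has_derivative G) (at x)"
    using assms by (auto simp: differentiable_def)
  have "((\<lambda>x. f x + g x) has_derivative (\<lambda>h. F h + G h)) (at x)"
    by (intro derivative_intros F)
  from partial_deriv_eqI[OF this] show ?thesis
    by (simp add: partial_deriv_eqI[OF F(1)] partial_deriv_eqI[OF F(2)])
qed

lemma partial_deriv_bilinear:
  assumes "bounded_bilinear P" "f differentiable (at x)" "g differentiable (at x)"
  shows "partial_deriv e (\<lambda>x. P (f x) (g x)) x = P (partial_deriv e f x) (g x) + P (f x) (partial_deriv e g x)"
proof -
  obtain F G where F: "(f has_derivative F) (at x)" "(g has_derivative G) (at x)"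
    using assms by (auto simp: differentiable_def)
  have "((\<lambda>x. P (f x) (g x)) has_derivative (\<lambda>h. P (f x) (G h) + P (F h) (g x))) (at x)"
    by (rule bounded_bilinear.FDERIV[OF assms(1) F])
  from partial_deriv_eqI[OF this] show ?thesis
    by (simp add: partial_deriv_eqI[OF F(1)] partial_deriv_eqI[OF F(2)])
qed

lemma C_k_differentiable: "C_k (Suc k) f \<Longrightarrow> f differentiable (at x)"
  by (simp add: differentiable_on_eq_differentiable_at)

lemma C_k_add: "C_k k f \<Longrightarrow> C_k k g \<Longrightarrow> C_k k (\<lambda>x. f x + g x)"
proof (induction k arbitrary: f g)
  case 0
  then show ?case by (auto intro: continuous_intros)
next
  case (Suc k)
  have "partial_deriv e (\<lambda>x. f x + g x) = (\<lambda>x. partial_deriv e f x + partial_deriv e g x)" for e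
    by (rule ext) (intro partial_deriv_add C_k_differentiable[OF Suc.prems(1)] C_k_differentiable[OF Suc.prems(2)])
  then show ?case
    using Suc by (auto intro!: differentiable_on_add)
qed

text \<open>The product rule turns a derivative of a product into a sum of products in which one factor has
  lost an order and the other has not; hence the induction runs over sums as well, and it uses that
  the classes decrease with the order.\<close>

lemma C_k_bilinear:
  assumes "bounded_bilinear P"
  shows "C_k k f \<Longrightarrow> C_k k g \<Longrightarrow> C_k k (\<lambda>x. P (f x) (g x))"
proof (induction k arbitrary: f g)
  case 0
  then show ?case by (auto intro: bounded_bilinear.continuous_on[OF assms])
next
  case (Suc k)
  have *: "partial_deriv e (\<lambda>x. P (f x) (g x)) =
      (\<lambda>x. P (partial_deriv e f x) (g x) + P (f x) (partial_deriv e g x))" for e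
    by (rule ext) (intro partial_deriv_bilinear assms C_k_differentiable[OF Suc.prems(1)] C_k_differentiable[OF Suc.prems(2)])
  have "(\<lambda>x. P (f x) (g x)) differentiable_on UNIV"
    using C_k_differentiable[OF Suc.prems(1)] C_k_differentiable[OF Suc.prems(2)]
    unfolding differentiable_on_eq_differentiable_at[OF open_UNIV] differentiable_def
    using bounded_bilinear.FDERIV[OF assms] by blast
  moreover have "C_k k (\<lambda>x. P (partial_deriv e f x) (g x) + P (f x) (partial_deriv e g x))"
    if "e \<in> Basis" for e
    using Suc.prems that C_k_mono_Suc[OF Suc.prems(1)] C_k_mono_Suc[OF Suc.prems(2)]
    by (intro C_k_add Suc.IH) auto
  ultimately show ?case
    using * by simp
qed

lemma smooth_add: "smooth f \<Longrightarrow> smooth g \<Longrightarrow> smooth (\<lambda>x. f x + g x)"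
  by (simp add: smooth_def C_k_add)

lemma smooth_bilinear: "bounded_bilinear P \<Longrightarrow> smooth f \<Longrightarrow> smooth g \<Longrightarrow> smooth (\<lambda>x. P (f x) (g x))"
  by (simp add: smooth_def C_k_bilinear)

lemmas smooth_scaleR = smooth_bilinear[OF bounded_bilinear_scaleR]
lemmas smooth_mult = smooth_bilinear[OF bounded_bilinear_mult]
lemmas smooth_inner = smooth_bilinear[OF bounded_bilinear_inner]

lemma smooth_sum: "finite A \<Longrightarrow> (\<And>a. a \<in> A \<Longrightarrow> smooth (f a)) \<Longrightarrow> smooth (\<lambda>x. \<Sum>a\<in>A. f a x)"
  by (induction A rule: finite_induct) (auto intro: smooth_const smooth_add)

lemma smooth_prod: "finite A \<Longrightarrow> (\<And>a. a \<in> A \<Longrightarrow> smooth (f a)) \<Longrightarrow> smooth (\<lambda>x. \<Prod>a\<in>A. f a x :: real)"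
  by (induction A rule: finite_induct) (auto intro: smooth_const smooth_mult)

lemma partial_deriv_inner_const: "partial_deriv e (\<lambda>x. x \<bullet> v) = (\<lambda>x. e \<bullet> v)"
  by (rule ext, rule partial_deriv_eqI) (auto intro!: derivative_eq_intros)

lemma smooth_coord: "smooth (\<lambda>x. x \<bullet> v)"
proof (subst smooth_iff, intro conjI ballI)
  show "(\<lambda>x. x \<bullet> v) differentiable_on UNIV"
    by (auto simp: differentiable_on_def intro!: derivative_intros)
qed (simp add: partial_deriv_inner_const smooth_const)

lemma pd_add: "smooth f \<Longrightarrow> smooth g \<Longrightarrow>
    partial_deriv e (\<lambda>x. f x + g x) x = partial_deriv e f x + partial_deriv e g x"
  by (simp add: partial_deriv_add smooth_differentiable)

lemma pd_bilinear: "bounded_bilinear P \<Longrightarrow> smooth f \<Longrightarrow> smooth g \<Longrightarrow>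
    partial_deriv e (\<lambda>x. P (f x) (g x)) x = P (partial_deriv e f x) (g x) + P (f x) (partial_deriv e g x)"
  by (simp add: partial_deriv_bilinear smooth_differentiable)

lemmas pd_scaleR = pd_bilinear[OF bounded_bilinear_scaleR]
lemmas pd_mult = pd_bilinear[OF bounded_bilinear_mult]
lemmas pd_inner = pd_bilinear[OF bounded_bilinear_inner]

lemma pd_sum: "finite A \<Longrightarrow> (\<And>a. a \<in> A \<Longrightarrow> smooth (f a)) \<Longrightarrow>
    partial_deriv e (\<lambda>x. \<Sum>a\<in>A. f a x) x = (\<Sum>a\<in>A. partial_deriv e (f a) x)"
  by (induction A rule: finite_induct) (simp_all add: pd_add smooth_sum)

lemma pd_zero_of_open_zero:
  assumes "open S" "x \<in> S" "\<And>y. y \<in> S \<Longrightarrow> f y = 0"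
  shows "partial_deriv e f x = 0"
proof -
  have "((\<lambda>x. 0) has_derivative (\<lambda>h. 0)) (at x)" by simp
  then have "(f has_derivative (\<lambda>h. 0)) (at x)"
    by (rule has_derivative_transform_within_open[of _ _ _ UNIV S]) (use assms in auto)
  then show ?thesis by (rule partial_deriv_eqI)
qed

text \<open>The second difference is symmetric in the two directions, and two applications of the mean value
  theorem, first along \<open>i\<close> and then along \<open>j\<close>, express it by one of the two mixed derivatives.
  Exchanging the directions gives the other one, and the equality of mixed derivatives follows in
  the limit \<open>h \<rightarrow> 0\<close>.\<close>

lemma mixed_difference:
  fixes f :: "'a::euclidean_space \<Rightarrow> real"
  assumes f: "smooth f" and i: "i \<in> Basis" and j: "j \<in> Basis" and h: "h > 0"
  shows "\<exists>s t. 0 < s \<and> s < h \<and> 0 < t \<and> t < h \<and>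
     f (x + h *\<^sub>R i + h *\<^sub>R j) - f (x + h *\<^sub>R i) - f (x + h *\<^sub>R j) + f x
       = h * h * partial_deriv j (partial_deriv i f) (x + s *\<^sub>R i + t *\<^sub>R j)"
proof -
  let ?g = "\<lambda>s. f ((x + h *\<^sub>R j) + s *\<^sub>R i) - f (x + s *\<^sub>R i)"
  let ?g' = "\<lambda>s. partial_deriv i f ((x + h *\<^sub>R j) + s *\<^sub>R i) - partial_deriv i f (x + s *\<^sub>R i)"
  have "(?g has_real_derivative ?g' s) (at s)" for s
    by (simp add: has_real_derivative_iff_has_vector_derivative)
      (intro derivative_intros differentiable_has_partial_along smooth_differentiable f)
  then obtain s where s: "0 < s" "s < h" "?g h - ?g 0 = (h - 0) * ?g' s"
    using MVT2[OF h, of ?g ?g'] by blast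
  let ?k = "\<lambda>t. partial_deriv i f ((x + s *\<^sub>R i) + t *\<^sub>R j)"
  let ?k' = "\<lambda>t. partial_deriv j (partial_deriv i f) ((x + s *\<^sub>R i) + t *\<^sub>R j)"
  have "(?k has_real_derivative ?k' t) (at t)" for t
    by (simp add: has_real_derivative_iff_has_vector_derivative)
      (intro differentiable_has_partial_along smooth_differentiable smooth_partial f i)
  then obtain t where t: "0 < t" "t < h" "?k h - ?k 0 = (h - 0) * ?k' t"
    using MVT2[OF h, of ?k ?k'] by blast
  have "?g' s = ?k h - ?k 0" by (simp add: algebra_simps)
  then have "?g h - ?g 0 = h * h * ?k' t" using s t by simp
  then show ?thesis using s t by (intro exI[of _ s] exI[of _ t]) (simp add: algebra_simps)
qed

lemma mixed_partial_real:
  fixes f :: "'a::euclidean_space \<Rightarrow> real"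
  assumes f: "smooth f" and i: "i \<in> Basis" and j: "j \<in> Basis"
  shows "partial_deriv j (partial_deriv i f) x = partial_deriv i (partial_deriv j f) x"
proof -
  define h where "h n = inverse (real (Suc n))" for n
  have hp: "h n > 0" for n by (simp add: h_def)
  have h0: "h \<longlonglongrightarrow> 0" unfolding h_def by (rule LIMSEQ_inverse_real_of_nat)
  obtain s t where st: "\<And>n. 0 < s n \<and> s n < h n \<and> 0 < t n \<and> t n < h n \<and>
     f (x + h n *\<^sub>R i + h n *\<^sub>R j) - f (x + h n *\<^sub>R i) - f (x + h n *\<^sub>R j) + f x
       = h n * h n * partial_deriv j (partial_deriv i f) (x + s n *\<^sub>R i + t n *\<^sub>R j)"
    using mixed_difference[OF f i j hp, where x=x] by metis
  obtain s' t' where st': "\<And>n. 0 < s' n \<and> s' n < h n \<and> 0 < t' n \<and> t' n < h n \<and>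
     f (x + h n *\<^sub>R j + h n *\<^sub>R i) - f (x + h n *\<^sub>R j) - f (x + h n *\<^sub>R i) + f x
       = h n * h n * partial_deriv i (partial_deriv j f) (x + s' n *\<^sub>R j + t' n *\<^sub>R i)"
    using mixed_difference[OF f j i hp, where x=x] by metis
  have eq: "partial_deriv j (partial_deriv i f) (x + s n *\<^sub>R i + t n *\<^sub>R j)
      = partial_deriv i (partial_deriv j f) (x + s' n *\<^sub>R j + t' n *\<^sub>R i)" for n
  proof -
    have "h n * h n * partial_deriv j (partial_deriv i f) (x + s n *\<^sub>R i + t n *\<^sub>R j)
      = h n * h n * partial_deriv i (partial_deriv j f) (x + s' n *\<^sub>R j + t' n *\<^sub>R i)"
      using conjunct2[OF conjunct2[OF conjunct2[OF conjunct2[OF st[of n]]]]]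
            conjunct2[OF conjunct2[OF conjunct2[OF conjunct2[OF st'[of n]]]]]
      by (simp add: algebra_simps)
    then show ?thesis using hp[of n] by simp
  qed
  have z: "u \<longlonglongrightarrow> 0" if "\<And>n. 0 < u n \<and> u n < h n" for u
  proof (rule tendsto_sandwich[OF _ _ tendsto_const h0])
    show "\<forall>\<^sub>F n in sequentially. 0 \<le> u n" using that by (intro always_eventually allI less_imp_le) blast
    show "\<forall>\<^sub>F n in sequentially. u n \<le> h n" using that by (intro always_eventually allI less_imp_le) blast
  qed
  have lim: "(\<lambda>n. g (x + a n *\<^sub>R v + b n *\<^sub>R w)) \<longlonglongrightarrow> g x"
    if "smooth g" "a \<longlonglongrightarrow> 0" "b \<longlonglongrightarrow> 0" for g :: "'a \<Rightarrow> real" and a b v w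
  proof -
    have "isCont g x"
      using smooth_continuous[OF that(1), of UNIV] by (simp add: continuous_on_eq_continuous_at)
    moreover have "(\<lambda>n. x + a n *\<^sub>R v + b n *\<^sub>R w) \<longlonglongrightarrow> x + 0 *\<^sub>R v + 0 *\<^sub>R w"
      by (intro tendsto_intros that)
    ultimately show ?thesis
      using isCont_tendsto_compose[of x g "\<lambda>n. x + a n *\<^sub>R v + b n *\<^sub>R w" sequentially] by simp
  qed
  have sz: "s \<longlonglongrightarrow> 0" by (rule z) (use st in blast)
  have tz: "t \<longlonglongrightarrow> 0" by (rule z) (use st in blast)
  have s'z: "s' \<longlonglongrightarrow> 0" by (rule z) (use st' in blast)
  have t'z: "t' \<longlonglongrightarrow> 0" by (rule z) (use st' in blast)
  have 1: "(\<lambda>n. partial_deriv j (partial_deriv i f) (x + s n *\<^sub>R i + t n *\<^sub>R j))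
     \<longlonglongrightarrow> partial_deriv j (partial_deriv i f) x"
    by (rule lim) (simp_all add: smooth_partial f i j sz tz)
  have 2: "(\<lambda>n. partial_deriv i (partial_deriv j f) (x + s' n *\<^sub>R j + t' n *\<^sub>R i))
     \<longlonglongrightarrow> partial_deriv i (partial_deriv j f) x"
    by (rule lim) (simp_all add: smooth_partial f i j s'z t'z)
  show ?thesis
    using LIMSEQ_unique[OF 1] 2 by (simp add: eq)
qed

lemma mixed_partial:
  fixes f :: "'a::euclidean_space \<Rightarrow> 'b::euclidean_space"
  assumes f: "smooth f" and i: "i \<in> Basis" and j: "j \<in> Basis"
  shows "partial_deriv j (partial_deriv i f) x = partial_deriv i (partial_deriv j f) x"
proof (rule euclidean_eqI)
  fix b :: 'b
  have pd: "partial_deriv e (\<lambda>x. g x \<bullet> b) = (\<lambda>x. partial_deriv e g x \<bullet> b)" if "smooth g" for g :: "'a \<Rightarrow> 'b" and e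
    using pd_inner[OF that smooth_const[of b]] by auto
  have "smooth (\<lambda>x. f x \<bullet> b)" by (intro smooth_inner f smooth_const)
  from mixed_partial_real[OF this i j, of x]
  show "partial_deriv j (partial_deriv i f) x \<bullet> b = partial_deriv i (partial_deriv j f) x \<bullet> b"
    using f i j by (simp add: pd smooth_partial)
qed

section \<open>Integration by parts\<close>

lemma integral_translation:
  fixes g :: "'a::euclidean_space \<Rightarrow> 'b::euclidean_space"
  assumes "g \<in> borel_measurable borel"
  shows "integral\<^sup>L lborel (\<lambda>x. g (x + a)) = integral\<^sup>L lborel g"
proof -
  have "integral\<^sup>L lborel g = integral\<^sup>L (distr lborel borel (\<lambda>x. a + x)) g"
    by (simp add: lborel_distr_plus)
  also have "\<dots> = integral\<^sup>L lborel (\<lambda>x. g (a + x))"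
    by (rule integral_distr) (auto simp: assms)
  finally show ?thesis by (simp add: add.commute)
qed

lemma integrable_continuous_compact_support:
  fixes g :: "'a::euclidean_space \<Rightarrow> 'b::euclidean_space"
  assumes "continuous_on UNIV g" "compact K" "\<And>x. x \<notin> K \<Longrightarrow> g x = 0"
  shows "integrable lborel g"
proof -
  have "integrable lborel (\<lambda>x. indicator K x *\<^sub>R g x)"
    by (rule borel_integrable_compact) (use assms continuous_on_subset in blast)+
  moreover have "(\<lambda>x. indicator K x *\<^sub>R g x) = g"
    using assms(3) by (auto simp: indicator_def)
  ultimately show ?thesis
    by simp
qed

lemma has_vector_derivative_quotient:
  fixes f :: "real \<Rightarrow> 'a::real_normed_vector"
  assumes "(f has_vector_derivative v) (at 0)"
  shows "((\<lambda>t. inverse t *\<^sub>R (f t - f 0)) \<longlongrightarrow> v) (at (0::real))"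
proof -
  have "((\<lambda>t. (1 / norm (t - 0)) *\<^sub>R (f t - (f 0 + (t - 0) *\<^sub>R v))) \<longlongrightarrow> 0) (at 0)"
    using assms unfolding has_vector_derivative_def has_derivative_at2 by simp
  then have "((\<lambda>t. norm ((1 / norm (t - 0)) *\<^sub>R (f t - (f 0 + (t - 0) *\<^sub>R v)))) \<longlongrightarrow> 0) (at 0)"
    by (rule tendsto_norm_zero)
  moreover have "\<forall>\<^sub>F t in at (0::real). norm ((1 / norm (t - 0)) *\<^sub>R (f t - (f 0 + (t - 0) *\<^sub>R v)))
      = norm (inverse t *\<^sub>R (f t - f 0) - v)"
    unfolding eventually_at_filter
  proof (rule always_eventually, intro allI impI)
    fix t :: real assume "t \<noteq> 0"
    then have "inverse t *\<^sub>R (f t - f 0) - v = inverse t *\<^sub>R (f t - (f 0 + (t - 0) *\<^sub>R v))"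
      by (simp add: algebra_simps)
    then show "norm ((1 / norm (t - 0)) *\<^sub>R (f t - (f 0 + (t - 0) *\<^sub>R v)))
      = norm (inverse t *\<^sub>R (f t - f 0) - v)"
      by (simp add: divide_inverse)
  qed
  ultimately have "((\<lambda>t. norm (inverse t *\<^sub>R (f t - f 0) - v)) \<longlongrightarrow> 0) (at 0)"
    by (rule Lim_transform_eventually)
  then show ?thesis by (simp add: tendsto_norm_zero_iff LIM_zero_iff)
qed

text \<open>By translation invariance the difference quotients of \<open>g\<close> have integral zero. They are
  bounded by the maximum of the derivative and live on a common ball, so the integral passes to the
  limit.\<close>

lemma integral_partial_zero:
  fixes g :: "'a::euclidean_space \<Rightarrow> 'b::euclidean_space"
  assumes g: "smooth g" and e: "e \<in> Basis" and K: "compact K" "\<And>x. x \<notin> K \<Longrightarrow> g x = 0"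
  shows "integral\<^sup>L lborel (partial_deriv e g) = 0"
proof -
  have pz: "partial_deriv e g x = 0" if "x \<notin> K" for x
    by (rule pd_zero_of_open_zero[of "-K"]) (use K that compact_imp_closed in auto)
  have cp: "continuous_on A (partial_deriv e g)" for A
    by (intro smooth_continuous smooth_partial g e)
  have cg: "continuous_on A g" for A by (intro smooth_continuous g)
  have mg: "g \<in> borel_measurable borel" by (intro borel_measurable_continuous_onI cg)
  obtain M where M: "\<And>x. x \<in> K \<Longrightarrow> norm (partial_deriv e g x) \<le> M"
    using compact_imp_bounded[OF compact_continuous_image[OF cp K(1)]]
    by (auto simp: bounded_iff)
  define M' where "M' = max M 0"
  have M': "norm (partial_deriv e g x) \<le> M'" for x
    using M[of x] pz[of x] by (cases "x \<in> K") (auto simp: M'_def)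
  obtain R where R: "\<And>x. x \<in> K \<Longrightarrow> norm x \<le> R"
    using compact_imp_bounded[OF K(1)] by (auto simp: bounded_iff)
  define h where "h n = inverse (real (Suc n))" for n
  have hp: "h n > 0" "h n \<le> 1" for n by (auto simp: h_def field_simps)
  define q where "q n x = inverse (h n) *\<^sub>R (g (x + h n *\<^sub>R e) - g x)" for n x
  have gi: "integrable lborel g" by (rule integrable_continuous_compact_support[OF cg K])
  have gi': "integrable lborel (\<lambda>x. g (x + a))" for a
  proof (rule integrable_continuous_compact_support)
    show "continuous_on UNIV (\<lambda>x. g (x + a))"
      by (rule continuous_on_compose2[OF cg[of UNIV]]) (auto intro: continuous_intros)
    show "compact ((\<lambda>x. x - a) ` K)" by (rule compact_continuous_image[OF _ K(1)]) (intro continuous_intros)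
    fix x assume "x \<notin> (\<lambda>x. x - a) ` K"
    then have "x + a \<notin> K" by (metis add_diff_cancel imageI)
    then show "g (x + a) = 0" by (rule K(2))
  qed
  have q0: "integral\<^sup>L lborel (q n) = 0" for n
    unfolding q_def by (simp add: gi gi' integral_translation[OF mg])
  have qb: "norm (q n x) \<le> M'" for n x
  proof -
    have "norm (g (x + h n *\<^sub>R e) - g (x + 0 *\<^sub>R e)) \<le> M' * norm (h n - 0)"
    proof (rule differentiable_bound[of UNIV "\<lambda>t. g (x + t *\<^sub>R e)" "\<lambda>t s. s *\<^sub>R partial_deriv e g (x + t *\<^sub>R e)"])
      show "((\<lambda>t. g (x + t *\<^sub>R e)) has_derivative (\<lambda>s. s *\<^sub>R partial_deriv e g (x + t *\<^sub>R e))) (at t within UNIV)" for t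
        using differentiable_has_partial_along[of g x t e, OF smooth_differentiable[OF g]]
        by (simp add: has_vector_derivative_def)
      show "onorm (\<lambda>s. s *\<^sub>R partial_deriv e g (x + t *\<^sub>R e)) \<le> M'" for t
        by (rule onorm_le) (use M'[of "x + t *\<^sub>R e"] in \<open>simp add: mult.commute[of M'] mult_left_mono\<close>)
    qed auto
    then have "norm (g (x + h n *\<^sub>R e) - g x) \<le> M' * h n" using hp[of n] by simp
    moreover have "norm (q n x) = norm (g (x + h n *\<^sub>R e) - g x) / h n"
      using hp[of n] by (simp add: q_def divide_inverse_commute del: scaleR_diff_right)
    ultimately show ?thesis using hp[of n] by (simp add: pos_divide_le_eq)
  qed
  have ql: "(\<lambda>n. q n x) \<longlonglongrightarrow> partial_deriv e g x" for x
  proof -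
    have "((\<lambda>t. g (x + t *\<^sub>R e)) has_vector_derivative partial_deriv e g x) (at 0)"
      by (intro differentiable_has_partial smooth_differentiable g)
    from has_vector_derivative_quotient[OF this]
    have "((\<lambda>t. inverse t *\<^sub>R (g (x + t *\<^sub>R e) - g x)) \<longlongrightarrow> partial_deriv e g x) (at 0)"
      by simp
    moreover have "filterlim h (at 0) sequentially"
      using LIMSEQ_inverse_real_of_nat by (auto simp: filterlim_at h_def[abs_def])
    ultimately show ?thesis
      unfolding q_def by (rule filterlim_compose)
  qed
  have "(\<lambda>n. integral\<^sup>L lborel (q n)) \<longlonglongrightarrow> integral\<^sup>L lborel (partial_deriv e g)"
  proof (rule integral_dominated_convergence[where w="\<lambda>x. M' * indicator (cball 0 (R+1)) x"])
    show "partial_deriv e g \<in> borel_measurable lborel"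
      using cp[of UNIV] by (simp add: borel_measurable_continuous_onI)
    show "q n \<in> borel_measurable lborel" for n
      unfolding q_def using gi gi' by (intro borel_measurable_integrable) simp
    show "integrable lborel (\<lambda>x. M' * indicat_real (cball 0 (R + 1)) x)"
      by (intro integrable_mult_right integrable_real_indicator) (auto simp: emeasure_lborel_cball_finite[simplified])
    show "AE x in lborel. (\<lambda>n. q n x) \<longlonglongrightarrow> partial_deriv e g x" using ql by simp
    show "AE x in lborel. norm (q n x) \<le> M' * indicator (cball 0 (R+1)) x" for n
    proof (rule AE_I2)
      fix x
      show "norm (q n x) \<le> M' * indicator (cball 0 (R+1)) x"
      proof (cases "norm x \<le> R + 1")
        case True then show ?thesis using qb by simp
      next
        case False
        then have "x \<notin> K" using R[of x] by auto
        moreover have "x + h n *\<^sub>R e \<notin> K"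
        proof
          assume "x + h n *\<^sub>R e \<in> K"
          then have "norm (x + h n *\<^sub>R e) \<le> R" by (rule R)
          moreover have "norm x \<le> norm (x + h n *\<^sub>R e) + norm (h n *\<^sub>R e)"
            by (metis add_diff_cancel norm_triangle_ineq4)
          moreover have "norm (h n *\<^sub>R e) \<le> 1" using hp[of n] e by simp
          ultimately show False using False by simp
        qed
        moreover have "M' \<ge> 0" by (simp add: M'_def)
        ultimately show ?thesis using K(2) by (simp add: q_def)
      qed
    qed
  qed
  then show ?thesis by (simp add: q0 LIMSEQ_const_iff)
qed

text \<open>Any compact set outside which the function vanishes can take the place of the closed support.\<close>

lemma test_function_iff:
  "test_function \<Omega> \<phi> \<longleftrightarrow> smooth \<phi> \<and> (\<exists>K. compact K \<and> K \<subseteq> \<Omega> \<and> (\<forall>x. x \<notin> K \<longrightarrow> \<phi> x = 0))"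
proof
  assume "test_function \<Omega> \<phi>"
  then show "smooth \<phi> \<and> (\<exists>K. compact K \<and> K \<subseteq> \<Omega> \<and> (\<forall>x. x \<notin> K \<longrightarrow> \<phi> x = 0))"
    unfolding test_function_def smooth_def
    by (intro conjI exI[of _ "closure {x. \<phi> x \<noteq> 0}"]) (auto simp: closure_def)
next
  assume "smooth \<phi> \<and> (\<exists>K. compact K \<and> K \<subseteq> \<Omega> \<and> (\<forall>x. x \<notin> K \<longrightarrow> \<phi> x = 0))"
  then obtain K where K: "smooth \<phi>" "compact K" "K \<subseteq> \<Omega>" "\<And>x. x \<notin> K \<Longrightarrow> \<phi> x = 0" by blast
  then have "closure {x. \<phi> x \<noteq> 0} \<subseteq> K"
    by (intro closure_minimal compact_imp_closed) auto
  moreover from this have "compact (closure {x. \<phi> x \<noteq> 0})"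
    using K(2) compact_Int_closed[of K "closure {x. \<phi> x \<noteq> 0}"] by (simp add: Int_absorb1)
  ultimately show "test_function \<Omega> \<phi>"
    using K unfolding test_function_def smooth_def by blast
qed

lemma test_smooth: "test_function \<Omega> \<phi> \<Longrightarrow> smooth \<phi>"
  by (simp add: test_function_iff)

lemma test_partial:
  assumes "test_function \<Omega> \<phi>" "e \<in> Basis"
  shows "test_function \<Omega> (partial_deriv e \<phi>)"
proof -
  obtain K where K: "smooth \<phi>" "compact K" "K \<subseteq> \<Omega>" "\<And>x. x \<notin> K \<Longrightarrow> \<phi> x = 0"
    using assms by (auto simp: test_function_iff)
  have "partial_deriv e \<phi> x = 0" if "x \<notin> K" for x
    by (rule pd_zero_of_open_zero[of "-K"]) (use K that compact_imp_closed in auto)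
  then show ?thesis
    unfolding test_function_iff using K assms smooth_partial by blast
qed

lemma test_add: "test_function \<Omega> \<phi> \<Longrightarrow> test_function \<Omega> \<psi> \<Longrightarrow> test_function \<Omega> (\<lambda>x. \<phi> x + \<psi> x)"
  unfolding test_function_iff
proof (elim conjE exE, intro conjI smooth_add)
  fix K K' assume "compact K" "K \<subseteq> \<Omega>" "\<forall>x. x \<notin> K \<longrightarrow> \<phi> x = 0"
    "compact K'" "K' \<subseteq> \<Omega>" "\<forall>x. x \<notin> K' \<longrightarrow> \<psi> x = 0"
  then show "\<exists>K. compact K \<and> K \<subseteq> \<Omega> \<and> (\<forall>x. x \<notin> K \<longrightarrow> \<phi> x + \<psi> x = 0)"
    by (intro exI[of _ "K \<union> K'"]) auto
qed

lemma test_bilinear: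
  assumes "bounded_bilinear P" "test_function \<Omega> \<phi>" "smooth \<psi>"
  shows "test_function \<Omega> (\<lambda>x. P (\<phi> x) (\<psi> x))"
  using assms unfolding test_function_iff
  by (auto intro: smooth_bilinear simp: bounded_bilinear.zero_left)

lemmas test_mult = test_bilinear[OF bounded_bilinear_mult]
lemmas test_scaleR = test_bilinear[OF bounded_bilinear_scaleR]
lemmas test_inner = test_bilinear[OF bounded_bilinear_inner]

lemma LINT_supported:
  fixes f :: "'a::euclidean_space \<Rightarrow> 'b::euclidean_space"
  assumes "\<Omega> \<in> sets lebesgue" "f \<in> borel_measurable borel" "\<And>x. x \<notin> \<Omega> \<Longrightarrow> f x = 0"
  shows "integral\<^sup>L (lebesgue_on \<Omega>) f = integral\<^sup>L lborel f"
proof -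
  have "integral\<^sup>L (lebesgue_on \<Omega>) f = integral\<^sup>L lebesgue (\<lambda>x. if x \<in> \<Omega> then f x else 0)"
    by (rule Lebesgue_Measure.integral_restrict_UNIV[symmetric]) fact
  also have "(\<lambda>x. if x \<in> \<Omega> then f x else 0) = f" using assms(3) by auto
  also have "integral\<^sup>L lebesgue f = integral\<^sup>L lborel f"
    by (rule integral_completion) (use assms in simp)
  finally show ?thesis .
qed

text \<open>Every integration by parts below is this statement for a product.\<close>

lemma LINT_partial_zero:
  fixes g :: "'a::euclidean_space \<Rightarrow> 'b::euclidean_space"
  assumes g: "test_function \<Omega> g" and e: "e \<in> Basis" and \<Omega>: "open \<Omega>"
  shows "(LINT x|lebesgue_on \<Omega>. partial_deriv e g x) = 0"
proof -
  obtain K where K: "smooth g" "compact K" "K \<subseteq> \<Omega>" "\<And>x. x \<notin> K \<Longrightarrow> g x = 0"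
    using g by (auto simp: test_function_iff)
  have pz: "partial_deriv e g x = 0" if "x \<notin> K" for x
    by (rule pd_zero_of_open_zero[of "-K"]) (use K that compact_imp_closed in auto)
  have "(LINT x|lebesgue_on \<Omega>. partial_deriv e g x) = integral\<^sup>L lborel (partial_deriv e g)"
    by (rule LINT_supported)
       (use \<Omega> K pz in \<open>auto intro!: borel_measurable_continuous_onI smooth_continuous smooth_partial e\<close>)
  also have "\<dots> = 0" by (rule integral_partial_zero[OF K(1) e K(2,4)])
  finally show ?thesis .
qed

lemma integrable_test:
  fixes g :: "'a::euclidean_space \<Rightarrow> 'b::euclidean_space"
  assumes g: "test_function \<Omega> g" and \<Omega>: "open \<Omega>"
  shows "integrable (lebesgue_on \<Omega>) g"
proof -
  obtain K where K: "smooth g" "compact K" "K \<subseteq> \<Omega>" "\<And>x. x \<notin> K \<Longrightarrow> g x = 0"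
    using g by (auto simp: test_function_iff)
  have "integrable lborel g"
    by (rule integrable_continuous_compact_support[OF smooth_continuous K(2,4)]) (use K in auto)
  then have "integrable lebesgue g" by (simp add: integrable_completion borel_measurable_integrable)
  moreover have "(\<lambda>x. if x \<in> \<Omega> then g x else 0) = g" using K(3,4) by force
  ultimately have "integrable lebesgue (\<lambda>x. if x \<in> \<Omega> then g x else 0)" by simp
  then show ?thesis using Lebesgue_Measure.integrable_restrict_UNIV[of \<Omega> g] \<Omega> by auto
qed

lemma locally_integrable_continuous:
  fixes f :: "'a::euclidean_space \<Rightarrow> 'b::euclidean_space"
  assumes "continuous_on UNIV f"
  shows "locally_integrable \<Omega> f"
  unfolding locally_integrable_def
proof (intro allI impI, elim conjE)
  fix K :: "'a set" assume "compact K"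
  then have "integrable lborel (\<lambda>x. indicator K x *\<^sub>R f x)"
    by (intro borel_integrable_compact) (use assms continuous_on_subset in blast)+
  then have "integrable lebesgue (\<lambda>x. indicator K x *\<^sub>R f x)"
    by (simp add: integrable_completion borel_measurable_integrable)
  then show "integrable (lebesgue_on K) f"
    using \<open>compact K\<close> by (simp add: integrable_restrict_space compact_imp_closed)
qed

lemma has_weak_deriv_smooth:
  fixes f :: "'a::euclidean_space \<Rightarrow> 'b::euclidean_space"
  assumes f: "smooth f" and e: "e \<in> Basis" and \<Omega>: "open \<Omega>"
  shows "has_weak_deriv \<Omega> e f (partial_deriv e f)"
  unfolding has_weak_deriv_def
proof (intro conjI allI impI)
  show "locally_integrable \<Omega> f" "locally_integrable \<Omega> (partial_deriv e f)"
    by (intro locally_integrable_continuous smooth_continuous smooth_partial f e)+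
  fix \<phi> :: "'a \<Rightarrow> real" assume \<phi>: "test_function \<Omega> \<phi>"
  have eq: "partial_deriv e (\<lambda>x. \<phi> x *\<^sub>R f x) x = partial_deriv e \<phi> x *\<^sub>R f x + \<phi> x *\<^sub>R partial_deriv e f x" for x
    by (rule pd_scaleR) (use f \<phi> test_smooth in auto)
  have "0 = (LINT x|lebesgue_on \<Omega>. partial_deriv e (\<lambda>x. \<phi> x *\<^sub>R f x) x)"
    by (rule LINT_partial_zero[symmetric]) (intro test_scaleR \<phi> f e \<Omega>)+
  also have "\<dots> = (LINT x|lebesgue_on \<Omega>. partial_deriv e \<phi> x *\<^sub>R f x) + (LINT x|lebesgue_on \<Omega>. \<phi> x *\<^sub>R partial_deriv e f x)"
    unfolding eq
    by (intro Bochner_Integration.integral_add integrable_test test_scaleR test_partial \<phi> f e \<Omega> smooth_partial)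
  finally show "(LINT x|lebesgue_on \<Omega>. partial_deriv e \<phi> x *\<^sub>R f x) = - (LINT x|lebesgue_on \<Omega>. \<phi> x *\<^sub>R partial_deriv e f x)"
    by (simp add: eq_neg_iff_add_eq_0)
qed

section \<open>Bump functions\<close>

text \<open>The functions $p(1/t)\,e^{-1/t}$, extended by zero to $t\le 0$. Differentiation only changes the
  polynomial \<open>p\<close>, so this family contains all derivatives of the flat function $e^{-1/t}$.\<close>

definition flat_exp :: "real poly \<Rightarrow> real \<Rightarrow> real" where
  "flat_exp p t = (if t > 0 then poly p (1 / t) * exp (- (1 / t)) else 0)"

lemma poly_exp_decay: "((\<lambda>y. poly p y * exp (- y)) \<longlongrightarrow> (0::real)) at_top"
proof -
  have "((\<lambda>y. \<Sum>i\<le>degree p. coeff p i * (y ^ i / exp y)) \<longlongrightarrow> (\<Sum>i\<le>degree p. coeff p i * 0)) at_top"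
    by (intro tendsto_intros tendsto_power_div_exp_0)
  moreover have "poly p y * exp (- y) = (\<Sum>i\<le>degree p. coeff p i * (y ^ i / exp y))" for y
    by (simp add: poly_altdef exp_minus sum_distrib_left sum_distrib_right divide_inverse algebra_simps)
  ultimately show ?thesis by simp
qed

text \<open>At the origin the difference quotient from the right is again a polynomial in $1/t$ times
  $e^{-1/t}$, which tends to zero.\<close>

lemma flat_exp_deriv:
  "(flat_exp p has_real_derivative flat_exp (pCons 0 (pCons 0 (p - pderiv p))) t) (at t)"
proof (cases t "0::real" rule: linorder_cases)
  case less
  have "((\<lambda>t. 0) has_real_derivative 0) (at t)" by simp
  then have "(flat_exp p has_real_derivative 0) (at t)"
    by (rule has_field_derivative_transform_within_open[of _ _ _ "{..<0}"]) (use less in \<open>auto simp: flat_exp_def\<close>)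
  then show ?thesis using less by (simp add: flat_exp_def)
next
  case greater
  have "((\<lambda>t. poly p (1 / t) * exp (- (1 / t))) has_real_derivative
      poly (pCons 0 (pCons 0 (p - pderiv p))) (1 / t) * exp (- (1 / t))) (at t)"
    using greater
    by (auto intro!: derivative_eq_intros simp: field_simps power2_eq_square)
  then have "(flat_exp p has_real_derivative poly (pCons 0 (pCons 0 (p - pderiv p))) (1 / t) * exp (- (1 / t))) (at t)"
    by (rule has_field_derivative_transform_within_open[of _ _ _ "{0<..}"]) (use greater in \<open>auto simp: flat_exp_def\<close>)
  then show ?thesis using greater by (simp add: flat_exp_def)
next
  case equal
  have "((\<lambda>h. flat_exp p h / h) \<longlongrightarrow> 0) (at_left 0)"
    by (rule tendsto_eventually) (auto simp: flat_exp_def eventually_at_filter)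
  moreover have "((\<lambda>h. flat_exp p h / h) \<longlongrightarrow> 0) (at_right 0)"
  proof -
    have "((\<lambda>h. poly (pCons 0 p) (inverse h) * exp (- inverse h)) \<longlongrightarrow> 0) (at_right 0)"
      by (rule filterlim_compose[OF poly_exp_decay filterlim_inverse_at_top_right])
    then show ?thesis
      by (rule Lim_transform_eventually) (auto simp: flat_exp_def eventually_at_filter divide_inverse)
  qed
  ultimately have "((\<lambda>h. flat_exp p h / h) \<longlongrightarrow> 0) (at 0)"
    by (simp add: filterlim_at_split)
  then show ?thesis using equal by (simp add: DERIV_def flat_exp_def)
qed

lemma smooth_flat_exp: "smooth (\<lambda>x. flat_exp p (x \<bullet> v + c))"
proof (rule smooth_coinduct[where P="\<lambda>f. \<exists>k p. f = (\<lambda>x. k * flat_exp p (x \<bullet> v + c))"])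
  show "\<exists>k q. (\<lambda>x. flat_exp p (x \<bullet> v + c)) = (\<lambda>x. k * flat_exp q (x \<bullet> v + c))"
    by (rule exI[of _ 1]) auto
  fix f :: "'a \<Rightarrow> real" assume "\<exists>k p. f = (\<lambda>x. k * flat_exp p (x \<bullet> v + c))"
  then obtain k p where f: "f = (\<lambda>x. k * flat_exp p (x \<bullet> v + c))" by blast
  let ?p' = "pCons 0 (pCons 0 (p - pderiv p))"
  have d: "(f has_derivative (\<lambda>h. k * (flat_exp ?p' (x \<bullet> v + c) * (h \<bullet> v)))) (at x)" for x
  proof -
    have "((\<lambda>x. flat_exp p (x \<bullet> v + c)) has_derivative (\<lambda>h. flat_exp ?p' (x \<bullet> v + c) * (h \<bullet> v))) (at x)"
      by (rule has_derivative_compose[of "\<lambda>x. x \<bullet> v + c" _ x UNIV "flat_exp p" "(*) (flat_exp ?p' (x \<bullet> v + c))"])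
         (use flat_exp_deriv[of p "x \<bullet> v + c"] in
           \<open>auto intro!: derivative_eq_intros simp: has_field_derivative_def\<close>)
    then show ?thesis unfolding f by (rule has_derivative_mult_right)
  qed
  then have "partial_deriv e f = (\<lambda>x. (k * (e \<bullet> v)) * flat_exp ?p' (x \<bullet> v + c))" for e
    using partial_deriv_eqI[OF d, of e] by (auto simp: fun_eq_iff)
  moreover have "f differentiable_on UNIV"
    using d by (auto simp: differentiable_on_eq_differentiable_at differentiable_def)
  ultimately show "f differentiable_on UNIV \<and> (\<forall>e\<in>Basis. \<exists>k p. partial_deriv e f = (\<lambda>x. k * flat_exp p (x \<bullet> v + c)))"
    by blast
qed

lemma flat_exp_range: "0 \<le> flat_exp 1 t" "flat_exp 1 t \<le> 1"
  by (auto simp: flat_exp_def)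

lemma flat_exp_lim: "t > 0 \<Longrightarrow> (\<lambda>n. flat_exp 1 (real (Suc n) * t)) \<longlonglongrightarrow> 1"
proof -
  assume t: "t > 0"
  have "(\<lambda>n. exp (- (inverse (real (Suc n)) * inverse t))) \<longlonglongrightarrow> exp (- (0 * inverse t))"
    by (intro tendsto_intros LIMSEQ_inverse_real_of_nat)
  moreover have "exp (- (inverse (real (Suc n)) * inverse t)) = flat_exp 1 (real (Suc n) * t)" for n
    using t by (simp add: flat_exp_def divide_inverse del: of_nat_Suc)
  ultimately show ?thesis by simp
qed

text \<open>Products over the coordinates of $e^{-1/(n(x_i-a_i))}\,e^{-1/(n(b_i-x_i))}$: inside the box all
  exponents tend to 0 as $n$ grows, outside one of the factors vanishes.\<close>

lemma box_bumps:
  fixes a b :: "'a::euclidean_space"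
  assumes "cbox a b \<subseteq> \<Omega>"
  obtains \<phi> :: "nat \<Rightarrow> 'a \<Rightarrow> real" where
    "\<And>n. test_function \<Omega> (\<phi> n)" "\<And>n x. 0 \<le> \<phi> n x \<and> \<phi> n x \<le> 1"
    "\<And>x. (\<lambda>n. \<phi> n x) \<longlonglongrightarrow> indicator (box a b) x" "\<And>n x. x \<notin> box a b \<Longrightarrow> \<phi> n x = 0"
proof
  define \<phi> :: "nat \<Rightarrow> 'a \<Rightarrow> real" where
    "\<phi> n x = (\<Prod>i\<in>Basis. flat_exp 1 (real (Suc n) * (x \<bullet> i - a \<bullet> i)) * flat_exp 1 (real (Suc n) * (b \<bullet> i - x \<bullet> i)))" for n x
  show z: "\<phi> n x = 0" if "x \<notin> box a b" for n x
  proof -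
    obtain i where "i \<in> Basis" "\<not> (a \<bullet> i < x \<bullet> i) \<or> \<not> (x \<bullet> i < b \<bullet> i)"
      using \<open>x \<notin> box a b\<close> by (auto simp: mem_box)
    then show ?thesis unfolding \<phi>_def
      by (intro prod_zero) (auto simp: flat_exp_def zero_less_mult_iff intro!: bexI[of _ i])
  qed
  show "test_function \<Omega> (\<phi> n)" for n
    unfolding test_function_iff
  proof (intro conjI exI[of _ "cbox a b"] allI impI)
    have eq: "\<phi> n = (\<lambda>x. \<Prod>i\<in>Basis. flat_exp 1 (x \<bullet> (real (Suc n) *\<^sub>R i) + - real (Suc n) * (a \<bullet> i))
        * flat_exp 1 (x \<bullet> (- real (Suc n) *\<^sub>R i) + real (Suc n) * (b \<bullet> i)))"
      by (auto simp: \<phi>_def fun_eq_iff algebra_simps simp del: of_nat_Suc intro!: prod.cong)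
    show "smooth (\<phi> n)" unfolding eq
      by (intro smooth_prod smooth_mult smooth_flat_exp finite_Basis)
    show "\<phi> n x = 0" if "x \<notin> cbox a b" for x
      using that box_subset_cbox z by blast
  qed (use assms in auto)
  show "0 \<le> \<phi> n x \<and> \<phi> n x \<le> 1" for n x
    unfolding \<phi>_def by (auto intro!: prod_nonneg prod_le_1 mult_le_one mult_nonneg_nonneg flat_exp_range)
  show "(\<lambda>n. \<phi> n x) \<longlonglongrightarrow> indicator (box a b) x" for x
  proof (cases "x \<in> box a b")
    case True
    have "(\<lambda>n. \<phi> n x) \<longlonglongrightarrow> (\<Prod>i\<in>(Basis::'a set). 1 * 1)"
      unfolding \<phi>_def by (intro tendsto_prod tendsto_mult flat_exp_lim) (use True in \<open>auto simp: mem_box\<close>)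
    then show ?thesis using True by simp
  qed (simp add: z)
qed

section \<open>The fundamental lemma of the calculus of variations\<close>

text \<open>The Borel sets over which \<open>F\<close> integrates to zero form a Dynkin system. It contains the boxes,
  which are stable under intersections, hence all Borel sets; Lebesgue sets differ from Borel sets by
  null sets.\<close>

lemma null_if_box_integrals_zero:
  fixes F :: "'a::euclidean_space \<Rightarrow> 'b::euclidean_space"
  assumes F: "integrable lebesgue F"
    and box0: "\<And>a b. (LINT x|lebesgue. indicator (box a b) x *\<^sub>R F x) = 0"
    and F0: "(LINT x|lebesgue. F x) = 0"
  shows "AE x in lebesgue. F x = 0"
proof -
  have ind: "integrable lebesgue (\<lambda>x. indicator A x *\<^sub>R F x)" if "A \<in> sets lebesgue" for A
    by (rule integrable_mult_indicator[OF that F])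
  have bor: "(LINT x|lebesgue. indicator A x *\<^sub>R F x) = 0" if "A \<in> sets borel" for A
  proof -
    let ?G = "range (\<lambda>(a, b::'a). box a b)"
    have sb: "sigma_sets UNIV ?G = sets borel"
      by (simp add: borel_eq_box)
    show ?thesis
    proof (rule sigma_sets_induct_disjoint[of ?G UNIV A])
      show "Int_stable ?G"
        by (auto simp: Int_stable_def box_Int_box)
      show "A \<in> sigma_sets UNIV ?G" using that sb by simp
      show "(LINT x|lebesgue. indicator B x *\<^sub>R F x) = 0" if "B \<in> ?G" for B
        using that box0 by auto
      show "(LINT x|lebesgue. indicator {} x *\<^sub>R F x) = 0" by simp
    next
      fix B assume "B \<in> sigma_sets UNIV ?G" and B0: "(LINT x|lebesgue. indicator B x *\<^sub>R F x) = 0"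
      then have B: "B \<in> sets lebesgue" using sb by auto
      have "(LINT x|lebesgue. indicator (UNIV - B) x *\<^sub>R F x) = (LINT x|lebesgue. F x - indicator B x *\<^sub>R F x)"
        by (rule Bochner_Integration.integral_cong) (auto simp: indicator_def)
      also have "\<dots> = 0" using F0 B0 F ind[OF B] by simp
      finally show "(LINT x|lebesgue. indicator (UNIV - B) x *\<^sub>R F x) = 0" .
    next
      fix B :: "nat \<Rightarrow> 'a set"
      assume disj: "disjoint_family B" and "range B \<subseteq> sigma_sets UNIV ?G"
        and B0: "\<And>i. (LINT x|lebesgue. indicator (B i) x *\<^sub>R F x) = 0"
      then have B: "B i \<in> sets lebesgue" for i using sb by auto
      have "set_lebesgue_integral lebesgue (\<Union>i. B i) F = (\<Sum>i. set_lebesgue_integral lebesgue (B i) F)"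
        by (rule lebesgue_integral_countable_add)
           (use B disj ind in \<open>auto simp: set_integrable_def disjoint_family_on_def\<close>)
      then show "(LINT x|lebesgue. indicator (\<Union> (range B)) x *\<^sub>R F x) = 0"
        using B0 by (simp add: set_lebesgue_integral_def)
    qed auto
  qed
  interpret sigma_finite_measure "lebesgue :: 'a measure"
  proof
    show "\<exists>A. countable A \<and> A \<subseteq> sets (lebesgue :: 'a measure) \<and> \<Union> A = space lebesgue \<and> (\<forall>a\<in>A. emeasure lebesgue a \<noteq> \<infinity>)"
      by (rule exI[of _ "range (\<lambda>n::nat. cball (0::'a) (real n))"])
         (auto simp: real_arch_simple emeasure_lborel_cball_finite[THEN less_imp_neq, simplified])
  qed
  show ?thesis
  proof (rule density_zero[OF F])
    fix A :: "'a set" assume "A \<in> sets lebesgue"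
    then obtain S N N' where A: "A = S \<union> N" "N \<subseteq> N'" "N' \<in> null_sets lborel" "S \<in> sets lborel"
      by (rule sets_completionE)
    have "AE x in lborel. x \<notin> N'" using A(3) by (rule AE_not_in)
    then have "AE x in lebesgue. x \<notin> N'" by (rule AE_completion)
    then have "AE x in lebesgue. indicator A x *\<^sub>R F x = indicator S x *\<^sub>R F x"
      by eventually_elim (use A in \<open>auto simp: indicator_def\<close>)
    then have "(LINT x|lebesgue. indicator A x *\<^sub>R F x) = (LINT x|lebesgue. indicator S x *\<^sub>R F x)"
      using \<open>A \<in> sets lebesgue\<close> A(4) ind by (intro integral_cong_AE borel_measurable_integrable) auto
    then show "set_lebesgue_integral lebesgue A F = 0"
      using bor[of S] A(4) by (simp add: set_lebesgue_integral_def)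
  qed
qed

text \<open>Testing with the bumps of a box shows that the integral of \<open>h\<close> over every box inside the domain
  vanishes, and countably many boxes exhaust the domain.\<close>

lemma fundamental_lemma:
  fixes h :: "'a::euclidean_space \<Rightarrow> 'b::euclidean_space"
  assumes \<Omega>: "open \<Omega>" and h: "locally_integrable \<Omega> h"
    and test0: "\<And>\<phi>::'a \<Rightarrow> real. test_function \<Omega> \<phi> \<Longrightarrow> (LINT x|lebesgue_on \<Omega>. \<phi> x *\<^sub>R h x) = 0"
  shows "AE x in lebesgue_on \<Omega>. h x = 0"
proof -
  have hint: "integrable lebesgue (\<lambda>x. indicator (cbox a b) x *\<^sub>R h x)" if "cbox a b \<subseteq> \<Omega>" for a b
    using h that compact_cbox[of a b] integrable_restrict_space[of "cbox a b" lebesgue h]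
    by (auto simp: locally_integrable_def)
  have hint': "integrable lebesgue (\<lambda>x. indicator (box a b) x *\<^sub>R h x)" if "cbox a b \<subseteq> \<Omega>" for a b
  proof -
    have "(\<lambda>x. indicator (box a b) x *\<^sub>R h x) = (\<lambda>x. indicator (box a b) x *\<^sub>R (indicator (cbox a b) x *\<^sub>R h x))"
      using box_subset_cbox[of a b] by (auto simp: indicator_def fun_eq_iff)
    then show ?thesis using integrable_mult_indicator[OF _ hint[OF that], of "box a b"] by simp
  qed
  have box0: "(LINT x|lebesgue. indicator (box a b) x *\<^sub>R h x) = 0" if ab: "cbox a b \<subseteq> \<Omega>" for a b
  proof -
    obtain \<phi> :: "nat \<Rightarrow> 'a \<Rightarrow> real" where \<phi>: "\<And>n. test_function \<Omega> (\<phi> n)"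
      "\<And>n x. 0 \<le> \<phi> n x \<and> \<phi> n x \<le> 1" "\<And>x. (\<lambda>n. \<phi> n x) \<longlonglongrightarrow> indicator (box a b) x"
      "\<And>n x. x \<notin> box a b \<Longrightarrow> \<phi> n x = 0"
      by (rule box_bumps[OF ab]) blast
    let ?H = "\<lambda>x. indicator (box a b) x *\<^sub>R h x"
    have z: "(LINT x|lebesgue. \<phi> n x *\<^sub>R ?H x) = 0" for n
    proof -
      have "0 = (LINT x|lebesgue_on \<Omega>. \<phi> n x *\<^sub>R h x)" using test0 \<phi>(1) by simp
      also have "\<dots> = (LINT x|lebesgue. (if x \<in> \<Omega> then \<phi> n x *\<^sub>R h x else 0))"
        by (rule Lebesgue_Measure.integral_restrict_UNIV[symmetric]) (use \<Omega> in auto)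
      also have "\<dots> = (LINT x|lebesgue. \<phi> n x *\<^sub>R ?H x)"
        using ab box_subset_cbox[of a b] \<phi>(4)
        by (intro Bochner_Integration.integral_cong) (auto simp: indicator_def)
      finally show ?thesis by simp
    qed
    have m: "\<phi> n \<in> borel_measurable lebesgue" for n
      using smooth_continuous[OF test_smooth[OF \<phi>(1)], of UNIV n]
      by (intro measurable_completion) (simp add: borel_measurable_continuous_onI)
    have "(\<lambda>n. LINT x|lebesgue. \<phi> n x *\<^sub>R ?H x) \<longlonglongrightarrow> (LINT x|lebesgue. indicator (box a b) x *\<^sub>R ?H x)"
    proof (rule integral_dominated_convergence[where w="\<lambda>x. norm (?H x)"])
      show "AE x in lebesgue. (\<lambda>n. \<phi> n x *\<^sub>R ?H x) \<longlonglongrightarrow> indicator (box a b) x *\<^sub>R ?H x"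
        by (intro AE_I2 tendsto_scaleR tendsto_const \<phi>)
      show "AE x in lebesgue. norm (\<phi> n x *\<^sub>R ?H x) \<le> norm (?H x)" for n
        by (rule AE_I2, subst norm_scaleR, rule mult_left_le_one_le) (use \<phi>(2)[of n] in auto)
      have mH: "?H \<in> borel_measurable lebesgue" using hint'[OF ab] by (rule borel_measurable_integrable)
      show "(\<lambda>x. \<phi> n x *\<^sub>R ?H x) \<in> borel_measurable lebesgue" for n
        by (rule borel_measurable_scaleR[OF m mH])
      show "(\<lambda>x. indicator (box a b) x *\<^sub>R ?H x) \<in> borel_measurable lebesgue"
        by (rule borel_measurable_scaleR[OF borel_measurable_indicator mH]) simp
      show "integrable lebesgue (\<lambda>x. norm (?H x))" by (rule integrable_norm[OF hint'[OF ab]])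
    qed
    moreover have "(\<lambda>x. indicator (box a b) x *\<^sub>R ?H x) = ?H" by (auto simp: indicator_def)
    ultimately have "(\<lambda>n::nat. 0) \<longlonglongrightarrow> (LINT x|lebesgue. ?H x)" by (simp only: z)
    then show ?thesis by (simp add: LIMSEQ_const_iff)
  qed
  have loc: "AE x in lebesgue. x \<in> box c d \<longrightarrow> h x = 0" if cd: "cbox c d \<subseteq> \<Omega>" for c d
  proof -
    have "AE x in lebesgue. indicator (box c d) x *\<^sub>R h x = 0"
    proof (rule null_if_box_integrals_zero[OF hint'[OF cd] _ box0[OF cd]])
      fix a b
      obtain a' b' where ab': "box a b \<inter> box c d = box a' b'" "cbox a b \<inter> cbox c d = cbox a' b'"
        unfolding Int_interval box_Int_box by blast
      have "(LINT x|lebesgue. indicator (box a b) x *\<^sub>R (indicator (box c d) x *\<^sub>R h x))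
         = (LINT x|lebesgue. indicator (box a' b') x *\<^sub>R h x)"
        unfolding ab'(1)[symmetric] by (intro Bochner_Integration.integral_cong) (auto simp: indicator_def)
      also have "\<dots> = 0" by (rule box0) (use ab' cd in blast)
      finally show "(LINT x|lebesgue. indicator (box a b) x *\<^sub>R (indicator (box c d) x *\<^sub>R h x)) = 0" .
    qed
    then show ?thesis by eventually_elim (auto simp: indicator_def)
  qed
  obtain \<D> where \<D>: "countable \<D>" "\<D> \<subseteq> Pow \<Omega>" "\<And>X. X \<in> \<D> \<Longrightarrow> \<exists>a b. X = cbox a b" "\<Union>\<D> = \<Omega>"
    by (rule open_countable_Union_open_cbox[OF \<Omega>]) blast
  have "AE x in lebesgue. x \<in> X \<longrightarrow> h x = 0" if XD: "X \<in> \<D>" for X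
  proof -
    obtain a b where X: "X = cbox a b" using \<D>(3)[OF XD] by blast
    have "AE x in lborel. x \<notin> cbox a b - box a b" by (rule AE_not_in[OF null_sets_cbox_Diff_box])
    then have "AE x in lebesgue. x \<notin> cbox a b - box a b" by (rule AE_completion)
    moreover have "AE x in lebesgue. x \<in> box a b \<longrightarrow> h x = 0" by (rule loc) (use XD \<D>(2) X in blast)
    ultimately show ?thesis by eventually_elim (use X in auto)
  qed
  then have "AE x in lebesgue. \<forall>X\<in>\<D>. x \<in> X \<longrightarrow> h x = 0"
    by (subst AE_ball_countable[OF \<D>(1)]) blast
  then have "AE x in lebesgue. x \<in> \<Omega> \<longrightarrow> h x = 0"
    by eventually_elim (use \<D>(4) in blast)
  then show ?thesis using \<Omega> by (simp add: AE_restrict_space_iff)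
qed

section \<open>The Hilbert space of square-integrable maps\<close>

definition L2norm :: "'a::euclidean_space set \<Rightarrow> ('a \<Rightarrow> 'b::euclidean_space) \<Rightarrow> real" where
  "L2norm \<Omega> f = sqrt (L2_norm_sq \<Omega> f)"

lemma L2_norm_sq_nonneg: "0 \<le> L2_norm_sq \<Omega> f"
  by (simp add: L2_norm_sq_def)

lemma L2norm_nonneg: "0 \<le> L2norm \<Omega> f"
  by (simp add: L2norm_def L2_norm_sq_nonneg)

lemma L2norm_sq: "(L2norm \<Omega> f)\<^sup>2 = L2_norm_sq \<Omega> f"
  by (simp add: L2norm_def L2_norm_sq_nonneg)

lemma L2_measurable: "L2 \<Omega> f \<Longrightarrow> f \<in> borel_measurable (lebesgue_on \<Omega>)"
  by (simp add: L2_def)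

lemma L2_integrable_sq: "L2 \<Omega> f \<Longrightarrow> integrable (lebesgue_on \<Omega>) (\<lambda>x. (norm (f x))\<^sup>2)"
  by (simp add: L2_def)

text \<open>Multiplication with a bounded weight is the main use: it controls both membership and norm.\<close>

lemma L2_dominated:
  assumes f: "L2 \<Omega> f" and F: "F \<in> borel_measurable (lebesgue_on \<Omega>)"
    and le: "AE x in lebesgue_on \<Omega>. norm (F x) \<le> C * norm (f x)"
  shows "L2 \<Omega> F" "L2_norm_sq \<Omega> F \<le> C\<^sup>2 * L2_norm_sq \<Omega> f"
proof -
  have le2: "AE x in lebesgue_on \<Omega>. (norm (F x))\<^sup>2 \<le> C\<^sup>2 * (norm (f x))\<^sup>2"
    using le by eventually_elim (metis norm_ge_zero power_mono power_mult_distrib)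
  have "integrable (lebesgue_on \<Omega>) (\<lambda>x. (norm (F x))\<^sup>2)"
    by (rule Bochner_Integration.integrable_bound[OF integrable_mult_right[OF L2_integrable_sq[OF f], of "C\<^sup>2"]])
       (use F le2 in auto)
  then show F': "L2 \<Omega> F" using F by (simp add: L2_def)
  have "L2_norm_sq \<Omega> F \<le> (LINT x|lebesgue_on \<Omega>. C\<^sup>2 * (norm (f x))\<^sup>2)"
    unfolding L2_norm_sq_def
    by (rule integral_mono_AE) (use f F' le2 in \<open>auto intro: L2_integrable_sq\<close>)
  then show "L2_norm_sq \<Omega> F \<le> C\<^sup>2 * L2_norm_sq \<Omega> f" by (simp add: L2_norm_sq_def)
qed

lemma L2norm_dominated:
  assumes f: "L2 \<Omega> f" and F: "F \<in> borel_measurable (lebesgue_on \<Omega>)"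
    and le: "AE x in lebesgue_on \<Omega>. norm (F x) \<le> C * norm (f x)" and C: "C \<ge> 0"
  shows "L2norm \<Omega> F \<le> C * L2norm \<Omega> f"
  using real_sqrt_le_mono[OF L2_dominated(2)[OF f F le]] C
  by (simp add: L2norm_def real_sqrt_mult)

lemma L2_zero: "L2 \<Omega> (\<lambda>x. 0)" "L2norm \<Omega> (\<lambda>x. 0) = 0"
  by (auto simp: L2_def L2norm_def L2_norm_sq_def)

lemma L2_add:
  assumes f: "L2 \<Omega> f" and g: "L2 \<Omega> g"
  shows "L2 \<Omega> (\<lambda>x. f x + g x)"
  unfolding L2_def
proof
  show m: "(\<lambda>x. f x + g x) \<in> borel_measurable (lebesgue_on \<Omega>)"
    by (intro borel_measurable_add L2_measurable f g)
  have le: "(norm (u + v))\<^sup>2 \<le> 2 * (norm u)\<^sup>2 + 2 * (norm v)\<^sup>2" for u v :: 'b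
  proof -
    have "(norm (u + v))\<^sup>2 \<le> (norm u + norm v)\<^sup>2"
      by (intro power_mono norm_triangle_ineq) auto
    also have "\<dots> \<le> 2 * (norm u)\<^sup>2 + 2 * (norm v)\<^sup>2"
      using zero_le_power2[of "norm u - norm v"] by (simp add: power2_eq_square algebra_simps)
    finally show ?thesis .
  qed
  have b: "integrable (lebesgue_on \<Omega>) (\<lambda>x. 2 * (norm (f x))\<^sup>2 + 2 * (norm (g x))\<^sup>2)"
    by (intro Bochner_Integration.integrable_add integrable_mult_right L2_integrable_sq f g)
  show "integrable (lebesgue_on \<Omega>) (\<lambda>x. (norm (f x + g x))\<^sup>2)"
    by (rule Bochner_Integration.integrable_bound[OF b]) (use m le in auto)
qed

lemma L2_scaleR: "L2 \<Omega> f \<Longrightarrow> L2 \<Omega> (\<lambda>x. c *\<^sub>R f x)"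
  by (rule L2_dominated(1)[where f=f and C="\<bar>c\<bar>"]) (auto simp: L2_def)

lemma L2_minus: "L2 \<Omega> f \<Longrightarrow> L2 \<Omega> (\<lambda>x. - f x)"
  using L2_scaleR[of \<Omega> f "-1"] by simp

lemma L2_diff: "L2 \<Omega> f \<Longrightarrow> L2 \<Omega> g \<Longrightarrow> L2 \<Omega> (\<lambda>x. f x - g x)"
  using L2_add[OF _ L2_minus, of \<Omega> f g] by simp

lemma L2_sum: "finite A \<Longrightarrow> (\<And>a. a \<in> A \<Longrightarrow> L2 \<Omega> (f a)) \<Longrightarrow> L2 \<Omega> (\<lambda>x. \<Sum>a\<in>A. f a x)"
  by (induction A rule: finite_induct) (auto intro: L2_zero L2_add)

lemma L2_norm: "L2 \<Omega> f \<Longrightarrow> L2 \<Omega> (\<lambda>x. norm (f x))" "L2norm \<Omega> (\<lambda>x. norm (f x)) = L2norm \<Omega> f"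
  by (auto simp: L2_def L2norm_def L2_norm_sq_def)

lemma L2_inner_integrable:
  assumes f: "L2 \<Omega> f" and g: "L2 \<Omega> g"
  shows "integrable (lebesgue_on \<Omega>) (\<lambda>x. f x \<bullet> g x)"
proof -
  have le: "\<bar>u \<bullet> v\<bar> \<le> (norm u)\<^sup>2 + (norm v)\<^sup>2" for u v :: 'b
  proof -
    have "\<bar>u \<bullet> v\<bar> \<le> norm u * norm v" by (rule Cauchy_Schwarz_ineq2)
    also have "norm u * norm v \<le> (norm u)\<^sup>2 + (norm v)\<^sup>2"
    proof -
      have "2 * (norm u * norm v) \<le> (norm u)\<^sup>2 + (norm v)\<^sup>2"
        using zero_le_power2[of "norm u - norm v"] by (simp add: power2_eq_square algebra_simps)
      moreover have "0 \<le> norm u * norm v" by simp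
      ultimately show ?thesis by linarith
    qed
    finally show ?thesis using zero_le_power2[of "norm u"] zero_le_power2[of "norm v"] by linarith
  qed
  have b: "integrable (lebesgue_on \<Omega>) (\<lambda>x. (norm (f x))\<^sup>2 + (norm (g x))\<^sup>2)"
    by (intro Bochner_Integration.integrable_add L2_integrable_sq f g)
  have m: "(\<lambda>x. f x \<bullet> g x) \<in> borel_measurable (lebesgue_on \<Omega>)"
    by (intro borel_measurable_inner L2_measurable f g)
  show ?thesis
    by (rule Bochner_Integration.integrable_bound[OF b m]) (use le in auto)
qed

lemma L2_expand:
  assumes f: "L2 \<Omega> f" and g: "L2 \<Omega> g"
  shows "L2_norm_sq \<Omega> (\<lambda>x. f x + t *\<^sub>R g x)
    = L2_norm_sq \<Omega> f + 2 * t * (LINT x|lebesgue_on \<Omega>. f x \<bullet> g x) + t\<^sup>2 * L2_norm_sq \<Omega> g"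
proof -
  have eq: "(norm (f x + t *\<^sub>R g x))\<^sup>2 = (norm (f x))\<^sup>2 + (2 * t) * (f x \<bullet> g x) + t\<^sup>2 * (norm (g x))\<^sup>2" for x
    unfolding power2_norm_eq_inner
    by (simp add: inner_add inner_commute power2_eq_square[of t] algebra_simps)
  show ?thesis
    unfolding L2_norm_sq_def eq
    using L2_integrable_sq[OF f] L2_integrable_sq[OF g] L2_inner_integrable[OF f g] by simp
qed

text \<open>The quadratic polynomial \<open>t \<mapsto> \<parallel>f + t g\<parallel>\<^sup>2\<close> is nonnegative; the value of \<open>t\<close> is its minimum, or, when
  the leading coefficient vanishes, a point where it would be negative.\<close>

lemma L2_Cauchy_Schwarz:
  assumes f: "L2 \<Omega> f" and g: "L2 \<Omega> g"
  shows "\<bar>LINT x|lebesgue_on \<Omega>. f x \<bullet> g x\<bar> \<le> L2norm \<Omega> f * L2norm \<Omega> g"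
proof -
  define A B I where "A = L2_norm_sq \<Omega> f" and "B = L2_norm_sq \<Omega> g"
    and "I = (LINT x|lebesgue_on \<Omega>. f x \<bullet> g x)"
  have q: "0 \<le> A + 2 * t * I + t\<^sup>2 * B" for t
    using L2_norm_sq_nonneg[of \<Omega> "\<lambda>x. f x + t *\<^sub>R g x"] unfolding L2_expand[OF f g] A_def B_def I_def .
  have B0: "B \<ge> 0" by (simp add: B_def L2_norm_sq_nonneg)
  have "I\<^sup>2 \<le> A * B"
  proof (cases "B = 0")
    case True
    have "I = 0"
    proof (rule ccontr)
      assume "I \<noteq> 0"
      then have "2 * (- (A + 1) / (2 * I)) * I = - (A + 1)" by (simp add: field_simps)
      then show False using q[of "- (A + 1) / (2 * I)"] True by simp
    qed
    then show ?thesis using True by simp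
  next
    case False
    then have "0 \<le> (A + 2 * (- I / B) * I + (- I / B)\<^sup>2 * B) * B"
      using q[of "- I / B"] B0 by (intro mult_nonneg_nonneg) auto
    also have "\<dots> = A * B - I\<^sup>2" using False by (simp add: field_simps power2_eq_square)
    finally show ?thesis by simp
  qed
  then have "sqrt (I\<^sup>2) \<le> sqrt (A * B)" by (rule real_sqrt_le_mono)
  then show ?thesis by (simp add: L2norm_def A_def B_def I_def real_sqrt_mult)
qed

lemma L2_Cauchy_Schwarz_abs:
  assumes f: "L2 \<Omega> f" and g: "L2 \<Omega> g"
  shows "(LINT x|lebesgue_on \<Omega>. norm (f x) * norm (g x)) \<le> L2norm \<Omega> f * L2norm \<Omega> g"
  using L2_Cauchy_Schwarz[OF L2_norm(1)[OF f] L2_norm(1)[OF g]] by (simp add: L2_norm(2))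

lemma L2norm_triangle:
  assumes f: "L2 \<Omega> f" and g: "L2 \<Omega> g"
  shows "L2norm \<Omega> (\<lambda>x. f x + g x) \<le> L2norm \<Omega> f + L2norm \<Omega> g"
proof -
  have "(L2norm \<Omega> (\<lambda>x. f x + g x))\<^sup>2 = (L2norm \<Omega> f)\<^sup>2 + 2 * (LINT x|lebesgue_on \<Omega>. f x \<bullet> g x) + (L2norm \<Omega> g)\<^sup>2"
    using L2_expand[OF f g, of 1] by (simp add: L2norm_sq)
  also have "\<dots> \<le> (L2norm \<Omega> f + L2norm \<Omega> g)\<^sup>2"
    using L2_Cauchy_Schwarz[OF f g] by (simp add: power2_sum)
  finally show ?thesis by (rule power2_le_imp_le) (simp add: L2norm_nonneg)
qed

lemma L2norm_scaleR: "L2norm \<Omega> (\<lambda>x. c *\<^sub>R f x) = \<bar>c\<bar> * L2norm \<Omega> f"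
  by (simp add: L2norm_def L2_norm_sq_def power_mult_distrib real_sqrt_mult)

lemma L2norm_minus: "L2norm \<Omega> (\<lambda>x. - f x) = L2norm \<Omega> f"
  by (simp add: L2norm_def L2_norm_sq_def)

lemma L2norm_cong_AE:
  assumes "f \<in> borel_measurable (lebesgue_on \<Omega>)" "g \<in> borel_measurable (lebesgue_on \<Omega>)"
    "AE x in lebesgue_on \<Omega>. f x = g x"
  shows "L2_norm_sq \<Omega> f = L2_norm_sq \<Omega> g"
  unfolding L2_norm_sq_def by (rule integral_cong_AE) (use assms in auto)

lemma L2_norm_sq_zero_AE:
  assumes "L2 \<Omega> f" "L2_norm_sq \<Omega> f = 0"
  shows "AE x in lebesgue_on \<Omega>. f x = 0"
proof -
  have "AE x in lebesgue_on \<Omega>. (norm (f x))\<^sup>2 = 0"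
    using assms integral_nonneg_eq_0_iff_AE[OF L2_integrable_sq[OF assms(1)]] by (simp add: L2_norm_sq_def)
  then show ?thesis by eventually_elim simp
qed

text \<open>Convergence in the mean along a filter. The members of the family need to be square integrable
  only eventually, since the difference quotients of a curve make sense only near the base point.\<close>

definition L2_lim :: "'a::euclidean_space set \<Rightarrow> ('i \<Rightarrow> 'a \<Rightarrow> 'b::euclidean_space) \<Rightarrow> ('a \<Rightarrow> 'b) \<Rightarrow> 'i filter \<Rightarrow> bool" where
  "L2_lim \<Omega> F f net \<longleftrightarrow> (\<forall>\<^sub>F n in net. L2 \<Omega> (F n)) \<and> L2 \<Omega> f \<and> ((\<lambda>n. L2norm \<Omega> (\<lambda>x. F n x - f x)) \<longlongrightarrow> 0) net"

lemma L2_limD: "L2_lim \<Omega> F f net \<Longrightarrow> L2 \<Omega> f"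
  by (simp add: L2_lim_def)

lemma L2_lim_dominated:
  fixes F :: "'i \<Rightarrow> 'a::euclidean_space \<Rightarrow> 'b::euclidean_space" and H :: "'i \<Rightarrow> 'a \<Rightarrow> 'c::euclidean_space"
  assumes lim: "L2_lim \<Omega> F f net"
    and "\<forall>\<^sub>F n in net. L2 \<Omega> (H n)" "L2 \<Omega> h"
    and le: "\<forall>\<^sub>F n in net. AE x in lebesgue_on \<Omega>. norm (H n x - h x) \<le> C * norm (F n x - f x)" and C: "C \<ge> 0"
  shows "L2_lim \<Omega> H h net"
  unfolding L2_lim_def
proof (intro conjI assms)
  have lim': "((\<lambda>n. C * L2norm \<Omega> (\<lambda>x. F n x - f x)) \<longlongrightarrow> C * 0) net"
    using lim by (intro tendsto_intros) (simp add: L2_lim_def)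
  have F: "\<forall>\<^sub>F n in net. L2 \<Omega> (F n)" using lim by (simp add: L2_lim_def)
  have "\<forall>\<^sub>F n in net. L2norm \<Omega> (\<lambda>x. H n x - h x) \<le> C * L2norm \<Omega> (\<lambda>x. F n x - f x)"
    using F assms(2) le
  proof eventually_elim
    case (elim n)
    show ?case
      by (rule L2norm_dominated[OF L2_diff[OF elim(1) L2_limD[OF lim]] L2_measurable[OF L2_diff[OF elim(2) assms(3)]] elim(3) C])
  qed
  then show "((\<lambda>n. L2norm \<Omega> (\<lambda>x. H n x - h x)) \<longlongrightarrow> 0) net"
    by (intro tendsto_sandwich[OF _ _ tendsto_const lim'[simplified]]) (auto simp: L2norm_nonneg)
qed

lemma L2_lim_bounded_linear:
  assumes "L2_lim \<Omega> F f net" "bounded_linear L"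
  shows "L2_lim \<Omega> (\<lambda>n x. L (F n x)) (\<lambda>x. L (f x)) net"
proof -
  obtain K where K: "K > 0" "\<And>x. norm (L x) \<le> norm x * K"
    using bounded_linear.pos_bounded[OF assms(2)] by blast
  have m: "L \<in> borel_measurable borel"
    using assms(2) by (intro borel_measurable_continuous_onI) (simp add: linear_continuous_on)
  have L: "L2 \<Omega> (\<lambda>x. L (g x))" if "L2 \<Omega> g" for g
    by (rule L2_dominated(1)[OF that, of _ K])
       (use K measurable_compose[OF L2_measurable[OF that] m] in \<open>auto simp: mult.commute\<close>)
  show ?thesis
    by (rule L2_lim_dominated[OF assms(1), of _ _ K])
       (use assms L K in \<open>auto simp: L2_lim_def linear_diff[OF bounded_linear.linear[OF assms(2)], symmetric] mult.commute elim: eventually_mono\<close>)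
qed

lemma L2_lim_add:
  assumes F: "L2_lim \<Omega> F f net" and G: "L2_lim \<Omega> G g net"
  shows "L2_lim \<Omega> (\<lambda>n x. F n x + G n x) (\<lambda>x. f x + g x) net"
proof -
  have ev: "\<forall>\<^sub>F n in net. L2 \<Omega> (F n) \<and> L2 \<Omega> (G n)" and f: "L2 \<Omega> f" and g: "L2 \<Omega> g"
    using F G by (auto simp: L2_lim_def eventually_conj)
  have "((\<lambda>n. L2norm \<Omega> (\<lambda>x. F n x - f x) + L2norm \<Omega> (\<lambda>x. G n x - g x)) \<longlongrightarrow> 0 + 0) net"
    using F G by (intro tendsto_add) (auto simp: L2_lim_def)
  then have 1: "((\<lambda>n. L2norm \<Omega> (\<lambda>x. F n x - f x) + L2norm \<Omega> (\<lambda>x. G n x - g x)) \<longlongrightarrow> 0) net" by simp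
  have 2: "\<forall>\<^sub>F n in net. norm (L2norm \<Omega> (\<lambda>x. (F n x + G n x) - (f x + g x)))
      \<le> L2norm \<Omega> (\<lambda>x. F n x - f x) + L2norm \<Omega> (\<lambda>x. G n x - g x)"
    using ev
  proof eventually_elim
    case (elim n)
    have "(\<lambda>x. (F n x + G n x) - (f x + g x)) = (\<lambda>x. (F n x - f x) + (G n x - g x))" by auto
    then show ?case using L2norm_triangle[OF L2_diff L2_diff, of \<Omega> "F n" f "G n" g] elim f g
      by (simp add: L2norm_nonneg)
  qed
  have 3: "\<forall>\<^sub>F n in net. L2 \<Omega> (\<lambda>x. F n x + G n x)"
    using ev by eventually_elim (simp add: L2_add)
  show ?thesis
    unfolding L2_lim_def using 3 L2_add[OF f g] Lim_null_comparison[OF 2 1] by blast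
qed

lemma L2_lim_const: "L2 \<Omega> f \<Longrightarrow> L2_lim \<Omega> (\<lambda>n. f) f net"
  by (simp add: L2_lim_def L2_zero)

lemma L2_lim_sum:
  assumes "finite A" "\<And>a. a \<in> A \<Longrightarrow> L2_lim \<Omega> (F a) (f a) net"
  shows "L2_lim \<Omega> (\<lambda>n x. \<Sum>a\<in>A. F a n x) (\<lambda>x. \<Sum>a\<in>A. f a x) net"
  using assms by (induction A rule: finite_induct) (auto intro: L2_lim_const L2_zero L2_lim_add)

lemma L2_lim_scaleR: "L2_lim \<Omega> F f net \<Longrightarrow> L2_lim \<Omega> (\<lambda>n x. c *\<^sub>R F n x) (\<lambda>x. c *\<^sub>R f x) net"
  by (rule L2_lim_bounded_linear) (auto intro: bounded_linear_scaleR_right)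

lemma L2_lim_n2:
  assumes F: "L2_lim \<Omega> F f net"
  shows "((\<lambda>n. L2norm \<Omega> (F n)) \<longlongrightarrow> L2norm \<Omega> f) net"
proof -
  have ev: "\<forall>\<^sub>F n in net. L2 \<Omega> (F n)" and f: "L2 \<Omega> f" using F by (auto simp: L2_lim_def)
  have "\<forall>\<^sub>F n in net. norm (L2norm \<Omega> (F n) - L2norm \<Omega> f) \<le> L2norm \<Omega> (\<lambda>x. F n x - f x)"
    using ev
  proof eventually_elim
    case (elim n)
    have "L2norm \<Omega> (F n) \<le> L2norm \<Omega> (\<lambda>x. F n x - f x) + L2norm \<Omega> f"
      using L2norm_triangle[OF L2_diff[OF elim f] f] by simp
    moreover have "L2norm \<Omega> f \<le> L2norm \<Omega> (\<lambda>x. F n x - f x) + L2norm \<Omega> (F n)"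
      using L2norm_triangle[OF L2_diff[OF f elim] elim] L2norm_minus[of \<Omega> "\<lambda>x. F n x - f x"] by simp
    ultimately show ?case by auto
  qed
  moreover have "((\<lambda>n. L2norm \<Omega> (\<lambda>x. F n x - f x)) \<longlongrightarrow> 0) net" using F by (simp add: L2_lim_def)
  ultimately have "((\<lambda>n. L2norm \<Omega> (F n) - L2norm \<Omega> f) \<longlongrightarrow> 0) net"
    by (rule Lim_null_comparison)
  then show ?thesis by (simp add: LIM_zero_iff)
qed

text \<open>Split \<open>F\<cdot>G - f\<cdot>g = (F - f)\<cdot>G + f\<cdot>(G - g)\<close> and apply Cauchy--Schwarz to both terms.\<close>

lemma L2_lim_inner_L1:
  assumes F: "L2_lim \<Omega> F f net" and G: "L2_lim \<Omega> G g net"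
  shows "((\<lambda>n. LINT x|lebesgue_on \<Omega>. \<bar>F n x \<bullet> G n x - f x \<bullet> g x\<bar>) \<longlongrightarrow> 0) net"
proof -
  have ev: "\<forall>\<^sub>F n in net. L2 \<Omega> (F n) \<and> L2 \<Omega> (G n)" and f: "L2 \<Omega> f" and g: "L2 \<Omega> g"
    using F G by (auto simp: L2_lim_def eventually_conj)
  have "((\<lambda>n. L2norm \<Omega> (\<lambda>x. F n x - f x) * L2norm \<Omega> (G n) + L2norm \<Omega> f * L2norm \<Omega> (\<lambda>x. G n x - g x))
      \<longlongrightarrow> 0 * L2norm \<Omega> g + L2norm \<Omega> f * 0) net"
    using F G L2_lim_n2[OF G] by (intro tendsto_intros) (auto simp: L2_lim_def)
  then have lim: "((\<lambda>n. L2norm \<Omega> (\<lambda>x. F n x - f x) * L2norm \<Omega> (G n) + L2norm \<Omega> f * L2norm \<Omega> (\<lambda>x. G n x - g x)) \<longlongrightarrow> 0) net"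
    by simp
  have "\<forall>\<^sub>F n in net. norm (LINT x|lebesgue_on \<Omega>. \<bar>F n x \<bullet> G n x - f x \<bullet> g x\<bar>)
     \<le> L2norm \<Omega> (\<lambda>x. F n x - f x) * L2norm \<Omega> (G n) + L2norm \<Omega> f * L2norm \<Omega> (\<lambda>x. G n x - g x)"
    using ev
  proof eventually_elim
    case (elim n)
    let ?a = "\<lambda>x. norm (F n x - f x) * norm (G n x)" and ?b = "\<lambda>x. norm (f x) * norm (G n x - g x)"
    have ia: "integrable (lebesgue_on \<Omega>) ?a" "integrable (lebesgue_on \<Omega>) ?b"
      using L2_inner_integrable[OF L2_norm(1) L2_norm(1), of \<Omega> "\<lambda>x. F n x - f x" "G n"]
            L2_inner_integrable[OF L2_norm(1) L2_norm(1), of \<Omega> f "\<lambda>x. G n x - g x"] elim f g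
      by (auto simp: L2_diff)
    have "(LINT x|lebesgue_on \<Omega>. \<bar>F n x \<bullet> G n x - f x \<bullet> g x\<bar>) \<le> (LINT x|lebesgue_on \<Omega>. ?a x + ?b x)"
    proof (rule integral_mono)
      show "integrable (lebesgue_on \<Omega>) (\<lambda>x. \<bar>F n x \<bullet> G n x - f x \<bullet> g x\<bar>)"
        using elim f g by (intro integrable_abs Bochner_Integration.integrable_diff L2_inner_integrable) auto
      show "integrable (lebesgue_on \<Omega>) (\<lambda>x. ?a x + ?b x)" using ia by simp
      fix x
      have "F n x \<bullet> G n x - f x \<bullet> g x = (F n x - f x) \<bullet> G n x + f x \<bullet> (G n x - g x)"
        by (simp add: inner_diff)
      then show "\<bar>F n x \<bullet> G n x - f x \<bullet> g x\<bar> \<le> ?a x + ?b x"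
        using Cauchy_Schwarz_ineq2[of "F n x - f x" "G n x"] Cauchy_Schwarz_ineq2[of "f x" "G n x - g x"]
        by linarith
    qed
    also have "\<dots> \<le> L2norm \<Omega> (\<lambda>x. F n x - f x) * L2norm \<Omega> (G n) + L2norm \<Omega> f * L2norm \<Omega> (\<lambda>x. G n x - g x)"
      using ia L2_Cauchy_Schwarz_abs[of \<Omega> "\<lambda>x. F n x - f x" "G n"] L2_Cauchy_Schwarz_abs[of \<Omega> f "\<lambda>x. G n x - g x"] elim f g
      by (simp add: L2_diff)
    finally show ?case by simp
  qed
  then show ?thesis by (rule Lim_null_comparison) (rule lim)
qed

lemma L2_lim_inner:
  assumes F: "L2_lim \<Omega> F f net" and G: "L2_lim \<Omega> G g net"
  shows "((\<lambda>n. LINT x|lebesgue_on \<Omega>. F n x \<bullet> G n x) \<longlongrightarrow> (LINT x|lebesgue_on \<Omega>. f x \<bullet> g x)) net"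
proof -
  have ev: "\<forall>\<^sub>F n in net. L2 \<Omega> (F n) \<and> L2 \<Omega> (G n)" and f: "L2 \<Omega> f" and g: "L2 \<Omega> g"
    using F G by (auto simp: L2_lim_def eventually_conj)
  have "\<forall>\<^sub>F n in net. norm ((LINT x|lebesgue_on \<Omega>. F n x \<bullet> G n x) - (LINT x|lebesgue_on \<Omega>. f x \<bullet> g x))
      \<le> (LINT x|lebesgue_on \<Omega>. \<bar>F n x \<bullet> G n x - f x \<bullet> g x\<bar>)"
    using ev
  proof eventually_elim
    case (elim n)
    have "(LINT x|lebesgue_on \<Omega>. F n x \<bullet> G n x) - (LINT x|lebesgue_on \<Omega>. f x \<bullet> g x)
       = (LINT x|lebesgue_on \<Omega>. F n x \<bullet> G n x - f x \<bullet> g x)"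
      using elim f g by (intro Bochner_Integration.integral_diff[symmetric] L2_inner_integrable) auto
    then show ?case using integral_abs_bound[of "lebesgue_on \<Omega>" "\<lambda>x. F n x \<bullet> G n x - f x \<bullet> g x"] by simp
  qed
  then have "((\<lambda>n. (LINT x|lebesgue_on \<Omega>. F n x \<bullet> G n x) - (LINT x|lebesgue_on \<Omega>. f x \<bullet> g x)) \<longlongrightarrow> 0) net"
    by (rule Lim_null_comparison) (rule L2_lim_inner_L1[OF F G])
  then show ?thesis by (simp add: LIM_zero_iff)
qed

section \<open>Weak derivatives\<close>

lemma test_measurable_bounded:
  fixes \<phi> :: "'a::euclidean_space \<Rightarrow> 'b::euclidean_space"
  assumes "test_function \<Omega> \<phi>"
  shows "\<phi> \<in> borel_measurable (lebesgue_on \<Omega>')" "\<exists>C\<ge>0. \<forall>x. norm (\<phi> x) \<le> C"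
proof -
  obtain K where K: "smooth \<phi>" "compact K" "K \<subseteq> \<Omega>" "\<And>x. x \<notin> K \<Longrightarrow> \<phi> x = 0"
    using assms by (auto simp: test_function_iff)
  have "\<phi> \<in> borel_measurable borel"
    by (rule borel_measurable_continuous_onI[OF smooth_continuous[OF K(1)]])
  then show "\<phi> \<in> borel_measurable (lebesgue_on \<Omega>')"
    by (intro measurable_restrict_space1 measurable_completion) simp
  obtain C where "\<And>x. x \<in> K \<Longrightarrow> norm (\<phi> x) \<le> C"
    using compact_imp_bounded[OF compact_continuous_image[OF smooth_continuous[OF K(1)] K(2)]]
    by (auto simp: bounded_iff)
  then have "norm (\<phi> x) \<le> max C 0" for x
    using K(4)[of x] by (cases "x \<in> K") fastforce+
  then show "\<exists>C\<ge>0. \<forall>x. norm (\<phi> x) \<le> C" by (intro exI[of _ "max C 0"]) auto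
qed

lemma integrable_test_scaleR:
  fixes g :: "'a::euclidean_space \<Rightarrow> 'b::euclidean_space" and \<phi> :: "'a \<Rightarrow> real"
  assumes \<Omega>: "open \<Omega>" and g: "locally_integrable \<Omega> g" and \<phi>: "test_function \<Omega> \<phi>"
  shows "integrable (lebesgue_on \<Omega>) (\<lambda>x. \<phi> x *\<^sub>R g x)"
proof -
  obtain K where K: "smooth \<phi>" "compact K" "K \<subseteq> \<Omega>" "\<And>x. x \<notin> K \<Longrightarrow> \<phi> x = 0"
    using \<phi> by (auto simp: test_function_iff)
  obtain C where C: "C \<ge> 0" "\<And>x. norm (\<phi> x) \<le> C" using test_measurable_bounded(2)[OF \<phi>] by blast
  have Ks: "K \<in> sets lebesgue" using K(2) by (simp add: compact_imp_closed)
  have "integrable (lebesgue_on K) g" using g K(2,3) by (simp add: locally_integrable_def)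
  then have *: "integrable lebesgue (\<lambda>x. if x \<in> K then g x else 0)"
    using Lebesgue_Measure.integrable_restrict_UNIV[OF Ks] by blast
  have 1: "integrable (lebesgue_on \<Omega>) (\<lambda>x. if x \<in> K then g x else 0)"
  proof -
    have "integrable lebesgue (\<lambda>x. if x \<in> \<Omega> then (if x \<in> K then g x else 0) else 0)"
      using * K(3) by (rule_tac back_subst[of "integrable lebesgue"]) (auto simp: fun_eq_iff)
    then show ?thesis using Lebesgue_Measure.integrable_restrict_UNIV[of \<Omega> "\<lambda>x. if x \<in> K then g x else 0"] \<Omega> by simp
  qed
  have "integrable (lebesgue_on \<Omega>) (\<lambda>x. \<phi> x *\<^sub>R (if x \<in> K then g x else 0))"
    by (rule Bochner_Integration.integrable_bound[OF integrable_mult_right[OF integrable_norm[OF 1], of C]])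
       (use C 1 test_measurable_bounded(1)[OF \<phi>] in \<open>auto intro!: mult_right_mono simp del: norm_scaleR simp: norm_scaleR\<close>)
  moreover have "(\<lambda>x. \<phi> x *\<^sub>R (if x \<in> K then g x else 0)) = (\<lambda>x. \<phi> x *\<^sub>R g x)"
    using K(4) by auto
  ultimately show ?thesis by simp
qed

text \<open>Weak derivatives are picked by an arbitrary choice; uniqueness is what permits computing with any
  representative.\<close>

lemma hwd_unique:
  fixes f :: "'a::euclidean_space \<Rightarrow> 'b::euclidean_space"
  assumes \<Omega>: "open \<Omega>" and e: "e \<in> Basis" and "has_weak_deriv \<Omega> e f g" "has_weak_deriv \<Omega> e f g'"
  shows "AE x in lebesgue_on \<Omega>. g x = g' x"
proof -
  have li: "locally_integrable \<Omega> g" "locally_integrable \<Omega> g'"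
    using assms by (auto simp: has_weak_deriv_def)
  have "AE x in lebesgue_on \<Omega>. g x - g' x = 0"
  proof (rule fundamental_lemma[OF \<Omega>])
    show "locally_integrable \<Omega> (\<lambda>x. g x - g' x)"
      using li by (auto simp: locally_integrable_def)
    fix \<phi> :: "'a \<Rightarrow> real" assume \<phi>: "test_function \<Omega> \<phi>"
    have "(LINT x|lebesgue_on \<Omega>. \<phi> x *\<^sub>R g x) = (LINT x|lebesgue_on \<Omega>. \<phi> x *\<^sub>R g' x)"
      using assms(3,4) \<phi> unfolding has_weak_deriv_def by (metis neg_equal_iff_equal)
    then show "(LINT x|lebesgue_on \<Omega>. \<phi> x *\<^sub>R (g x - g' x)) = 0"
      using integrable_test_scaleR[OF \<Omega> li(1) \<phi>] integrable_test_scaleR[OF \<Omega> li(2) \<phi>]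
      by (simp add: scaleR_diff_right)
  qed
  then show ?thesis by eventually_elim simp
qed

lemma hwd_weak_deriv: "has_weak_deriv \<Omega> e f g \<Longrightarrow> has_weak_deriv \<Omega> e f (weak_deriv \<Omega> e f)"
  unfolding weak_deriv_def by (rule someI[of "has_weak_deriv \<Omega> e f"])

lemma hwd_AE:
  fixes f :: "'a::euclidean_space \<Rightarrow> 'b::euclidean_space"
  assumes "open \<Omega>" "e \<in> Basis" "has_weak_deriv \<Omega> e f g"
  shows "AE x in lebesgue_on \<Omega>. weak_deriv \<Omega> e f x = g x"
  using hwd_unique[OF assms(1,2) hwd_weak_deriv[OF assms(3)] assms(3)] .

lemma hwd_cong:
  fixes f :: "'a::euclidean_space \<Rightarrow> 'b::euclidean_space"
  assumes \<Omega>: "open \<Omega>" and e: "e \<in> Basis" and f: "has_weak_deriv \<Omega> e f g"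
    and f': "locally_integrable \<Omega> f'" and ae: "AE x in lebesgue_on \<Omega>. f x = f' x"
  shows "has_weak_deriv \<Omega> e f' g"
  unfolding has_weak_deriv_def
proof (intro conjI allI impI f')
  show "locally_integrable \<Omega> g" using f by (simp add: has_weak_deriv_def)
  fix \<phi> :: "'a \<Rightarrow> real" assume \<phi>: "test_function \<Omega> \<phi>"
  have lif: "locally_integrable \<Omega> f" using f by (simp add: has_weak_deriv_def)
  have "(LINT x|lebesgue_on \<Omega>. partial_deriv e \<phi> x *\<^sub>R f' x) = (LINT x|lebesgue_on \<Omega>. partial_deriv e \<phi> x *\<^sub>R f x)"
    using integrable_test_scaleR[OF \<Omega> lif test_partial[OF \<phi> e]] integrable_test_scaleR[OF \<Omega> f' test_partial[OF \<phi> e]] ae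
    by (intro integral_cong_AE borel_measurable_integrable) auto
  also have "\<dots> = - (LINT x|lebesgue_on \<Omega>. \<phi> x *\<^sub>R g x)"
    using f \<phi> by (simp add: has_weak_deriv_def)
  finally show "(LINT x|lebesgue_on \<Omega>. partial_deriv e \<phi> x *\<^sub>R f' x) = - (LINT x|lebesgue_on \<Omega>. \<phi> x *\<^sub>R g x)" .
qed

lemma hwd_lincomb:
  fixes f :: "'a::euclidean_space \<Rightarrow> 'b::euclidean_space"
  assumes \<Omega>: "open \<Omega>" and e: "e \<in> Basis" and f: "has_weak_deriv \<Omega> e f f'" and g: "has_weak_deriv \<Omega> e g g'"
  shows "has_weak_deriv \<Omega> e (\<lambda>x. a *\<^sub>R f x + b *\<^sub>R g x) (\<lambda>x. a *\<^sub>R f' x + b *\<^sub>R g' x)"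
  unfolding has_weak_deriv_def
proof (intro conjI allI impI)
  have li: "locally_integrable \<Omega> f" "locally_integrable \<Omega> f'" "locally_integrable \<Omega> g" "locally_integrable \<Omega> g'"
    using f g by (auto simp: has_weak_deriv_def)
  then show "locally_integrable \<Omega> (\<lambda>x. a *\<^sub>R f x + b *\<^sub>R g x)" "locally_integrable \<Omega> (\<lambda>x. a *\<^sub>R f' x + b *\<^sub>R g' x)"
    by (auto simp: locally_integrable_def)
  fix \<phi> :: "'a \<Rightarrow> real" assume \<phi>: "test_function \<Omega> \<phi>"
  have lin: "(LINT x|lebesgue_on \<Omega>. \<psi> x *\<^sub>R (a *\<^sub>R u x + b *\<^sub>R v x))
     = a *\<^sub>R (LINT x|lebesgue_on \<Omega>. \<psi> x *\<^sub>R u x) + b *\<^sub>R (LINT x|lebesgue_on \<Omega>. \<psi> x *\<^sub>R v x)"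
    if "locally_integrable \<Omega> u" "locally_integrable \<Omega> v" "test_function \<Omega> \<psi>" for u v :: "'a \<Rightarrow> 'b" and \<psi> :: "'a \<Rightarrow> real"
  proof -
    have "(LINT x|lebesgue_on \<Omega>. \<psi> x *\<^sub>R (a *\<^sub>R u x + b *\<^sub>R v x))
       = (LINT x|lebesgue_on \<Omega>. a *\<^sub>R (\<psi> x *\<^sub>R u x) + b *\<^sub>R (\<psi> x *\<^sub>R v x))"
      by (simp add: algebra_simps)
    also have "\<dots> = a *\<^sub>R (LINT x|lebesgue_on \<Omega>. \<psi> x *\<^sub>R u x) + b *\<^sub>R (LINT x|lebesgue_on \<Omega>. \<psi> x *\<^sub>R v x)"
      using integrable_test_scaleR[OF \<Omega> that(1,3)] integrable_test_scaleR[OF \<Omega> that(2,3)]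
      by (subst Bochner_Integration.integral_add) (auto simp del: scaleR_scaleR)
    finally show ?thesis .
  qed
  show "(LINT x|lebesgue_on \<Omega>. partial_deriv e \<phi> x *\<^sub>R (a *\<^sub>R f x + b *\<^sub>R g x))
      = - (LINT x|lebesgue_on \<Omega>. \<phi> x *\<^sub>R (a *\<^sub>R f' x + b *\<^sub>R g' x))"
    unfolding lin[OF li(1,3) test_partial[OF \<phi> e]] lin[OF li(2,4) \<phi>]
    using f g \<phi> by (simp add: has_weak_deriv_def)
qed

text \<open>Completeness of Lebesgue measure: a change on a null set preserves measurability. This is what
  makes integrals over chosen representatives of weak derivatives meaningful.\<close>

lemma measurable_AE_cong:
  fixes f g :: "'a::euclidean_space \<Rightarrow> 'b::topological_space"
  assumes S: "S \<in> sets lebesgue" and f: "f \<in> borel_measurable (lebesgue_on S)"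
    and ae: "AE x in lebesgue_on S. f x = g x"
  shows "g \<in> borel_measurable (lebesgue_on S)"
proof (rule borel_measurableI)
  fix A :: "'b set" assume "open A"
  have "AE x in lebesgue. x \<in> S \<longrightarrow> f x = g x"
    using ae S by (simp add: AE_restrict_space_iff)
  then obtain N where N: "N \<in> null_sets lebesgue" "{x \<in> space lebesgue. \<not> (x \<in> S \<longrightarrow> f x = g x)} \<subseteq> N"
    unfolding eventually_ae_filter by blast
  have "f -` A \<inter> S \<in> sets (lebesgue_on S)"
    using measurable_sets[OF f, of A] \<open>open A\<close> by simp
  then have 1: "f -` A \<inter> S \<in> sets lebesgue"
    using S by (simp add: sets_restrict_space_iff)
  have 2: "g -` A \<inter> S \<inter> N \<in> sets lebesgue"
    using null_sets_completion_subset[OF _ N(1), of "g -` A \<inter> S \<inter> N"] by auto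
  have "g -` A \<inter> S = (f -` A \<inter> S - N) \<union> (g -` A \<inter> S \<inter> N)"
    using N(2) by auto
  also have "\<dots> \<in> sets lebesgue" using 1 2 N(1) by auto
  finally show "g -` A \<inter> space (lebesgue_on S) \<in> sets (lebesgue_on S)"
    using S by (simp add: sets_restrict_space_iff)
qed

section \<open>Second-order jets\<close>

text \<open>\<open>F1 e\<close> and \<open>F2 e' e\<close> are representatives of the first and second weak derivatives. With
  representatives carried along, linear combinations are exact at every point, whereas the chosen
  weak derivatives are linear only almost everywhere.\<close>

definition weak_jet :: "'a::euclidean_space set \<Rightarrow> ('a \<Rightarrow> 'b::euclidean_space) \<Rightarrow> ('a \<Rightarrow> 'a \<Rightarrow> 'b) \<Rightarrow> ('a \<Rightarrow> 'a \<Rightarrow> 'a \<Rightarrow> 'b) \<Rightarrow> bool" where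
  "weak_jet \<Omega> f F1 F2 \<longleftrightarrow> (\<forall>e\<in>Basis. has_weak_deriv \<Omega> e f (F1 e) \<and>
      (\<forall>e'\<in>Basis. has_weak_deriv \<Omega> e' (F1 e) (F2 e' e)))"

definition jet_L2 :: "'a::euclidean_space set \<Rightarrow> ('a \<Rightarrow> 'b::euclidean_space) \<Rightarrow> ('a \<Rightarrow> 'a \<Rightarrow> 'b) \<Rightarrow> ('a \<Rightarrow> 'a \<Rightarrow> 'a \<Rightarrow> 'b) \<Rightarrow> bool" where
  "jet_L2 \<Omega> f F1 F2 \<longleftrightarrow> weak_jet \<Omega> f F1 F2 \<and> L2 \<Omega> f \<and> (\<forall>e\<in>Basis. L2 \<Omega> (F1 e) \<and> (\<forall>e'\<in>Basis. L2 \<Omega> (F2 e' e)))"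

lemma weak_jet_AE:
  fixes f :: "'a::euclidean_space \<Rightarrow> 'b::euclidean_space"
  assumes \<Omega>: "open \<Omega>" and j: "weak_jet \<Omega> f F1 F2"
  shows "e \<in> Basis \<Longrightarrow> AE x in lebesgue_on \<Omega>. weak_deriv \<Omega> e f x = F1 e x"
    "e \<in> Basis \<Longrightarrow> e' \<in> Basis \<Longrightarrow> AE x in lebesgue_on \<Omega>. weak_deriv \<Omega> e' (weak_deriv \<Omega> e f) x = F2 e' e x"
    "AE x in lebesgue_on \<Omega>. weak_laplacian \<Omega> f x = (\<Sum>e\<in>Basis. F2 e e x)"
    "AE x in lebesgue_on \<Omega>. grad_sq \<Omega> f x = (\<Sum>e\<in>Basis. (norm (F1 e x))\<^sup>2)"
proof -
  show 1: "AE x in lebesgue_on \<Omega>. weak_deriv \<Omega> e f x = F1 e x" if "e \<in> Basis" for e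
    by (rule hwd_AE[OF \<Omega> that]) (use j that in \<open>auto simp: weak_jet_def\<close>)
  show 2: "AE x in lebesgue_on \<Omega>. weak_deriv \<Omega> e' (weak_deriv \<Omega> e f) x = F2 e' e x" if e: "e \<in> Basis" and e': "e' \<in> Basis" for e e'
  proof (rule hwd_AE[OF \<Omega> e'], rule hwd_cong[OF \<Omega> e'])
    show "has_weak_deriv \<Omega> e' (F1 e) (F2 e' e)" using j e e' by (auto simp: weak_jet_def)
    have "has_weak_deriv \<Omega> e f (F1 e)" using j e by (auto simp: weak_jet_def)
    from hwd_weak_deriv[OF this] show "locally_integrable \<Omega> (weak_deriv \<Omega> e f)"
      by (simp add: has_weak_deriv_def)
    show "AE x in lebesgue_on \<Omega>. F1 e x = weak_deriv \<Omega> e f x"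
      using 1[OF e] by eventually_elim simp
  qed
  have "AE x in lebesgue_on \<Omega>. \<forall>e\<in>Basis. weak_deriv \<Omega> e (weak_deriv \<Omega> e f) x = F2 e e x"
    by (rule AE_finite_allI) (auto intro: 2)
  then show "AE x in lebesgue_on \<Omega>. weak_laplacian \<Omega> f x = (\<Sum>e\<in>Basis. F2 e e x)"
    by eventually_elim (simp add: weak_laplacian_def)
  have "AE x in lebesgue_on \<Omega>. \<forall>e\<in>Basis. weak_deriv \<Omega> e f x = F1 e x"
    by (rule AE_finite_allI) (auto intro: 1)
  then show "AE x in lebesgue_on \<Omega>. grad_sq \<Omega> f x = (\<Sum>e\<in>Basis. (norm (F1 e x))\<^sup>2)"
    by eventually_elim (simp add: grad_sq_def)
qed

lemma sobolev_2_iff: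
  "sobolev 2 \<Omega> f \<longleftrightarrow> (\<exists>F1 F2. jet_L2 \<Omega> f F1 F2)"
proof
  assume "sobolev 2 \<Omega> f"
  then have f: "L2 \<Omega> f" and
    "\<forall>e\<in>Basis. \<exists>g. has_weak_deriv \<Omega> e f g \<and> L2 \<Omega> g \<and> (\<forall>e'\<in>Basis. \<exists>g'. has_weak_deriv \<Omega> e' g g' \<and> L2 \<Omega> g')"
    by (simp_all add: numeral_2_eq_2)
  then obtain F1 where F1: "\<And>e. e \<in> Basis \<Longrightarrow> has_weak_deriv \<Omega> e f (F1 e) \<and> L2 \<Omega> (F1 e) \<and>
      (\<forall>e'\<in>Basis. \<exists>g'. has_weak_deriv \<Omega> e' (F1 e) g' \<and> L2 \<Omega> g')"
    by metis
  then have "\<forall>e e'. \<exists>g'. e \<in> Basis \<longrightarrow> e' \<in> Basis \<longrightarrow> has_weak_deriv \<Omega> e' (F1 e) g' \<and> L2 \<Omega> g'" by blast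
  then obtain F2 where "\<And>e e'. e \<in> Basis \<Longrightarrow> e' \<in> Basis \<Longrightarrow> has_weak_deriv \<Omega> e' (F1 e) (F2 e e') \<and> L2 \<Omega> (F2 e e')"
    by metis
  then have "jet_L2 \<Omega> f F1 (\<lambda>e' e. F2 e e')"
    using f F1 by (auto simp: jet_L2_def weak_jet_def)
  then show "\<exists>F1 F2. jet_L2 \<Omega> f F1 F2" by blast
next
  assume "\<exists>F1 F2. jet_L2 \<Omega> f F1 F2"
  then show "sobolev 2 \<Omega> f"
    by (auto simp: numeral_2_eq_2 jet_L2_def weak_jet_def)
       blast
qed

text \<open>The norm can be computed from any jet, which reduces all statements about $W^{2,2}$ below to
  statements about finitely many elements of $L^2$.\<close>

lemma W22_norm_jet:
  fixes f :: "'a::euclidean_space \<Rightarrow> 'b::euclidean_space"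
  assumes \<Omega>: "open \<Omega>" and j: "jet_L2 \<Omega> f F1 F2"
  shows "W22_norm \<Omega> f = sqrt (L2_norm_sq \<Omega> f + (\<Sum>e\<in>Basis. L2_norm_sq \<Omega> (F1 e))
     + (\<Sum>e\<in>Basis. \<Sum>e'\<in>Basis. L2_norm_sq \<Omega> (F2 e' e)))"
proof -
  have wj: "weak_jet \<Omega> f F1 F2" using j by (simp add: jet_L2_def)
  have eq: "L2_norm_sq \<Omega> g = L2_norm_sq \<Omega> h"
    if "AE x in lebesgue_on \<Omega>. g x = h x" "L2 \<Omega> h" for g h :: "'a \<Rightarrow> 'b"
  proof (rule L2norm_cong_AE[OF _ L2_measurable[OF that(2)] that(1)])
    have "AE x in lebesgue_on \<Omega>. h x = g x" using that(1) by eventually_elim simp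
    from measurable_AE_cong[OF _ L2_measurable[OF that(2)] this]
    show "g \<in> borel_measurable (lebesgue_on \<Omega>)" using \<Omega> by auto
  qed
  have 1: "L2_norm_sq \<Omega> (weak_deriv \<Omega> e f) = L2_norm_sq \<Omega> (F1 e)" if "e \<in> Basis" for e
    by (rule eq[OF weak_jet_AE(1)[OF \<Omega> wj that]]) (use j that in \<open>auto simp: jet_L2_def\<close>)
  have 2: "L2_norm_sq \<Omega> (weak_deriv \<Omega> e' (weak_deriv \<Omega> e f)) = L2_norm_sq \<Omega> (F2 e' e)"
    if "e \<in> Basis" "e' \<in> Basis" for e e'
    by (rule eq[OF weak_jet_AE(2)[OF \<Omega> wj that]]) (use j that in \<open>auto simp: jet_L2_def\<close>)
  show ?thesis by (simp add: W22_norm_def 1 2)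
qed

lemma jet_L2_lincomb:
  fixes f :: "'a::euclidean_space \<Rightarrow> 'b::euclidean_space"
  assumes \<Omega>: "open \<Omega>" and f: "jet_L2 \<Omega> f F1 F2" and g: "jet_L2 \<Omega> g G1 G2"
  shows "jet_L2 \<Omega> (\<lambda>x. a *\<^sub>R f x + b *\<^sub>R g x) (\<lambda>e x. a *\<^sub>R F1 e x + b *\<^sub>R G1 e x)
     (\<lambda>e' e x. a *\<^sub>R F2 e' e x + b *\<^sub>R G2 e' e x)"
  using f g unfolding jet_L2_def weak_jet_def
  by (auto intro!: hwd_lincomb[OF \<Omega>] L2_add L2_scaleR)

lemma jet_L2_diff:
  fixes f :: "'a::euclidean_space \<Rightarrow> 'b::euclidean_space"
  assumes "open \<Omega>" "jet_L2 \<Omega> f F1 F2" "jet_L2 \<Omega> g G1 G2"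
  shows "jet_L2 \<Omega> (\<lambda>x. f x - g x) (\<lambda>e x. F1 e x - G1 e x) (\<lambda>e' e x. F2 e' e x - G2 e' e x)"
  using jet_L2_lincomb[OF assms, of 1 "-1"] by simp

lemma jet_L2_D:
  assumes "jet_L2 \<Omega> f F1 F2"
  shows "L2 \<Omega> f" "e \<in> Basis \<Longrightarrow> L2 \<Omega> (F1 e)" "e \<in> Basis \<Longrightarrow> e' \<in> Basis \<Longrightarrow> L2 \<Omega> (F2 e' e)"
  using assms by (auto simp: jet_L2_def)

lemma L2norm_le_W22_norm:
  fixes f :: "'a::euclidean_space \<Rightarrow> 'b::euclidean_space"
  assumes \<Omega>: "open \<Omega>" and j: "jet_L2 \<Omega> f F1 F2"
  shows "L2norm \<Omega> f \<le> W22_norm \<Omega> f" "e \<in> Basis \<Longrightarrow> L2norm \<Omega> (F1 e) \<le> W22_norm \<Omega> f"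
    "e \<in> Basis \<Longrightarrow> e' \<in> Basis \<Longrightarrow> L2norm \<Omega> (F2 e' e) \<le> W22_norm \<Omega> f"
proof -
  let ?A = "\<Sum>e\<in>Basis. L2_norm_sq \<Omega> (F1 e)" and ?B = "\<Sum>e\<in>Basis. \<Sum>e'\<in>Basis. L2_norm_sq \<Omega> (F2 e' e)"
  have A: "?A \<ge> 0" and B: "?B \<ge> 0" by (auto intro!: sum_nonneg L2_norm_sq_nonneg)
  have N: "L2_norm_sq \<Omega> f \<ge> 0" by (rule L2_norm_sq_nonneg)
  show "L2norm \<Omega> f \<le> W22_norm \<Omega> f"
    unfolding W22_norm_jet[OF assms] L2norm_def using A B by (intro real_sqrt_le_mono) simp
  show "L2norm \<Omega> (F1 e) \<le> W22_norm \<Omega> f" if "e \<in> Basis" for e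
  proof -
    have "L2_norm_sq \<Omega> (F1 e) \<le> ?A"
      by (rule member_le_sum[OF that]) (auto simp: L2_norm_sq_nonneg)
    then show ?thesis
      unfolding W22_norm_jet[OF assms] L2norm_def using B N by (intro real_sqrt_le_mono) simp
  qed
  show "L2norm \<Omega> (F2 e' e) \<le> W22_norm \<Omega> f" if "e \<in> Basis" "e' \<in> Basis" for e e'
  proof -
    have "L2_norm_sq \<Omega> (F2 e' e) \<le> (\<Sum>e'\<in>Basis. L2_norm_sq \<Omega> (F2 e' e))"
      by (rule member_le_sum[OF that(2)]) (auto simp: L2_norm_sq_nonneg)
    also have "\<dots> \<le> ?B"
      by (rule member_le_sum[OF that(1)]) (auto intro!: sum_nonneg L2_norm_sq_nonneg)
    finally show ?thesis
      unfolding W22_norm_jet[OF assms] L2norm_def using A N by (intro real_sqrt_le_mono) simp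
  qed
qed

lemma W22_norm_le:
  fixes f :: "'a::euclidean_space \<Rightarrow> 'b::euclidean_space"
  assumes \<Omega>: "open \<Omega>" and j: "jet_L2 \<Omega> f F1 F2"
  shows "W22_norm \<Omega> f \<le> L2norm \<Omega> f + (\<Sum>e\<in>Basis. L2norm \<Omega> (F1 e)) + (\<Sum>e\<in>Basis. \<Sum>e'\<in>Basis. L2norm \<Omega> (F2 e' e))"
proof -
  have s: "sqrt (sum g A) \<le> (\<Sum>a\<in>A. sqrt (g a))" if "finite A" "\<And>a. g a \<ge> 0" for g :: "'a \<Rightarrow> real" and A
    using that(1)
  proof (induction A rule: finite_induct)
    case (insert a A)
    have "sqrt (g a + sum g A) \<le> sqrt (g a) + sqrt (sum g A)"
      by (rule sqrt_add_le_add_sqrt) (auto intro: sum_nonneg that)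
    then show ?case using insert by simp
  qed simp
  let ?A = "\<Sum>e\<in>Basis. L2_norm_sq \<Omega> (F1 e)" and ?B = "\<Sum>e\<in>Basis. \<Sum>e'\<in>Basis. L2_norm_sq \<Omega> (F2 e' e)"
  have A: "?A \<ge> 0" and B: "?B \<ge> 0" by (auto intro!: sum_nonneg L2_norm_sq_nonneg)
  have "sqrt (L2_norm_sq \<Omega> f + ?A + ?B) \<le> sqrt (L2_norm_sq \<Omega> f) + sqrt ?A + sqrt ?B"
    using sqrt_add_le_add_sqrt[of "L2_norm_sq \<Omega> f + ?A" ?B] sqrt_add_le_add_sqrt[of "L2_norm_sq \<Omega> f" ?A]
      A B L2_norm_sq_nonneg[of \<Omega> f] by linarith
  also have "sqrt ?A \<le> (\<Sum>e\<in>Basis. L2norm \<Omega> (F1 e))"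
    unfolding L2norm_def by (rule s) (auto simp: L2_norm_sq_nonneg)
  also have "sqrt ?B \<le> (\<Sum>e\<in>Basis. sqrt (\<Sum>e'\<in>Basis. L2_norm_sq \<Omega> (F2 e' e)))"
    by (rule s) (auto intro!: sum_nonneg L2_norm_sq_nonneg)
  also have "\<dots> \<le> (\<Sum>e\<in>Basis. \<Sum>e'\<in>Basis. L2norm \<Omega> (F2 e' e))"
    unfolding L2norm_def by (intro sum_mono s) (auto simp: L2_norm_sq_nonneg)
  finally show ?thesis unfolding W22_norm_jet[OF assms] L2norm_def by simp
qed

text \<open>Convergence in $W^{2,2}$, expressed by convergence of the members of the jets in the mean; see
  \<open>jet_lim_iff\<close>.\<close>

definition jet_lim :: "'a::euclidean_space set \<Rightarrow> ('i \<Rightarrow> 'a \<Rightarrow> 'b::euclidean_space) \<Rightarrow> ('i \<Rightarrow> 'a \<Rightarrow> 'a \<Rightarrow> 'b) \<Rightarrow> ('i \<Rightarrow> 'a \<Rightarrow> 'a \<Rightarrow> 'a \<Rightarrow> 'b) \<Rightarrow>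
    ('a \<Rightarrow> 'b) \<Rightarrow> ('a \<Rightarrow> 'a \<Rightarrow> 'b) \<Rightarrow> ('a \<Rightarrow> 'a \<Rightarrow> 'a \<Rightarrow> 'b) \<Rightarrow> 'i filter \<Rightarrow> bool" where
  "jet_lim \<Omega> P P1 P2 f F1 F2 net \<longleftrightarrow> L2_lim \<Omega> P f net \<and>
     (\<forall>e\<in>Basis. L2_lim \<Omega> (\<lambda>n. P1 n e) (F1 e) net \<and> (\<forall>e'\<in>Basis. L2_lim \<Omega> (\<lambda>n. P2 n e' e) (F2 e' e) net))"

lemma jet_lim_iff:
  fixes f :: "'a::euclidean_space \<Rightarrow> 'b::euclidean_space"
  assumes \<Omega>: "open \<Omega>" and f: "jet_L2 \<Omega> f F1 F2" and P: "\<forall>\<^sub>F n in net. jet_L2 \<Omega> (P n) (P1 n) (P2 n)"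
  shows "((\<lambda>n. W22_norm \<Omega> (\<lambda>x. P n x - f x)) \<longlongrightarrow> 0) net \<longleftrightarrow> jet_lim \<Omega> P P1 P2 f F1 F2 net"
proof
  assume lim: "((\<lambda>n. W22_norm \<Omega> (\<lambda>x. P n x - f x)) \<longlongrightarrow> 0) net"
  have "((\<lambda>n. L2norm \<Omega> (\<lambda>x. P n x - f x)) \<longlongrightarrow> 0) net"
    by (rule Lim_null_comparison[OF _ lim])
       (use P in eventually_elim, simp add: L2norm_nonneg L2norm_le_W22_norm(1)[OF \<Omega> jet_L2_diff[OF \<Omega> _ f]])
  moreover have "((\<lambda>n. L2norm \<Omega> (\<lambda>x. P1 n e x - F1 e x)) \<longlongrightarrow> 0) net" if "e \<in> Basis" for e
    by (rule Lim_null_comparison[OF _ lim])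
       (use P in eventually_elim, simp add: L2norm_nonneg L2norm_le_W22_norm(2)[OF \<Omega> jet_L2_diff[OF \<Omega> _ f]] that)
  moreover have "((\<lambda>n. L2norm \<Omega> (\<lambda>x. P2 n e' e x - F2 e' e x)) \<longlongrightarrow> 0) net" if "e \<in> Basis" "e' \<in> Basis" for e e'
    by (rule Lim_null_comparison[OF _ lim])
       (use P in eventually_elim, simp add: L2norm_nonneg L2norm_le_W22_norm(3)[OF \<Omega> jet_L2_diff[OF \<Omega> _ f]] that)
  ultimately show "jet_lim \<Omega> P P1 P2 f F1 F2 net"
    unfolding jet_lim_def L2_lim_def using jet_L2_D[OF f] P
    by (auto elim!: eventually_mono intro: jet_L2_D)
next
  assume j: "jet_lim \<Omega> P P1 P2 f F1 F2 net"
  have "((\<lambda>n. L2norm \<Omega> (\<lambda>x. P n x - f x) + (\<Sum>e\<in>Basis. L2norm \<Omega> (\<lambda>x. P1 n e x - F1 e x))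
     + (\<Sum>e\<in>Basis. \<Sum>e'\<in>Basis. L2norm \<Omega> (\<lambda>x. P2 n e' e x - F2 e' e x))) \<longlongrightarrow> 0 + (\<Sum>e\<in>(Basis::'a set). 0) + (\<Sum>e\<in>(Basis::'a set). \<Sum>e'\<in>(Basis::'a set). 0)) net"
    using j unfolding jet_lim_def L2_lim_def by (intro tendsto_add tendsto_sum) auto
  then have lim: "((\<lambda>n. L2norm \<Omega> (\<lambda>x. P n x - f x) + (\<Sum>e\<in>Basis. L2norm \<Omega> (\<lambda>x. P1 n e x - F1 e x))
     + (\<Sum>e\<in>Basis. \<Sum>e'\<in>Basis. L2norm \<Omega> (\<lambda>x. P2 n e' e x - F2 e' e x))) \<longlongrightarrow> 0) net" by simp
  show "((\<lambda>n. W22_norm \<Omega> (\<lambda>x. P n x - f x)) \<longlongrightarrow> 0) net"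
  proof (rule Lim_null_comparison[OF _ lim])
    show "\<forall>\<^sub>F n in net. norm (W22_norm \<Omega> (\<lambda>x. P n x - f x)) \<le> L2norm \<Omega> (\<lambda>x. P n x - f x) + (\<Sum>e\<in>Basis. L2norm \<Omega> (\<lambda>x. P1 n e x - F1 e x))
     + (\<Sum>e\<in>Basis. \<Sum>e'\<in>Basis. L2norm \<Omega> (\<lambda>x. P2 n e' e x - F2 e' e x))"
      using P
    proof eventually_elim
      case (elim n)
      have j: "jet_L2 \<Omega> (\<lambda>x. P n x - f x) (\<lambda>e x. P1 n e x - F1 e x) (\<lambda>e' e x. P2 n e' e x - F2 e' e x)"
        by (rule jet_L2_diff[OF \<Omega> elim f])
      have "0 \<le> W22_norm \<Omega> (\<lambda>x. P n x - f x)"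
        using L2norm_le_W22_norm(1)[OF \<Omega> j] L2norm_nonneg[of \<Omega> "\<lambda>x. P n x - f x"] by linarith
      then show ?case using W22_norm_le[OF \<Omega> j] by simp
    qed
  qed
qed

lemma jet_lim_lincomb:
  assumes "jet_lim \<Omega> P P1 P2 f F1 F2 net" "jet_lim \<Omega> Q Q1 Q2 g G1 G2 net"
  shows "jet_lim \<Omega> (\<lambda>n x. a *\<^sub>R P n x + b *\<^sub>R Q n x) (\<lambda>n e x. a *\<^sub>R P1 n e x + b *\<^sub>R Q1 n e x)
     (\<lambda>n e' e x. a *\<^sub>R P2 n e' e x + b *\<^sub>R Q2 n e' e x) (\<lambda>x. a *\<^sub>R f x + b *\<^sub>R g x)
     (\<lambda>e x. a *\<^sub>R F1 e x + b *\<^sub>R G1 e x) (\<lambda>e' e x. a *\<^sub>R F2 e' e x + b *\<^sub>R G2 e' e x) net"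
  using assms unfolding jet_lim_def by (auto intro!: L2_lim_add L2_lim_scaleR)

lemma jet_L2_test:
  fixes \<phi> :: "'a::euclidean_space \<Rightarrow> 'b::euclidean_space"
  assumes \<Omega>: "open \<Omega>" and \<phi>: "test_function \<Omega> \<phi>"
  shows "jet_L2 \<Omega> \<phi> (\<lambda>e. partial_deriv e \<phi>) (\<lambda>e' e. partial_deriv e' (partial_deriv e \<phi>))"
proof -
  have L: "L2 \<Omega> \<psi>" if "test_function \<Omega> \<psi>" for \<psi> :: "'a \<Rightarrow> 'b"
  proof -
    have "test_function \<Omega> (\<lambda>x. \<psi> x \<bullet> \<psi> x)"
      by (rule test_inner[OF that test_smooth[OF that]])
    from integrable_test[OF this \<Omega>] show ?thesis
      using test_measurable_bounded(1)[OF that] by (simp add: L2_def power2_norm_eq_inner)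
  qed
  show ?thesis
    unfolding jet_L2_def weak_jet_def
    using \<phi> \<Omega> by (auto intro!: L has_weak_deriv_smooth test_partial test_smooth smooth_partial)
qed

section \<open>Regularized homogeneous expressions\<close>

text \<open>Finite expressions in the coordinates $x\cdot v$, in $r^2$ and in $1/r$. The radius is regularized:
  \<open>Winv\<close> is interpreted as $1/\sqrt{r^2+\varepsilon}$. For $\varepsilon>0$ every expression is a smooth function, for
  $\varepsilon=0$ the expressions include the components of $u^{(\ell)}$ and their derivatives, and
  differentiation is the same symbolic operation for all $\varepsilon$. Singular functions are thus limits
  of smooth ones together with all their derivatives.\<close>

datatype 'a rexpr = Cst real | Crd 'a | Rsq | Winv | Plus "'a rexpr" "'a rexpr" | Times "'a rexpr" "'a rexpr"

primrec ev :: "real \<Rightarrow> 'a::euclidean_space \<Rightarrow> 'a rexpr \<Rightarrow> real" where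
  "ev \<epsilon> x (Cst c) = c"
| "ev \<epsilon> x (Crd v) = x \<bullet> v"
| "ev \<epsilon> x Rsq = x \<bullet> x"
| "ev \<epsilon> x Winv = inverse (sqrt (x \<bullet> x + \<epsilon>))"
| "ev \<epsilon> x (Plus s t) = ev \<epsilon> x s + ev \<epsilon> x t"
| "ev \<epsilon> x (Times s t) = ev \<epsilon> x s * ev \<epsilon> x t"

primrec D :: "'a::euclidean_space \<Rightarrow> 'a rexpr \<Rightarrow> 'a rexpr" where
  "D e (Cst c) = Cst 0"
| "D e (Crd v) = Cst (e \<bullet> v)"
| "D e Rsq = Times (Cst 2) (Crd e)"
| "D e Winv = Times (Cst (-1)) (Times (Crd e) (Times Winv (Times Winv Winv)))"
| "D e (Plus s t) = Plus (D e s) (D e t)"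
| "D e (Times s t) = Plus (Times (D e s) t) (Times s (D e t))"

text \<open>A lower bound for the order of growth at the origin, which is why a sum takes the minimum.\<close>

primrec deg :: "'a rexpr \<Rightarrow> int" where
  "deg (Cst c) = 0"
| "deg (Crd v) = 1"
| "deg Rsq = 2"
| "deg Winv = -1"
| "deg (Plus s t) = min (deg s) (deg t)"
| "deg (Times s t) = deg s + deg t"

lemma deg_D: "deg (D e t) \<ge> deg t - 1"
  by (induction t) auto

lemma inverse_sqrt_has_derivative:
  assumes "x \<bullet> x + \<epsilon> > 0"
  shows "((\<lambda>x. inverse (sqrt (x \<bullet> x + \<epsilon>))) has_derivative (\<lambda>h. - (x \<bullet> h) * inverse (sqrt (x \<bullet> x + \<epsilon>)) ^ 3)) (at x)"
proof -
  let ?s = "sqrt (x \<bullet> x + \<epsilon>)"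
  have s: "?s > 0" using assms by simp
  have 1: "((\<lambda>x. x \<bullet> x + \<epsilon>) has_derivative (\<lambda>h. 2 * (x \<bullet> h))) (at x)"
    by (auto intro!: derivative_eq_intros simp: inner_commute)
  have 2: "((\<lambda>y. inverse (sqrt y)) has_real_derivative - (inverse ?s ^ 3 / 2)) (at (x \<bullet> x + \<epsilon>))"
    using assms s by (auto intro!: derivative_eq_intros simp: power3_eq_cube field_simps)
  have "((\<lambda>x. inverse (sqrt (x \<bullet> x + \<epsilon>))) has_derivative (\<lambda>h. - (inverse ?s ^ 3 / 2) * (2 * (x \<bullet> h)))) (at x)"
    by (rule has_derivative_compose[OF 1, of "\<lambda>y. inverse (sqrt y)" "(*) (- (inverse ?s ^ 3 / 2))"])
       (use 2 in \<open>simp add: has_field_derivative_def\<close>)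
  moreover have "(\<lambda>h. - (inverse ?s ^ 3 / 2) * (2 * (x \<bullet> h))) = (\<lambda>h. - (x \<bullet> h) * inverse ?s ^ 3)" by auto
  ultimately show ?thesis by simp
qed

lemma ev_has_derivative:
  assumes "x \<bullet> x + \<epsilon> > 0"
  shows "((\<lambda>x. ev \<epsilon> x t) has_derivative (\<lambda>h. ev \<epsilon> x (D h t))) (at x)"
proof (induction t)
  case Winv
  then show ?case using inverse_sqrt_has_derivative[OF assms]
    by (simp add: power3_eq_cube algebra_simps)
next
  case (Times s t)
  have "((\<lambda>x. ev \<epsilon> x s * ev \<epsilon> x t) has_derivative (\<lambda>h. ev \<epsilon> x s * ev \<epsilon> x (D h t) + ev \<epsilon> x (D h s) * ev \<epsilon> x t)) (at x)"
    by (rule has_derivative_mult[OF Times])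
  then show ?case by (simp add: add.commute)
next
  case (Plus s t)
  then show ?case by (auto intro: has_derivative_add)
qed (auto intro!: derivative_eq_intros simp: inner_commute)

lemma ev_linear: "ev \<epsilon> x (D (\<Sum>b\<in>Basis. (v \<bullet> b) *\<^sub>R b) t) = (\<Sum>b\<in>Basis. (v \<bullet> b) * ev \<epsilon> x (D b t))"
  if "x \<bullet> x + \<epsilon> > 0"
proof -
  interpret linear "\<lambda>h. ev \<epsilon> x (D h t)"
    using ev_has_derivative[OF that] has_derivative_linear by blast
  show ?thesis by (simp only: sum scaleR) simp
qed

lemma ev_direction: "x \<bullet> x + \<epsilon> > 0 \<Longrightarrow> ev \<epsilon> x (D v t) = (\<Sum>b\<in>Basis. (v \<bullet> b) * ev \<epsilon> x (D b t))"
  using ev_linear[of x \<epsilon> v t] by (simp add: euclidean_representation)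

lemma partial_deriv_ev: "x \<bullet> x + \<epsilon> > 0 \<Longrightarrow> partial_deriv e (\<lambda>x. ev \<epsilon> x t) x = ev \<epsilon> x (D e t)"
  using partial_deriv_eqI[OF ev_has_derivative] .

lemma pos_eps: "\<epsilon> > 0 \<Longrightarrow> (x::'a::euclidean_space) \<bullet> x + \<epsilon> > 0"
  using inner_ge_zero[of x] by linarith

lemma smooth_ev: "\<epsilon> > 0 \<Longrightarrow> smooth (\<lambda>x. ev \<epsilon> x t)"
proof (rule smooth_coinduct[where P="\<lambda>f. \<exists>t. f = (\<lambda>x. ev \<epsilon> x t)"])
  fix f :: "'a \<Rightarrow> real" assume \<epsilon>: "\<epsilon> > 0" and "\<exists>t. f = (\<lambda>x. ev \<epsilon> x t)"
  then obtain t where f: "f = (\<lambda>x. ev \<epsilon> x t)" by blast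
  have "f differentiable_on UNIV"
    unfolding differentiable_on_eq_differentiable_at[OF open_UNIV] differentiable_def f
    using ev_has_derivative[OF pos_eps[OF \<epsilon>]] by blast
  moreover have "partial_deriv e f = (\<lambda>x. ev \<epsilon> x (D e t))" for e
    unfolding f by (rule ext) (rule partial_deriv_ev[OF pos_eps[OF \<epsilon>]])
  ultimately show "f differentiable_on UNIV \<and> (\<forall>e\<in>Basis. \<exists>t. partial_deriv e f = (\<lambda>x. ev \<epsilon> x t))"
    by blast
qed auto

lemma ev_mixed: "ev \<epsilon> x (D i (D j t)) = ev \<epsilon> x (D j (D i t))"
  by (induction t) (auto simp: algebra_simps inner_commute)

lemma ev_tendsto: "x \<noteq> 0 \<Longrightarrow> \<epsilon> \<longlonglongrightarrow> 0 \<Longrightarrow> (\<lambda>n. ev (\<epsilon> n) x t) \<longlonglongrightarrow> ev 0 x t"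
proof (induction t)
  case Winv
  then have "(\<lambda>n. inverse (sqrt (x \<bullet> x + \<epsilon> n))) \<longlonglongrightarrow> inverse (sqrt (x \<bullet> x + 0))"
    by (intro tendsto_intros) auto
  then show ?case by simp
qed (auto intro: tendsto_intros)

text \<open>The bound is uniform in \<open>\<epsilon>\<close> because $\sqrt{r^2+\varepsilon}\ge r$. It is restricted to the unit ball, where a
  lower power of $r$ dominates a higher one, as sums require.\<close>

lemma ev_bound_aux:
  "\<exists>C\<ge>0. \<forall>\<epsilon>\<ge>0. \<forall>x::'a::euclidean_space. x \<noteq> 0 \<longrightarrow> norm x \<le> 1 \<longrightarrow> \<bar>ev \<epsilon> x t\<bar> \<le> C * (norm x powi deg t)"
proof (induction t)
  case (Cst c)
  then show ?case by (intro exI[of _ "\<bar>c\<bar>"]) auto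
next
  case (Crd v)
  then show ?case
    by (intro exI[of _ "norm v"]) (auto simp: mult.commute intro: order_trans[OF Cauchy_Schwarz_ineq2])
next
  case Rsq
  then show ?case by (intro exI[of _ 1]) (auto simp: power2_norm_eq_inner)
next
  case Winv
  have "\<bar>inverse (sqrt (x \<bullet> x + \<epsilon>))\<bar> \<le> norm x powi - 1" if "\<epsilon> \<ge> 0" "x \<noteq> 0" for \<epsilon> and x :: 'a
  proof -
    have "norm x \<le> sqrt (x \<bullet> x + \<epsilon>)"
      unfolding norm_eq_sqrt_inner using that by (intro real_sqrt_le_mono) simp
    then show ?thesis using that by (simp add: power_int_minus le_imp_inverse_le abs_of_nonneg)
  qed
  then show ?case by (intro exI[of _ 1]) auto
next
  case (Plus s t)
  obtain C1 where C1: "C1 \<ge> 0" "\<forall>\<epsilon>\<ge>0. \<forall>x::'a. x \<noteq> 0 \<longrightarrow> norm x \<le> 1 \<longrightarrow> \<bar>ev \<epsilon> x s\<bar> \<le> C1 * (norm x powi deg s)"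
    using Plus(1) by blast
  obtain C2 where C2: "C2 \<ge> 0" "\<forall>\<epsilon>\<ge>0. \<forall>x::'a. x \<noteq> 0 \<longrightarrow> norm x \<le> 1 \<longrightarrow> \<bar>ev \<epsilon> x t\<bar> \<le> C2 * (norm x powi deg t)"
    using Plus(2) by blast
  note C = C1(1) C2(1) C1(2)[rule_format] C2(2)[rule_format]
  have "\<bar>ev \<epsilon> x s + ev \<epsilon> x t\<bar> \<le> (C1 + C2) * (norm x powi min (deg s) (deg t))"
    if x: "\<epsilon> \<ge> 0" "x \<noteq> 0" "norm x \<le> 1" for \<epsilon> x
  proof -
    have "norm x powi deg s \<le> norm x powi min (deg s) (deg t)" "norm x powi deg t \<le> norm x powi min (deg s) (deg t)"
      using x by (auto intro!: power_int_decreasing)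
    then have "C1 * (norm x powi deg s) \<le> C1 * (norm x powi min (deg s) (deg t))"
      "C2 * (norm x powi deg t) \<le> C2 * (norm x powi min (deg s) (deg t))"
      using C by (auto intro: mult_left_mono)
    then show ?thesis using C(3)[OF x] C(4)[OF x] by (simp add: distrib_right)
  qed
  then show ?case using C by (intro exI[of _ "C1 + C2"]) auto
next
  case (Times s t)
  obtain C1 where C1: "C1 \<ge> 0" "\<forall>\<epsilon>\<ge>0. \<forall>x::'a. x \<noteq> 0 \<longrightarrow> norm x \<le> 1 \<longrightarrow> \<bar>ev \<epsilon> x s\<bar> \<le> C1 * (norm x powi deg s)"
    using Times(1) by blast
  obtain C2 where C2: "C2 \<ge> 0" "\<forall>\<epsilon>\<ge>0. \<forall>x::'a. x \<noteq> 0 \<longrightarrow> norm x \<le> 1 \<longrightarrow> \<bar>ev \<epsilon> x t\<bar> \<le> C2 * (norm x powi deg t)"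
    using Times(2) by blast
  note C = C1(1) C2(1) C1(2)[rule_format] C2(2)[rule_format]
  have "\<bar>ev \<epsilon> x s * ev \<epsilon> x t\<bar> \<le> (C1 * C2) * (norm x powi (deg s + deg t))"
    if x: "\<epsilon> \<ge> 0" "x \<noteq> 0" "norm x \<le> 1" for \<epsilon> x
  proof -
    have "\<bar>ev \<epsilon> x s * ev \<epsilon> x t\<bar> \<le> (C1 * (norm x powi deg s)) * (C2 * (norm x powi deg t))"
      unfolding abs_mult using C(3)[OF x] C(4)[OF x] C(1) by (intro mult_mono) auto
    then show ?thesis using x by (simp add: power_int_add algebra_simps)
  qed
  then show ?case using C by (intro exI[of _ "C1 * C2"]) auto
qed

lemma ev_bound:
  assumes "deg t \<ge> - int k"
  obtains C where "C \<ge> 0"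
    "\<And>\<epsilon> x::'a::euclidean_space. \<epsilon> \<ge> 0 \<Longrightarrow> x \<noteq> 0 \<Longrightarrow> norm x \<le> 1 \<Longrightarrow> \<bar>ev \<epsilon> x t\<bar> \<le> C * inverse (norm x) ^ k"
proof -
  obtain C where C0: "C \<ge> 0" "\<forall>\<epsilon>\<ge>0. \<forall>x::'a. x \<noteq> 0 \<longrightarrow> norm x \<le> 1 \<longrightarrow> \<bar>ev \<epsilon> x t\<bar> \<le> C * (norm x powi deg t)"
    using ev_bound_aux[of t] by blast
  note C = C0(1) C0(2)[rule_format]
  have "\<bar>ev \<epsilon> x t\<bar> \<le> C * inverse (norm x) ^ k" if x: "\<epsilon> \<ge> 0" "x \<noteq> 0" "norm x \<le> 1" for \<epsilon> and x :: 'a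
  proof -
    have "norm x powi deg t \<le> norm x powi (- int k)"
      using x assms by (auto intro!: power_int_decreasing)
    also have "\<dots> = inverse (norm x) ^ k" by (simp add: power_int_minus power_inverse)
    finally show ?thesis using C(2)[OF x] mult_left_mono[OF _ C(1)] by fastforce
  qed
  then show ?thesis using that C(1) by blast
qed

lemma measurable_ev: "(\<lambda>x. ev \<epsilon> x t) \<in> borel_measurable borel"
  by (induction t) (simp_all add: borel_measurable_continuous_onI continuous_on_inner)

text \<open>Expressions that agree off the origin have equal derivatives there, although these are different
  as symbolic expressions.\<close>

lemma ev_eq_D:
  assumes "\<And>x. x \<noteq> 0 \<Longrightarrow> ev 0 x s = ev 0 x t" "x \<noteq> 0"
  shows "ev 0 x (D e s) = ev 0 x (D e t)"
proof -
  have p: "x \<bullet> x + 0 > 0" using assms(2) by simp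
  have "((\<lambda>x. ev 0 x t) has_derivative (\<lambda>h. ev 0 x (D h s))) (at x)"
    by (rule has_derivative_transform_within_open[OF ev_has_derivative[OF p], of "- {0}"])
       (use assms in auto)
  from partial_deriv_eqI[OF this, of e] partial_deriv_ev[OF p, of e t] show ?thesis by simp
qed

text \<open>Euler's identity $x\cdot\nabla t = d\,t$, as \<open>D x t\<close> is the derivative in the direction \<open>x\<close>. In this form
  homogeneity is preserved by all operations without any scaling of the argument.\<close>

definition homog :: "real \<Rightarrow> 'a::euclidean_space rexpr \<Rightarrow> bool" where
  "homog d t \<longleftrightarrow> (\<forall>x. x \<noteq> 0 \<longrightarrow> ev 0 x (D x t) = d * ev 0 x t)"

lemma homog_Winv: "homog (-1) (Winv :: 'a::euclidean_space rexpr)"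
  unfolding homog_def
proof (intro allI impI)
  fix x :: 'a assume "x \<noteq> 0"
  then have "norm x > 0" by simp
  then show "ev 0 x (D x Winv) = - 1 * ev 0 x Winv"
    by (simp add: norm_eq_sqrt_inner[symmetric] power2_norm_eq_inner[symmetric] power2_eq_square field_simps)
qed

lemma homog_simps: "homog 0 (Cst c)" "homog 1 (Crd v)" "homog 2 Rsq"
  by (auto simp: homog_def)

lemma homog_Plus: "homog d s \<Longrightarrow> homog d t \<Longrightarrow> homog d (Plus s t)"
  by (auto simp: homog_def algebra_simps)

lemma homog_Times: "homog d s \<Longrightarrow> homog d' t \<Longrightarrow> homog (d + d') (Times s t)"
  by (auto simp: homog_def algebra_simps)

text \<open>Differentiate Euler's identity in the direction \<open>e\<close> and exchange the order of the derivatives.\<close>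

lemma homog_D:
  assumes t: "homog d t"
  shows "homog (d - 1) (D e t)"
  unfolding homog_def
proof (intro allI impI)
  fix x :: 'a assume x: "x \<noteq> 0"
  have p: "y \<bullet> y + 0 > 0" if "y \<noteq> 0" for y :: 'a using that by simp
  have 1: "((\<lambda>y. \<Sum>b\<in>Basis. (y \<bullet> b) * ev 0 y (D b t)) has_derivative
     (\<lambda>h. \<Sum>b\<in>Basis. (x \<bullet> b) * ev 0 x (D h (D b t)) + (h \<bullet> b) * ev 0 x (D b t))) (at x)"
    by (intro has_derivative_sum has_derivative_mult ev_has_derivative[OF p[OF x]]) (auto intro!: derivative_eq_intros)
  have "((\<lambda>y. d * ev 0 y t) has_derivative
     (\<lambda>h. \<Sum>b\<in>Basis. (x \<bullet> b) * ev 0 x (D h (D b t)) + (h \<bullet> b) * ev 0 x (D b t))) (at x)"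
  proof (rule has_derivative_transform_within_open[OF 1, of "- {0}"])
    fix y :: 'a assume "y \<in> - {0}"
    then have y: "y \<noteq> 0" by simp
    show "(\<Sum>b\<in>Basis. (y \<bullet> b) * ev 0 y (D b t)) = d * ev 0 y t"
      using t y ev_direction[OF p[OF y], of y t] by (simp add: homog_def)
  qed (use x in auto)
  from partial_deriv_eqI[OF this, of e]
  have "partial_deriv e (\<lambda>y. ev 0 y (Times (Cst d) t)) x
     = (\<Sum>b\<in>Basis. (x \<bullet> b) * ev 0 x (D e (D b t)) + (e \<bullet> b) * ev 0 x (D b t))" by simp
  then have "d * ev 0 x (D e t) = (\<Sum>b\<in>Basis. (x \<bullet> b) * ev 0 x (D e (D b t)) + (e \<bullet> b) * ev 0 x (D b t))"
    by (simp add: partial_deriv_ev[OF p[OF x]] del: ev.simps(6)) simp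
  also have "\<dots> = (\<Sum>b\<in>Basis. (x \<bullet> b) * ev 0 x (D b (D e t))) + (\<Sum>b\<in>Basis. (e \<bullet> b) * ev 0 x (D b t))"
    by (simp add: sum.distrib ev_mixed[of _ _ e])
  also have "\<dots> = ev 0 x (D x (D e t)) + ev 0 x (D e t)"
    using ev_direction[OF p[OF x], of x "D e t"] ev_direction[OF p[OF x], of e t] by simp
  finally show "ev 0 x (D x (D e t)) = (d - 1) * ev 0 x (D e t)" by (simp add: algebra_simps)
qed

section \<open>Integrability of powers of the radius\<close>

text \<open>The integrand is dominated by $\sum_n 2^{k(n+1)}\,1_{B(0,2^{-n})}$, whose integral is a convergent
  geometric series.\<close>

lemma nn_integral_inverse_norm_power:
  assumes k: "k < DIM('a::euclidean_space)"
  shows "(\<integral>\<^sup>+x. indicator (ball (0::'a) 1) x * ennreal (inverse (norm x) ^ k) \<partial>lborel) < \<infinity>"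
proof -
  let ?V = "unit_ball_vol (real DIM('a))"
  let ?B = "\<lambda>n. ball (0::'a) ((1/2) ^ n)"
  let ?c = "\<lambda>n. (2::real) ^ (k * Suc n)"
  have le: "f n \<le> (\<Sum>n. f n)" for f :: "nat \<Rightarrow> ennreal" and n
    using sum_le_suminf[of f "{n}"] by (simp add: summableI)
  have ptw: "indicator (ball (0::'a) 1) x * ennreal (inverse (norm x) ^ k) \<le> (\<Sum>n. ennreal (?c n) * indicator (?B n) x)"
    if x: "x \<noteq> 0" for x :: 'a
  proof (cases "norm x < 1")
    case True
    have "\<exists>n. (1/2) ^ n \<le> norm x"
      using real_arch_pow_inv[of "norm x" "1/2"] x by (auto intro: less_imp_le)
    \<comment> \<open>The dyadic shell of \<open>x\<close>: the ball of radius \<open>(1/2) ^ (N - 1)\<close> contains \<open>x\<close>, the next one does not.\<close>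
  define N where "N = (LEAST n. (1/2) ^ n \<le> norm x)"
    have N: "(1/2) ^ N \<le> norm x"
      unfolding N_def by (rule LeastI_ex) fact
    have "N \<noteq> 0" using N True by (cases N) auto
    then obtain n where n: "N = Suc n" by (cases N) auto
    have "\<not> (1/2) ^ n \<le> norm x"
      using not_less_Least[of n "\<lambda>n. (1/2) ^ n \<le> norm x"] n unfolding N_def by auto
    then have xn: "x \<in> ?B n" by simp
    have "inverse (norm x) \<le> inverse ((1/2) ^ Suc n)"
      using N n by (intro le_imp_inverse_le) auto
    then have "inverse (norm x) ^ k \<le> (2 ^ Suc n) ^ k"
      by (intro power_mono) (auto simp: power_divide)
    also have "\<dots> = ?c n" by (simp only: power_mult[symmetric] mult.commute)
    finally have "inverse (norm x) ^ k \<le> ?c n" .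
    then have "indicator (ball (0::'a) 1) x * ennreal (inverse (norm x) ^ k) \<le> ennreal (?c n) * indicator (?B n) x"
      using True xn by (simp add: ennreal_leI)
    also have "\<dots> \<le> (\<Sum>n. ennreal (?c n) * indicator (?B n) x)"
      by (rule le[of "\<lambda>n. ennreal (?c n) * indicator (?B n) x"])
    finally show ?thesis .
  qed simp
  have "AE x in lborel. (x::'a) \<noteq> 0" by (rule AE_lborel_singleton)
  then have "AE x in lborel. indicator (ball (0::'a) 1) x * ennreal (inverse (norm x) ^ k) \<le> (\<Sum>n. ennreal (?c n) * indicator (?B n) x)"
    by eventually_elim (rule ptw)
  then have "(\<integral>\<^sup>+x. indicator (ball (0::'a) 1) x * ennreal (inverse (norm x) ^ k) \<partial>lborel)
     \<le> (\<integral>\<^sup>+x. (\<Sum>n. ennreal (?c n) * indicator (?B n) x) \<partial>lborel)"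
    by (rule nn_integral_mono_AE)
  also have "\<dots> = (\<Sum>n. \<integral>\<^sup>+x. ennreal (?c n) * indicator (?B n) x \<partial>lborel)"
    by (rule nn_integral_suminf, intro borel_measurable_times_ennreal borel_measurable_const borel_measurable_indicator) simp
  also have "\<dots> = (\<Sum>n. ennreal (?c n * (?V * ((1/2) ^ n) ^ DIM('a))))"
    by (rule suminf_cong, subst nn_integral_cmult_indicator) (simp_all add: emeasure_ball ennreal_mult[symmetric])
  also have "\<dots> \<le> (\<Sum>n. ennreal ((2 ^ k * ?V) * (1/2) ^ n))"
  proof (intro suminf_le summableI ennreal_leI)
    fix n
    have "(2::real) ^ (k * n) * ((1/2) ^ n) ^ DIM('a) \<le> 2 ^ (k * n) * ((1/2) ^ n) ^ Suc k"
      using k by (intro mult_left_mono power_decreasing power_le_one) auto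
    also have "\<dots> = (1/2) ^ n"
      by (simp add: power_mult[symmetric] power_divide) (simp add: mult.commute)
    finally have "(2 ^ k * ?V) * (2 ^ (k * n) * ((1/2) ^ n) ^ DIM('a)) \<le> (2 ^ k * ?V) * (1/2) ^ n"
      by (intro mult_left_mono) auto
    then show "?c n * (?V * ((1/2) ^ n) ^ DIM('a)) \<le> (2 ^ k * ?V) * (1/2) ^ n"
      by (simp add: power_add algebra_simps)
  qed
  also have "\<dots> = ennreal (\<Sum>n. (2 ^ k * ?V) * (1/2) ^ n)"
    by (rule suminf_ennreal2) (auto intro!: summable_mult summable_geometric)
  also have "\<dots> < \<infinity>" by simp
  finally show ?thesis .
qed

abbreviation UB :: "'a::euclidean_space set" where "UB \<equiv> ball 0 1"

lemma integrable_inverse_norm_power: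
  assumes k: "k < DIM('a::euclidean_space)"
  shows "integrable (lebesgue_on (UB::'a set)) (\<lambda>x. inverse (norm x) ^ k)"
proof -
  have "integrable lborel (\<lambda>x::'a. indicator UB x *\<^sub>R inverse (norm x) ^ k)"
  proof (rule integrableI_bounded)
    have "(\<integral>\<^sup>+x. ennreal (norm (indicator (UB::'a set) x *\<^sub>R inverse (norm x) ^ k)) \<partial>lborel)
      = (\<integral>\<^sup>+x. indicator (UB::'a set) x * ennreal (inverse (norm x) ^ k) \<partial>lborel)"
      by (intro nn_integral_cong) (auto simp: indicator_def)
    then show "(\<integral>\<^sup>+x. ennreal (norm (indicator (UB::'a set) x *\<^sub>R inverse (norm x) ^ k)) \<partial>lborel) < \<infinity>"
      using nn_integral_inverse_norm_power[OF k] by simp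
    show "(\<lambda>x::'a. indicator UB x *\<^sub>R inverse (norm x) ^ k) \<in> borel_measurable lborel"
      by (intro borel_measurable_scaleR borel_measurable_indicator borel_measurable_power
          borel_measurable_inverse borel_measurable_norm) auto
  qed
  then have "integrable lebesgue (\<lambda>x::'a. indicator UB x *\<^sub>R inverse (norm x) ^ k)"
    by (simp add: integrable_completion borel_measurable_integrable)
  then show ?thesis by (simp add: integrable_restrict_space)
qed

lemma AE_UB_nonzero: "AE x in lebesgue_on (UB::'a::euclidean_space set). x \<noteq> 0 \<and> norm x \<le> 1"
proof -
  have "AE x in lebesgue. (x::'a) \<noteq> 0"
    by (rule AE_completion) (rule AE_lborel_singleton)
  then have "AE x in lebesgue. (x::'a) \<in> UB \<longrightarrow> x \<noteq> 0 \<and> norm x \<le> 1"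
    by eventually_elim auto
  then show ?thesis by (simp add: AE_restrict_space_iff)
qed

lemma AE_UB_not_empty: "\<not> (AE x in lebesgue_on (UB::'a::euclidean_space set). x \<noteq> x)"
proof
  assume "AE x in lebesgue_on (UB :: 'a set). x \<noteq> x"
  then have "emeasure (lebesgue_on (UB :: 'a set)) (space (lebesgue_on UB)) = 0"
    using ae_filter_eq_bot_iff[of "lebesgue_on (UB :: 'a set)"] by (simp add: trivial_limit_def)
  then have "emeasure lborel (UB :: 'a set) = 0" by (simp add: emeasure_restrict_space)
  then show False using unit_ball_vol_pos[of "real DIM('a)"] by (simp add: emeasure_ball)
qed

lemma measurable_ev_UB: "(\<lambda>x. ev \<epsilon> x t) \<in> borel_measurable (lebesgue_on S)"
  by (intro measurable_restrict_space1 measurable_completion) (simp add: measurable_ev)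

lemma integrable_ev:
  fixes t :: "'a::euclidean_space rexpr"
  assumes "deg t > - int DIM('a)" "\<epsilon> \<ge> 0"
  shows "integrable (lebesgue_on UB) (\<lambda>x. ev \<epsilon> x t)"
proof -
  define k where "k = nat (int DIM('a) - 1)"
  have k: "k < DIM('a)" "deg t \<ge> - int k" using assms DIM_positive[where 'a='a] unfolding k_def by arith+
  obtain C where C: "C \<ge> 0" "\<And>\<epsilon> x::'a. \<epsilon> \<ge> 0 \<Longrightarrow> x \<noteq> 0 \<Longrightarrow> norm x \<le> 1 \<Longrightarrow> \<bar>ev \<epsilon> x t\<bar> \<le> C * inverse (norm x) ^ k"
    by (rule ev_bound[OF k(2)]) blast
  show ?thesis
  proof (rule Bochner_Integration.integrable_bound[OF integrable_mult_right[OF integrable_inverse_norm_power[OF k(1)], of C]])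
    show "AE x in lebesgue_on UB. norm (ev \<epsilon> x t) \<le> norm (C * inverse (norm x) ^ k)"
      using AE_UB_nonzero by eventually_elim (use C assms in auto)
  qed (rule measurable_ev_UB)
qed

lemma locally_integrable_of_integrable:
  fixes f :: "'a::euclidean_space \<Rightarrow> 'b::euclidean_space"
  assumes \<Omega>: "open \<Omega>" and f: "integrable (lebesgue_on \<Omega>) f"
  shows "locally_integrable \<Omega> f"
  unfolding locally_integrable_def
proof (intro allI impI, elim conjE)
  fix K :: "'a set" assume K: "compact K" "K \<subseteq> \<Omega>"
  have Ks: "K \<in> sets lebesgue" using K(1) by (simp add: compact_imp_closed)
  have "integrable lebesgue (\<lambda>x. if x \<in> \<Omega> then f x else 0)"
    using f \<Omega> Lebesgue_Measure.integrable_restrict_UNIV[of \<Omega> f] by simp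
  from integrable_mult_indicator[OF Ks this]
  have "integrable lebesgue (\<lambda>x. indicator K x *\<^sub>R (if x \<in> \<Omega> then f x else 0))" .
  moreover have "(\<lambda>x. indicator K x *\<^sub>R (if x \<in> \<Omega> then f x else 0)) = (\<lambda>x. if x \<in> K then f x else 0)"
    using K by (auto simp: indicator_def fun_eq_iff)
  ultimately show "integrable (lebesgue_on K) f"
    using Lebesgue_Measure.integrable_restrict_UNIV[OF Ks, of f] by simp
qed

lemma eps_seq: "(\<lambda>n. inverse (real (Suc n))) \<longlonglongrightarrow> 0" "inverse (real (Suc n)) > 0"
  by (rule LIMSEQ_inverse_real_of_nat) simp

lemma ev_integral_limit:
  fixes t :: "'a::euclidean_space rexpr"
  assumes t: "deg t > - int DIM('a)" and \<phi>: "\<phi> \<in> borel_measurable (lebesgue_on UB)" and M: "\<And>x. \<bar>\<phi> x\<bar> \<le> M"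
  shows "(\<lambda>n. LINT x|lebesgue_on UB. \<phi> x * ev (inverse (real (Suc n))) x t) \<longlonglongrightarrow> (LINT x|lebesgue_on UB. \<phi> x * ev 0 x t)"
proof -
  define k where "k = nat (int DIM('a) - 1)"
  have k: "k < DIM('a)" "deg t \<ge> - int k" using t DIM_positive[where 'a='a] unfolding k_def by arith+
  obtain C where C: "C \<ge> 0" "\<And>\<epsilon> x::'a. \<epsilon> \<ge> 0 \<Longrightarrow> x \<noteq> 0 \<Longrightarrow> norm x \<le> 1 \<Longrightarrow> \<bar>ev \<epsilon> x t\<bar> \<le> C * inverse (norm x) ^ k"
    by (rule ev_bound[OF k(2)]) blast
  have M0: "M \<ge> 0" using M[of undefined] by linarith
  show ?thesis
  proof (rule integral_dominated_convergence[where w="\<lambda>x. M * (C * inverse (norm x) ^ k)"])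
    show "AE x in lebesgue_on UB. (\<lambda>n. \<phi> x * ev (inverse (real (Suc n))) x t) \<longlonglongrightarrow> \<phi> x * ev 0 x t"
      using AE_UB_nonzero by eventually_elim (intro tendsto_mult tendsto_const ev_tendsto eps_seq, simp)
    show "AE x in lebesgue_on UB. norm (\<phi> x * ev (inverse (real (Suc n))) x t) \<le> M * (C * inverse (norm x) ^ k)" for n
      using AE_UB_nonzero
    proof eventually_elim
      case (elim x)
      show ?case unfolding real_norm_def abs_mult
        by (intro mult_mono M C) (use elim M0 eps_seq(2)[of n] in \<open>auto intro: less_imp_le\<close>)
    qed
    show "integrable (lebesgue_on UB) (\<lambda>x::'a. M * (C * inverse (norm x) ^ k))"
      by (intro integrable_mult_right integrable_inverse_norm_power k)
  qed (auto intro!: borel_measurable_times \<phi> measurable_ev_UB)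
qed

text \<open>For $\varepsilon>0$ this is integration by parts of smooth functions, and both sides converge as
  $\varepsilon\to0$ by dominated convergence. The degree condition makes the derivative integrable, so that
  the origin contributes nothing.\<close>

lemma hwd_ev:
  fixes t :: "'a::euclidean_space rexpr"
  assumes t: "deg t - 1 > - int DIM('a)" and e: "e \<in> Basis"
  shows "has_weak_deriv UB e (\<lambda>x. ev 0 x t) (\<lambda>x. ev 0 x (D e t))"
  unfolding has_weak_deriv_def
proof (intro conjI allI impI)
  have t': "deg (D e t) > - int DIM('a)" using deg_D[of t e] t by linarith
  have t0: "deg t > - int DIM('a)" using t by linarith
  show "locally_integrable UB (\<lambda>x. ev 0 x t)" "locally_integrable UB (\<lambda>x. ev 0 x (D e t))"
    by (intro locally_integrable_of_integrable integrable_ev t' t0 open_ball order_refl)+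
  fix \<phi> :: "'a \<Rightarrow> real" assume \<phi>: "test_function UB \<phi>"
  obtain M where M: "\<And>x. \<bar>\<phi> x\<bar> \<le> M" using test_measurable_bounded(2)[OF \<phi>] by auto
  obtain M' where M': "\<And>x. \<bar>partial_deriv e \<phi> x\<bar> \<le> M'" using test_measurable_bounded(2)[OF test_partial[OF \<phi> e]] by auto
  have 1: "(\<lambda>n. LINT x|lebesgue_on UB. partial_deriv e \<phi> x * ev (inverse (real (Suc n))) x t) \<longlonglongrightarrow> (LINT x|lebesgue_on UB. partial_deriv e \<phi> x * ev 0 x t)"
    by (rule ev_integral_limit[OF t0 test_measurable_bounded(1)[OF test_partial[OF \<phi> e]] M'])
  have 2: "(\<lambda>n. LINT x|lebesgue_on UB. \<phi> x * ev (inverse (real (Suc n))) x (D e t)) \<longlonglongrightarrow> (LINT x|lebesgue_on UB. \<phi> x * ev 0 x (D e t))"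
    by (rule ev_integral_limit[OF t' test_measurable_bounded(1)[OF \<phi>] M])
  have eq: "(LINT x|lebesgue_on UB. partial_deriv e \<phi> x * ev (inverse (real (Suc n))) x t)
     = - (LINT x|lebesgue_on UB. \<phi> x * ev (inverse (real (Suc n))) x (D e t))" for n
  proof -
    have pd: "partial_deriv e (\<lambda>x. ev (inverse (real (Suc n))) x t) = (\<lambda>x. ev (inverse (real (Suc n))) x (D e t))"
      by (rule ext, rule partial_deriv_ev, rule pos_eps, rule eps_seq)
    have "has_weak_deriv UB e (\<lambda>x. ev (inverse (real (Suc n))) x t) (\<lambda>x. ev (inverse (real (Suc n))) x (D e t))"
      using has_weak_deriv_smooth[OF smooth_ev[OF eps_seq(2)[of n], of t] e open_ball] unfolding pd .
    then show ?thesis using \<phi> by (simp add: has_weak_deriv_def)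
  qed
  have "(LINT x|lebesgue_on UB. partial_deriv e \<phi> x * ev 0 x t) = - (LINT x|lebesgue_on UB. \<phi> x * ev 0 x (D e t))"
    by (rule LIMSEQ_unique[OF 1[unfolded eq] tendsto_minus[OF 2]])
  then show "(LINT x|lebesgue_on UB. partial_deriv e \<phi> x *\<^sub>R ev 0 x t) = - (LINT x|lebesgue_on UB. \<phi> x *\<^sub>R ev 0 x (D e t))"
    by simp
qed

lemma L2_ev:
  fixes t :: "'a::euclidean_space rexpr"
  assumes t: "2 * deg t > - int DIM('a)" "\<epsilon> \<ge> 0"
  shows "L2 UB (\<lambda>x. ev \<epsilon> x t)"
proof -
  have "integrable (lebesgue_on UB) (\<lambda>x. ev \<epsilon> x (Times t t))"
    by (rule integrable_ev) (use t in auto)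
  then show ?thesis by (simp add: L2_def measurable_ev_UB power2_eq_square)
qed

lemma L2_lim_ev:
  fixes t :: "'a::euclidean_space rexpr"
  assumes t: "2 * deg t > - int DIM('a)"
  shows "L2_lim UB (\<lambda>n x. ev (inverse (real (Suc n))) x t) (\<lambda>x. ev 0 x t) sequentially"
proof -
  define k where "k = nat (- deg t)"
  have k: "2 * k < DIM('a)" "deg t \<ge> - int k" using t DIM_positive[where 'a='a] unfolding k_def by arith+
  obtain C where C: "C \<ge> 0" "\<And>\<epsilon> x::'a. \<epsilon> \<ge> 0 \<Longrightarrow> x \<noteq> 0 \<Longrightarrow> norm x \<le> 1 \<Longrightarrow> \<bar>ev \<epsilon> x t\<bar> \<le> C * inverse (norm x) ^ k"
    by (rule ev_bound[OF k(2)]) blast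
  have e0: "0 \<le> inverse (real (Suc n))" for n by simp
  have "(\<lambda>n. LINT x|lebesgue_on UB. (norm (ev (inverse (real (Suc n))) x t - ev 0 x t))\<^sup>2) \<longlonglongrightarrow> (LINT x|lebesgue_on (UB::'a set). 0)"
  proof (rule integral_dominated_convergence[where w="\<lambda>x. (2 * C)\<^sup>2 * inverse (norm x) ^ (2 * k)"])
    show "AE x in lebesgue_on UB. (\<lambda>n. (norm (ev (inverse (real (Suc n))) x t - ev 0 x t))\<^sup>2) \<longlonglongrightarrow> 0"
      using AE_UB_nonzero
    proof eventually_elim
      case (elim x)
      have "(\<lambda>n. (norm (ev (inverse (real (Suc n))) x t - ev 0 x t))\<^sup>2) \<longlonglongrightarrow> (norm (ev 0 x t - ev 0 x t))\<^sup>2"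
        by (intro tendsto_intros ev_tendsto eps_seq) (use elim in auto)
      then show ?case by simp
    qed
    show "AE x in lebesgue_on UB. norm ((norm (ev (inverse (real (Suc n))) x t - ev 0 x t))\<^sup>2) \<le> (2 * C)\<^sup>2 * inverse (norm x) ^ (2 * k)" for n
      using AE_UB_nonzero
    proof eventually_elim
      case (elim x)
      have "\<bar>ev (inverse (real (Suc n))) x t - ev 0 x t\<bar> \<le> 2 * C * inverse (norm x) ^ k"
        using C(2)[OF e0[of n], of x] C(2)[of 0 x] elim by linarith
      then have "(\<bar>ev (inverse (real (Suc n))) x t - ev 0 x t\<bar>)\<^sup>2 \<le> (2 * C * inverse (norm x) ^ k)\<^sup>2"
        by (intro power_mono) auto
      then show ?case by (simp add: power_mult_distrib power_mult[symmetric] mult.commute)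
    qed
    show "integrable (lebesgue_on UB) (\<lambda>x::'a. (2 * C)\<^sup>2 * inverse (norm x) ^ (2 * k))"
      by (intro integrable_mult_right integrable_inverse_norm_power k)
  qed (auto intro!: borel_measurable_power borel_measurable_norm borel_measurable_diff measurable_ev_UB)
  then have "(\<lambda>n. sqrt (LINT x|lebesgue_on UB. (norm (ev (inverse (real (Suc n))) x t - ev 0 x t))\<^sup>2)) \<longlonglongrightarrow> sqrt 0"
    by (intro tendsto_intros) simp
  then show ?thesis
    using L2_ev[OF t] by (simp add: L2_lim_def L2norm_def L2_norm_sq_def)
qed

section \<open>Differential calculus off the origin\<close>

definition lap :: "'a::euclidean_space rexpr \<Rightarrow> 'a \<Rightarrow> real" where
  "lap t x = (\<Sum>b\<in>Basis. ev 0 x (D b (D b t)))"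

definition grad_prod :: "'a::euclidean_space rexpr \<Rightarrow> 'a rexpr \<Rightarrow> 'a \<Rightarrow> real" where
  "grad_prod s t x = (\<Sum>b\<in>Basis. ev 0 x (D b s) * ev 0 x (D b t))"

abbreviation rinv :: "'a::euclidean_space \<Rightarrow> real" where "rinv x \<equiv> ev 0 x Winv"

lemma rinv_sq: "x \<noteq> 0 \<Longrightarrow> (x \<bullet> x) * rinv x * rinv x = 1"
proof -
  assume "x \<noteq> 0"
  then have "norm x > 0" by simp
  then show ?thesis by (simp add: norm_eq_sqrt_inner[symmetric] power2_norm_eq_inner[symmetric] power2_eq_square field_simps)
qed

lemma ev_direction_0: "x \<noteq> 0 \<Longrightarrow> ev 0 x (D v t) = (\<Sum>b\<in>Basis. (v \<bullet> b) * ev 0 x (D b t))"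
  using ev_direction[of x 0 v t] by simp

lemma lap_Plus: "lap (Plus s t) x = lap s x + lap t x"
  by (simp add: lap_def sum.distrib)

lemma lap_Times: "lap (Times s t) x = lap s x * ev 0 x t + 2 * grad_prod s t x + ev 0 x s * lap t x"
  by (simp add: lap_def grad_prod_def sum.distrib sum_distrib_left sum_distrib_right algebra_simps)

lemma lap_Cst: "lap (Cst c) x = 0" "grad_prod (Cst c) t x = 0"
  by (auto simp: lap_def grad_prod_def)

lemma lap_Crd: "lap (Crd v) x = 0"
  by (simp add: lap_def)

lemma grad_prod_Crd: "x \<noteq> 0 \<Longrightarrow> grad_prod (Crd v) t x = ev 0 x (D v t)"
  by (simp add: ev_direction_0[of x v t] grad_prod_def inner_commute)

lemma lap_Rsq: "lap (Rsq :: 'a::euclidean_space rexpr) x = 2 * real DIM('a)"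
  by (simp add: lap_def)

lemma grad_prod_Rsq: "x \<noteq> 0 \<Longrightarrow> grad_prod Rsq t x = 2 * ev 0 x (D x t)"
  by (simp add: ev_direction_0[of x x t] grad_prod_def sum_distrib_left mult.assoc)

lemma grad_prod_Winv: "x \<noteq> 0 \<Longrightarrow> grad_prod Winv t x = - (rinv x ^ 3) * ev 0 x (D x t)"
  unfolding ev_direction_0[of x x t] by (simp add: grad_prod_def sum_distrib_left power3_eq_cube sum_negf[symmetric] algebra_simps)

lemma grad_prod_Times: "grad_prod (Times r s) t x = ev 0 x r * grad_prod s t x + ev 0 x s * grad_prod r t x"
  by (simp add: grad_prod_def sum.distrib sum_distrib_left algebra_simps)

lemma lap_Winv:
  assumes x: "x \<noteq> 0"
  shows "lap (Winv :: 'a::euclidean_space rexpr) x = (3 - real DIM('a)) * rinv x ^ 3"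
proof -
  let ?w = "rinv x"
  have "lap (Winv :: 'a rexpr) x = (\<Sum>b\<in>Basis. - (?w ^ 3) + 3 * ?w ^ 5 * ((x \<bullet> b) * (x \<bullet> b)))"
    unfolding lap_def
    by (rule sum.cong) (auto simp: power3_eq_cube power_numeral_reduce algebra_simps inner_same_Basis)
  also have "\<dots> = - (real DIM('a) * ?w ^ 3) + 3 * ?w ^ 5 * (x \<bullet> x)"
    unfolding sum.distrib sum_distrib_left[symmetric] euclidean_inner[of x x, symmetric] by simp
  also have "3 * ?w ^ 5 * (x \<bullet> x) = 3 * ?w ^ 3 * ((x \<bullet> x) * ?w * ?w)" by (simp add: power_numeral_reduce)
  finally show ?thesis by (simp only: rinv_sq[OF x]) (simp add: algebra_simps)
qed

lemma sum_ev_eq_D: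
  assumes "finite I" "\<And>x. x \<noteq> 0 \<Longrightarrow> (\<Sum>i\<in>I. ev 0 x (t i)) = ev 0 x s" "x \<noteq> 0"
  shows "(\<Sum>i\<in>I. ev 0 x (D e (t i))) = ev 0 x (D e s)"
proof -
  have p: "x \<bullet> x + 0 > 0" using assms(3) by simp
  have 1: "((\<lambda>x. \<Sum>i\<in>I. ev 0 x (t i)) has_derivative (\<lambda>h. \<Sum>i\<in>I. ev 0 x (D h (t i)))) (at x)"
    by (intro has_derivative_sum ev_has_derivative p)
  have "((\<lambda>x. ev 0 x s) has_derivative (\<lambda>h. \<Sum>i\<in>I. ev 0 x (D h (t i)))) (at x)"
    by (rule has_derivative_transform_within_open[OF 1, of "- {0}"]) (use assms in auto)
  from partial_deriv_eqI[OF this, of e] partial_deriv_ev[OF p, of e s] show ?thesis by simp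
qed

text \<open>The Laplacian commutes with directional derivatives; since expressions that agree off the origin
  may differ symbolically, the order is exchanged semantically.\<close>

lemma lap_D:
  assumes "\<And>x. x \<noteq> 0 \<Longrightarrow> lap t x = ev 0 x s" "x \<noteq> 0"
  shows "lap (D e t) x = ev 0 x (D e s)"
proof -
  have "lap (D e t) x = (\<Sum>b\<in>Basis. ev 0 x (D e (D b (D b t))))"
    unfolding lap_def
  proof (rule sum.cong[OF refl])
    fix b :: 'a
    have "ev 0 x (D b (D b (D e t))) = ev 0 x (D b (D e (D b t)))"
      by (rule ev_eq_D[OF _ assms(2)]) (rule ev_mixed)
    also have "\<dots> = ev 0 x (D e (D b (D b t)))" by (rule ev_mixed)
    finally show "ev 0 x (D b (D b (D e t))) = ev 0 x (D e (D b (D b t)))" .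
  qed
  also have "\<dots> = ev 0 x (D e s)"
    by (rule sum_ev_eq_D[OF finite_Basis _ assms(2)]) (use assms(1) in \<open>simp add: lap_def\<close>)
  finally show ?thesis .
qed

text \<open>If \<open>f\<close> is homogeneous of degree 0 with $\Delta f=-L\,r^{-2}f$, then $\nabla f$ is orthogonal to the radial
  gradient of $r^{-2}$, so that only $\Delta(r^{-2})f + r^{-2}\Delta f$ remains.\<close>

lemma lap_Winv2:
  fixes t :: "'a::euclidean_space rexpr"
  assumes x: "x \<noteq> 0" and h: "homog 0 t" and L: "lap t x = - L * rinv x ^ 2 * ev 0 x t"
  shows "lap (Times (Times Winv Winv) t) x = (8 - 2 * real DIM('a) - L) * rinv x ^ 4 * ev 0 x t"
    "grad_prod (Times Winv Winv) t x = 0"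
proof -
  let ?w = "rinv x"
  have h0: "ev 0 x (D x t) = 0" using h x by (simp add: homog_def)
  show G: "grad_prod (Times Winv Winv) t x = 0" by (simp add: grad_prod_Times grad_prod_Winv[OF x] h0 del: ev.simps(4))
  have wx: "ev 0 x (D x Winv) = - ?w" using homog_Winv[unfolded homog_def, rule_format, OF x] by simp
  have "grad_prod Winv Winv x = ?w ^ 4"
    unfolding grad_prod_Winv[OF x] wx by (simp add: power_numeral_reduce)
  then have H: "lap (Times Winv Winv) x = (8 - 2 * real DIM('a)) * ?w ^ 4"
    unfolding lap_Times lap_Winv[OF x] by (simp add: power_numeral_reduce algebra_simps del: ev.simps(4))
  show "lap (Times (Times Winv Winv) t) x = (8 - 2 * real DIM('a) - L) * ?w ^ 4 * ev 0 x t"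
    unfolding lap_Times[of "Times Winv Winv"] G L H by (simp add: power_numeral_reduce algebra_simps del: ev.simps(4))
qed

section \<open>Vector-valued expressions\<close>

definition vec_ev :: "real \<Rightarrow> ('b::euclidean_space \<Rightarrow> 'a::euclidean_space rexpr) \<Rightarrow> 'a \<Rightarrow> 'b" where
  "vec_ev \<epsilon> T x = (\<Sum>b\<in>Basis. ev \<epsilon> x (T b) *\<^sub>R b)"

lemma vec_ev_inner: "b \<in> Basis \<Longrightarrow> vec_ev \<epsilon> T x \<bullet> b = ev \<epsilon> x (T b)"
  by (simp add: vec_ev_def inner_sum_left inner_Basis if_distrib sum.delta cong: if_cong)

lemma hwd_bounded_linear:
  fixes f :: "'a::euclidean_space \<Rightarrow> 'b::euclidean_space" and L :: "'b \<Rightarrow> 'c::euclidean_space"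
  assumes \<Omega>: "open \<Omega>" and e: "e \<in> Basis" and L: "bounded_linear L" and f: "has_weak_deriv \<Omega> e f g"
  shows "has_weak_deriv \<Omega> e (\<lambda>x. L (f x)) (\<lambda>x. L (g x))"
  unfolding has_weak_deriv_def
proof (intro conjI allI impI)
  have li: "locally_integrable \<Omega> f" "locally_integrable \<Omega> g"
    using f by (auto simp: has_weak_deriv_def)
  then show "locally_integrable \<Omega> (\<lambda>x. L (f x))" "locally_integrable \<Omega> (\<lambda>x. L (g x))"
    using integrable_bounded_linear[OF L] by (auto simp: locally_integrable_def)
  fix \<phi> :: "'a \<Rightarrow> real" assume \<phi>: "test_function \<Omega> \<phi>"
  have eq: "(LINT x|lebesgue_on \<Omega>. \<psi> x *\<^sub>R L (u x)) = L (LINT x|lebesgue_on \<Omega>. \<psi> x *\<^sub>R u x)"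
    if "locally_integrable \<Omega> u" "test_function \<Omega> \<psi>" for u :: "'a \<Rightarrow> 'b" and \<psi> :: "'a \<Rightarrow> real"
    using integral_bounded_linear[OF L integrable_test_scaleR[OF \<Omega> that]]
    by (simp add: linear_cmul[OF bounded_linear.linear[OF L]])
  show "(LINT x|lebesgue_on \<Omega>. partial_deriv e \<phi> x *\<^sub>R L (f x)) = - (LINT x|lebesgue_on \<Omega>. \<phi> x *\<^sub>R L (g x))"
    unfolding eq[OF li(1) test_partial[OF \<phi> e]] eq[OF li(2) \<phi>]
    using f \<phi> by (simp add: has_weak_deriv_def linear_neg[OF bounded_linear.linear[OF L]])
qed

lemma hwd_zero: "open \<Omega> \<Longrightarrow> e \<in> Basis \<Longrightarrow> has_weak_deriv \<Omega> e (\<lambda>x. 0) (\<lambda>x. 0)"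
  using has_weak_deriv_smooth[OF smooth_const[of 0], of e \<Omega>] by simp

lemma hwd_sum:
  fixes f :: "'i \<Rightarrow> 'a::euclidean_space \<Rightarrow> 'b::euclidean_space"
  assumes "open \<Omega>" "e \<in> Basis" "finite A" "\<And>i. i \<in> A \<Longrightarrow> has_weak_deriv \<Omega> e (f i) (g i)"
  shows "has_weak_deriv \<Omega> e (\<lambda>x. \<Sum>i\<in>A. f i x) (\<lambda>x. \<Sum>i\<in>A. g i x)"
  using assms(3,4)
proof (induction A rule: finite_induct)
  case empty
  then show ?case using hwd_zero[OF assms(1,2)] by simp
next
  case (insert a A)
  then show ?case
    using hwd_lincomb[OF assms(1,2), of "f a" "g a" "\<lambda>x. \<Sum>i\<in>A. f i x" "\<lambda>x. \<Sum>i\<in>A. g i x" 1 1] by simp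
qed

lemma hwd_components:
  fixes F G :: "'b::euclidean_space \<Rightarrow> 'a::euclidean_space \<Rightarrow> real"
  assumes "open \<Omega>" "e \<in> Basis" "\<And>b. b \<in> Basis \<Longrightarrow> has_weak_deriv \<Omega> e (F b) (G b)"
  shows "has_weak_deriv \<Omega> e (\<lambda>x. \<Sum>b\<in>Basis. F b x *\<^sub>R b) (\<lambda>x. \<Sum>b\<in>Basis. G b x *\<^sub>R b)"
  by (intro hwd_sum hwd_bounded_linear[OF assms(1,2) bounded_linear_scaleR_left] assms finite_Basis)

lemma hwd_smooth_scaleR:
  fixes f :: "'a::euclidean_space \<Rightarrow> 'b::euclidean_space" and \<theta> :: "'a \<Rightarrow> real"
  assumes \<Omega>: "open \<Omega>" and e: "e \<in> Basis" and \<theta>: "smooth \<theta>" and f: "has_weak_deriv \<Omega> e f g"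
  shows "has_weak_deriv \<Omega> e (\<lambda>x. \<theta> x *\<^sub>R f x) (\<lambda>x. partial_deriv e \<theta> x *\<^sub>R f x + \<theta> x *\<^sub>R g x)"
  unfolding has_weak_deriv_def
proof (intro conjI allI impI)
  have li: "locally_integrable \<Omega> f" "locally_integrable \<Omega> g"
    using f by (auto simp: has_weak_deriv_def)
  have lis: "locally_integrable \<Omega> (\<lambda>x. \<psi> x *\<^sub>R u x)" if \<psi>: "smooth \<psi>" and u: "locally_integrable \<Omega> u"
    for \<psi> :: "'a \<Rightarrow> real" and u :: "'a \<Rightarrow> 'b"
    unfolding locally_integrable_def
  proof (intro allI impI)
    fix K assume K: "compact K \<and> K \<subseteq> \<Omega>"
    obtain C where C: "\<And>x. x \<in> K \<Longrightarrow> norm (\<psi> x) \<le> C"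
      using compact_imp_bounded[OF compact_continuous_image[OF smooth_continuous[OF \<psi>], of K]] K
      unfolding bounded_iff by blast
    have iu: "integrable (lebesgue_on K) u" using u K by (simp add: locally_integrable_def)
    have m: "\<psi> \<in> borel_measurable (lebesgue_on K)"
      by (intro measurable_restrict_space1 measurable_completion)
        (simp add: borel_measurable_continuous_onI[OF smooth_continuous[OF \<psi>]])
    show "integrable (lebesgue_on K) (\<lambda>x. \<psi> x *\<^sub>R u x)"
    proof (rule Bochner_Integration.integrable_bound[OF integrable_mult_right[OF integrable_norm[OF iu], of C]])
      show "(\<lambda>x. \<psi> x *\<^sub>R u x) \<in> borel_measurable (lebesgue_on K)"
        by (rule borel_measurable_scaleR[OF m borel_measurable_integrable[OF iu]])
      show "AE x in lebesgue_on K. norm (\<psi> x *\<^sub>R u x) \<le> norm (C * norm (u x))"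
      proof (rule AE_I2)
        fix x assume "x \<in> space (lebesgue_on K)"
        then have "norm (\<psi> x) \<le> C" using C by simp
        then have "norm (\<psi> x) * norm (u x) \<le> \<bar>C\<bar> * norm (u x)" by (intro mult_right_mono) auto
        then show "norm (\<psi> x *\<^sub>R u x) \<le> norm (C * norm (u x))" by (simp add: abs_mult)
      qed
    qed
  qed
  show "locally_integrable \<Omega> (\<lambda>x. \<theta> x *\<^sub>R f x)" by (rule lis[OF \<theta> li(1)])
  show "locally_integrable \<Omega> (\<lambda>x. partial_deriv e \<theta> x *\<^sub>R f x + \<theta> x *\<^sub>R g x)"
    using lis[OF smooth_partial[OF \<theta> e] li(1)] lis[OF \<theta> li(2)] by (auto simp: locally_integrable_def)
  fix \<phi> :: "'a \<Rightarrow> real" assume \<phi>: "test_function \<Omega> \<phi>"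
  have t1: "test_function \<Omega> (\<lambda>x. \<phi> x * \<theta> x)" by (rule test_mult[OF \<phi> \<theta>])
  have t2: "test_function \<Omega> (\<lambda>x. partial_deriv e \<phi> x * \<theta> x)" by (rule test_mult[OF test_partial[OF \<phi> e] \<theta>])
  have t3: "test_function \<Omega> (\<lambda>x. \<phi> x * partial_deriv e \<theta> x)" by (rule test_mult[OF \<phi> smooth_partial[OF \<theta> e]])
  have "(LINT x|lebesgue_on \<Omega>. partial_deriv e (\<lambda>x. \<phi> x * \<theta> x) x *\<^sub>R f x) = - (LINT x|lebesgue_on \<Omega>. (\<phi> x * \<theta> x) *\<^sub>R g x)"
    using f t1 by (simp add: has_weak_deriv_def)
  moreover have "(LINT x|lebesgue_on \<Omega>. partial_deriv e (\<lambda>x. \<phi> x * \<theta> x) x *\<^sub>R f x)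
     = (LINT x|lebesgue_on \<Omega>. (partial_deriv e \<phi> x * \<theta> x) *\<^sub>R f x) + (LINT x|lebesgue_on \<Omega>. (\<phi> x * partial_deriv e \<theta> x) *\<^sub>R f x)"
    using integrable_test_scaleR[OF \<Omega> li(1) t2] integrable_test_scaleR[OF \<Omega> li(1) t3]
    by (simp add: pd_mult[OF test_smooth[OF \<phi>] \<theta>] scaleR_add_left)
  moreover have "(LINT x|lebesgue_on \<Omega>. \<phi> x *\<^sub>R (partial_deriv e \<theta> x *\<^sub>R f x + \<theta> x *\<^sub>R g x))
     = (LINT x|lebesgue_on \<Omega>. (\<phi> x * partial_deriv e \<theta> x) *\<^sub>R f x) + (LINT x|lebesgue_on \<Omega>. (\<phi> x * \<theta> x) *\<^sub>R g x)"
    using integrable_test_scaleR[OF \<Omega> li(1) t3] integrable_test_scaleR[OF \<Omega> li(2) t1]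
    by (simp add: scaleR_add_right)
  ultimately show "(LINT x|lebesgue_on \<Omega>. partial_deriv e \<phi> x *\<^sub>R \<theta> x *\<^sub>R f x)
      = - (LINT x|lebesgue_on \<Omega>. \<phi> x *\<^sub>R (partial_deriv e \<theta> x *\<^sub>R f x + \<theta> x *\<^sub>R g x))"
    by (simp add: algebra_simps)
qed

lemma smooth_vec_ev: "\<epsilon> > 0 \<Longrightarrow> smooth (vec_ev \<epsilon> T)"
  unfolding vec_ev_def[abs_def] by (intro smooth_sum smooth_scaleR smooth_ev smooth_const finite_Basis)

lemma pd_vec_ev: "\<epsilon> > 0 \<Longrightarrow> partial_deriv e (vec_ev \<epsilon> T) = vec_ev \<epsilon> (\<lambda>b. D e (T b))"
proof
  fix x :: 'a assume \<epsilon>: "\<epsilon> > 0"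
  have "partial_deriv e (vec_ev \<epsilon> T) x = (\<Sum>b\<in>Basis. partial_deriv e (\<lambda>x. ev \<epsilon> x (T b) *\<^sub>R b) x)"
    unfolding vec_ev_def[abs_def] by (rule pd_sum) (auto intro!: smooth_scaleR smooth_ev smooth_const \<epsilon>)
  also have "\<dots> = (\<Sum>b\<in>Basis. ev \<epsilon> x (D e (T b)) *\<^sub>R b)"
    by (rule sum.cong) (auto simp: pd_scaleR[OF smooth_ev[OF \<epsilon>] smooth_const] partial_deriv_ev[OF pos_eps[OF \<epsilon>]])
  finally show "partial_deriv e (vec_ev \<epsilon> T) x = vec_ev \<epsilon> (\<lambda>b. D e (T b)) x" by (simp add: vec_ev_def)
qed

lemma hwd_vec_ev:
  fixes T :: "'b::euclidean_space \<Rightarrow> 'a::euclidean_space rexpr"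
  assumes "\<And>b. b \<in> Basis \<Longrightarrow> deg (T b) - 1 > - int DIM('a)" "e \<in> Basis"
  shows "has_weak_deriv UB e (vec_ev 0 T) (vec_ev 0 (\<lambda>b. D e (T b)))"
  unfolding vec_ev_def[abs_def] by (rule hwd_components) (auto intro: hwd_ev assms)

lemma L2_lim_vec_ev:
  fixes T :: "'b::euclidean_space \<Rightarrow> 'a::euclidean_space rexpr"
  assumes "\<And>b. b \<in> Basis \<Longrightarrow> 2 * deg (T b) > - int DIM('a)"
  shows "L2_lim UB (\<lambda>n. vec_ev (inverse (real (Suc n))) T) (vec_ev 0 T) sequentially"
  unfolding vec_ev_def[abs_def]
  by (intro L2_lim_sum finite_Basis L2_lim_bounded_linear[OF L2_lim_ev bounded_linear_scaleR_left] assms)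

lemma jet_vec_ev:
  fixes T :: "'b::euclidean_space \<Rightarrow> 'a::euclidean_space rexpr"
  assumes "\<And>b. b \<in> Basis \<Longrightarrow> deg (T b) \<ge> 0" "DIM('a) \<ge> 5"
  shows "jet_L2 UB (vec_ev 0 T) (\<lambda>e. vec_ev 0 (\<lambda>b. D e (T b))) (\<lambda>e' e. vec_ev 0 (\<lambda>b. D e' (D e (T b))))" (is ?J)
    "jet_lim UB (\<lambda>n. vec_ev (inverse (real (Suc n))) T) (\<lambda>n e. partial_deriv e (vec_ev (inverse (real (Suc n))) T))
      (\<lambda>n e' e. partial_deriv e' (partial_deriv e (vec_ev (inverse (real (Suc n))) T)))
      (vec_ev 0 T) (\<lambda>e. vec_ev 0 (\<lambda>b. D e (T b))) (\<lambda>e' e. vec_ev 0 (\<lambda>b. D e' (D e (T b)))) sequentially" (is ?K)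
proof -
  have d1: "deg (D e (T b)) \<ge> -1" if "b \<in> Basis" for b e using deg_D[of "T b" e] assms(1)[OF that] by linarith
  have d2: "deg (D e' (D e (T b))) \<ge> -2" if "b \<in> Basis" for b e e' using deg_D[of "D e (T b)" e'] d1[OF that, of e] by linarith
  have l0: "L2_lim UB (\<lambda>n. vec_ev (inverse (real (Suc n))) T) (vec_ev 0 T) sequentially"
    by (rule L2_lim_vec_ev) (use assms in fastforce)
  have l1: "L2_lim UB (\<lambda>n. vec_ev (inverse (real (Suc n))) (\<lambda>b. D e (T b))) (vec_ev 0 (\<lambda>b. D e (T b))) sequentially" for e
    by (rule L2_lim_vec_ev) (use assms(2) d1[of _ e] in fastforce)
  have l2: "L2_lim UB (\<lambda>n. vec_ev (inverse (real (Suc n))) (\<lambda>b. D e' (D e (T b)))) (vec_ev 0 (\<lambda>b. D e' (D e (T b)))) sequentially" for e e'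
    by (rule L2_lim_vec_ev) (use assms(2) d2[of _ e' e] in fastforce)
  have h1: "has_weak_deriv UB e (vec_ev 0 T) (vec_ev 0 (\<lambda>b. D e (T b)))" if "e \<in> Basis" for e
    by (rule hwd_vec_ev[OF _ that]) (use assms in fastforce)
  have h2: "has_weak_deriv UB e' (vec_ev 0 (\<lambda>b. D e (T b))) (vec_ev 0 (\<lambda>b. D e' (D e (T b))))" if "e' \<in> Basis" for e e'
    by (rule hwd_vec_ev[OF _ that]) (use assms(2) d1[of _ e] in fastforce)
  show ?J
    unfolding jet_L2_def weak_jet_def using h1 h2 L2_limD[OF l0] L2_limD[OF l1] L2_limD[OF l2] by blast
  show ?K unfolding jet_lim_def by (simp add: pd_vec_ev l0 l1 l2 del: of_nat_Suc)
qed

section \<open>Maps that are homogeneous of degree zero\<close>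

lemma LINT_cong_AE:
  fixes f g :: "'a::euclidean_space \<Rightarrow> 'b::euclidean_space"
  assumes "S \<in> sets lebesgue" "g \<in> borel_measurable (lebesgue_on S)" "AE x in lebesgue_on S. f x = g x"
  shows "(LINT x|lebesgue_on S. f x) = (LINT x|lebesgue_on S. g x)"
proof (rule integral_cong_AE)
  have "AE x in lebesgue_on S. g x = f x" using assms(3) by eventually_elim simp
  from measurable_AE_cong[OF assms(1,2) this] show "f \<in> borel_measurable (lebesgue_on S)" .
qed fact+

lemma integrable_test_ev:
  fixes t :: "'a::euclidean_space rexpr" and \<phi> :: "'a \<Rightarrow> real"
  assumes \<phi>: "test_function UB \<phi>" and t: "deg t > - int DIM('a)"
  shows "integrable (lebesgue_on UB) (\<lambda>x. \<phi> x * ev 0 x t)"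
  using integrable_test_scaleR[OF open_ball locally_integrable_of_integrable[OF open_ball integrable_ev[OF t order_refl]] \<phi>]
  by simp

text \<open>The pairing of a test function with an expression, in which the computations for the weak equation
  are carried out.\<close>

definition test_pairing :: "('a::euclidean_space \<Rightarrow> real) \<Rightarrow> 'a rexpr \<Rightarrow> real" where
  "test_pairing \<phi> t = (LINT x|lebesgue_on UB. \<phi> x * ev 0 x t)"

lemma test_pairing_parts:
  fixes t :: "'a::euclidean_space rexpr"
  assumes "test_function UB \<phi>" "deg t - 1 > - int DIM('a)" "e \<in> Basis"
  shows "test_pairing (partial_deriv e \<phi>) t = - test_pairing \<phi> (D e t)"
  using hwd_ev[OF assms(2,3)] assms(1) by (simp add: has_weak_deriv_def test_pairing_def)

lemma test_pairing_Plus: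
  fixes s t :: "'a::euclidean_space rexpr"
  assumes "test_function UB \<phi>" "deg s > - int DIM('a)" "deg t > - int DIM('a)"
  shows "test_pairing \<phi> (Plus s t) = test_pairing \<phi> s + test_pairing \<phi> t"
  using integrable_test_ev[OF assms(1,2)] integrable_test_ev[OF assms(1,3)]
  by (simp add: test_pairing_def distrib_left)

text \<open>Moves a derivative from the non-smooth test function \<open>\<phi> s\<close> to \<open>t\<close>. It is \<open>test_pairing_parts\<close> for the product
  of \<open>t\<close> and \<open>s\<close>, arranged so that the left-hand side pairs $\partial_e(\varphi s)$ with \<open>t\<close>.\<close>

lemma test_pairing_parts_weight:
  fixes t :: "'a::euclidean_space rexpr"
  assumes \<phi>: "test_function UB \<phi>" and d: "deg t + deg s - 1 > - int DIM('a)" and e: "e \<in> Basis"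
  shows "test_pairing (partial_deriv e \<phi>) (Times t s) + test_pairing \<phi> (Times t (D e s)) = - test_pairing \<phi> (Times (D e t) s)"
proof -
  have "test_pairing (partial_deriv e \<phi>) (Times t s) = - test_pairing \<phi> (D e (Times t s))"
    by (rule test_pairing_parts[OF \<phi> _ e]) (use d in simp)
  also have "\<dots> = - (test_pairing \<phi> (Times (D e t) s) + test_pairing \<phi> (Times t (D e s)))"
    using deg_D[of t e] deg_D[of s e] d by (simp add: test_pairing_Plus[OF \<phi>])
  finally show ?thesis by simp
qed

lemma test_pairing_parts_weight2:
  fixes t :: "'a::euclidean_space rexpr"
  assumes \<phi>: "test_function UB \<phi>" and d: "deg t + deg s - 2 > - int DIM('a)" and e: "e \<in> Basis"
  shows "test_pairing (partial_deriv e (partial_deriv e \<phi>)) (Times t s) + 2 * test_pairing (partial_deriv e \<phi>) (Times t (D e s))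
      + test_pairing \<phi> (Times t (D e (D e s))) = test_pairing \<phi> (Times (D e (D e t)) s)"
proof -
  have p: "test_function UB (partial_deriv e \<phi>)" by (rule test_partial[OF \<phi> e])
  have ds: "deg (D e s) \<ge> deg s - 1" "deg (D e t) \<ge> deg t - 1" by (rule deg_D)+
  have 1: "test_pairing (partial_deriv e (partial_deriv e \<phi>)) (Times t s) + test_pairing (partial_deriv e \<phi>) (Times t (D e s))
     = - test_pairing (partial_deriv e \<phi>) (Times (D e t) s)"
    by (rule test_pairing_parts_weight[OF p _ e]) (use d in simp)
  have 2: "test_pairing (partial_deriv e \<phi>) (Times t (D e s)) + test_pairing \<phi> (Times t (D e (D e s)))
     = - test_pairing \<phi> (Times (D e t) (D e s))"
    by (rule test_pairing_parts_weight[OF \<phi> _ e]) (use d ds in simp)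
  have 3: "test_pairing (partial_deriv e \<phi>) (Times (D e t) s) + test_pairing \<phi> (Times (D e t) (D e s))
     = - test_pairing \<phi> (Times (D e (D e t)) s)"
    by (rule test_pairing_parts_weight[OF \<phi> _ e]) (use d ds in simp)
  show ?thesis using 1 2 3 by simp
qed

lemma pd_component: "smooth \<phi> \<Longrightarrow> partial_deriv e (\<lambda>x. \<phi> x \<bullet> b) = (\<lambda>x. partial_deriv e \<phi> x \<bullet> b)"
  using pd_inner[OF _ smooth_const[of b], of \<phi> e] by (auto simp: fun_eq_iff)

text \<open>The abstract form of the map $q$: its components \<open>T b\<close> are homogeneous of degree 0 and satisfy
  $\Delta T_b=-L_b\,r^{-2}T_b$, the map has length 1, and \<open>g\<close> turns out to be $r^2|\nabla q|^2$. The condition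
  \<open>biharm\<close> on the eigenvalues makes $q$ biharmonic; for $q$ itself the eigenvalues are
  $\lambda=\ell(\ell+m-2)$ on the components from $u^{(\ell)}$ and 0 on the constant one, and $g=\lambda\sin^2\alpha$.\<close>

locale cone_map =
  fixes T :: "'b::euclidean_space \<Rightarrow> 'a::euclidean_space rexpr" and L :: "'b \<Rightarrow> real" and g :: real
  assumes homog_T: "b \<in> Basis \<Longrightarrow> homog 0 (T b)"
    and deg_T: "b \<in> Basis \<Longrightarrow> deg (T b) \<ge> 0"
    and eigen: "b \<in> Basis \<Longrightarrow> x \<noteq> 0 \<Longrightarrow> lap (T b) x = - L b * rinv x ^ 2 * ev 0 x (T b)"
    and unit: "x \<noteq> 0 \<Longrightarrow> (\<Sum>b\<in>Basis. (ev 0 x (T b))\<^sup>2) = 1"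
    and energy: "x \<noteq> 0 \<Longrightarrow> (\<Sum>b\<in>Basis. L b * (ev 0 x (T b))\<^sup>2) = g"
    and biharm: "b \<in> Basis \<Longrightarrow> L b = 0 \<or> L b + 2 * real DIM('a) - 8 = 2 * g"
    and dim: "DIM('a) \<ge> 7"
begin

abbreviation q where "q \<equiv> vec_ev 0 T"
abbreviation q1 where "q1 e \<equiv> vec_ev 0 (\<lambda>b. D e (T b))"
abbreviation q2 where "q2 e' e \<equiv> vec_ev 0 (\<lambda>b. D e' (D e (T b)))"

definition A :: "'b \<Rightarrow> 'a rexpr" where
  "A b = Times (Cst (- L b)) (Times (Times Winv Winv) (T b))"

lemma degs: "b \<in> Basis \<Longrightarrow> deg (D e (T b)) \<ge> -1" "b \<in> Basis \<Longrightarrow> deg (A b) \<ge> -2"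
  "b \<in> Basis \<Longrightarrow> deg (D e (A b)) \<ge> -3" "b \<in> Basis \<Longrightarrow> deg (D e' (D e (A b))) \<ge> -4"
proof -
  show 1: "deg (D e (T b)) \<ge> -1" if "b \<in> Basis" using deg_D[of "T b" e] deg_T[OF that] by linarith
  show 2: "deg (A b) \<ge> -2" if "b \<in> Basis" using deg_T[OF that] by (simp add: A_def)
  show 3: "deg (D e (A b)) \<ge> -3" if "b \<in> Basis" using deg_D[of "A b" e] 2[OF that] by linarith
  show "deg (D e' (D e (A b))) \<ge> -4" if "b \<in> Basis" using deg_D[of "D e (A b)" e'] 3[OF that] by linarith
qed

lemma jets:
  "jet_L2 UB q q1 q2"
  "jet_lim UB (\<lambda>n. vec_ev (inverse (real (Suc n))) T) (\<lambda>n e. partial_deriv e (vec_ev (inverse (real (Suc n))) T))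
      (\<lambda>n e' e. partial_deriv e' (partial_deriv e (vec_ev (inverse (real (Suc n))) T))) q q1 q2 sequentially"
  using jet_vec_ev[of T] deg_T dim by auto

lemma weak_jet_q: "weak_jet UB q q1 q2"
  using jets(1) by (simp add: jet_L2_def)

lemma norm_vec_ev: "(norm (vec_ev \<epsilon> S x))\<^sup>2 = (\<Sum>b\<in>Basis. (ev \<epsilon> x (S b))\<^sup>2)" for S :: "'b \<Rightarrow> 'a rexpr"
  unfolding power2_norm_eq_inner euclidean_inner[of "vec_ev \<epsilon> S x" "vec_ev \<epsilon> S x"]
  by (simp add: vec_ev_inner power2_eq_square)

lemma norm_q: "x \<noteq> 0 \<Longrightarrow> norm (q x) = 1"
  using norm_vec_ev[of 0 T x] unit[of x] by (simp add: power2_eq_1_iff) (metis norm_ge_zero le_minus_one_simps(3))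

lemma lap_q: "x \<noteq> 0 \<Longrightarrow> (\<Sum>e\<in>Basis. q2 e e x) = vec_ev 0 A x"
proof -
  assume x: "x \<noteq> 0"
  have "(\<Sum>e\<in>Basis. q2 e e x) = (\<Sum>b\<in>Basis. lap (T b) x *\<^sub>R b)"
    unfolding vec_ev_def by (subst sum.swap) (simp add: lap_def scaleR_sum_left)
  also have "\<dots> = vec_ev 0 A x"
    unfolding vec_ev_def by (rule sum.cong) (auto simp: eigen[OF _ x] A_def power2_eq_square algebra_simps simp del: ev.simps(4))
  finally show ?thesis .
qed

text \<open>Apply the Laplacian to \<open>unit\<close>: the Leibniz rule gives $2\sum_b|\nabla T_b|^2 + 2\sum_b T_b\Delta T_b=0$.\<close>

lemma grad_prod_sum: "x \<noteq> 0 \<Longrightarrow> (\<Sum>b\<in>Basis. grad_prod (T b) (T b) x) = g * rinv x ^ 2"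
proof -
  assume x: "x \<noteq> 0"
  have d1: "(\<Sum>b\<in>Basis. ev 0 x (D e (Times (T b) (T b)))) = 0" if "x \<noteq> 0" for e x
    using sum_ev_eq_D[OF finite_Basis, of "\<lambda>b. Times (T b) (T b)" "Cst 1" x e] unit that
    by (simp add: power2_eq_square)
  have "(\<Sum>b\<in>Basis. ev 0 x (D e (D e (Times (T b) (T b))))) = 0" for e
    using sum_ev_eq_D[OF finite_Basis, of "\<lambda>b. D e (Times (T b) (T b))" "Cst 0" x e] d1 x
    by simp
  then have "(\<Sum>b\<in>Basis. lap (Times (T b) (T b)) x) = 0"
    unfolding lap_def by (subst sum.swap) simp
  then have "(\<Sum>b\<in>Basis. 2 * grad_prod (T b) (T b) x) = (\<Sum>b\<in>Basis. 2 * rinv x ^ 2 * (L b * (ev 0 x (T b))\<^sup>2))"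
    unfolding lap_Times
    by (simp add: eigen[OF _ x] sum.distrib sum_negf sum_subtractf power2_eq_square algebra_simps del: ev.simps(4))
  then show ?thesis
    by (simp only: sum_distrib_left[symmetric] energy[OF x]) (simp del: ev.simps(4))
qed

lemma grad_q: "x \<noteq> 0 \<Longrightarrow> (\<Sum>e\<in>Basis. (norm (q1 e x))\<^sup>2) = g * rinv x ^ 2"
  unfolding norm_vec_ev using grad_prod_sum[of x] by (subst sum.swap) (simp add: grad_prod_def power2_eq_square del: ev.simps(4))

lemma AE_q:
  "AE x in lebesgue_on UB. weak_laplacian UB q x = vec_ev 0 A x"
  "AE x in lebesgue_on UB. grad_sq UB q x = g * rinv x ^ 2"
  "AE x in lebesgue_on UB. \<forall>e\<in>Basis. weak_deriv UB e q x = q1 e x"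
proof -
  show "AE x in lebesgue_on UB. weak_laplacian UB q x = vec_ev 0 A x"
    using weak_jet_AE(3)[OF open_ball weak_jet_q] AE_UB_nonzero by eventually_elim (simp add: lap_q)
  show "AE x in lebesgue_on UB. grad_sq UB q x = g * rinv x ^ 2"
    using weak_jet_AE(4)[OF open_ball weak_jet_q] AE_UB_nonzero by eventually_elim (simp add: grad_q)
  show "AE x in lebesgue_on UB. \<forall>e\<in>Basis. weak_deriv UB e q x = q1 e x"
    by (rule AE_finite_allI) (auto intro: weak_jet_AE(1)[OF open_ball weak_jet_q])
qed

lemma lap_A: "b \<in> Basis \<Longrightarrow> x \<noteq> 0 \<Longrightarrow> lap (A b) x = 2 * g * L b * rinv x ^ 4 * ev 0 x (T b)"
proof -
  assume b: "b \<in> Basis" and x: "x \<noteq> 0"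
  have "lap (A b) x = - L b * ((8 - 2 * real DIM('a) - L b) * rinv x ^ 4 * ev 0 x (T b))"
    unfolding A_def lap_Times[of "Cst _"] lap_Cst lap_Winv2(1)[OF x homog_T[OF b] eigen[OF b x]] by simp
  also have "\<dots> = (L b * (L b + 2 * real DIM('a) - 8)) * (rinv x ^ 4 * ev 0 x (T b))"
    by (simp add: algebra_simps del: ev.simps(4))
  also have "L b * (L b + 2 * real DIM('a) - 8) = L b * (2 * g)" using biharm[OF b] by auto
  finally show ?thesis by (simp add: algebra_simps del: ev.simps(4))
qed

definition W2 :: "'a rexpr" where "W2 = Times (Cst g) (Times Winv Winv)"

lemma div_W2: "b \<in> Basis \<Longrightarrow> x \<noteq> 0 \<Longrightarrow> (\<Sum>e\<in>Basis. ev 0 x (D e (Times W2 (D e (T b))))) = - g * L b * rinv x ^ 4 * ev 0 x (T b)"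
proof -
  assume b: "b \<in> Basis" and x: "x \<noteq> 0"
  have "(\<Sum>e\<in>Basis. ev 0 x (D e (Times W2 (D e (T b))))) = grad_prod W2 (T b) x + ev 0 x W2 * lap (T b) x"
    by (simp add: grad_prod_def lap_def sum.distrib sum_distrib_left)
  also have "grad_prod W2 (T b) x = 0"
    unfolding W2_def grad_prod_Times[of "Cst _"] lap_Cst lap_Winv2(2)[OF x homog_T[OF b] eigen[OF b x]] by simp
  finally show ?thesis unfolding eigen[OF b x] by (simp add: W2_def power_numeral_reduce algebra_simps del: ev.simps(4))
qed

lemma deg_W2: "deg W2 = -2" by (simp add: W2_def)

lemma dimi: "- int DIM('a) \<le> -7" using dim by linarith

lemma test_comp: "test_function UB \<phi> \<Longrightarrow> test_function UB (\<lambda>x. \<phi> x \<bullet> b)" for \<phi> :: "'a \<Rightarrow> 'b"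
  by (rule test_inner[OF _ smooth_const])

text \<open>Off the origin, $\Delta^2T_b=2gL_br^{-4}T_b$ and $\operatorname{div}(g\,r^{-2}\nabla T_b)=-gL_br^{-4}T_b$. Hence
  $\Delta^2T_b+2\operatorname{div}(|\nabla q|^2\nabla T_b)=0$, and the singularity is too weak to contribute.\<close>

lemma linear_equation_component:
  assumes \<phi>: "test_function UB \<phi>" and b: "b \<in> Basis"
  shows "(\<Sum>e\<in>Basis. test_pairing (partial_deriv e (partial_deriv e \<phi>)) (A b))
     = 2 * (\<Sum>e\<in>Basis. test_pairing (partial_deriv e \<phi>) (Times W2 (D e (T b))))"
proof -
  have dA: "deg (D e (A b)) - 1 > - int DIM('a)" "deg (A b) - 1 > - int DIM('a)" "deg (D e (D e (A b))) > - int DIM('a)" for e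
    using degs(2-4)[OF b] dimi by (smt (verit))+
  have dW: "deg (Times W2 (D e (T b))) - 1 > - int DIM('a)" "deg (D e (Times W2 (D e (T b)))) > - int DIM('a)" for e
    using degs(1)[OF b, of e] deg_W2 deg_D[of "Times W2 (D e (T b))" e] dimi unfolding deg.simps by linarith+
  have "(\<Sum>e\<in>Basis. test_pairing (partial_deriv e (partial_deriv e \<phi>)) (A b)) = (\<Sum>e\<in>Basis. test_pairing \<phi> (D e (D e (A b))))"
    by (rule sum.cong) (simp_all add: test_pairing_parts test_partial \<phi> dA)
  also have "\<dots> = (LINT x|lebesgue_on UB. (\<Sum>e\<in>Basis. \<phi> x * ev 0 x (D e (D e (A b)))))"
    unfolding test_pairing_def by (rule Bochner_Integration.integral_sum[symmetric]) (rule integrable_test_ev[OF \<phi> dA(3)])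
  also have "\<dots> = (LINT x|lebesgue_on UB. - 2 * (\<Sum>e\<in>Basis. \<phi> x * ev 0 x (D e (Times W2 (D e (T b))))))"
  proof (rule integral_cong_AE)
    show "AE x in lebesgue_on UB. (\<Sum>e\<in>Basis. \<phi> x * ev 0 x (D e (D e (A b)))) =
        - 2 * (\<Sum>e\<in>Basis. \<phi> x * ev 0 x (D e (Times W2 (D e (T b)))))"
      using AE_UB_nonzero
    proof eventually_elim
      case (elim x)
      then show ?case
        unfolding sum_distrib_left[symmetric] using lap_A[OF b, of x] div_W2[OF b, of x]
        by (simp add: lap_def del: ev.simps(4) D.simps)
    qed
  qed (intro borel_measurable_sum borel_measurable_times borel_measurable_const measurable_ev_UB test_measurable_bounded(1)[OF \<phi>])+
  also have "\<dots> = - 2 * (\<Sum>e\<in>Basis. test_pairing \<phi> (D e (Times W2 (D e (T b)))))"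
    unfolding test_pairing_def integral_mult_right_zero
    by (subst Bochner_Integration.integral_sum) (rule integrable_test_ev[OF \<phi> dW(2)], simp)
  also have "\<dots> = 2 * (\<Sum>e\<in>Basis. test_pairing (partial_deriv e \<phi>) (Times W2 (D e (T b))))"
    by (simp add: test_pairing_parts[OF \<phi> dW(1)] sum_negf del: D.simps)
  finally show ?thesis .
qed

lemma laplacian_component: "smooth \<phi> \<Longrightarrow> laplacian \<phi> x \<bullet> b = (\<Sum>e\<in>Basis. partial_deriv e (partial_deriv e (\<lambda>x. \<phi> x \<bullet> b)) x)"
  for \<phi> :: "'a \<Rightarrow> 'b"
  by (simp add: laplacian_def inner_sum_left pd_component smooth_partial)

text \<open>The map solves $\Delta^2q+2\operatorname{div}(|\nabla q|^2\nabla q)=0$ without any multiplier. This is the reason why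
  second derivatives of a variation disappear from the second variation of the bienergy.\<close>

lemma linear_equation:
  assumes \<phi>: "test_function UB \<phi>"
  shows "(LINT x|lebesgue_on UB. vec_ev 0 A x \<bullet> laplacian \<phi> x)
    = 2 * (LINT x|lebesgue_on UB. (g * rinv x ^ 2) * (\<Sum>e\<in>Basis. q1 e x \<bullet> partial_deriv e \<phi> x))"
proof -
  have sm: "smooth \<phi>" by (rule test_smooth[OF \<phi>])
  let ?\<phi> = "\<lambda>b x. \<phi> x \<bullet> b"
  have t: "test_function UB (?\<phi> b)" for b by (rule test_comp[OF \<phi>])
  have dA: "deg (A b) > - int DIM('a)" if "b \<in> Basis" for b
    using degs(2)[OF that] dimi by linarith
  have dW: "deg (Times W2 (D e (T b))) > - int DIM('a)" if "b \<in> Basis" for e b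
    using degs(1)[OF that, of e] deg_W2 dimi unfolding deg.simps by linarith
  have "(LINT x|lebesgue_on UB. vec_ev 0 A x \<bullet> laplacian \<phi> x)
     = (LINT x|lebesgue_on UB. (\<Sum>b\<in>Basis. \<Sum>e\<in>Basis. partial_deriv e (partial_deriv e (?\<phi> b)) x * ev 0 x (A b)))"
    by (rule arg_cong[where f="integral\<^sup>L _"], rule ext)
       (subst euclidean_inner, simp add: vec_ev_inner laplacian_component[OF sm] sum_distrib_left mult.commute)
  also have "\<dots> = (\<Sum>b\<in>Basis. \<Sum>e\<in>Basis. test_pairing (partial_deriv e (partial_deriv e (?\<phi> b))) (A b))"
    unfolding test_pairing_def
    by (subst Bochner_Integration.integral_sum, intro Bochner_Integration.integrable_sum integrable_test_ev test_partial t dA, assumption+,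
        intro sum.cong refl Bochner_Integration.integral_sum integrable_test_ev test_partial t dA, assumption+)
  also have "\<dots> = (\<Sum>b\<in>Basis. 2 * (\<Sum>e\<in>Basis. test_pairing (partial_deriv e (?\<phi> b)) (Times W2 (D e (T b)))))"
    by (rule sum.cong[OF refl]) (rule linear_equation_component[OF t])
  also have "\<dots> = 2 * (LINT x|lebesgue_on UB. (\<Sum>b\<in>Basis. \<Sum>e\<in>Basis. partial_deriv e (?\<phi> b) x * ev 0 x (Times W2 (D e (T b)))))"
    unfolding test_pairing_def sum_distrib_left[symmetric]
    by (subst Bochner_Integration.integral_sum, intro Bochner_Integration.integrable_sum integrable_test_ev test_partial t dW, assumption+,
        rule arg_cong[where f="(*) 2"],
        intro sum.cong refl Bochner_Integration.integral_sum[symmetric] integrable_test_ev test_partial t dW, assumption+)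
  also have "(\<lambda>x. \<Sum>b\<in>Basis. \<Sum>e\<in>Basis. partial_deriv e (?\<phi> b) x * ev 0 x (Times W2 (D e (T b))))
     = (\<lambda>x. (g * rinv x ^ 2) * (\<Sum>e\<in>Basis. q1 e x \<bullet> partial_deriv e \<phi> x))"
  proof
    fix x
    have "(\<Sum>e\<in>Basis. q1 e x \<bullet> partial_deriv e \<phi> x) = (\<Sum>e\<in>Basis. \<Sum>b\<in>Basis. ev 0 x (D e (T b)) * (partial_deriv e \<phi> x \<bullet> b))"
      by (intro sum.cong refl, subst euclidean_inner) (simp add: vec_ev_inner)
    also have "\<dots> = (\<Sum>b\<in>Basis. \<Sum>e\<in>Basis. ev 0 x (D e (T b)) * (partial_deriv e \<phi> x \<bullet> b))" by (rule sum.swap)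
    finally show "(\<Sum>b\<in>Basis. \<Sum>e\<in>Basis. partial_deriv e (?\<phi> b) x * ev 0 x (Times W2 (D e (T b))))
      = (g * rinv x ^ 2) * (\<Sum>e\<in>Basis. q1 e x \<bullet> partial_deriv e \<phi> x)"
      by (simp add: pd_component[OF sm] W2_def sum_distrib_left power2_eq_square algebra_simps del: ev.simps(4))
  qed
  finally show ?thesis .
qed

abbreviation TT where "TT j k \<equiv> Times (T j) (T k)"

text \<open>The multiplier $\langle\Delta^2q,q\rangle-2|\nabla q|^4$ vanishes. The test map $\langle q,\varphi\rangle q$ has components
  \<open>\<Sum>j. \<phi>\<^sub>j (T j)(T k)\<close>, to which \<open>test_pairing_parts_weight2\<close> applies term by term; what remains is
  $\langle\Delta^2q,q\rangle\langle q,\varphi\rangle$, and $\langle\Delta^2q,q\rangle=2g^2r^{-4}$ by \<open>energy\<close>.\<close>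

lemma second_equation:
  assumes \<phi>: "test_function UB \<phi>"
  shows "(LINT x|lebesgue_on UB. weak_laplacian UB q x \<bullet> weak_laplacian UB (\<lambda>y. (q y \<bullet> \<phi> y) *\<^sub>R q y) x)
    = 2 * (LINT x|lebesgue_on UB. (g * rinv x ^ 2)\<^sup>2 * (q x \<bullet> \<phi> x))"
proof -
  let ?\<phi> = "\<lambda>b x. \<phi> x \<bullet> b"
  have t: "test_function UB (?\<phi> b)" for b by (rule test_comp[OF \<phi>])
  have st: "smooth (?\<phi> b)" for b by (rule test_smooth[OF t])
  have spt: "smooth (partial_deriv e (?\<phi> b))" if "e \<in> Basis" for e b by (rule smooth_partial[OF st that])
  let ?\<psi> = "\<lambda>y. (q y \<bullet> \<phi> y) *\<^sub>R q y"
  let ?F1 = "\<lambda>e x. \<Sum>k\<in>Basis. (\<Sum>j\<in>Basis. partial_deriv e (?\<phi> j) x *\<^sub>R ev 0 x (TT j k) + ?\<phi> j x *\<^sub>R ev 0 x (D e (TT j k))) *\<^sub>R k"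
  let ?F2 = "\<lambda>e' e x. \<Sum>k\<in>Basis. (\<Sum>j\<in>Basis.
      (partial_deriv e' (partial_deriv e (?\<phi> j)) x *\<^sub>R ev 0 x (TT j k) + partial_deriv e (?\<phi> j) x *\<^sub>R ev 0 x (D e' (TT j k)))
    + (partial_deriv e' (?\<phi> j) x *\<^sub>R ev 0 x (D e (TT j k)) + ?\<phi> j x *\<^sub>R ev 0 x (D e' (D e (TT j k))))) *\<^sub>R k"
  have \<psi>: "?\<psi> = (\<lambda>x. \<Sum>k\<in>Basis. (\<Sum>j\<in>Basis. ?\<phi> j x *\<^sub>R ev 0 x (TT j k)) *\<^sub>R k)"
  proof
    fix x
    have "q x \<bullet> \<phi> x = (\<Sum>j\<in>Basis. ev 0 x (T j) * (\<phi> x \<bullet> j))"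
      by (subst euclidean_inner) (simp add: vec_ev_inner)
    moreover have "q x = (\<Sum>k\<in>Basis. ev 0 x (T k) *\<^sub>R k)" by (simp add: vec_ev_def)
    ultimately show "?\<psi> x = (\<Sum>k\<in>Basis. (\<Sum>j\<in>Basis. ?\<phi> j x *\<^sub>R ev 0 x (TT j k)) *\<^sub>R k)"
      by (simp add: scaleR_sum_right sum_distrib_left sum_distrib_right algebra_simps)
  qed
  have dT: "deg (TT j k) \<ge> 0" if "j \<in> Basis" "k \<in> Basis" for j k
    using deg_T[OF that(1)] deg_T[OF that(2)] by simp
  have dDT: "deg (D e (TT j k)) \<ge> -1" if "j \<in> Basis" "k \<in> Basis" for e j k
    using deg_D[of "TT j k" e] dT[OF that] by linarith
  have dDDT: "deg (D e' (D e (TT j k))) \<ge> -2" if "j \<in> Basis" "k \<in> Basis" for e' e j k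
    using deg_D[of "D e (TT j k)" e'] dDT[OF that, of e] by linarith
  have h0: "has_weak_deriv UB e (\<lambda>x. ev 0 x (TT j k)) (\<lambda>x. ev 0 x (D e (TT j k)))"
    if "j \<in> Basis" "k \<in> Basis" "e \<in> Basis" for j k e
    by (rule hwd_ev[OF _ that(3)]) (use dT[OF that(1,2)] dimi in linarith)
  have h1: "has_weak_deriv UB e' (\<lambda>x. ev 0 x (D e (TT j k))) (\<lambda>x. ev 0 x (D e' (D e (TT j k))))"
    if "j \<in> Basis" "k \<in> Basis" "e' \<in> Basis" for j k e e'
    by (rule hwd_ev[OF _ that(3)]) (use dDT[OF that(1,2), of e] dimi in linarith)
  have hp: "has_weak_deriv UB e (\<lambda>x. f1 x + f2 x) (\<lambda>x. g1 x + g2 x)"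
    if "e \<in> Basis" "has_weak_deriv UB e f1 g1" "has_weak_deriv UB e f2 g2" for e and f1 f2 g1 g2 :: "'a \<Rightarrow> real"
    using hwd_lincomb[OF open_ball that, of 1 1] by simp
  have wj: "weak_jet UB ?\<psi> ?F1 ?F2"
    unfolding weak_jet_def \<psi>
    by (intro conjI ballI hwd_components hwd_sum open_ball finite_Basis hp hwd_smooth_scaleR h0 h1 st spt)
  let ?N = "\<lambda>x. \<Sum>k\<in>Basis. \<Sum>j\<in>Basis. \<Sum>e\<in>Basis.
       (partial_deriv e (partial_deriv e (?\<phi> j)) x * ev 0 x (Times (A k) (TT j k))
      + 2 * (partial_deriv e (?\<phi> j) x * ev 0 x (Times (A k) (D e (TT j k)))))
      + ?\<phi> j x * ev 0 x (Times (A k) (D e (D e (TT j k))))"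
  have deg0: "deg (Times (A k) (TT j k)) > - int DIM('a)" "deg (Times (A k) (D e (TT j k))) > - int DIM('a)"
    "deg (Times (A k) (D e (D e (TT j k)))) > - int DIM('a)" "deg (A k) + deg (TT j k) - 2 > - int DIM('a)"
    if "j \<in> Basis" "k \<in> Basis" for j k e
  proof -
    note dd = dT[OF that] dDT[OF that, of e] dDDT[OF that, of e e] degs(2)[OF that(2)] dimi
    have tm: "deg (Times (A k) t) = deg (A k) + deg t" for t by simp
    show "deg (Times (A k) (TT j k)) > - int DIM('a)" using dd unfolding tm by linarith
    show "deg (Times (A k) (D e (TT j k))) > - int DIM('a)" using dd unfolding tm by linarith
    show "deg (Times (A k) (D e (D e (TT j k)))) > - int DIM('a)" using dd unfolding tm by linarith
    show "deg (A k) + deg (TT j k) - 2 > - int DIM('a)" using dd by linarith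
  qed
  have deg1: "deg (Times (D e (D e (A k))) (TT j k)) > - int DIM('a)" if "j \<in> Basis" "k \<in> Basis" for j k e
    using dT[OF that] degs(4)[OF that(2), of e e] dimi unfolding deg.simps(6)[of _ "TT j k"] by linarith
  note iN = integrable_test_ev[OF test_partial[OF test_partial[OF t]] deg0(1)] integrable_test_ev[OF test_partial[OF t] deg0(2)]
    integrable_test_ev[OF t deg0(3)]
  have iN': "integrable (lebesgue_on UB) (\<lambda>x. (partial_deriv e (partial_deriv e (?\<phi> j)) x * ev 0 x (Times (A k) (TT j k))
      + 2 * (partial_deriv e (?\<phi> j) x * ev 0 x (Times (A k) (D e (TT j k)))))
      + ?\<phi> j x * ev 0 x (Times (A k) (D e (D e (TT j k)))))" if "j \<in> Basis" "k \<in> Basis" "e \<in> Basis" for j k e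
    by (intro Bochner_Integration.integrable_add integrable_mult_right iN that)
  have iM: "integrable (lebesgue_on UB) (\<lambda>x. ?\<phi> j x * ev 0 x (Times (D e (D e (A k))) (TT j k)))"
    if "j \<in> Basis" "k \<in> Basis" for j k e
    by (rule integrable_test_ev[OF t deg1[OF that]])
  have "(LINT x|lebesgue_on UB. weak_laplacian UB q x \<bullet> weak_laplacian UB ?\<psi> x) = (LINT x|lebesgue_on UB. ?N x)"
  proof (rule LINT_cong_AE)
    show "?N \<in> borel_measurable (lebesgue_on UB)"
      by (intro borel_measurable_integrable Bochner_Integration.integrable_sum iN')
    show "AE x in lebesgue_on UB. weak_laplacian UB q x \<bullet> weak_laplacian UB ?\<psi> x = ?N x"
      using weak_jet_AE(3)[OF open_ball wj] AE_q(1)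
    proof eventually_elim
      case (elim x)
      have "vec_ev 0 A x \<bullet> (\<Sum>e\<in>Basis. ?F2 e e x) = (\<Sum>e\<in>Basis. \<Sum>k\<in>Basis. ev 0 x (A k) * (\<Sum>j\<in>Basis.
      (partial_deriv e (partial_deriv e (?\<phi> j)) x *\<^sub>R ev 0 x (TT j k) + partial_deriv e (?\<phi> j) x *\<^sub>R ev 0 x (D e (TT j k)))
    + (partial_deriv e (?\<phi> j) x *\<^sub>R ev 0 x (D e (TT j k)) + ?\<phi> j x *\<^sub>R ev 0 x (D e (D e (TT j k))))))"
        by (simp only: inner_sum_right inner_scaleR_right) (simp add: vec_ev_inner mult.commute del: D.simps ev.simps)
      also have "\<dots> = (\<Sum>k\<in>Basis. \<Sum>e\<in>Basis. \<Sum>j\<in>Basis. ev 0 x (A k) * (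
      (partial_deriv e (partial_deriv e (?\<phi> j)) x *\<^sub>R ev 0 x (TT j k) + partial_deriv e (?\<phi> j) x *\<^sub>R ev 0 x (D e (TT j k)))
    + (partial_deriv e (?\<phi> j) x *\<^sub>R ev 0 x (D e (TT j k)) + ?\<phi> j x *\<^sub>R ev 0 x (D e (D e (TT j k))))))"
        unfolding sum_distrib_left by (rule sum.swap)
      also have "\<dots> = (\<Sum>k\<in>Basis. \<Sum>j\<in>Basis. \<Sum>e\<in>Basis. ev 0 x (A k) * (
      (partial_deriv e (partial_deriv e (?\<phi> j)) x *\<^sub>R ev 0 x (TT j k) + partial_deriv e (?\<phi> j) x *\<^sub>R ev 0 x (D e (TT j k)))
    + (partial_deriv e (?\<phi> j) x *\<^sub>R ev 0 x (D e (TT j k)) + ?\<phi> j x *\<^sub>R ev 0 x (D e (D e (TT j k))))))"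
        by (intro sum.cong[OF refl] sum.swap)
      also have "\<dots> = ?N x"
      proof -
        have tm: "ev 0 x (Times (A k) t) = ev 0 x (A k) * ev 0 x t" for k t by simp
        show ?thesis unfolding tm
          by (intro sum.cong[OF refl]) (simp add: algebra_simps del: D.simps ev.simps)
      qed
      finally show ?case using elim by simp
    qed
  qed simp
  also have "\<dots> = (\<Sum>k\<in>Basis. \<Sum>j\<in>Basis. \<Sum>e\<in>Basis.
      test_pairing (partial_deriv e (partial_deriv e (?\<phi> j))) (Times (A k) (TT j k)) + 2 * test_pairing (partial_deriv e (?\<phi> j)) (Times (A k) (D e (TT j k)))
      + test_pairing (?\<phi> j) (Times (A k) (D e (D e (TT j k)))))" (is "_ = ?S")
  proof -
    have 1: "(LINT x|lebesgue_on UB. (partial_deriv e (partial_deriv e (?\<phi> j)) x * ev 0 x (Times (A k) (TT j k))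
      + 2 * (partial_deriv e (?\<phi> j) x * ev 0 x (Times (A k) (D e (TT j k)))))
      + ?\<phi> j x * ev 0 x (Times (A k) (D e (D e (TT j k)))))
      = test_pairing (partial_deriv e (partial_deriv e (?\<phi> j))) (Times (A k) (TT j k)) + 2 * test_pairing (partial_deriv e (?\<phi> j)) (Times (A k) (D e (TT j k)))
      + test_pairing (?\<phi> j) (Times (A k) (D e (D e (TT j k))))" if jk: "j \<in> Basis" "k \<in> Basis" "e \<in> Basis" for j k e
    proof -
      note i = iN(1)[OF jk(3) jk(3) jk(1,2), of j] iN(2)[OF jk(3) jk(1,2), of j e] iN(3)[OF jk(1,2), of j e]
      show ?thesis
        unfolding test_pairing_def
        by (subst Bochner_Integration.integral_add[OF Bochner_Integration.integrable_add[OF i(1) integrable_mult_right[OF i(2)]] i(3)],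
            subst Bochner_Integration.integral_add[OF i(1) integrable_mult_right[OF i(2)]], subst integral_mult_right_zero, rule refl)
    qed
    have "(LINT x|lebesgue_on UB. ?N x) = (\<Sum>k\<in>Basis. \<Sum>j\<in>Basis. \<Sum>e\<in>Basis. (LINT x|lebesgue_on UB. (partial_deriv e (partial_deriv e (?\<phi> j)) x * ev 0 x (Times (A k) (TT j k))
      + 2 * (partial_deriv e (?\<phi> j) x * ev 0 x (Times (A k) (D e (TT j k)))))
      + ?\<phi> j x * ev 0 x (Times (A k) (D e (D e (TT j k))))))"
      by (subst Bochner_Integration.integral_sum, intro Bochner_Integration.integrable_sum iN', assumption+,
          rule sum.cong[OF refl], subst Bochner_Integration.integral_sum, intro Bochner_Integration.integrable_sum iN', assumption+,
          rule sum.cong[OF refl], subst Bochner_Integration.integral_sum, intro iN', assumption+, rule refl)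
    also have "\<dots> = ?S" by (intro sum.cong[OF refl] 1)
    finally show ?thesis .
  qed
  also have "\<dots> = (\<Sum>k\<in>Basis. \<Sum>j\<in>Basis. \<Sum>e\<in>Basis. test_pairing (?\<phi> j) (Times (D e (D e (A k))) (TT j k)))"
    by (intro sum.cong[OF refl] test_pairing_parts_weight2 t deg0(4))
  also have "\<dots> = (LINT x|lebesgue_on UB. (\<Sum>k\<in>Basis. \<Sum>j\<in>Basis. \<Sum>e\<in>Basis. ?\<phi> j x * ev 0 x (Times (D e (D e (A k))) (TT j k))))"
    unfolding test_pairing_def
    by (subst Bochner_Integration.integral_sum, intro Bochner_Integration.integrable_sum iM, assumption+,
          rule sum.cong[OF refl], subst Bochner_Integration.integral_sum, intro Bochner_Integration.integrable_sum iM, assumption+,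
          rule sum.cong[OF refl], subst Bochner_Integration.integral_sum, intro iM, assumption+, rule refl)
  also have "\<dots> = (LINT x|lebesgue_on UB. 2 * ((g * rinv x ^ 2)\<^sup>2 * (q x \<bullet> \<phi> x)))"
  proof (rule LINT_cong_AE[symmetric])
    show "(\<lambda>x. \<Sum>k\<in>Basis. \<Sum>j\<in>Basis. \<Sum>e\<in>Basis. ?\<phi> j x * ev 0 x (Times (D e (D e (A k))) (TT j k))) \<in> borel_measurable (lebesgue_on UB)"
      by (intro borel_measurable_integrable Bochner_Integration.integrable_sum iM)
    show "AE x in lebesgue_on UB. 2 * ((g * rinv x ^ 2)\<^sup>2 * (q x \<bullet> \<phi> x)) =
        (\<Sum>k\<in>Basis. \<Sum>j\<in>Basis. \<Sum>e\<in>Basis. ?\<phi> j x * ev 0 x (Times (D e (D e (A k))) (TT j k)))"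
      using AE_UB_nonzero
    proof eventually_elim
      case (elim x)
      then have x: "x \<noteq> 0" by simp
      have "(\<Sum>k\<in>Basis. \<Sum>j\<in>Basis. \<Sum>e\<in>Basis. ?\<phi> j x * ev 0 x (Times (D e (D e (A k))) (TT j k)))
        = (\<Sum>k\<in>Basis. \<Sum>j\<in>Basis. (?\<phi> j x * ev 0 x (T j)) * (lap (A k) x * ev 0 x (T k)))"
        unfolding lap_def ev.simps(6) sum_distrib_left sum_distrib_right
        by (intro sum.cong[OF refl]) (simp add: algebra_simps del: D.simps ev.simps)
      also have "\<dots> = (\<Sum>k\<in>Basis. (q x \<bullet> \<phi> x) * (lap (A k) x * ev 0 x (T k)))"
      proof -
        have "q x \<bullet> \<phi> x = (\<Sum>j\<in>Basis. ?\<phi> j x * ev 0 x (T j))"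
          by (subst euclidean_inner) (simp add: vec_ev_inner mult.commute)
        then show ?thesis by (simp add: sum_distrib_right)
      qed
      also have "\<dots> = (\<Sum>k\<in>Basis. ((q x \<bullet> \<phi> x) * (2 * g * rinv x ^ 4)) * (L k * (ev 0 x (T k))\<^sup>2))"
        by (intro sum.cong[OF refl]) (simp add: lap_A[OF _ x] power2_eq_square algebra_simps del: ev.simps(4))
      also have "\<dots> = 2 * ((g * rinv x ^ 2)\<^sup>2 * (q x \<bullet> \<phi> x))"
        unfolding sum_distrib_left[symmetric] energy[OF x] by (simp add: power_numeral_reduce algebra_simps del: ev.simps(4))
      finally show ?case by simp
    qed
  qed simp
  finally show ?thesis by simp
qed

lemma measurable_rinv: "(\<lambda>x. g * rinv x ^ 2) \<in> borel_measurable (lebesgue_on UB)"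
  by (intro borel_measurable_times borel_measurable_power measurable_ev_UB) simp

lemma measurable_vec_ev: "vec_ev 0 S \<in> borel_measurable (lebesgue_on UB)" for S :: "'b \<Rightarrow> 'a rexpr"
  unfolding vec_ev_def[abs_def] by (intro borel_measurable_sum borel_measurable_scaleR measurable_ev_UB) simp

lemma W22_sphere_q: "W22_sphere UB q"
  unfolding W22_sphere_def sobolev_2_iff
proof
  show "\<exists>F1 F2. jet_L2 UB q F1 F2" using jets(1) by blast
  show "AE x in lebesgue_on UB. q x \<in> sphere 0 1"
    using AE_UB_nonzero by eventually_elim (simp add: norm_q)
qed

theorem weak_biharmonic_q: "weak_biharmonic_map UB q"
  unfolding weak_biharmonic_map_def
proof (intro conjI allI impI W22_sphere_q)
  fix \<phi> :: "'a \<Rightarrow> 'b" assume \<phi>: "test_function UB \<phi>"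
  have UB: "UB \<in> sets lebesgue" by simp
  have mt: "partial_deriv e \<phi> \<in> borel_measurable (lebesgue_on UB)" if "e \<in> Basis" for e
    by (rule test_measurable_bounded(1)[OF test_partial[OF \<phi> that]])
  have ml: "laplacian \<phi> \<in> borel_measurable (lebesgue_on UB)"
    unfolding laplacian_def[abs_def]
    by (intro borel_measurable_sum test_measurable_bounded(1)[OF test_partial[OF test_partial[OF \<phi>]]])
  have mp: "\<phi> \<in> borel_measurable (lebesgue_on UB)" by (rule test_measurable_bounded(1)[OF \<phi>])
  have "(LINT x|lebesgue_on UB. weak_laplacian UB q x \<bullet> laplacian \<phi> x) = (LINT x|lebesgue_on UB. vec_ev 0 A x \<bullet> laplacian \<phi> x)"
    by (rule LINT_cong_AE[OF UB]) (use AE_q(1) in \<open>auto intro!: borel_measurable_inner measurable_vec_ev ml elim: eventually_mono\<close>)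
  moreover have "(LINT x|lebesgue_on UB. grad_sq UB q x * (\<Sum>e\<in>Basis. weak_deriv UB e q x \<bullet> partial_deriv e \<phi> x))
      = (LINT x|lebesgue_on UB. (g * rinv x ^ 2) * (\<Sum>e\<in>Basis. q1 e x \<bullet> partial_deriv e \<phi> x))"
  proof (rule LINT_cong_AE[OF UB])
    show "(\<lambda>x. (g * rinv x ^ 2) * (\<Sum>e\<in>Basis. q1 e x \<bullet> partial_deriv e \<phi> x)) \<in> borel_measurable (lebesgue_on UB)"
      by (intro borel_measurable_times[OF measurable_rinv] borel_measurable_sum borel_measurable_inner measurable_vec_ev mt)
    show "AE x in lebesgue_on UB. grad_sq UB q x * (\<Sum>e\<in>Basis. weak_deriv UB e q x \<bullet> partial_deriv e \<phi> x)
       = (g * rinv x ^ 2) * (\<Sum>e\<in>Basis. q1 e x \<bullet> partial_deriv e \<phi> x)"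
      using AE_q(2,3) by eventually_elim (simp del: ev.simps)
  qed
  moreover have "(LINT x|lebesgue_on UB. (grad_sq UB q x)\<^sup>2 * (q x \<bullet> \<phi> x)) = (LINT x|lebesgue_on UB. (g * rinv x ^ 2)\<^sup>2 * (q x \<bullet> \<phi> x))"
  proof (rule LINT_cong_AE[OF UB])
    show "(\<lambda>x. (g * rinv x ^ 2)\<^sup>2 * (q x \<bullet> \<phi> x)) \<in> borel_measurable (lebesgue_on UB)"
      by (intro borel_measurable_times borel_measurable_power[OF measurable_rinv] borel_measurable_inner measurable_vec_ev mp)
    show "AE x in lebesgue_on UB. (grad_sq UB q x)\<^sup>2 * (q x \<bullet> \<phi> x) = (g * rinv x ^ 2)\<^sup>2 * (q x \<bullet> \<phi> x)"
      using AE_q(2) by eventually_elim (simp del: ev.simps)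
  qed
  ultimately show "(LINT x|lebesgue_on UB. weak_laplacian UB q x \<bullet> laplacian \<phi> x)
        - 2 * (LINT x|lebesgue_on UB. grad_sq UB q x * (\<Sum>e\<in>Basis. weak_deriv UB e q x \<bullet> partial_deriv e \<phi> x))
        - (LINT x|lebesgue_on UB. weak_laplacian UB q x \<bullet> weak_laplacian UB (\<lambda>y. (q y \<bullet> \<phi> y) *\<^sub>R q y) x)
        + 2 * (LINT x|lebesgue_on UB. (grad_sq UB q x)\<^sup>2 * (q x \<bullet> \<phi> x)) = 0"
    using linear_equation[OF \<phi>] second_equation[OF \<phi>] by linarith
qed

text \<open>In a constant component the harmonic map equation reads $g\,r^{-2}T_b=0$.\<close>

lemma not_harmonic_q:
  assumes b: "b \<in> Basis" and L: "L b = 0" and nz: "\<And>x. x \<noteq> 0 \<Longrightarrow> ev 0 x (T b) \<noteq> 0" and g: "g \<noteq> 0"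
  shows "\<not> harmonic_map UB q"
proof
  assume "harmonic_map UB q"
  then have "AE x in lebesgue_on UB. weak_laplacian UB q x + grad_sq UB q x *\<^sub>R q x = 0"
    by (simp add: harmonic_map_def)
  then have "AE x in lebesgue_on (UB :: 'a set). x \<noteq> x"
    using AE_q(1,2) AE_UB_nonzero
  proof eventually_elim
    case (elim x)
    then have "(vec_ev 0 A x + (g * rinv x ^ 2) *\<^sub>R q x) \<bullet> b = 0" by (simp del: ev.simps)
    then have "g * rinv x ^ 2 * ev 0 x (T b) = 0"
      using b L by (simp add: inner_add_left vec_ev_inner A_def del: ev.simps(4))
    moreover have "rinv x \<noteq> 0" using rinv_sq[of x] elim by auto
    ultimately show ?case using g nz[of x] elim by simp
  qed
  then show False using AE_UB_not_empty by blast
qed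

end

section \<open>The Hardy--Rellich inequality\<close>

lemma sq_norm_radial_le:
  fixes v :: "'a::euclidean_space \<Rightarrow> 'b::euclidean_space"
  shows "(norm (\<Sum>j\<in>Basis. (x \<bullet> j) *\<^sub>R v j))\<^sup>2 \<le> (x \<bullet> x) * (\<Sum>j\<in>Basis. (norm (v j))\<^sup>2)"
proof -
  have "norm (\<Sum>j\<in>Basis. (x \<bullet> j) *\<^sub>R v j) \<le> (\<Sum>j\<in>Basis. \<bar>x \<bullet> j\<bar> * norm (v j))"
    by (rule order_trans[OF norm_sum]) simp
  then have "(norm (\<Sum>j\<in>Basis. (x \<bullet> j) *\<^sub>R v j))\<^sup>2 \<le> (\<Sum>j\<in>Basis. \<bar>x \<bullet> j\<bar> * norm (v j))\<^sup>2"
    by (intro power_mono) auto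
  also have "\<dots> \<le> (\<Sum>j\<in>Basis. \<bar>x \<bullet> j\<bar>\<^sup>2) * (\<Sum>j\<in>Basis. (norm (v j))\<^sup>2)"
    by (rule Cauchy_Schwarz_ineq_sum)
  also have "(\<Sum>j\<in>Basis. \<bar>x \<bullet> j\<bar>\<^sup>2) = x \<bullet> x"
    by (simp add: euclidean_inner[of x x] power2_eq_square)
  finally show ?thesis .
qed

text \<open>The square of \<open>\<Delta> - (n/2) w X\<close> is nonnegative. What is left has the factor $n^2/4-2n$ in front of
  $w^2|X|^2$, which is nonnegative exactly for $n\ge8$, so that $|X|^2$ may be replaced by $rN$.\<close>

lemma hardy_rellich_pointwise:
  fixes \<Delta> X :: "'b::real_inner" and n w r N :: real
  assumes n: "n \<ge> 8" and w: "w > 0" "w * r \<le> 1" and X: "(norm X)\<^sup>2 \<le> r * N" and N: "N \<ge> 0"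
  shows "n * (- 2 * w\<^sup>2 * (norm X)\<^sup>2 + w * (\<Delta> \<bullet> X) + w * N) - n / 2 * (- 2 * w\<^sup>2 * r * N + n * w * N)
     \<le> (norm \<Delta>)\<^sup>2 - n\<^sup>2 / 4 * (w * N)"
proof -
  have "0 \<le> (norm (\<Delta> - (n / 2 * w) *\<^sub>R X))\<^sup>2" by simp
  also have "\<dots> = (norm \<Delta>)\<^sup>2 - n * w * (\<Delta> \<bullet> X) + n\<^sup>2 / 4 * w\<^sup>2 * (norm X)\<^sup>2"
    unfolding power2_norm_eq_inner by (simp add: inner_diff inner_commute power2_eq_square algebra_simps)
  finally have 1: "n * w * (\<Delta> \<bullet> X) \<le> (norm \<Delta>)\<^sup>2 + n\<^sup>2 / 4 * w\<^sup>2 * (norm X)\<^sup>2" by simp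
  have c: "n\<^sup>2 / 4 - 2 * n \<ge> 0" "n\<^sup>2 / 4 - n \<ge> 0"
    using n mult_mono[of 8 n n n] by (simp_all add: power2_eq_square)
  have 2: "(n\<^sup>2 / 4 - 2 * n) * (w\<^sup>2 * (norm X)\<^sup>2) \<le> (n\<^sup>2 / 4 - 2 * n) * (w\<^sup>2 * (r * N))"
    by (intro mult_left_mono X c) auto
  have 3: "(n\<^sup>2 / 4 - n) * ((w * N) * (w * r)) \<le> (n\<^sup>2 / 4 - n) * ((w * N) * 1)"
    by (intro mult_left_mono c w mult_nonneg_nonneg N) (use w in auto)
  show ?thesis using 1 2 3 by (simp add: power2_eq_square algebra_simps)
qed

text \<open>A calibration argument with $w=1/(r^2+\varepsilon)$, $X=x\cdot\nabla\varphi$ and the two fields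
  $P_i=w\,\partial_i\varphi\cdot X$ and $Q_j=w\,x_j|\nabla\varphi|^2$. In \<open>n div P - (n/2) div Q\<close> the terms with mixed second
  derivatives cancel by the symmetry of the Hessian, and by \<open>hardy_rellich_pointwise\<close> this divergence
  is at most $|\Delta\varphi|^2-\frac{n^2}{4}w|\nabla\varphi|^2$. Its integral is zero.\<close>

lemma hardy_rellich_test:
  fixes \<phi> :: "'a::euclidean_space \<Rightarrow> 'b::euclidean_space"
  assumes \<phi>: "test_function UB \<phi>" and n: "DIM('a) \<ge> 8" and \<epsilon>: "\<epsilon> > 0"
  shows "(\<Sum>e\<in>Basis. L2_norm_sq UB (\<lambda>x. ev \<epsilon> x Winv *\<^sub>R partial_deriv e \<phi> x))
     \<le> 4 / (real DIM('a))\<^sup>2 * L2_norm_sq UB (laplacian \<phi>)"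
proof -
  let ?n = "real DIM('a)"
  let ?W = "Times Winv Winv :: 'a rexpr"
  let ?w = "\<lambda>x. ev \<epsilon> x ?W"
  define d where "d e = partial_deriv e \<phi>" for e
  define d2 where "d2 e' e = partial_deriv e' (partial_deriv e \<phi>)" for e' e
  define X where "X x = (\<Sum>j\<in>Basis. (x \<bullet> j) *\<^sub>R d j x)" for x
  define N where "N x = (\<Sum>i\<in>Basis. d i x \<bullet> d i x)" for x
  have sw: "smooth ?w" by (rule smooth_ev[OF \<epsilon>])
  have s\<phi>: "smooth \<phi>" by (rule test_smooth[OF \<phi>])
  have sd: "smooth (d e)" if "e \<in> Basis" for e unfolding d_def by (rule smooth_partial[OF s\<phi> that])
  have sX: "smooth X" unfolding X_def[abs_def] by (intro smooth_sum smooth_scaleR smooth_coord sd finite_Basis)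
  have sN: "smooth N" unfolding N_def[abs_def] by (intro smooth_sum smooth_inner sd finite_Basis)
  have td: "test_function UB (d e)" if "e \<in> Basis" for e unfolding d_def by (rule test_partial[OF \<phi> that])
  have pw: "partial_deriv e ?w x = - 2 * (x \<bullet> e) * (?w x)\<^sup>2" for e x
    unfolding partial_deriv_ev[OF pos_eps[OF \<epsilon>]] by (simp add: power2_eq_square algebra_simps)
  have pd: "partial_deriv e (d e') x = d2 e e' x" for e e' x by (simp add: d_def d2_def)
  have pX: "partial_deriv i X x = d i x + (\<Sum>j\<in>Basis. (x \<bullet> j) *\<^sub>R d2 i j x)" if i: "i \<in> Basis" for i x
  proof -
    have "partial_deriv i X x = (\<Sum>j\<in>Basis. partial_deriv i (\<lambda>x. (x \<bullet> j) *\<^sub>R d j x) x)"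
      unfolding X_def[abs_def] by (rule pd_sum) (auto intro: smooth_scaleR smooth_coord sd)
    also have "\<dots> = (\<Sum>j\<in>Basis. (i \<bullet> j) *\<^sub>R d j x + (x \<bullet> j) *\<^sub>R d2 i j x)"
      by (rule sum.cong) (auto simp: pd_scaleR[OF smooth_coord sd] partial_deriv_inner_const pd)
    also have "\<dots> = d i x + (\<Sum>j\<in>Basis. (x \<bullet> j) *\<^sub>R d2 i j x)"
      using i by (simp add: sum.distrib inner_Basis if_distrib[of "\<lambda>c. c *\<^sub>R _"] cong: if_cong)
    finally show ?thesis .
  qed
  have pN: "partial_deriv j N x = 2 * (\<Sum>i\<in>Basis. d i x \<bullet> d2 j i x)" for j x
  proof -
    have "partial_deriv j N x = (\<Sum>i\<in>Basis. partial_deriv j (\<lambda>x. d i x \<bullet> d i x) x)"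
      unfolding N_def[abs_def] by (rule pd_sum) (auto intro: smooth_inner sd)
    also have "\<dots> = (\<Sum>i\<in>Basis. 2 * (d i x \<bullet> d2 j i x))"
      by (rule sum.cong) (auto simp: pd_inner[OF sd sd] pd inner_commute)
    finally show ?thesis by (simp add: sum_distrib_left)
  qed
  define P where "P i x = (d i x \<bullet> X x) * ?w x" for i x
  define Q where "Q j x = (N x) * (?w x * (x \<bullet> j))" for j x
  define M where "M x = (\<Sum>i\<in>Basis. \<Sum>j\<in>Basis. (x \<bullet> j) * (d i x \<bullet> d2 i j x))" for x
  have tP: "test_function UB (P i)" if "i \<in> Basis" for i
    unfolding P_def[abs_def] by (intro test_mult test_inner td sX sw that)
  have tN: "test_function UB N"
  proof -
    have tz: "test_function UB (\<lambda>x::'a. 0::real)" unfolding test_function_iff by (auto intro: smooth_const)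
    have "test_function UB (\<lambda>x. \<Sum>i\<in>B. d i x \<bullet> d i x)" if "finite B" "B \<subseteq> Basis" for B
      using that by (induction B rule: finite_induct) (auto intro!: test_add test_inner td sd tz)
    then show ?thesis unfolding N_def[abs_def] by simp
  qed
  have tQ: "test_function UB (Q j)" for j
    unfolding Q_def[abs_def] by (intro test_mult tN smooth_mult sw smooth_coord)
  have pP: "partial_deriv i (P i) x = (d2 i i x \<bullet> X x + d i x \<bullet> (d i x + (\<Sum>j\<in>Basis. (x \<bullet> j) *\<^sub>R d2 i j x))) * ?w x
     + (d i x \<bullet> X x) * (- 2 * (x \<bullet> i) * (?w x)\<^sup>2)" if i: "i \<in> Basis" for i x
    unfolding P_def[abs_def] pd_mult[OF smooth_inner[OF sd[OF i] sX] sw] pd_inner[OF sd[OF i] sX] pX[OF i] pd pw by simp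
  have pQ: "partial_deriv j (Q j) x = (2 * (\<Sum>i\<in>Basis. d i x \<bullet> d2 j i x)) * (?w x * (x \<bullet> j))
     + N x * (- 2 * (x \<bullet> j) * (?w x)\<^sup>2 * (x \<bullet> j) + ?w x)" if j: "j \<in> Basis" for j x
    unfolding Q_def[abs_def] pd_mult[OF sN smooth_mult[OF sw smooth_coord]] pd_mult[OF sw smooth_coord] pN pw partial_deriv_inner_const
    using j by simp
  have lap: "laplacian \<phi> x = (\<Sum>i\<in>Basis. d2 i i x)" for x by (simp add: laplacian_def d2_def)
  have XX: "(\<Sum>i\<in>Basis. (d i x \<bullet> X x) * (x \<bullet> i)) = (norm (X x))\<^sup>2" for x
  proof -
    have "X x \<bullet> X x = (\<Sum>i\<in>Basis. (x \<bullet> i) * (d i x \<bullet> X x))"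
      by (subst (1) X_def) (simp add: inner_sum_left)
    then show ?thesis by (simp add: power2_norm_eq_inner mult.commute)
  qed
  have SP: "(\<Sum>i\<in>Basis. partial_deriv i (P i) x) = - 2 * (?w x)\<^sup>2 * (norm (X x))\<^sup>2 + ?w x * (laplacian \<phi> x \<bullet> X x) + ?w x * N x + ?w x * M x" for x
  proof -
    have "(\<Sum>i\<in>Basis. partial_deriv i (P i) x) = (\<Sum>i\<in>Basis. ?w x * (d2 i i x \<bullet> X x) + ?w x * (d i x \<bullet> d i x)
       + ?w x * (\<Sum>j\<in>Basis. (x \<bullet> j) * (d i x \<bullet> d2 i j x)) + (- 2 * (?w x)\<^sup>2) * ((d i x \<bullet> X x) * (x \<bullet> i)))"
      by (rule sum.cong[OF refl]) (simp add: pP inner_add_right inner_sum_right algebra_simps del: ev.simps)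
    also have "\<dots> = ?w x * (\<Sum>i\<in>Basis. d2 i i x \<bullet> X x) + ?w x * N x + ?w x * M x + (- 2 * (?w x)\<^sup>2) * (norm (X x))\<^sup>2"
      unfolding sum.distrib sum_distrib_left[symmetric] XX N_def M_def ..
    finally show ?thesis by (simp add: lap inner_sum_left del: ev.simps)
  qed
  have MM: "(\<Sum>j\<in>Basis. (\<Sum>i\<in>Basis. d i x \<bullet> d2 j i x) * (x \<bullet> j)) = M x" for x
  proof -
    have "(\<Sum>j\<in>Basis. (\<Sum>i\<in>Basis. d i x \<bullet> d2 j i x) * (x \<bullet> j)) = (\<Sum>j\<in>Basis. \<Sum>i\<in>Basis. (x \<bullet> j) * (d i x \<bullet> d2 i j x))"
      unfolding sum_distrib_right
      by (intro sum.cong[OF refl]) (simp add: d2_def mixed_partial[OF s\<phi>] mult.commute)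
    also have "\<dots> = M x" unfolding M_def by (rule sum.swap)
    finally show ?thesis .
  qed
  have SQ: "(\<Sum>j\<in>Basis. partial_deriv j (Q j) x) = - 2 * (?w x)\<^sup>2 * (x \<bullet> x) * N x + ?n * ?w x * N x + 2 * ?w x * M x" for x
  proof -
    have "(\<Sum>j\<in>Basis. partial_deriv j (Q j) x) = (\<Sum>j\<in>Basis. (2 * ?w x) * ((\<Sum>i\<in>Basis. d i x \<bullet> d2 j i x) * (x \<bullet> j))
      + (- 2 * (?w x)\<^sup>2 * N x) * ((x \<bullet> j) * (x \<bullet> j)) + ?w x * N x)"
      by (rule sum.cong[OF refl]) (simp add: pQ algebra_simps del: ev.simps)
    also have "\<dots> = (2 * ?w x) * M x + (- 2 * (?w x)\<^sup>2 * N x) * (x \<bullet> x) + ?n * (?w x * N x)"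
      unfolding sum.distrib sum_distrib_left[symmetric] MM euclidean_inner[of x x, symmetric] by simp
    finally show ?thesis by (simp add: algebra_simps del: ev.simps)
  qed
  have N_eq: "N x = (\<Sum>i\<in>Basis. (norm (d i x))\<^sup>2)" for x by (simp add: N_def power2_norm_eq_inner)
  have wpos: "?w x > 0" and wle: "?w x * (x \<bullet> x) \<le> 1" for x
  proof -
    have p: "x \<bullet> x + \<epsilon> > 0" by (rule pos_eps[OF \<epsilon>])
    have w: "?w x = inverse (x \<bullet> x + \<epsilon>)" using p by (simp add: inverse_mult_distrib[symmetric] del: inverse_mult_distrib)
    show "?w x > 0" unfolding w using p by simp
    show "?w x * (x \<bullet> x) \<le> 1" unfolding w using p \<epsilon> by (simp add: field_simps)
  qed
  have pt: "?n * (\<Sum>i\<in>Basis. partial_deriv i (P i) x) - ?n / 2 * (\<Sum>j\<in>Basis. partial_deriv j (Q j) x)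
     \<le> (norm (laplacian \<phi> x))\<^sup>2 - ?n\<^sup>2 / 4 * (\<Sum>e\<in>Basis. (norm (ev \<epsilon> x Winv *\<^sub>R d e x))\<^sup>2)" for x
  proof -
    have N0: "N x \<ge> 0" unfolding N_eq by (intro sum_nonneg) simp
    have X: "(norm (X x))\<^sup>2 \<le> (x \<bullet> x) * N x"
      unfolding X_def N_eq by (rule sq_norm_radial_le)
    have Nw: "(\<Sum>e\<in>Basis. (norm (ev \<epsilon> x Winv *\<^sub>R d e x))\<^sup>2) = ?w x * N x"
      unfolding N_eq sum_distrib_left
      by (rule sum.cong) (simp_all only: norm_scaleR power_mult_distrib real_norm_def power2_abs, simp add: power2_eq_square)
    have "?n * (\<Sum>i\<in>Basis. partial_deriv i (P i) x) - ?n / 2 * (\<Sum>j\<in>Basis. partial_deriv j (Q j) x)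
      = ?n * (- 2 * (?w x)\<^sup>2 * (norm (X x))\<^sup>2 + ?w x * (laplacian \<phi> x \<bullet> X x) + ?w x * N x)
        - ?n / 2 * (- 2 * (?w x)\<^sup>2 * (x \<bullet> x) * N x + ?n * ?w x * N x)"
      unfolding SP SQ by (simp add: algebra_simps del: ev.simps)
    also have "\<dots> \<le> (norm (laplacian \<phi> x))\<^sup>2 - ?n\<^sup>2 / 4 * (?w x * N x)"
      by (rule hardy_rellich_pointwise[OF _ wpos wle X N0]) (use n in simp)
    finally show ?thesis unfolding Nw .
  qed
  have iP: "integrable (lebesgue_on UB) (\<lambda>x. \<Sum>i\<in>Basis. partial_deriv i (P i) x)"
    by (intro Bochner_Integration.integrable_sum integrable_test test_partial tP open_ball)
  have iQ: "integrable (lebesgue_on UB) (\<lambda>x. \<Sum>i\<in>Basis. partial_deriv i (Q i) x)"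
    by (intro Bochner_Integration.integrable_sum integrable_test test_partial tQ open_ball)
  have zP: "(LINT x|lebesgue_on UB. (\<Sum>i\<in>Basis. partial_deriv i (P i) x)) = 0"
    by (subst Bochner_Integration.integral_sum)
       (auto intro!: integrable_test test_partial tP sum.neutral LINT_partial_zero)
  have zQ: "(LINT x|lebesgue_on UB. (\<Sum>i\<in>Basis. partial_deriv i (Q i) x)) = 0"
    by (subst Bochner_Integration.integral_sum)
       (auto intro!: integrable_test test_partial tQ sum.neutral LINT_partial_zero)
  have Ltest: "L2 UB \<psi>" if "test_function UB \<psi>" for \<psi> :: "'a \<Rightarrow> 'b"
    using jet_L2_D(1)[OF jet_L2_test[OF open_ball that]] .
  have iL: "integrable (lebesgue_on UB) (\<lambda>x. (norm (laplacian \<phi> x))\<^sup>2)"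
    unfolding laplacian_def
    by (rule L2_integrable_sq, intro L2_sum finite_Basis Ltest test_partial \<phi>)
  have tw: "test_function UB (\<lambda>x. ev \<epsilon> x Winv *\<^sub>R d e x)" if "e \<in> Basis" for e
    using test_bilinear[OF bounded_bilinear.flip[OF bounded_bilinear_scaleR] td[OF that] smooth_ev[OF \<epsilon>, of Winv]] .
  have iW: "integrable (lebesgue_on UB) (\<lambda>x. (norm (ev \<epsilon> x Winv *\<^sub>R d e x))\<^sup>2)" if "e \<in> Basis" for e
    by (rule L2_integrable_sq[OF Ltest[OF tw[OF that]]])
  have iS: "integrable (lebesgue_on UB) (\<lambda>x. \<Sum>e\<in>Basis. (norm (ev \<epsilon> x Winv *\<^sub>R d e x))\<^sup>2)"
    by (intro Bochner_Integration.integrable_sum iW)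
  have "0 = (LINT x|lebesgue_on UB. ?n * (\<Sum>i\<in>Basis. partial_deriv i (P i) x) - ?n / 2 * (\<Sum>j\<in>Basis. partial_deriv j (Q j) x))"
    by (subst Bochner_Integration.integral_diff[OF integrable_mult_right[OF iP] integrable_mult_right[OF iQ]])
       (simp add: zP zQ)
  also have "\<dots> \<le> (LINT x|lebesgue_on UB. (norm (laplacian \<phi> x))\<^sup>2 - ?n\<^sup>2 / 4 * (\<Sum>e\<in>Basis. (norm (ev \<epsilon> x Winv *\<^sub>R d e x))\<^sup>2))"
    by (rule integral_mono[OF _ _ pt]) (intro Bochner_Integration.integrable_diff integrable_mult_right iP iQ iL iS)+
  also have "\<dots> = L2_norm_sq UB (laplacian \<phi>) - ?n\<^sup>2 / 4 * (LINT x|lebesgue_on UB. (\<Sum>e\<in>Basis. (norm (ev \<epsilon> x Winv *\<^sub>R d e x))\<^sup>2))"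
    by (subst Bochner_Integration.integral_diff[OF iL integrable_mult_right[OF iS]], subst integral_mult_right_zero)
       (simp add: L2_norm_sq_def)
  also have "(LINT x|lebesgue_on UB. (\<Sum>e\<in>Basis. (norm (ev \<epsilon> x Winv *\<^sub>R d e x))\<^sup>2)) = (\<Sum>e\<in>Basis. L2_norm_sq UB (\<lambda>x. ev \<epsilon> x Winv *\<^sub>R d e x))"
    unfolding L2_norm_sq_def by (rule Bochner_Integration.integral_sum) (rule iW)
  finally show ?thesis using n by (simp add: d_def field_simps)
qed

text \<open>Integrate $\partial_e(x_e|\varphi|^2)=|\varphi|^2+2x_e\,\varphi\cdot\partial_e\varphi$ and use $|x_e|\le1$ on the ball.\<close>

lemma poincare_test:
  fixes \<phi> :: "'a::euclidean_space \<Rightarrow> 'b::euclidean_space"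
  assumes \<phi>: "test_function UB \<phi>" and e: "e \<in> Basis"
  shows "L2norm UB \<phi> \<le> 2 * L2norm UB (partial_deriv e \<phi>)"
proof -
  have s\<phi>: "smooth \<phi>" by (rule test_smooth[OF \<phi>])
  define P where "P x = (\<phi> x \<bullet> \<phi> x) * (x \<bullet> e)" for x
  have tP: "test_function UB P" unfolding P_def[abs_def] by (intro test_mult test_inner \<phi> s\<phi> smooth_coord)
  have pP: "partial_deriv e P x = 2 * (x \<bullet> e) * (\<phi> x \<bullet> partial_deriv e \<phi> x) + (norm (\<phi> x))\<^sup>2" for x
    unfolding P_def[abs_def] pd_mult[OF smooth_inner[OF s\<phi> s\<phi>] smooth_coord] pd_inner[OF s\<phi> s\<phi>] partial_deriv_inner_const
    using e by (simp add: power2_norm_eq_inner inner_commute)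
  have Ltest: "L2 UB \<psi>" if "test_function UB \<psi>" for \<psi> :: "'a \<Rightarrow> 'b"
    using jet_L2_D(1)[OF jet_L2_test[OF open_ball that]] .
  note i1 = L2_integrable_sq[OF Ltest[OF \<phi>]] and i2 = L2_integrable_sq[OF Ltest[OF test_partial[OF \<phi> e]]]
  have "(LINT x|lebesgue_on UB. (norm (\<phi> x))\<^sup>2 - 4 * (norm (partial_deriv e \<phi> x))\<^sup>2) \<le> (LINT x|lebesgue_on UB. 2 * partial_deriv e P x)"
  proof (rule integral_mono)
    show "integrable (lebesgue_on UB) (\<lambda>x. (norm (\<phi> x))\<^sup>2 - 4 * (norm (partial_deriv e \<phi> x))\<^sup>2)"
      by (intro Bochner_Integration.integrable_diff integrable_mult_right i1 i2)
    show "integrable (lebesgue_on UB) (\<lambda>x. 2 * partial_deriv e P x)"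
      by (intro integrable_mult_right integrable_test test_partial tP e open_ball)
    fix x :: 'a assume "x \<in> space (lebesgue_on UB)"
    then have "norm x \<le> 1" by simp
    then have xe: "\<bar>x \<bullet> e\<bar> \<le> 1" using Basis_le_norm[OF e, of x] by linarith
    then have xe2: "(x \<bullet> e)\<^sup>2 \<le> 1" by (simp add: abs_square_le_1)
    \<comment> \<open>Completing the square with the factor 2 leaves the norm of \<open>\<phi>\<close> with coefficient 1.\<close>
    have "0 \<le> (norm (\<phi> x + (2 * (x \<bullet> e)) *\<^sub>R partial_deriv e \<phi> x))\<^sup>2" by simp
    also have "\<dots> = (norm (\<phi> x))\<^sup>2 + 4 * (x \<bullet> e) * (\<phi> x \<bullet> partial_deriv e \<phi> x) + 4 * ((x \<bullet> e)\<^sup>2 * (norm (partial_deriv e \<phi> x))\<^sup>2)"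
      unfolding power2_norm_eq_inner by (simp add: inner_add inner_commute power2_eq_square algebra_simps)
    also have "(x \<bullet> e)\<^sup>2 * (norm (partial_deriv e \<phi> x))\<^sup>2 \<le> 1 * (norm (partial_deriv e \<phi> x))\<^sup>2"
      by (intro mult_right_mono xe2) simp
    finally show "(norm (\<phi> x))\<^sup>2 - 4 * (norm (partial_deriv e \<phi> x))\<^sup>2 \<le> 2 * partial_deriv e P x"
      unfolding pP by simp
  qed
  also have "\<dots> = 0" using LINT_partial_zero[OF tP e open_ball] by simp
  finally have "L2_norm_sq UB \<phi> \<le> 4 * L2_norm_sq UB (partial_deriv e \<phi>)"
    unfolding L2_norm_sq_def using i1 i2 by simp
  then have "sqrt (L2_norm_sq UB \<phi>) \<le> sqrt (4 * L2_norm_sq UB (partial_deriv e \<phi>))" by (rule real_sqrt_le_mono)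
  then show ?thesis by (simp add: L2norm_def real_sqrt_mult)
qed

section \<open>The space $W^{2,2}_0$\<close>

text \<open>Elements of $W^{2,2}_0$ of the unit ball together with a jet; see \<open>jet_W22_0_iff\<close>.\<close>

definition jet_W22_0 :: "('a::euclidean_space \<Rightarrow> 'b::euclidean_space) \<Rightarrow> ('a \<Rightarrow> 'a \<Rightarrow> 'b) \<Rightarrow> ('a \<Rightarrow> 'a \<Rightarrow> 'a \<Rightarrow> 'b) \<Rightarrow> bool" where
  "jet_W22_0 f F1 F2 \<longleftrightarrow> jet_L2 UB f F1 F2 \<and> (\<exists>\<phi>::nat \<Rightarrow> 'a \<Rightarrow> 'b. (\<forall>n. test_function UB (\<phi> n)) \<and>
     jet_lim UB \<phi> (\<lambda>n e. partial_deriv e (\<phi> n)) (\<lambda>n e' e. partial_deriv e' (partial_deriv e (\<phi> n))) f F1 F2 sequentially)"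

lemma jet_W22_0_iff: "jet_L2 UB f F1 F2 \<Longrightarrow> jet_W22_0 f F1 F2 \<longleftrightarrow> W22_0 UB f"
  for f :: "'a::euclidean_space \<Rightarrow> 'b::euclidean_space"
proof -
  assume j: "jet_L2 UB f F1 F2"
  have "(\<lambda>n. W22_norm UB (\<lambda>x. \<phi> n x - f x)) \<longlonglongrightarrow> 0 \<longleftrightarrow>
      jet_lim UB \<phi> (\<lambda>n e. partial_deriv e (\<phi> n)) (\<lambda>n e' e. partial_deriv e' (partial_deriv e (\<phi> n))) f F1 F2 sequentially"
    if "\<forall>n. test_function UB (\<phi> n)" for \<phi> :: "nat \<Rightarrow> 'a \<Rightarrow> 'b"
    by (rule jet_lim_iff[OF open_ball j]) (use that in \<open>simp add: jet_L2_test\<close>)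
  then show ?thesis unfolding jet_W22_0_def W22_0_def sobolev_2_iff using j by blast
qed

text \<open>The regularized weight is bounded, so the inequality passes to limits in $W^{2,2}$.\<close>

lemma hardy_rellich_eps:
  fixes f :: "'a::euclidean_space \<Rightarrow> 'b::euclidean_space"
  assumes j: "jet_W22_0 f F1 F2" and n: "DIM('a) \<ge> 8" and \<epsilon>: "\<epsilon> > 0"
  shows "(\<Sum>e\<in>Basis. L2_norm_sq UB (\<lambda>x. ev \<epsilon> x Winv *\<^sub>R F1 e x))
     \<le> 4 / (real DIM('a))\<^sup>2 * L2_norm_sq UB (\<lambda>x. \<Sum>e\<in>Basis. F2 e e x)"
proof -
  obtain \<phi> :: "nat \<Rightarrow> 'a \<Rightarrow> 'b" where \<phi>: "\<And>n. test_function UB (\<phi> n)" and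
    lim: "jet_lim UB \<phi> (\<lambda>n e. partial_deriv e (\<phi> n)) (\<lambda>n e' e. partial_deriv e' (partial_deriv e (\<phi> n))) f F1 F2 sequentially"
    using j unfolding jet_W22_0_def by blast
  have wb: "\<bar>ev \<epsilon> x Winv\<bar> \<le> inverse (sqrt \<epsilon>)" for x :: 'a
    using \<epsilon> by (simp add: le_imp_inverse_le abs_of_nonneg)
  have L: "L2 UB (\<lambda>x. ev \<epsilon> x Winv *\<^sub>R h x)" if "L2 UB h" for h :: "'a \<Rightarrow> 'b"
    by (rule L2_dominated(1)[OF that, of _ "inverse (sqrt \<epsilon>)"])
       (use wb in \<open>auto intro!: borel_measurable_scaleR measurable_ev_UB L2_measurable[OF that] mult_right_mono simp del: ev.simps\<close>)
  have l1: "L2_lim UB (\<lambda>n x. ev \<epsilon> x Winv *\<^sub>R partial_deriv e (\<phi> n) x) (\<lambda>x. ev \<epsilon> x Winv *\<^sub>R F1 e x) sequentially" if e: "e \<in> Basis" for e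
  proof -
    have l: "L2_lim UB (\<lambda>n. partial_deriv e (\<phi> n)) (F1 e) sequentially"
      using lim e unfolding jet_lim_def by blast
    show ?thesis
    proof (rule L2_lim_dominated[OF l, of _ _ "inverse (sqrt \<epsilon>)"])
      show "\<forall>\<^sub>F n in sequentially. L2 UB (\<lambda>x. ev \<epsilon> x Winv *\<^sub>R partial_deriv e (\<phi> n) x)"
        using l L by (auto simp: L2_lim_def elim: eventually_mono simp del: ev.simps)
      show "L2 UB (\<lambda>x. ev \<epsilon> x Winv *\<^sub>R F1 e x)" by (rule L[OF L2_limD[OF l]])
      show "\<forall>\<^sub>F n in sequentially. AE x in lebesgue_on UB. norm (ev \<epsilon> x Winv *\<^sub>R partial_deriv e (\<phi> n) x - ev \<epsilon> x Winv *\<^sub>R F1 e x)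
         \<le> inverse (sqrt \<epsilon>) * norm (partial_deriv e (\<phi> n) x - F1 e x)"
        using wb by (intro always_eventually allI AE_I2) (simp add: scaleR_diff_right[symmetric] mult_right_mono del: ev.simps scaleR_diff_right)
    qed (use \<epsilon> in simp)
  qed
  have l2: "L2_lim UB (\<lambda>n. laplacian (\<phi> n)) (\<lambda>x. \<Sum>e\<in>Basis. F2 e e x) sequentially"
    unfolding laplacian_def[abs_def] by (rule L2_lim_sum) (use lim in \<open>auto simp: jet_lim_def\<close>)
  have sq: "(\<lambda>n. L2_norm_sq UB (h n)) \<longlonglongrightarrow> L2_norm_sq UB h'" if "L2_lim UB h h' sequentially" for h and h' :: "'a \<Rightarrow> 'b"
    using tendsto_power[OF L2_lim_n2[OF that], of 2] by (simp add: L2norm_sq)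
  show ?thesis
  proof (rule LIMSEQ_le)
    show "(\<lambda>n. \<Sum>e\<in>Basis. L2_norm_sq UB (\<lambda>x. ev \<epsilon> x Winv *\<^sub>R partial_deriv e (\<phi> n) x))
        \<longlonglongrightarrow> (\<Sum>e\<in>Basis. L2_norm_sq UB (\<lambda>x. ev \<epsilon> x Winv *\<^sub>R F1 e x))"
      by (intro tendsto_sum sq l1)
    show "(\<lambda>n. 4 / (real DIM('a))\<^sup>2 * L2_norm_sq UB (laplacian (\<phi> n))) \<longlonglongrightarrow> 4 / (real DIM('a))\<^sup>2 * L2_norm_sq UB (\<lambda>x. \<Sum>e\<in>Basis. F2 e e x)"
      by (intro tendsto_mult tendsto_const sq l2)
    show "\<exists>N. \<forall>k\<ge>N. (\<Sum>e\<in>Basis. L2_norm_sq UB (\<lambda>x. ev \<epsilon> x Winv *\<^sub>R partial_deriv e (\<phi> k) x))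
        \<le> 4 / (real DIM('a))\<^sup>2 * L2_norm_sq UB (laplacian (\<phi> k))"
      using hardy_rellich_test[OF \<phi> n \<epsilon>] by blast
  qed
qed

text \<open>As $\varepsilon$ decreases to 0 the regularized weights increase to $r^{-2}$, and monotone convergence
  applies.\<close>

theorem hardy_rellich:
  fixes f :: "'a::euclidean_space \<Rightarrow> 'b::euclidean_space"
  assumes j: "jet_W22_0 f F1 F2" and n: "DIM('a) \<ge> 8"
  shows "integrable (lebesgue_on UB) (\<lambda>x. rinv x ^ 2 * (\<Sum>e\<in>Basis. (norm (F1 e x))\<^sup>2))"
    "(LINT x|lebesgue_on UB. rinv x ^ 2 * (\<Sum>e\<in>Basis. (norm (F1 e x))\<^sup>2))
     \<le> 4 / (real DIM('a))\<^sup>2 * L2_norm_sq UB (\<lambda>x. \<Sum>e\<in>Basis. F2 e e x)"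
proof -
  let ?\<epsilon> = "\<lambda>n. inverse (real (Suc n))"
  define N where "N x = (\<Sum>e\<in>Basis. (norm (F1 e x))\<^sup>2)" for x
  let ?B = "4 / (real DIM('a))\<^sup>2 * L2_norm_sq UB (\<lambda>x. \<Sum>e\<in>Basis. F2 e e x)"
  define F where "F n x = (ev (?\<epsilon> n) x Winv)\<^sup>2 * N x" for n x
  have jL: "jet_L2 UB f F1 F2" using j by (simp add: jet_W22_0_def)
  have m1: "F1 e \<in> borel_measurable (lebesgue_on UB)" if "e \<in> Basis" for e by (rule L2_measurable[OF jet_L2_D(2)[OF jL that]])
  have iN: "integrable (lebesgue_on UB) N"
    unfolding N_def[abs_def] by (intro Bochner_Integration.integrable_sum L2_integrable_sq jet_L2_D(2)[OF jL])
  have N0: "N x \<ge> 0" for x unfolding N_def by (intro sum_nonneg) simp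
  have FN: "F n x = (\<Sum>e\<in>Basis. (norm (ev (?\<epsilon> n) x Winv *\<^sub>R F1 e x))\<^sup>2)" for n x
    unfolding F_def N_def sum_distrib_left by (rule sum.cong) (auto simp: power_mult_distrib)
  have Lw: "L2 UB (\<lambda>x. ev (?\<epsilon> n) x Winv *\<^sub>R F1 e x)" if "e \<in> Basis" for n e
  proof (rule L2_dominated(1)[OF jet_L2_D(2)[OF jL that], of _ "inverse (sqrt (?\<epsilon> n))"])
    have "\<bar>ev (?\<epsilon> n) x Winv\<bar> \<le> inverse (sqrt (?\<epsilon> n))" for x :: 'a
      by (simp only: ev.simps, subst abs_of_nonneg) (auto intro!: le_imp_inverse_le simp: add_nonneg_nonneg simp del: of_nat_Suc)
    then show "AE x in lebesgue_on UB. norm (ev (?\<epsilon> n) x Winv *\<^sub>R F1 e x) \<le> inverse (sqrt (?\<epsilon> n)) * norm (F1 e x)"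
      by (intro AE_I2) (simp add: mult_right_mono del: ev.simps of_nat_Suc)
  qed (intro borel_measurable_scaleR measurable_ev_UB m1 that)
  have iF: "integrable (lebesgue_on UB) (F n)" for n
    unfolding FN[abs_def] by (intro Bochner_Integration.integrable_sum L2_integrable_sq Lw)
  have bF: "(LINT x|lebesgue_on UB. F n x) \<le> ?B" for n
  proof -
    have "(LINT x|lebesgue_on UB. F n x) = (\<Sum>e\<in>Basis. L2_norm_sq UB (\<lambda>x. ev (?\<epsilon> n) x Winv *\<^sub>R F1 e x))"
      unfolding FN L2_norm_sq_def by (intro Bochner_Integration.integral_sum L2_integrable_sq Lw)
    also have "\<dots> \<le> ?B" by (rule hardy_rellich_eps[OF j n eps_seq(2)])
    finally show ?thesis .
  qed
  have mono: "mono (\<lambda>n. F n x)" for x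
  proof (rule incseq_SucI)
    fix n
    have "ev (?\<epsilon> n) x Winv \<le> ev (?\<epsilon> (Suc n)) x Winv"
    proof -
      have a: "?\<epsilon> (Suc n) \<le> ?\<epsilon> n" by (intro le_imp_inverse_le) auto
      have b: "0 < sqrt (x \<bullet> x + ?\<epsilon> (Suc n))"
        unfolding real_sqrt_gt_0_iff by (rule pos_eps[OF eps_seq(2)])
      show ?thesis
        unfolding ev.simps by (rule le_imp_inverse_le[OF real_sqrt_le_mono[OF add_left_mono[OF a]] b])
    qed
    moreover have "0 \<le> ev (?\<epsilon> n) x Winv"
      using pos_eps[OF eps_seq(2), of x n] by simp
    ultimately show "F n x \<le> F (Suc n) x"
      unfolding F_def by (intro mult_right_mono power_mono N0)
  qed
  have lim: "AE x in lebesgue_on UB. (\<lambda>n. F n x) \<longlonglongrightarrow> rinv x ^ 2 * N x"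
    using AE_UB_nonzero unfolding F_def
    by eventually_elim (intro tendsto_mult tendsto_power tendsto_const ev_tendsto eps_seq, simp)
  have "mono (\<lambda>n. LINT x|lebesgue_on UB. F n x)"
    by (rule incseq_SucI) (intro integral_mono iF incseq_SucD[OF mono])
  then obtain L where L: "(\<lambda>n. LINT x|lebesgue_on UB. F n x) \<longlonglongrightarrow> L"
    using incseq_convergent[of "\<lambda>n. LINT x|lebesgue_on UB. F n x" ?B] bF by blast
  have m: "(\<lambda>x. rinv x ^ 2 * N x) \<in> borel_measurable (lebesgue_on UB)"
    by (intro borel_measurable_times borel_measurable_power measurable_ev_UB borel_measurable_integrable[OF iN])
  have mAE: "AE x in lebesgue_on UB. mono (\<lambda>n. F n x)" using mono by simp
  show "integrable (lebesgue_on UB) (\<lambda>x. rinv x ^ 2 * (\<Sum>e\<in>Basis. (norm (F1 e x))\<^sup>2))"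
    using integrable_monotone_convergence[OF iF mAE lim L m] unfolding N_def .
  have "(LINT x|lebesgue_on UB. rinv x ^ 2 * N x) = L"
    by (rule integral_monotone_convergence[OF iF mAE lim L m])
  also have "L \<le> ?B" by (rule LIMSEQ_le_const2[OF L]) (use bF in blast)
  finally show "(LINT x|lebesgue_on UB. rinv x ^ 2 * (\<Sum>e\<in>Basis. (norm (F1 e x))\<^sup>2)) \<le> ?B" unfolding N_def .
qed

lemma poincare:
  fixes f :: "'a::euclidean_space \<Rightarrow> 'b::euclidean_space"
  assumes j: "jet_W22_0 f F1 F2" and e: "e \<in> Basis"
  shows "L2norm UB f \<le> 2 * L2norm UB (F1 e)"
proof -
  obtain \<phi> :: "nat \<Rightarrow> 'a \<Rightarrow> 'b" where \<phi>: "\<And>n. test_function UB (\<phi> n)" and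
    lim: "jet_lim UB \<phi> (\<lambda>n e. partial_deriv e (\<phi> n)) (\<lambda>n e' e. partial_deriv e' (partial_deriv e (\<phi> n))) f F1 F2 sequentially"
    using j unfolding jet_W22_0_def by blast
  have l0: "(\<lambda>n. L2norm UB (\<phi> n)) \<longlonglongrightarrow> L2norm UB f" by (rule L2_lim_n2) (use lim in \<open>simp add: jet_lim_def\<close>)
  have l1: "(\<lambda>n. 2 * L2norm UB (partial_deriv e (\<phi> n))) \<longlonglongrightarrow> 2 * L2norm UB (F1 e)"
    by (intro tendsto_mult tendsto_const L2_lim_n2) (use lim e in \<open>simp add: jet_lim_def\<close>)
  show ?thesis by (rule LIMSEQ_le[OF l0 l1]) (use poincare_test[OF \<phi> e] in blast)
qed

section \<open>Product rule\<close>

text \<open>A jet that is a limit of jets of smooth maps without boundary condition: the maps $q$, by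
  regularization, and all elements of $W^{2,2}_0$ have this property, and it suffices for the product
  rule.\<close>

definition smooth_jet :: "('a::euclidean_space \<Rightarrow> 'b::euclidean_space) \<Rightarrow> ('a \<Rightarrow> 'a \<Rightarrow> 'b) \<Rightarrow> ('a \<Rightarrow> 'a \<Rightarrow> 'a \<Rightarrow> 'b) \<Rightarrow> bool" where
  "smooth_jet f F1 F2 \<longleftrightarrow> jet_L2 UB f F1 F2 \<and> (\<exists>\<phi>::nat \<Rightarrow> 'a \<Rightarrow> 'b. (\<forall>n. smooth (\<phi> n)) \<and>
     jet_lim UB \<phi> (\<lambda>n e. partial_deriv e (\<phi> n)) (\<lambda>n e' e. partial_deriv e' (partial_deriv e (\<phi> n))) f F1 F2 sequentially)"

lemma smooth_jet_W22_0: "jet_W22_0 f F1 F2 \<Longrightarrow> smooth_jet f F1 F2"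
  unfolding jet_W22_0_def smooth_jet_def using test_smooth by blast

lemma smooth_jet_L2: "smooth_jet f F1 F2 \<Longrightarrow> jet_L2 UB f F1 F2"
  by (simp add: smooth_jet_def)

lemma pd_lincomb:
  assumes "smooth f" "smooth g"
  shows "partial_deriv e (\<lambda>x. a *\<^sub>R f x + b *\<^sub>R g x) = (\<lambda>x. a *\<^sub>R partial_deriv e f x + b *\<^sub>R partial_deriv e g x)"
proof
  fix x
  show "partial_deriv e (\<lambda>x. a *\<^sub>R f x + b *\<^sub>R g x) x = a *\<^sub>R partial_deriv e f x + b *\<^sub>R partial_deriv e g x"
    by (simp add: pd_add[OF smooth_scaleR[OF smooth_const assms(1)] smooth_scaleR[OF smooth_const assms(2)]]
        pd_scaleR[OF smooth_const assms(1)] pd_scaleR[OF smooth_const assms(2)])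
qed

lemma jet_lim_cong:
  assumes "jet_lim \<Omega> P P1 P2 f F1 F2 net" "\<And>n e. e \<in> Basis \<Longrightarrow> P1 n e = Q1 n e"
    "\<And>n e e'. e \<in> Basis \<Longrightarrow> P2 n e' e = Q2 n e' e"
  shows "jet_lim \<Omega> P Q1 Q2 f F1 F2 net"
  using assms unfolding jet_lim_def by simp

lemma smooth_jet_lincomb:
  fixes f g :: "'a::euclidean_space \<Rightarrow> 'b::euclidean_space"
  assumes f: "smooth_jet f F1 F2" and g: "smooth_jet g G1 G2"
  shows "smooth_jet (\<lambda>x. a *\<^sub>R f x + b *\<^sub>R g x) (\<lambda>e x. a *\<^sub>R F1 e x + b *\<^sub>R G1 e x)
     (\<lambda>e' e x. a *\<^sub>R F2 e' e x + b *\<^sub>R G2 e' e x)"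
proof -
  obtain \<phi> where \<phi>: "\<And>n::nat. smooth (\<phi> n)"
    and l1: "jet_lim UB \<phi> (\<lambda>n e. partial_deriv e (\<phi> n)) (\<lambda>n e' e. partial_deriv e' (partial_deriv e (\<phi> n))) f F1 F2 sequentially"
    using f unfolding smooth_jet_def by blast
  obtain \<psi> where \<psi>: "\<And>n::nat. smooth (\<psi> n)"
    and l2: "jet_lim UB \<psi> (\<lambda>n e. partial_deriv e (\<psi> n)) (\<lambda>n e' e. partial_deriv e' (partial_deriv e (\<psi> n))) g G1 G2 sequentially"
    using g unfolding smooth_jet_def by blast
  note l = jet_lim_lincomb[OF l1 l2, of a b]
  have sm: "\<forall>n. smooth (\<lambda>x. a *\<^sub>R \<phi> n x + b *\<^sub>R \<psi> n x)"
    by (intro allI smooth_add smooth_scaleR smooth_const \<phi> \<psi>)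
  show ?thesis
    unfolding smooth_jet_def
    by (intro conjI jet_L2_lincomb open_ball smooth_jet_L2[OF f] smooth_jet_L2[OF g] exI[of _ "\<lambda>n x. a *\<^sub>R \<phi> n x + b *\<^sub>R \<psi> n x"] sm
        jet_lim_cong[OF l]) (simp_all add: pd_lincomb smooth_partial \<phi> \<psi>)
qed

lemma jet_W22_0_lincomb:
  fixes f g :: "'a::euclidean_space \<Rightarrow> 'b::euclidean_space"
  assumes f: "jet_W22_0 f F1 F2" and g: "jet_W22_0 g G1 G2"
  shows "jet_W22_0 (\<lambda>x. a *\<^sub>R f x + b *\<^sub>R g x) (\<lambda>e x. a *\<^sub>R F1 e x + b *\<^sub>R G1 e x)
     (\<lambda>e' e x. a *\<^sub>R F2 e' e x + b *\<^sub>R G2 e' e x)"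
proof -
  obtain \<phi> where \<phi>: "\<And>n::nat. test_function UB (\<phi> n)"
    and l1: "jet_lim UB \<phi> (\<lambda>n e. partial_deriv e (\<phi> n)) (\<lambda>n e' e. partial_deriv e' (partial_deriv e (\<phi> n))) f F1 F2 sequentially"
    using f unfolding jet_W22_0_def by blast
  obtain \<psi> where \<psi>: "\<And>n::nat. test_function UB (\<psi> n)"
    and l2: "jet_lim UB \<psi> (\<lambda>n e. partial_deriv e (\<psi> n)) (\<lambda>n e' e. partial_deriv e' (partial_deriv e (\<psi> n))) g G1 G2 sequentially"
    using g unfolding jet_W22_0_def by blast
  note l = jet_lim_lincomb[OF l1 l2, of a b]
  have tsc: "test_function UB (\<lambda>x. c *\<^sub>R h x)" if "test_function UB h" for c and h :: "'a \<Rightarrow> 'b"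
    using test_bilinear[OF bounded_bilinear.flip[OF bounded_bilinear_scaleR] that smooth_const[of c]] .
  have sm: "\<forall>n. test_function UB (\<lambda>x. a *\<^sub>R \<phi> n x + b *\<^sub>R \<psi> n x)"
    by (intro allI test_add tsc \<phi> \<psi>)
  show ?thesis
    unfolding jet_W22_0_def
    by (intro conjI jet_L2_lincomb open_ball smooth_jet_L2[OF smooth_jet_W22_0[OF f]] smooth_jet_L2[OF smooth_jet_W22_0[OF g]]
        exI[of _ "\<lambda>n x. a *\<^sub>R \<phi> n x + b *\<^sub>R \<psi> n x"] sm
        jet_lim_cong[OF l]) (simp_all add: pd_lincomb smooth_partial test_smooth[OF \<phi>] test_smooth[OF \<psi>])
qed

lemma weighted_inner_limit:
  fixes F G :: "nat \<Rightarrow> 'a::euclidean_space \<Rightarrow> 'b::euclidean_space"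
  assumes \<theta>: "test_function UB \<theta>" and F: "L2_lim UB F f sequentially" and G: "L2_lim UB G g sequentially"
  shows "(\<lambda>n. LINT x|lebesgue_on UB. \<theta> x * (F n x \<bullet> G n x)) \<longlonglongrightarrow> (LINT x|lebesgue_on UB. \<theta> x * (f x \<bullet> g x))"
proof -
  obtain C where C: "C \<ge> 0" "\<And>x. norm (\<theta> x) \<le> C" using test_measurable_bounded(2)[OF \<theta>] by blast
  have L: "L2 UB (\<lambda>x. \<theta> x *\<^sub>R h x)" if "L2 UB h" for h :: "'a \<Rightarrow> 'b"
    by (rule L2_dominated(1)[OF that, of _ C])
       (use C in \<open>auto intro!: borel_measurable_scaleR test_measurable_bounded(1)[OF \<theta>] L2_measurable[OF that] mult_right_mono\<close>)
  have "L2_lim UB (\<lambda>n x. \<theta> x *\<^sub>R F n x) (\<lambda>x. \<theta> x *\<^sub>R f x) sequentially"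
  proof (rule L2_lim_dominated[OF F _ L[OF L2_limD[OF F]] _ C(1)])
    show "\<forall>\<^sub>F n in sequentially. L2 UB (\<lambda>x. \<theta> x *\<^sub>R F n x)"
      using F L by (auto simp: L2_lim_def elim: eventually_mono)
    show "\<forall>\<^sub>F n in sequentially. AE x in lebesgue_on UB. norm (\<theta> x *\<^sub>R F n x - \<theta> x *\<^sub>R f x) \<le> C * norm (F n x - f x)"
      using C by (intro always_eventually allI AE_I2) (simp add: scaleR_diff_right[symmetric] mult_right_mono del: scaleR_diff_right)
  qed
  from L2_lim_inner[OF this G] show ?thesis by simp
qed

text \<open>The product rule for smooth maps passes to the limit because products of two sequences that
  converge in $L^2$ converge in $L^1$.\<close>

lemma hwd_inner:
  fixes f g :: "'a::euclidean_space \<Rightarrow> 'b::euclidean_space"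
  assumes e: "e \<in> Basis" and sf: "\<And>n::nat. smooth (F n)" and sg: "\<And>n. smooth (G n)"
    and f: "L2_lim UB F f sequentially" "L2_lim UB (\<lambda>n. partial_deriv e (F n)) f' sequentially"
    and g: "L2_lim UB G g sequentially" "L2_lim UB (\<lambda>n. partial_deriv e (G n)) g' sequentially"
  shows "has_weak_deriv UB e (\<lambda>x. f x \<bullet> g x) (\<lambda>x. f' x \<bullet> g x + f x \<bullet> g' x)"
  unfolding has_weak_deriv_def
proof (intro conjI allI impI)
  show "locally_integrable UB (\<lambda>x. f x \<bullet> g x)" "locally_integrable UB (\<lambda>x. f' x \<bullet> g x + f x \<bullet> g' x)"
    by (intro locally_integrable_of_integrable open_ball Bochner_Integration.integrable_add L2_inner_integrable L2_limD[OF f(1)] L2_limD[OF f(2)] L2_limD[OF g(1)] L2_limD[OF g(2)])+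
  fix \<theta> :: "'a \<Rightarrow> real" assume \<theta>: "test_function UB \<theta>"
  have wi: "integrable (lebesgue_on UB) (\<lambda>x. \<theta> x * (h x \<bullet> k x))" if "L2 UB h" "L2 UB k" for h k :: "'a \<Rightarrow> 'b"
    using integrable_test_scaleR[OF open_ball locally_integrable_of_integrable[OF open_ball L2_inner_integrable[OF that]] \<theta>] by simp
  have ev: "\<forall>\<^sub>F n in sequentially. L2 UB (F n) \<and> L2 UB (partial_deriv e (F n)) \<and> L2 UB (G n) \<and> L2 UB (partial_deriv e (G n))"
    using f g by (auto simp: L2_lim_def eventually_conj)
  have eq: "\<forall>\<^sub>F n in sequentially. (LINT x|lebesgue_on UB. partial_deriv e \<theta> x * (F n x \<bullet> G n x))
     = - ((LINT x|lebesgue_on UB. \<theta> x * (partial_deriv e (F n) x \<bullet> G n x)) + (LINT x|lebesgue_on UB. \<theta> x * (F n x \<bullet> partial_deriv e (G n) x)))"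
    using ev
  proof eventually_elim
    case (elim n)
    have "has_weak_deriv UB e (\<lambda>x. F n x \<bullet> G n x) (partial_deriv e (\<lambda>x. F n x \<bullet> G n x))"
      by (intro has_weak_deriv_smooth smooth_inner sf sg e open_ball)
    then have "(LINT x|lebesgue_on UB. partial_deriv e \<theta> x * (F n x \<bullet> G n x))
       = - (LINT x|lebesgue_on UB. \<theta> x * (partial_deriv e (F n) x \<bullet> G n x) + \<theta> x * (F n x \<bullet> partial_deriv e (G n) x))"
      using \<theta> by (simp add: has_weak_deriv_def pd_inner[OF sf sg] distrib_left)
    then show ?case using elim by (simp add: wi)
  qed
  have 1: "(\<lambda>n. LINT x|lebesgue_on UB. partial_deriv e \<theta> x * (F n x \<bullet> G n x)) \<longlonglongrightarrow> (LINT x|lebesgue_on UB. partial_deriv e \<theta> x * (f x \<bullet> g x))"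
    by (rule weighted_inner_limit[OF test_partial[OF \<theta> e] f(1) g(1)])
  have 2: "(\<lambda>n. - ((LINT x|lebesgue_on UB. \<theta> x * (partial_deriv e (F n) x \<bullet> G n x)) + (LINT x|lebesgue_on UB. \<theta> x * (F n x \<bullet> partial_deriv e (G n) x))))
     \<longlonglongrightarrow> - ((LINT x|lebesgue_on UB. \<theta> x * (f' x \<bullet> g x)) + (LINT x|lebesgue_on UB. \<theta> x * (f x \<bullet> g' x)))"
    by (intro tendsto_minus tendsto_add weighted_inner_limit \<theta> f g)
  have "(LINT x|lebesgue_on UB. partial_deriv e \<theta> x * (f x \<bullet> g x)) = - ((LINT x|lebesgue_on UB. \<theta> x * (f' x \<bullet> g x)) + (LINT x|lebesgue_on UB. \<theta> x * (f x \<bullet> g' x)))"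
    by (rule LIMSEQ_unique[OF Lim_transform_eventually[OF 1 eq] 2])
  also have "(LINT x|lebesgue_on UB. \<theta> x * (f' x \<bullet> g x)) + (LINT x|lebesgue_on UB. \<theta> x * (f x \<bullet> g' x))
     = (LINT x|lebesgue_on UB. \<theta> x * (f' x \<bullet> g x) + \<theta> x * (f x \<bullet> g' x))"
    by (intro Bochner_Integration.integral_add[symmetric] wi L2_limD[OF f(1)] L2_limD[OF f(2)] L2_limD[OF g(1)] L2_limD[OF g(2)])
  finally show "(LINT x|lebesgue_on UB. partial_deriv e \<theta> x *\<^sub>R (f x \<bullet> g x)) = - (LINT x|lebesgue_on UB. \<theta> x *\<^sub>R (f' x \<bullet> g x + f x \<bullet> g' x))"
    by (simp add: distrib_left)
qed

text \<open>The Laplacian of \<open>\<langle>f, g\<rangle> + \<langle>h, k\<rangle>\<close> by the Leibniz rule. It is applied to the constraint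
  $|U|^2=1$ and to its first two derivatives along a variation.\<close>

lemma laplacian_constant_products:
  fixes f g h k :: "'a::euclidean_space \<Rightarrow> 'b::euclidean_space"
  assumes f: "smooth_jet f F1 F2" and g: "smooth_jet g G1 G2" and h: "smooth_jet h H1 H2" and k: "smooth_jet k K1 K2"
    and c: "AE x in lebesgue_on UB. f x \<bullet> g x + h x \<bullet> k x = c"
  shows "AE x in lebesgue_on UB.
      ((\<Sum>e\<in>Basis. F2 e e x) \<bullet> g x + 2 * (\<Sum>e\<in>Basis. F1 e x \<bullet> G1 e x) + f x \<bullet> (\<Sum>e\<in>Basis. G2 e e x))
    + ((\<Sum>e\<in>Basis. H2 e e x) \<bullet> k x + 2 * (\<Sum>e\<in>Basis. H1 e x \<bullet> K1 e x) + h x \<bullet> (\<Sum>e\<in>Basis. K2 e e x)) = 0"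
proof -
  have first: "has_weak_deriv UB e (\<lambda>x. f x \<bullet> g x) (\<lambda>x. F1 e x \<bullet> g x + f x \<bullet> G1 e x)"
    and second: "has_weak_deriv UB e (\<lambda>x. F1 e x \<bullet> g x + f x \<bullet> G1 e x)
        (\<lambda>x. (F2 e e x \<bullet> g x + F1 e x \<bullet> G1 e x) + (F1 e x \<bullet> G1 e x + f x \<bullet> G2 e e x))"
    if e: "e \<in> Basis" and f: "smooth_jet f F1 F2" and g: "smooth_jet g G1 G2"
    for e and f g :: "'a \<Rightarrow> 'b" and F1 F2 G1 G2
  proof -
    obtain \<phi> where \<phi>: "\<And>n::nat. smooth (\<phi> n)"
      and l1: "jet_lim UB \<phi> (\<lambda>n e. partial_deriv e (\<phi> n)) (\<lambda>n e' e. partial_deriv e' (partial_deriv e (\<phi> n))) f F1 F2 sequentially"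
      using f unfolding smooth_jet_def by blast
    obtain \<psi> where \<psi>: "\<And>n::nat. smooth (\<psi> n)"
      and l2: "jet_lim UB \<psi> (\<lambda>n e. partial_deriv e (\<psi> n)) (\<lambda>n e' e. partial_deriv e' (partial_deriv e (\<psi> n))) g G1 G2 sequentially"
      using g unfolding smooth_jet_def by blast
    have a: "L2_lim UB \<phi> f sequentially" "L2_lim UB (\<lambda>n. partial_deriv e (\<phi> n)) (F1 e) sequentially"
      "L2_lim UB (\<lambda>n. partial_deriv e (partial_deriv e (\<phi> n))) (F2 e e) sequentially"
      "L2_lim UB \<psi> g sequentially" "L2_lim UB (\<lambda>n. partial_deriv e (\<psi> n)) (G1 e) sequentially"
      "L2_lim UB (\<lambda>n. partial_deriv e (partial_deriv e (\<psi> n))) (G2 e e) sequentially"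
      using l1 l2 e unfolding jet_lim_def by blast+
    show "has_weak_deriv UB e (\<lambda>x. f x \<bullet> g x) (\<lambda>x. F1 e x \<bullet> g x + f x \<bullet> G1 e x)"
      by (rule hwd_inner[OF e \<phi> \<psi> a(1,2,4,5)])
    have 1: "has_weak_deriv UB e (\<lambda>x. F1 e x \<bullet> g x) (\<lambda>x. F2 e e x \<bullet> g x + F1 e x \<bullet> G1 e x)"
      by (rule hwd_inner[OF e smooth_partial[OF \<phi> e] \<psi> a(2,3,4,5)])
    have 2: "has_weak_deriv UB e (\<lambda>x. f x \<bullet> G1 e x) (\<lambda>x. F1 e x \<bullet> G1 e x + f x \<bullet> G2 e e x)"
      by (rule hwd_inner[OF e \<phi> smooth_partial[OF \<psi> e] a(1,2,5,6)])
    show "has_weak_deriv UB e (\<lambda>x. F1 e x \<bullet> g x + f x \<bullet> G1 e x)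
        (\<lambda>x. (F2 e e x \<bullet> g x + F1 e x \<bullet> G1 e x) + (F1 e x \<bullet> G1 e x + f x \<bullet> G2 e e x))"
      using hwd_lincomb[OF open_ball e 1 2, of 1 1] by simp
  qed
  have z: "AE x in lebesgue_on UB. (F2 e e x \<bullet> g x + 2 * (F1 e x \<bullet> G1 e x) + f x \<bullet> G2 e e x) + (H2 e e x \<bullet> k x + 2 * (H1 e x \<bullet> K1 e x) + h x \<bullet> K2 e e x) = 0"
    if e: "e \<in> Basis" for e
  proof -
    have 1: "has_weak_deriv UB e (\<lambda>x. f x \<bullet> g x + h x \<bullet> k x) (\<lambda>x. (F1 e x \<bullet> g x + f x \<bullet> G1 e x) + (H1 e x \<bullet> k x + h x \<bullet> K1 e x))"
      using hwd_lincomb[OF open_ball e first[OF e f g] first[OF e h k], of 1 1] by simp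
    have 2: "has_weak_deriv UB e (\<lambda>x. (F1 e x \<bullet> g x + f x \<bullet> G1 e x) + (H1 e x \<bullet> k x + h x \<bullet> K1 e x))
       (\<lambda>x. ((F2 e e x \<bullet> g x + F1 e x \<bullet> G1 e x) + (F1 e x \<bullet> G1 e x + f x \<bullet> G2 e e x)) + ((H2 e e x \<bullet> k x + H1 e x \<bullet> K1 e x) + (H1 e x \<bullet> K1 e x + h x \<bullet> K2 e e x)))"
      using hwd_lincomb[OF open_ball e second[OF e f g] second[OF e h k], of 1 1] by simp
    have cc: "has_weak_deriv UB e (\<lambda>x. c) (\<lambda>x. 0)"
      using has_weak_deriv_smooth[OF smooth_const[of c] e open_ball, of 0 1] by simp
    have "AE x in lebesgue_on UB. c = f x \<bullet> g x + h x \<bullet> k x" using c by eventually_elim simp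
    from hwd_cong[OF open_ball e cc _ this] 1
    have "has_weak_deriv UB e (\<lambda>x. f x \<bullet> g x + h x \<bullet> k x) (\<lambda>x. 0)" by (simp add: has_weak_deriv_def)
    from hwd_unique[OF open_ball e 1 this]
    have "AE x in lebesgue_on UB. 0 = (F1 e x \<bullet> g x + f x \<bullet> G1 e x) + (H1 e x \<bullet> k x + h x \<bullet> K1 e x)"
      by eventually_elim simp
    from hwd_cong[OF open_ball e hwd_zero[OF open_ball e] _ this] 2
    have "has_weak_deriv UB e (\<lambda>x. (F1 e x \<bullet> g x + f x \<bullet> G1 e x) + (H1 e x \<bullet> k x + h x \<bullet> K1 e x)) (\<lambda>x. 0)"
      by (simp add: has_weak_deriv_def)
    from hwd_unique[OF open_ball e 2 this] show ?thesis by eventually_elim simp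
  qed
  have "AE x in lebesgue_on UB. \<forall>e\<in>Basis. (F2 e e x \<bullet> g x + 2 * (F1 e x \<bullet> G1 e x) + f x \<bullet> G2 e e x) + (H2 e e x \<bullet> k x + 2 * (H1 e x \<bullet> K1 e x) + h x \<bullet> K2 e e x) = 0"
    by (rule AE_finite_allI[OF finite_Basis z])
  then show ?thesis
  proof eventually_elim
    case (elim x)
    then have "(\<Sum>e\<in>Basis. (F2 e e x \<bullet> g x + 2 * (F1 e x \<bullet> G1 e x) + f x \<bullet> G2 e e x) + (H2 e e x \<bullet> k x + 2 * (H1 e x \<bullet> K1 e x) + h x \<bullet> K2 e e x)) = 0"
      by (intro sum.neutral) auto
    then show ?case by (simp add: sum.distrib inner_sum_left inner_sum_right sum_distrib_left)
  qed
qed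

section \<open>Essentially bounded maps\<close>

text \<open>The essential supremum of a norm over a set of positive measure is nonnegative, and it is finite
  by assumption; so the passage to a real number loses nothing.\<close>

lemma Linf_norm_AE:
  fixes f :: "'a::euclidean_space \<Rightarrow> 'b::euclidean_space"
  assumes "Linf UB f"
  shows "AE x in lebesgue_on UB. norm (f x) \<le> Linf_norm UB f" "0 \<le> Linf_norm UB f"
proof -
  let ?s = "esssup (lebesgue_on UB) (\<lambda>x. ereal (norm (f x)))"
  have ae: "AE x in lebesgue_on UB. ereal (norm (f x)) \<le> ?s" by (rule esssup_AE)
  have pos: "0 \<le> ?s"
  proof (rule ccontr)
    assume "\<not> 0 \<le> ?s"
    then have neg: "?s < 0" by simp
    have "AE x in lebesgue_on (UB :: 'a set). x \<noteq> x"
      using ae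
    proof eventually_elim
      case (elim x)
      then have "ereal (norm (f x)) < 0" using neg by (rule le_less_trans)
      then show ?case by (simp add: zero_ereal_def)
    qed
    then show False using AE_UB_not_empty by blast
  qed
  have fin: "?s < \<infinity>" using assms by (simp add: Linf_def)
  have s: "ereal (Linf_norm UB f) = ?s"
    unfolding Linf_norm_def using pos fin by (intro ereal_real') auto
  show "AE x in lebesgue_on UB. norm (f x) \<le> Linf_norm UB f"
    using ae unfolding s[symmetric] by simp
  show "0 \<le> Linf_norm UB f" using pos unfolding s[symmetric] by (simp add: zero_ereal_def)
qed

section \<open>Differentiable curves of maps\<close>

definition diff_quot :: "(real \<Rightarrow> 'a \<Rightarrow> 'b::real_vector) \<Rightarrow> real \<Rightarrow> real \<Rightarrow> 'a \<Rightarrow> 'b" where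
  "diff_quot F t h x = (F (t + h) x - F t x) /\<^sub>R h"

lemma diff_quot_step: "h \<noteq> 0 \<Longrightarrow> F (t + h) = (\<lambda>x. F t x + h *\<^sub>R diff_quot F t h x)"
  by (auto simp: diff_quot_def)

lemma eventually_at_0_nonzero: "\<forall>\<^sub>F h in at (0::real). h \<noteq> 0"
  by (simp add: eventually_at_filter)

lemma L2_lim_cong:
  assumes "L2_lim \<Omega> F f net" "\<forall>\<^sub>F n in net. F n = G n"
  shows "L2_lim \<Omega> G f net"
proof -
  have 1: "\<forall>\<^sub>F n in net. L2 \<Omega> (F n)" and 2: "L2 \<Omega> f" and 3: "((\<lambda>n. L2norm \<Omega> (\<lambda>x. F n x - f x)) \<longlongrightarrow> 0) net"
    using assms(1) by (auto simp: L2_lim_def)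
  have "\<forall>\<^sub>F n in net. L2 \<Omega> (G n)" using 1 assms(2) by eventually_elim simp
  moreover have "\<forall>\<^sub>F n in net. L2norm \<Omega> (\<lambda>x. F n x - f x) = L2norm \<Omega> (\<lambda>x. G n x - f x)"
    using assms(2) by eventually_elim simp
  ultimately show ?thesis using 2 Lim_transform_eventually[OF 3] by (simp add: L2_lim_def)
qed

lemma L2_lim_curve:
  fixes F :: "real \<Rightarrow> 'a::euclidean_space \<Rightarrow> 'b::euclidean_space"
  assumes F: "L2_lim \<Omega> (diff_quot F t) F' (at 0)" and Ft: "L2 \<Omega> (F t)"
  shows "L2_lim \<Omega> (\<lambda>h. F (t + h)) (F t) (at 0)"
proof -
  have ev: "\<forall>\<^sub>F h in at 0. L2 \<Omega> (diff_quot F t h)" using F by (simp add: L2_lim_def)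
  have "\<forall>\<^sub>F h in at 0. L2 \<Omega> (F (t + h))"
    using ev eventually_at_0_nonzero
  proof eventually_elim
    case (elim h)
    then show ?case unfolding diff_quot_step[OF elim(2)] by (intro L2_add L2_scaleR Ft)
  qed
  moreover have "((\<lambda>h. L2norm \<Omega> (\<lambda>x. F (t + h) x - F t x)) \<longlongrightarrow> 0) (at 0)"
  proof (rule Lim_transform_eventually)
    have "((\<lambda>h. \<bar>h\<bar> * L2norm \<Omega> (diff_quot F t h)) \<longlongrightarrow> \<bar>0\<bar> * L2norm \<Omega> F') (at 0)"
      by (intro tendsto_mult tendsto_rabs tendsto_ident_at L2_lim_n2 F)
    then show "((\<lambda>h. \<bar>h\<bar> * L2norm \<Omega> (diff_quot F t h)) \<longlongrightarrow> 0) (at 0)" by simp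
    show "\<forall>\<^sub>F h in at 0. \<bar>h\<bar> * L2norm \<Omega> (diff_quot F t h) = L2norm \<Omega> (\<lambda>x. F (t + h) x - F t x)"
      using eventually_at_0_nonzero
    proof eventually_elim
      case (elim h)
      have "(\<lambda>x. F (t + h) x - F t x) = (\<lambda>x. h *\<^sub>R diff_quot F t h x)" using elim by (simp add: diff_quot_def)
      then show ?case by (simp add: L2norm_scaleR)
    qed
  qed
  ultimately show ?thesis using Ft by (simp add: L2_lim_def)
qed

text \<open>The integral is a continuous bilinear form on $L^2$.\<close>

lemma inner_integral_deriv:
  fixes F G :: "real \<Rightarrow> 'a::euclidean_space \<Rightarrow> 'b::euclidean_space"
  assumes F: "L2_lim \<Omega> (diff_quot F t) F' (at 0)" "L2 \<Omega> (F t)" and G: "L2_lim \<Omega> (diff_quot G t) G' (at 0)" "L2 \<Omega> (G t)"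
  shows "((\<lambda>s. LINT x|lebesgue_on \<Omega>. F s x \<bullet> G s x) has_real_derivative
     (LINT x|lebesgue_on \<Omega>. F' x \<bullet> G t x) + (LINT x|lebesgue_on \<Omega>. F t x \<bullet> G' x)) (at t)"
  unfolding DERIV_def
proof -
  have lim: "((\<lambda>h. (LINT x|lebesgue_on \<Omega>. diff_quot F t h x \<bullet> G (t + h) x) + (LINT x|lebesgue_on \<Omega>. F t x \<bullet> diff_quot G t h x))
     \<longlongrightarrow> (LINT x|lebesgue_on \<Omega>. F' x \<bullet> G t x) + (LINT x|lebesgue_on \<Omega>. F t x \<bullet> G' x)) (at 0)"
    by (intro tendsto_add L2_lim_inner F(1) G(1) L2_lim_curve[OF G] L2_lim_const F(2))
  have ev: "\<forall>\<^sub>F h in at 0. L2 \<Omega> (diff_quot F t h)" "\<forall>\<^sub>F h in at 0. L2 \<Omega> (diff_quot G t h)"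
    "\<forall>\<^sub>F h in at 0. L2 \<Omega> (F (t + h))" "\<forall>\<^sub>F h in at 0. L2 \<Omega> (G (t + h))"
    using F(1) G(1) L2_lim_curve[OF G] L2_lim_curve[OF F] by (auto simp: L2_lim_def)
  have "\<forall>\<^sub>F h in at 0. (LINT x|lebesgue_on \<Omega>. diff_quot F t h x \<bullet> G (t + h) x) + (LINT x|lebesgue_on \<Omega>. F t x \<bullet> diff_quot G t h x)
     = ((LINT x|lebesgue_on \<Omega>. F (t + h) x \<bullet> G (t + h) x) - (LINT x|lebesgue_on \<Omega>. F t x \<bullet> G t x)) / h"
    using ev eventually_at_0_nonzero
  proof eventually_elim
    case (elim h)
    have "(LINT x|lebesgue_on \<Omega>. F (t + h) x \<bullet> G (t + h) x) - (LINT x|lebesgue_on \<Omega>. F t x \<bullet> G t x)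
       = (LINT x|lebesgue_on \<Omega>. F (t + h) x \<bullet> G (t + h) x - F t x \<bullet> G t x)"
      using elim F(2) G(2) by (intro Bochner_Integration.integral_diff[symmetric] L2_inner_integrable) auto
    also have "\<dots> = (LINT x|lebesgue_on \<Omega>. h * (diff_quot F t h x \<bullet> G (t + h) x) + h * (F t x \<bullet> diff_quot G t h x))"
      using elim(5) by (intro Bochner_Integration.integral_cong refl) (simp add: diff_quot_def inner_diff mult.assoc[symmetric])
    also have "\<dots> = h * (LINT x|lebesgue_on \<Omega>. diff_quot F t h x \<bullet> G (t + h) x) + h * (LINT x|lebesgue_on \<Omega>. F t x \<bullet> diff_quot G t h x)"
      using elim F(2) by (subst Bochner_Integration.integral_add) (auto intro!: integrable_mult_right L2_inner_integrable)
    finally show ?case using elim(5) by (simp add: field_simps)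
  qed
  from Lim_transform_eventually[OF lim this]
  show "((\<lambda>h. ((LINT x|lebesgue_on \<Omega>. F (t + h) x \<bullet> G (t + h) x) - (LINT x|lebesgue_on \<Omega>. F t x \<bullet> G t x)) / h)
     \<longlongrightarrow> (LINT x|lebesgue_on \<Omega>. F' x \<bullet> G t x) + (LINT x|lebesgue_on \<Omega>. F t x \<bullet> G' x)) (at 0)" .
qed

definition ess_bdd :: "('a::euclidean_space \<Rightarrow> 'b::euclidean_space) \<Rightarrow> bool" where
  "ess_bdd f \<longleftrightarrow> f \<in> borel_measurable (lebesgue_on UB) \<and> (\<exists>C\<ge>0. AE x in lebesgue_on UB. norm (f x) \<le> C)"

text \<open>Convergence in $L^\infty$; the rate \<open>c\<close> stands for the norm.\<close>

definition unif_lim :: "('i \<Rightarrow> 'a::euclidean_space \<Rightarrow> 'b::euclidean_space) \<Rightarrow> ('a \<Rightarrow> 'b) \<Rightarrow> 'i filter \<Rightarrow> bool" where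
  "unif_lim F f net \<longleftrightarrow> (\<forall>\<^sub>F n in net. ess_bdd (F n)) \<and> ess_bdd f \<and>
     (\<exists>c. (c \<longlongrightarrow> 0) net \<and> (\<forall>\<^sub>F n in net. c n \<ge> 0 \<and> (AE x in lebesgue_on UB. norm (F n x - f x) \<le> c n)))"

lemma L2_bdd_inner:
  assumes "ess_bdd f" "L2 UB g"
  shows "L2 UB (\<lambda>x. f x \<bullet> g x)"
proof -
  obtain C where C: "C \<ge> 0" "AE x in lebesgue_on UB. norm (f x) \<le> C" using assms(1) by (auto simp: ess_bdd_def)
  have "AE x in lebesgue_on UB. norm (f x \<bullet> g x) \<le> C * norm (g x)"
    using C(2)
  proof eventually_elim
    case (elim x)
    have "\<bar>f x \<bullet> g x\<bar> \<le> norm (f x) * norm (g x)" by (rule Cauchy_Schwarz_ineq2)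
    also have "\<dots> \<le> C * norm (g x)" by (intro mult_right_mono elim) simp
    finally show ?case by simp
  qed
  moreover have "(\<lambda>x. f x \<bullet> g x) \<in> borel_measurable (lebesgue_on UB)"
    using assms(1) by (intro borel_measurable_inner L2_measurable[OF assms(2)]) (simp add: ess_bdd_def)
  ultimately show ?thesis by (intro L2_dominated(1)[OF assms(2)])
qed

lemma L2_lim_bdd_inner:
  fixes F G :: "'i \<Rightarrow> 'a::euclidean_space \<Rightarrow> 'b::euclidean_space"
  assumes F: "unif_lim F f net" and G: "L2_lim UB G g net"
  shows "L2_lim UB (\<lambda>n x. F n x \<bullet> G n x) (\<lambda>x. f x \<bullet> g x) net"
proof -
  have bf: "ess_bdd f" and bF: "\<forall>\<^sub>F n in net. ess_bdd (F n)" using F by (auto simp: unif_lim_def)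
  obtain c where c: "(c \<longlongrightarrow> 0) net" "\<forall>\<^sub>F n in net. c n \<ge> 0 \<and> (AE x in lebesgue_on UB. norm (F n x - f x) \<le> c n)"
    using F by (auto simp: unif_lim_def)
  obtain C where C: "C \<ge> 0" "AE x in lebesgue_on UB. norm (f x) \<le> C" using bf by (auto simp: ess_bdd_def)
  have g: "L2 UB g" and Gev: "\<forall>\<^sub>F n in net. L2 UB (G n)" using G by (auto simp: L2_lim_def)
  have "\<forall>\<^sub>F n in net. L2 UB (\<lambda>x. F n x \<bullet> G n x)" using bF Gev by eventually_elim (rule L2_bdd_inner)
  moreover have "L2 UB (\<lambda>x. f x \<bullet> g x)" by (rule L2_bdd_inner[OF bf g])
  moreover have "((\<lambda>n. L2norm UB (\<lambda>x. F n x \<bullet> G n x - f x \<bullet> g x)) \<longlongrightarrow> 0) net"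
  proof (rule Lim_null_comparison)
    have "((\<lambda>n. c n * L2norm UB (G n) + C * L2norm UB (\<lambda>x. G n x - g x)) \<longlongrightarrow> 0 * L2norm UB g + C * 0) net"
      using G by (intro tendsto_intros c L2_lim_n2) (auto simp: L2_lim_def)
    then show "((\<lambda>n. c n * L2norm UB (G n) + C * L2norm UB (\<lambda>x. G n x - g x)) \<longlongrightarrow> 0) net" by simp
    show "\<forall>\<^sub>F n in net. norm (L2norm UB (\<lambda>x. F n x \<bullet> G n x - f x \<bullet> g x)) \<le> c n * L2norm UB (G n) + C * L2norm UB (\<lambda>x. G n x - g x)"
      using bF Gev c(2)
    proof eventually_elim
      case (elim n)
      have mF: "F n \<in> borel_measurable (lebesgue_on UB)" and mf: "f \<in> borel_measurable (lebesgue_on UB)"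
        using elim bf by (auto simp: ess_bdd_def)
      have m1: "(\<lambda>x. (F n x - f x) \<bullet> G n x) \<in> borel_measurable (lebesgue_on UB)"
        by (intro borel_measurable_inner borel_measurable_diff mF mf L2_measurable elim)
      have m2: "(\<lambda>x. f x \<bullet> (G n x - g x)) \<in> borel_measurable (lebesgue_on UB)"
        by (intro borel_measurable_inner borel_measurable_diff mf L2_measurable elim g)
      have a1: "AE x in lebesgue_on UB. norm ((F n x - f x) \<bullet> G n x) \<le> c n * norm (G n x)"
        using elim(3)[THEN conjunct2]
      proof eventually_elim
        case (elim x)
        have "\<bar>(F n x - f x) \<bullet> G n x\<bar> \<le> norm (F n x - f x) * norm (G n x)" by (rule Cauchy_Schwarz_ineq2)
        also have "\<dots> \<le> c n * norm (G n x)" by (intro mult_right_mono elim) simp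
        finally show ?case by simp
      qed
      have a2: "AE x in lebesgue_on UB. norm (f x \<bullet> (G n x - g x)) \<le> C * norm (G n x - g x)"
        using C(2)
      proof eventually_elim
        case (elim x)
        have "\<bar>f x \<bullet> (G n x - g x)\<bar> \<le> norm (f x) * norm (G n x - g x)" by (rule Cauchy_Schwarz_ineq2)
        also have "\<dots> \<le> C * norm (G n x - g x)" by (intro mult_right_mono elim) simp
        finally show ?case by simp
      qed
      have "L2norm UB (\<lambda>x. F n x \<bullet> G n x - f x \<bullet> g x) = L2norm UB (\<lambda>x. (F n x - f x) \<bullet> G n x + f x \<bullet> (G n x - g x))"
        by (simp add: inner_diff)
      also have "\<dots> \<le> L2norm UB (\<lambda>x. (F n x - f x) \<bullet> G n x) + L2norm UB (\<lambda>x. f x \<bullet> (G n x - g x))"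
        by (rule L2norm_triangle[OF L2_dominated(1)[OF elim(2) m1 a1] L2_dominated(1)[OF L2_diff[OF elim(2) g] m2 a2]])
      also have "\<dots> \<le> c n * L2norm UB (G n) + C * L2norm UB (\<lambda>x. G n x - g x)"
        by (intro add_mono L2norm_dominated[OF elim(2) m1 a1] L2norm_dominated[OF L2_diff[OF elim(2) g] m2 a2]) (use elim C in auto)
      finally show ?case by (simp add: L2norm_nonneg)
    qed
  qed
  ultimately show ?thesis by (simp add: L2_lim_def)
qed

lemma unif_lim_const: "ess_bdd f \<Longrightarrow> unif_lim (\<lambda>n. f) f net"
  unfolding unif_lim_def by (auto intro!: exI[of _ "\<lambda>n. 0"])

text \<open>The pointwise product of a bounded and a square integrable map is square integrable, hence the
  product of an $L^\infty$-differentiable with an $L^2$-differentiable curve is $L^2$-differentiable.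
  By the identity $|\nabla U|^2=-\langle U,\Delta U\rangle$ this applies to the energy density.\<close>

lemma diff_quot_inner_lim:
  fixes F G :: "real \<Rightarrow> 'a::euclidean_space \<Rightarrow> 'b::euclidean_space"
  assumes F: "unif_lim (diff_quot F t) F' (at 0)" "ess_bdd (F t)" and G: "L2_lim UB (diff_quot G t) G' (at 0)" "L2 UB (G t)"
  shows "L2_lim UB (diff_quot (\<lambda>s x. F s x \<bullet> G s x) t) (\<lambda>x. F' x \<bullet> G t x + F t x \<bullet> G' x) (at 0)"
proof -
  have 1: "L2_lim UB (\<lambda>h x. diff_quot F t h x \<bullet> G (t + h) x) (\<lambda>x. F' x \<bullet> G t x) (at 0)"
    by (rule L2_lim_bdd_inner[OF F(1) L2_lim_curve[OF G]])
  have 2: "L2_lim UB (\<lambda>h x. F t x \<bullet> diff_quot G t h x) (\<lambda>x. F t x \<bullet> G' x) (at 0)"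
    by (rule L2_lim_bdd_inner[OF unif_lim_const[OF F(2)] G(1)])
  show ?thesis
  proof (rule L2_lim_cong[OF L2_lim_add[OF 1 2]])
    show "\<forall>\<^sub>F h in at 0. (\<lambda>x. diff_quot F t h x \<bullet> G (t + h) x + F t x \<bullet> diff_quot G t h x) = diff_quot (\<lambda>s x. F s x \<bullet> G s x) t h"
      using eventually_at_0_nonzero by eventually_elim (simp add: fun_eq_iff diff_quot_def inner_diff field_simps)
  qed
qed

lemma ess_bdd_Linf: "Linf UB f \<longleftrightarrow> ess_bdd f"
  for f :: "'a::euclidean_space \<Rightarrow> 'b::euclidean_space"
proof
  assume "Linf UB f"
  then show "ess_bdd f" using Linf_norm_AE[of f] by (auto simp: ess_bdd_def Linf_def)
next
  assume "ess_bdd f"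
  then obtain C where C: "f \<in> borel_measurable (lebesgue_on UB)" "AE x in lebesgue_on UB. norm (f x) \<le> C" by (auto simp: ess_bdd_def)
  have "esssup (lebesgue_on UB) (\<lambda>x. ereal (norm (f x))) \<le> ereal C"
    by (rule esssup_I) (use C in auto)
  then show "Linf UB f" using C(1) by (auto simp: Linf_def intro: le_less_trans)
qed

lemma ess_bdd_lincomb: "ess_bdd f \<Longrightarrow> ess_bdd g \<Longrightarrow> ess_bdd (\<lambda>x. a *\<^sub>R f x + b *\<^sub>R g x)"
proof -
  assume "ess_bdd f" "ess_bdd g"
  then obtain C K where C: "f \<in> borel_measurable (lebesgue_on UB)" "C \<ge> 0" "AE x in lebesgue_on UB. norm (f x) \<le> C"
    and K: "g \<in> borel_measurable (lebesgue_on UB)" "K \<ge> 0" "AE x in lebesgue_on UB. norm (g x) \<le> K" unfolding ess_bdd_def by blast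
  have "AE x in lebesgue_on UB. norm (a *\<^sub>R f x + b *\<^sub>R g x) \<le> \<bar>a\<bar> * C + \<bar>b\<bar> * K"
    using C(3) K(3)
  proof eventually_elim
    case (elim x)
    have "norm (a *\<^sub>R f x + b *\<^sub>R g x) \<le> \<bar>a\<bar> * norm (f x) + \<bar>b\<bar> * norm (g x)"
      by (rule order_trans[OF norm_triangle_ineq]) simp
    also have "\<dots> \<le> \<bar>a\<bar> * C + \<bar>b\<bar> * K" by (intro add_mono mult_left_mono elim) auto
    finally show ?case .
  qed
  then show ?thesis
    unfolding ess_bdd_def using C K by (intro conjI exI[of _ "\<bar>a\<bar> * C + \<bar>b\<bar> * K"] borel_measurable_add borel_measurable_scaleR) auto
qed

lemma diff_quot_lincomb: "diff_quot F t h = (\<lambda>x. inverse h *\<^sub>R F (t + h) x + (- inverse h) *\<^sub>R F t x)"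
  by (auto simp: diff_quot_def algebra_simps)

lemma eventually_near:
  fixes t \<epsilon> :: real
  assumes "\<bar>t\<bar> < \<epsilon>"
  shows "\<forall>\<^sub>F h in at 0. \<bar>t + h\<bar> < \<epsilon>"
proof -
  have "((\<lambda>h. \<bar>t + h\<bar>) \<longlongrightarrow> \<bar>t + 0\<bar>) (at 0)" by (intro tendsto_intros)
  then show ?thesis using assms by (intro order_tendstoD(2)) auto
qed

text \<open>Differentiability in $W^{2,2}\cap L^\infty$ is differentiability of every member of the jet in $L^2$ and
  of the curve itself in $L^\infty$.\<close>

lemma curve_deriv_limits:
  fixes U V :: "real \<Rightarrow> 'a::euclidean_space \<Rightarrow> 'b::euclidean_space"
  assumes c: "W22_Linf_curve_deriv UB \<epsilon> U V" and t: "\<bar>t\<bar> < \<epsilon>"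
    and jU: "\<And>t. \<bar>t\<bar> < \<epsilon> \<Longrightarrow> jet_L2 UB (U t) (U1 t) (U2 t)" and jV: "jet_L2 UB (V t) V1 V2"
  shows "jet_lim UB (diff_quot U t) (\<lambda>h e. diff_quot (\<lambda>t. U1 t e) t h) (\<lambda>h e' e. diff_quot (\<lambda>t. U2 t e' e) t h) (V t) V1 V2 (at 0)"
    "unif_lim (diff_quot U t) (V t) (at 0)"
proof -
  have bU: "ess_bdd (U s)" and bV: "ess_bdd (V s)" if "\<bar>s\<bar> < \<epsilon>" for s
    using c that by (auto simp: W22_Linf_curve_deriv_def W22_Linf_def ess_bdd_Linf)
  have lim: "((\<lambda>h. W22_Linf_norm UB (\<lambda>x. diff_quot U t h x - V t x)) \<longlongrightarrow> 0) (at 0)"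
    using c t unfolding W22_Linf_curve_deriv_def diff_quot_def by blast
  have jq: "\<forall>\<^sub>F h in at 0. jet_L2 UB (diff_quot U t h) (\<lambda>e. diff_quot (\<lambda>t. U1 t e) t h) (\<lambda>e' e. diff_quot (\<lambda>t. U2 t e' e) t h)"
    using eventually_near[OF t]
  proof eventually_elim
    case (elim h)
    show ?case unfolding diff_quot_lincomb by (rule jet_L2_lincomb[OF open_ball jU[OF elim] jU[OF t]])
  qed
  have bq: "\<forall>\<^sub>F h in at 0. ess_bdd (diff_quot U t h)"
    using eventually_near[OF t] by eventually_elim (unfold diff_quot_lincomb, intro ess_bdd_lincomb bU t)
  have bd: "\<forall>\<^sub>F h in at 0. Linf UB (\<lambda>x. diff_quot U t h x - V t x)"
    using bq
  proof eventually_elim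
    case (elim h)
    then show ?case using ess_bdd_lincomb[OF elim bV[OF t], of 1 "-1"] by (simp add: ess_bdd_Linf)
  qed
  have W0: "\<forall>\<^sub>F h in at 0. 0 \<le> W22_norm UB (\<lambda>x. diff_quot U t h x - V t x)"
    using jq
  proof eventually_elim
    case (elim h)
    show ?case using L2norm_le_W22_norm(1)[OF open_ball jet_L2_diff[OF open_ball elim jV]] L2norm_nonneg order_trans by blast
  qed
  have 1: "((\<lambda>h. W22_norm UB (\<lambda>x. diff_quot U t h x - V t x)) \<longlongrightarrow> 0) (at 0)"
  proof (rule Lim_null_comparison[OF _ lim])
    show "\<forall>\<^sub>F h in at 0. norm (W22_norm UB (\<lambda>x. diff_quot U t h x - V t x)) \<le> W22_Linf_norm UB (\<lambda>x. diff_quot U t h x - V t x)"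
      using W0 bd
    proof eventually_elim
      case (elim h)
      then show ?case using Linf_norm_AE(2)[OF elim(2)] by (simp add: W22_Linf_norm_def)
    qed
  qed
  show "jet_lim UB (diff_quot U t) (\<lambda>h e. diff_quot (\<lambda>t. U1 t e) t h) (\<lambda>h e' e. diff_quot (\<lambda>t. U2 t e' e) t h) (V t) V1 V2 (at 0)"
    using jet_lim_iff[OF open_ball jV jq] 1 by blast
  have 2: "((\<lambda>h. Linf_norm UB (\<lambda>x. diff_quot U t h x - V t x)) \<longlongrightarrow> 0) (at 0)"
  proof (rule Lim_null_comparison[OF _ lim])
    show "\<forall>\<^sub>F h in at 0. norm (Linf_norm UB (\<lambda>x. diff_quot U t h x - V t x)) \<le> W22_Linf_norm UB (\<lambda>x. diff_quot U t h x - V t x)"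
      using W0 bd
    proof eventually_elim
      case (elim h)
      then show ?case using Linf_norm_AE(2)[OF elim(2)] by (simp add: W22_Linf_norm_def)
    qed
  qed
  have 3: "\<forall>\<^sub>F h in at 0. Linf_norm UB (\<lambda>x. diff_quot U t h x - V t x) \<ge> 0 \<and>
     (AE x in lebesgue_on UB. norm (diff_quot U t h x - V t x) \<le> Linf_norm UB (\<lambda>x. diff_quot U t h x - V t x))"
    using bd by eventually_elim (auto intro: Linf_norm_AE)
  show "unif_lim (diff_quot U t) (V t) (at 0)"
    unfolding unif_lim_def using bq bV[OF t] 2 3 by blast
qed

text \<open>Along the sequence $1/(n+1)$ only countably many null sets occur.\<close>

lemma unif_lim_AE:
  fixes F :: "real \<Rightarrow> 'a::euclidean_space \<Rightarrow> 'b::euclidean_space"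
  assumes "unif_lim F f (at 0)"
  shows "AE x in lebesgue_on UB. (\<lambda>n. F (inverse (real (Suc n))) x) \<longlonglongrightarrow> f x"
proof -
  let ?h = "\<lambda>n. inverse (real (Suc n))"
  obtain c where c: "(c \<longlongrightarrow> 0) (at 0)" "\<forall>\<^sub>F h in at 0. c h \<ge> 0 \<and> (AE x in lebesgue_on UB. norm (F h x - f x) \<le> c h)"
    using assms by (auto simp: unif_lim_def)
  have h: "filterlim ?h (at 0) sequentially"
    using LIMSEQ_inverse_real_of_nat by (auto simp: filterlim_at)
  have c': "(\<lambda>n. c (?h n)) \<longlonglongrightarrow> 0" by (rule filterlim_compose[OF c(1) h])
  have "\<forall>\<^sub>F n in sequentially. c (?h n) \<ge> 0 \<and> (AE x in lebesgue_on UB. norm (F (?h n) x - f x) \<le> c (?h n))"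
    by (rule eventually_compose_filterlim[OF c(2) h])
  then obtain N where N: "\<And>n. n \<ge> N \<Longrightarrow> AE x in lebesgue_on UB. norm (F (?h n) x - f x) \<le> c (?h n)"
    unfolding eventually_sequentially by blast
  have "AE x in lebesgue_on UB. \<forall>n\<in>{N..}. norm (F (?h n) x - f x) \<le> c (?h n)"
    by (subst AE_ball_countable) (use N in auto)
  then show ?thesis
  proof eventually_elim
    case (elim x)
    have "(\<lambda>n. F (?h n) x - f x) \<longlonglongrightarrow> 0"
    proof (rule Lim_null_comparison[OF _ c'])
      show "\<forall>\<^sub>F n in sequentially. norm (F (?h n) x - f x) \<le> c (?h n)"
        unfolding eventually_sequentially using elim by (intro exI[of _ N]) auto
    qed
    then show ?case by (simp add: LIM_zero_iff)
  qed
qed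

text \<open>A pointwise constraint \<open>\<langle>F, G\<rangle> = c\<close> may be differentiated along a curve, as its difference
  quotients converge almost everywhere.\<close>

lemma constraint_deriv:
  fixes F G :: "real \<Rightarrow> 'a::euclidean_space \<Rightarrow> 'b::euclidean_space"
  assumes F: "unif_lim (diff_quot F t) F' (at 0)" and G: "unif_lim (diff_quot G t) G' (at 0)" and t: "\<bar>t\<bar> < \<epsilon>"
    and c: "\<And>s. \<bar>s\<bar> < \<epsilon> \<Longrightarrow> AE x in lebesgue_on UB. F s x \<bullet> G s x = c"
  shows "AE x in lebesgue_on UB. F' x \<bullet> G t x + F t x \<bullet> G' x = 0"
proof -
  let ?h = "\<lambda>n. inverse (real (Suc n))"
  have h: "filterlim ?h (at 0) sequentially"
    using LIMSEQ_inverse_real_of_nat by (auto simp: filterlim_at)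
  obtain N where N: "\<And>n. n \<ge> N \<Longrightarrow> \<bar>t + ?h n\<bar> < \<epsilon>"
    using eventually_compose_filterlim[OF eventually_near[OF t] h] unfolding eventually_sequentially by blast
  have "AE x in lebesgue_on UB. \<forall>n\<in>{N..}. F (t + ?h n) x \<bullet> G (t + ?h n) x = c"
    by (subst AE_ball_countable) (use N c in auto)
  then show ?thesis
    using unif_lim_AE[OF F] unif_lim_AE[OF G] c[OF t]
  proof eventually_elim
    case (elim x)
    have hz: "?h n \<noteq> 0" for n by simp
    have quot: "diff_quot F t k x \<bullet> G (t + k) x + F t x \<bullet> diff_quot G t k x = (F (t + k) x \<bullet> G (t + k) x - F t x \<bullet> G t x) / k" for k
      by (simp add: diff_quot_def inner_diff divide_inverse algebra_simps)
    have Gl: "(\<lambda>n. G (t + ?h n) x) \<longlonglongrightarrow> G t x + 0 *\<^sub>R G' x"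
      unfolding diff_quot_step[OF hz, of G] by (intro tendsto_intros elim LIMSEQ_inverse_real_of_nat)
    have "(\<lambda>n. diff_quot F t (?h n) x \<bullet> G (t + ?h n) x + F t x \<bullet> diff_quot G t (?h n) x) \<longlonglongrightarrow> F' x \<bullet> (G t x + 0 *\<^sub>R G' x) + F t x \<bullet> G' x"
      by (intro tendsto_add tendsto_inner Gl elim tendsto_const)
    moreover have "\<forall>\<^sub>F n in sequentially. diff_quot F t (?h n) x \<bullet> G (t + ?h n) x + F t x \<bullet> diff_quot G t (?h n) x = 0"
      unfolding eventually_sequentially
    proof (intro exI[of _ N] allI impI)
      fix n assume "n \<ge> N"
      then have "F (t + ?h n) x \<bullet> G (t + ?h n) x = F t x \<bullet> G t x" using elim by simp
      moreover have "diff_quot F t (?h n) x \<bullet> G (t + ?h n) x + F t x \<bullet> diff_quot G t (?h n) x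
         = (F (t + ?h n) x \<bullet> G (t + ?h n) x - F t x \<bullet> G t x) / ?h n"
        by (rule quot)
      ultimately show "diff_quot F t (?h n) x \<bullet> G (t + ?h n) x + F t x \<bullet> diff_quot G t (?h n) x = 0" by simp
    qed
    ultimately have "(\<lambda>n::nat. 0) \<longlonglongrightarrow> F' x \<bullet> (G t x + 0 *\<^sub>R G' x) + F t x \<bullet> G' x"
      by (rule Lim_transform_eventually)
    then show ?case by (simp add: LIMSEQ_const_iff)
  qed
qed

text \<open>A triangle inequality up to a constant is enough for closure arguments and follows from the one in
  $L^2$.\<close>

lemma W22_norm_triangle:
  fixes f g :: "'a::euclidean_space \<Rightarrow> 'b::euclidean_space"
  assumes f: "jet_L2 UB f F1 F2" and g: "jet_L2 UB g G1 G2"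
  shows "W22_norm UB (\<lambda>x. f x + g x) \<le> (1 + real DIM('a) + real DIM('a) * real DIM('a)) * (W22_norm UB f + W22_norm UB g)"
proof -
  let ?s = "W22_norm UB f + W22_norm UB g"
  have fg: "jet_L2 UB (\<lambda>x. f x + g x) (\<lambda>e x. F1 e x + G1 e x) (\<lambda>e' e x. F2 e' e x + G2 e' e x)"
    using jet_L2_lincomb[OF open_ball f g, of 1 1] by simp
  have 0: "L2norm UB (\<lambda>x. f x + g x) \<le> ?s"
    using L2norm_triangle[OF jet_L2_D(1)[OF f] jet_L2_D(1)[OF g]] L2norm_le_W22_norm(1)[OF open_ball f] L2norm_le_W22_norm(1)[OF open_ball g] by linarith
  have 1: "L2norm UB (\<lambda>x. F1 e x + G1 e x) \<le> ?s" if "e \<in> Basis" for e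
    using L2norm_triangle[OF jet_L2_D(2)[OF f that] jet_L2_D(2)[OF g that]]
      L2norm_le_W22_norm(2)[OF open_ball f that] L2norm_le_W22_norm(2)[OF open_ball g that] by linarith
  have 2: "L2norm UB (\<lambda>x. F2 e' e x + G2 e' e x) \<le> ?s" if "e \<in> Basis" "e' \<in> Basis" for e e'
    using L2norm_triangle[OF jet_L2_D(3)[OF f that] jet_L2_D(3)[OF g that]]
      L2norm_le_W22_norm(3)[OF open_ball f that] L2norm_le_W22_norm(3)[OF open_ball g that] by linarith
  have "W22_norm UB (\<lambda>x. f x + g x) \<le> ?s + (\<Sum>e\<in>(Basis::'a set). ?s) + (\<Sum>e\<in>(Basis::'a set). \<Sum>e'\<in>(Basis::'a set). ?s)"
    by (rule order_trans[OF W22_norm_le[OF open_ball fg]]) (intro add_mono sum_mono 0 1 2)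
  also have "\<dots> = (1 + real DIM('a) + real DIM('a) * real DIM('a)) * ?s" by (simp add: algebra_simps)
  finally show ?thesis .
qed

text \<open>$W^{2,2}_0$ is closed, so that derivatives of a curve with fixed boundary values stay in it.\<close>

lemma jet_W22_0_closed:
  fixes f :: "'a::euclidean_space \<Rightarrow> 'b::euclidean_space"
  assumes f: "jet_L2 UB f F1 F2" and net: "net \<noteq> bot"
    and P: "\<forall>\<^sub>F h in net. jet_W22_0 (P h) (P1 h) (P2 h)" and lim: "jet_lim UB P P1 P2 f F1 F2 net"
  shows "jet_W22_0 f F1 F2"
proof -
  let ?K = "1 + real DIM('a) + real DIM('a) * real DIM('a)"
  have K: "?K > 0" by (simp add: add_pos_nonneg)
  have gen: "k * (a / (2 * k) + a / (2 * k)) = a" if "k > 0" for k a :: real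
    using that by (simp add: field_simps)
  have "((\<lambda>h. W22_norm UB (\<lambda>x. P h x - f x)) \<longlongrightarrow> 0) net"
    using jet_lim_iff[OF open_ball f] P lim unfolding jet_W22_0_def by (metis (mono_tags, lifting) eventually_mono)
  then have small: "\<forall>\<^sub>F h in net. W22_norm UB (\<lambda>x. P h x - f x) < \<delta>" if "\<delta> > 0" for \<delta>
    using order_tendstoD(2) that by blast
  have "\<exists>\<phi>. test_function UB \<phi> \<and> W22_norm UB (\<lambda>x. \<phi> x - f x) < inverse (real (Suc n))" for n
  proof -
    \<comment> \<open>Two errors of size \<open>\<delta>\<close> add up to the desired bound after the loss of the factor \<open>?K\<close>.\<close>
    define \<delta> where "\<delta> = inverse (real (Suc n)) / (2 * ?K)"
    have \<delta>: "\<delta> > 0" unfolding \<delta>_def using K by (intro divide_pos_pos) auto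
    obtain h where h: "jet_W22_0 (P h) (P1 h) (P2 h)" "W22_norm UB (\<lambda>x. P h x - f x) < \<delta>"
      using eventually_happens'[OF net eventually_conj[OF P small[OF \<delta>]]] by blast
    have jP: "jet_L2 UB (P h) (P1 h) (P2 h)" using h(1) by (simp add: jet_W22_0_def)
    have "W22_0 UB (P h)" using jet_W22_0_iff[OF jP] h(1) by blast
    then obtain \<phi> :: "nat \<Rightarrow> 'a \<Rightarrow> 'b" where \<phi>: "\<And>k. test_function UB (\<phi> k)" "(\<lambda>k. W22_norm UB (\<lambda>x. \<phi> k x - P h x)) \<longlonglongrightarrow> 0"
      unfolding W22_0_def by blast
    obtain k where k: "W22_norm UB (\<lambda>x. \<phi> k x - P h x) < \<delta>"
      using order_tendstoD(2)[OF \<phi>(2) \<delta>] unfolding eventually_sequentially by blast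
    have "W22_norm UB (\<lambda>x. (\<phi> k x - P h x) + (P h x - f x)) \<le> ?K * (W22_norm UB (\<lambda>x. \<phi> k x - P h x) + W22_norm UB (\<lambda>x. P h x - f x))"
      by (rule W22_norm_triangle[OF jet_L2_diff[OF open_ball jet_L2_test[OF open_ball \<phi>(1)] jP] jet_L2_diff[OF open_ball jP f]])
    also have "\<dots> < ?K * (\<delta> + \<delta>)"
      using k h(2) K by (intro mult_strict_left_mono add_strict_mono)
    also have "\<dots> = inverse (real (Suc n))"
      unfolding \<delta>_def by (rule gen[OF K])
    finally show ?thesis using \<phi>(1) by auto
  qed
  then obtain \<phi> where \<phi>: "\<And>n. test_function UB (\<phi> n) \<and> W22_norm UB (\<lambda>x. \<phi> n x - f x) < inverse (real (Suc n))"
    by metis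
  have "(\<lambda>n. W22_norm UB (\<lambda>x. \<phi> n x - f x)) \<longlonglongrightarrow> 0"
  proof (rule Lim_null_comparison[OF _ LIMSEQ_inverse_real_of_nat])
    show "\<forall>\<^sub>F n in sequentially. norm (W22_norm UB (\<lambda>x. \<phi> n x - f x)) \<le> inverse (real (Suc n))"
    proof (intro always_eventually allI)
      fix n
      have "0 \<le> W22_norm UB (\<lambda>x. \<phi> n x - f x)"
        using L2norm_le_W22_norm(1)[OF open_ball jet_L2_diff[OF open_ball jet_L2_test[OF open_ball] f]] \<phi>[of n] L2norm_nonneg order_trans by blast
      then show "norm (W22_norm UB (\<lambda>x. \<phi> n x - f x)) \<le> inverse (real (Suc n))"
        using \<phi>[of n] by simp
    qed
  qed
  then have "W22_0 UB f" unfolding W22_0_def sobolev_2_iff using f \<phi> by blast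
  then show ?thesis using jet_W22_0_iff[OF f] by blast
qed

section \<open>The second variation\<close>

context cone_map
begin

lemma smooth_jet_q: "smooth_jet q q1 q2"
  unfolding smooth_jet_def
  by (intro conjI exI[of _ "\<lambda>n. vec_ev (inverse (real (Suc n))) T"] allI jets smooth_vec_ev eps_seq)

lemma L2_W2: "e \<in> Basis \<Longrightarrow> L2 UB (vec_ev 0 (\<lambda>b. Times W2 (D e (T b))))"
proof (rule L2_limD[OF L2_lim_vec_ev])
  fix b :: 'b assume b: "b \<in> Basis"
  show "2 * deg (Times W2 (D e (T b))) > - int DIM('a)"
  proof -
    have "- 3 \<le> deg (Times W2 (D e (T b)))"
      using degs(1)[OF b, of e] deg_W2 unfolding deg.simps by linarith
    moreover have "- int DIM('a) \<le> - 7" by (rule dimi)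
    ultimately show ?thesis by linarith
  qed
qed

lemma vec_ev_W2: "vec_ev 0 (\<lambda>b. Times W2 (D e (T b))) x = (g * rinv x ^ 2) *\<^sub>R q1 e x"
  by (simp add: vec_ev_def W2_def scaleR_sum_right power2_eq_square mult.assoc del: ev.simps(4))

text \<open>Both sides are continuous in $W^{2,2}$: $\Delta q$ grows like $r^{-2}$ and $|\nabla q|^2\nabla q$ like $r^{-3}$, which
  are square integrable in dimension at least 7.\<close>

lemma linear_equation_W22_0:
  assumes z: "jet_W22_0 z Z1 Z2"
  shows "(LINT x|lebesgue_on UB. vec_ev 0 A x \<bullet> (\<Sum>e\<in>Basis. Z2 e e x))
    = 2 * (LINT x|lebesgue_on UB. (g * rinv x ^ 2) * (\<Sum>e\<in>Basis. q1 e x \<bullet> Z1 e x))" (is ?th1)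
    "integrable (lebesgue_on UB) (\<lambda>x. (g * rinv x ^ 2) * (\<Sum>e\<in>Basis. q1 e x \<bullet> Z1 e x))" (is ?th2)
proof -
  let ?S = "\<lambda>e. vec_ev 0 (\<lambda>b. Times W2 (D e (T b)))"
  obtain \<phi> where \<phi>: "\<And>n::nat. test_function UB (\<phi> n)"
    and l: "jet_lim UB \<phi> (\<lambda>n e. partial_deriv e (\<phi> n)) (\<lambda>n e' e. partial_deriv e' (partial_deriv e (\<phi> n))) z Z1 Z2 sequentially"
    using z unfolding jet_W22_0_def by blast
  have LA: "L2 UB (vec_ev 0 A)"
    by (rule L2_limD[OF L2_lim_vec_ev]) (use degs(2) dimi in fastforce)
  have eqS: "(LINT x|lebesgue_on UB. (g * rinv x ^ 2) * (\<Sum>e\<in>Basis. q1 e x \<bullet> h e x)) = (\<Sum>e\<in>Basis. LINT x|lebesgue_on UB. ?S e x \<bullet> h e x)"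
    and iS: "integrable (lebesgue_on UB) (\<lambda>x. (g * rinv x ^ 2) * (\<Sum>e\<in>Basis. q1 e x \<bullet> h e x))"
    if h: "\<And>e. e \<in> Basis \<Longrightarrow> L2 UB (h e)" for h :: "'a \<Rightarrow> 'a \<Rightarrow> 'b"
  proof -
    have eq: "(\<lambda>x. (g * rinv x ^ 2) * (\<Sum>e\<in>Basis. q1 e x \<bullet> h e x)) = (\<lambda>x. \<Sum>e\<in>Basis. ?S e x \<bullet> h e x)"
      by (simp add: vec_ev_W2 sum_distrib_left del: ev.simps(4))
    show "(LINT x|lebesgue_on UB. (g * rinv x ^ 2) * (\<Sum>e\<in>Basis. q1 e x \<bullet> h e x)) = (\<Sum>e\<in>Basis. LINT x|lebesgue_on UB. ?S e x \<bullet> h e x)"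
      unfolding eq by (rule Bochner_Integration.integral_sum) (intro L2_inner_integrable L2_W2 h)
    show "integrable (lebesgue_on UB) (\<lambda>x. (g * rinv x ^ 2) * (\<Sum>e\<in>Basis. q1 e x \<bullet> h e x))"
      unfolding eq by (intro Bochner_Integration.integrable_sum L2_inner_integrable L2_W2 h)
  qed
  have jz: "jet_L2 UB z Z1 Z2" using z by (simp add: jet_W22_0_def)
  show ?th2 by (rule iS) (rule jet_L2_D(2)[OF jz])
  have 1: "(\<lambda>n. LINT x|lebesgue_on UB. vec_ev 0 A x \<bullet> laplacian (\<phi> n) x) \<longlonglongrightarrow> (LINT x|lebesgue_on UB. vec_ev 0 A x \<bullet> (\<Sum>e\<in>Basis. Z2 e e x))"
    unfolding laplacian_def
    by (rule L2_lim_inner[OF L2_lim_const[OF LA] L2_lim_sum[OF finite_Basis]]) (use l in \<open>simp add: jet_lim_def\<close>)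
  have 2: "(\<lambda>n. 2 * (\<Sum>e\<in>Basis. LINT x|lebesgue_on UB. ?S e x \<bullet> partial_deriv e (\<phi> n) x)) \<longlonglongrightarrow> 2 * (\<Sum>e\<in>Basis. LINT x|lebesgue_on UB. ?S e x \<bullet> Z1 e x)"
    by (intro tendsto_mult tendsto_const tendsto_sum L2_lim_inner L2_lim_const L2_W2) (use l in \<open>simp_all add: jet_lim_def\<close>)
  have eq: "(LINT x|lebesgue_on UB. vec_ev 0 A x \<bullet> laplacian (\<phi> n) x) = 2 * (\<Sum>e\<in>Basis. LINT x|lebesgue_on UB. ?S e x \<bullet> partial_deriv e (\<phi> n) x)" for n
    unfolding linear_equation[OF \<phi>]
    by (subst eqS) (rule jet_L2_D(2)[OF jet_L2_test[OF open_ball \<phi>]], simp_all)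
  have "(LINT x|lebesgue_on UB. vec_ev 0 A x \<bullet> (\<Sum>e\<in>Basis. Z2 e e x)) = 2 * (\<Sum>e\<in>Basis. LINT x|lebesgue_on UB. ?S e x \<bullet> Z1 e x)"
    by (rule LIMSEQ_unique[OF 1[unfolded eq] 2])
  then show ?th1 by (subst eqS) (rule jet_L2_D(2)[OF jz], simp_all)
qed

lemma g_nonneg: "g \<ge> 0"
proof -
  obtain e :: 'a where "e \<in> Basis" using nonempty_Basis by blast
  then have e: "e \<noteq> 0" by auto
  have "rinv e \<noteq> 0" using rinv_sq[OF e] by auto
  moreover have "0 \<le> g * rinv e ^ 2"
    unfolding grad_q[OF e, symmetric] by (intro sum_nonneg) simp
  ultimately show ?thesis by (simp add: zero_le_mult_iff del: ev.simps)
qed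

lemma grad_inner_le:
  fixes a b :: "'c \<Rightarrow> 'b"
  assumes "finite I"
  shows "(\<Sum>e\<in>I. a e \<bullet> b e)\<^sup>2 \<le> (\<Sum>e\<in>I. (norm (a e))\<^sup>2) * (\<Sum>e\<in>I. (norm (b e))\<^sup>2)"
proof -
  have "\<bar>\<Sum>e\<in>I. a e \<bullet> b e\<bar> \<le> (\<Sum>e\<in>I. norm (a e) * norm (b e))"
    by (rule order_trans[OF sum_abs]) (intro sum_mono Cauchy_Schwarz_ineq2)
  then have "\<bar>\<Sum>e\<in>I. a e \<bullet> b e\<bar>\<^sup>2 \<le> (\<Sum>e\<in>I. norm (a e) * norm (b e))\<^sup>2" by (intro power_mono) auto
  also have "\<dots> \<le> (\<Sum>e\<in>I. (norm (a e))\<^sup>2) * (\<Sum>e\<in>I. (norm (b e))\<^sup>2)"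
    by (rule Cauchy_Schwarz_ineq_sum)
  finally show ?thesis by simp
qed

text \<open>Let $\eta$ and $\zeta$ be the first two derivatives of the variation at 0, and $G=|\nabla q|^2=g\,r^{-2}$. Since
  $|U_t|=1$ gives $|\nabla U_t|^2=-\langle U_t,\Delta U_t\rangle$, the bienergy is
  $\frac12\int|\Delta U_t|^2-\langle U_t,\Delta U_t\rangle^2$ and can be differentiated twice. The Laplacians of the
  constraints $\langle\eta,q\rangle=0$ and $\langle\zeta,q\rangle+|\eta|^2=0$ turn the second derivative into
  $\int|\Delta\eta|^2-4\langle\nabla q,\nabla\eta\rangle^2-2G|\nabla\eta|^2$ plus
  $\int\langle\Delta q,\Delta\zeta\rangle-2G\langle\nabla q,\nabla\zeta\rangle$. The latter vanishes by the linear equation. With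
  $\langle\nabla q,\nabla\eta\rangle^2\le G|\nabla\eta|^2$ and the Hardy--Rellich inequality the former is at least
  $(1-24g/n^2)\int|\Delta\eta|^2$, and $\int|\Delta\eta|^2=0$ would force $\eta=0$.\<close>

lemma second_variation_positive:
  assumes var: "variation_with_field UB q \<epsilon> U \<eta>" and \<eta>: "\<not> (AE x in lebesgue_on UB. \<eta> x = 0)"
    and n8: "DIM('a) \<ge> 8" and gap: "24 * g < (real DIM('a))\<^sup>2"
  shows "\<exists>D. has_second_deriv (\<lambda>t. bienergy UB (U t)) D 0 \<and> D > 0"
proof -
  have \<epsilon>: "0 < \<epsilon>" and sph: "\<And>t. \<bar>t\<bar> < \<epsilon> \<Longrightarrow> W22_sphere UB (U t)"
    and bc: "\<And>t. \<bar>t\<bar> < \<epsilon> \<Longrightarrow> W22_0 UB (\<lambda>x. U t x - q x)"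
    and U0: "AE x in lebesgue_on UB. U 0 x = q x"
    using var by (auto simp: variation_with_field_def)
  obtain U' U'' where c1: "W22_Linf_curve_deriv UB \<epsilon> U U'" and c2: "W22_Linf_curve_deriv UB \<epsilon> U' U''"
    and c3: "W22_Linf_curve_continuous UB \<epsilon> U''" and \<eta>U: "\<eta> = U' 0"
    using var by (auto simp: variation_with_field_def)
  have z: "\<bar>0::real\<bar> < \<epsilon>" using \<epsilon> by simp
  have ex: "\<exists>F. jet_L2 UB f (fst F) (snd F)" if "sobolev 2 UB f" for f :: "'a \<Rightarrow> 'b"
    using that unfolding sobolev_2_iff by auto
  have "\<forall>t. \<exists>F. \<bar>t\<bar> < \<epsilon> \<longrightarrow> jet_L2 UB (U t) (fst F) (snd F)"
    using c1 ex unfolding W22_Linf_curve_deriv_def W22_Linf_def by blast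
  then obtain JU where JU: "\<And>t. \<bar>t\<bar> < \<epsilon> \<Longrightarrow> jet_L2 UB (U t) (fst (JU t)) (snd (JU t))" by metis
  have "\<forall>t. \<exists>F. \<bar>t\<bar> < \<epsilon> \<longrightarrow> jet_L2 UB (U' t) (fst F) (snd F)"
    using c1 ex unfolding W22_Linf_curve_deriv_def W22_Linf_def by blast
  then obtain JV where JV: "\<And>t. \<bar>t\<bar> < \<epsilon> \<Longrightarrow> jet_L2 UB (U' t) (fst (JV t)) (snd (JV t))" by metis
  have "\<forall>t. \<exists>F. \<bar>t\<bar> < \<epsilon> \<longrightarrow> jet_L2 UB (U'' t) (fst F) (snd F)"
    using c2 ex unfolding W22_Linf_curve_deriv_def W22_Linf_def by blast
  then obtain JW where JW: "\<And>t. \<bar>t\<bar> < \<epsilon> \<Longrightarrow> jet_L2 UB (U'' t) (fst (JW t)) (snd (JW t))" by metis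
  define u1 u2 where "u1 t = fst (JU t)" and "u2 t = snd (JU t)" for t
  define v1 v2 where "v1 t = fst (JV t)" and "v2 t = snd (JV t)" for t
  define w1 w2 where "w1 t = fst (JW t)" and "w2 t = snd (JW t)" for t
  have ju: "\<And>t. \<bar>t\<bar> < \<epsilon> \<Longrightarrow> jet_L2 UB (U t) (u1 t) (u2 t)" using JU by (simp add: u1_def u2_def)
  have jv: "\<And>t. \<bar>t\<bar> < \<epsilon> \<Longrightarrow> jet_L2 UB (U' t) (v1 t) (v2 t)" using JV by (simp add: v1_def v2_def)
  have jw: "\<And>t. \<bar>t\<bar> < \<epsilon> \<Longrightarrow> jet_L2 UB (U'' t) (w1 t) (w2 t)" using JW by (simp add: w1_def w2_def)
  have bU: "ess_bdd (U t)" "ess_bdd (U' t)" "ess_bdd (U'' t)" if "\<bar>t\<bar> < \<epsilon>" for t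
    using c1 c2 that by (auto simp: W22_Linf_curve_deriv_def W22_Linf_def ess_bdd_Linf)
  have limU: "jet_lim UB (diff_quot U t) (\<lambda>h e. diff_quot (\<lambda>t. u1 t e) t h) (\<lambda>h e' e. diff_quot (\<lambda>t. u2 t e' e) t h) (U' t) (v1 t) (v2 t) (at 0)"
    "unif_lim (diff_quot U t) (U' t) (at 0)" if t: "\<bar>t\<bar> < \<epsilon>" for t
    by (rule curve_deriv_limits[OF c1 t ju jv[OF t]], assumption)+
  have limV: "jet_lim UB (diff_quot U' t) (\<lambda>h e. diff_quot (\<lambda>t. v1 t e) t h) (\<lambda>h e' e. diff_quot (\<lambda>t. v2 t e' e) t h) (U'' t) (w1 t) (w2 t) (at 0)"
    "unif_lim (diff_quot U' t) (U'' t) (at 0)" if t: "\<bar>t\<bar> < \<epsilon>" for t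
    by (rule curve_deriv_limits[OF c2 t jv jw[OF t]], assumption)+
  \<comment> \<open>All derivatives of the variation keep the boundary values, by closedness of $W^{2,2}_0$.\<close>
  have j0: "jet_W22_0 (\<lambda>x. U t x - q x) (\<lambda>e x. u1 t e x - q1 e x) (\<lambda>e' e x. u2 t e' e x - q2 e' e x)" if t: "\<bar>t\<bar> < \<epsilon>" for t
    using jet_W22_0_iff[OF jet_L2_diff[OF open_ball ju[OF t] jets(1)]] bc[OF t] by blast
  have sU: "smooth_jet (U t) (u1 t) (u2 t)" if t: "\<bar>t\<bar> < \<epsilon>" for t
    using smooth_jet_lincomb[OF smooth_jet_W22_0[OF j0[OF t]] smooth_jet_q, of 1 1] by simp
  have jV0: "jet_W22_0 (U' t) (v1 t) (v2 t)" if t: "\<bar>t\<bar> < \<epsilon>" for t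
  proof (rule jet_W22_0_closed[OF jv[OF t] _ _ limU(1)[OF t]])
    show "\<forall>\<^sub>F h in at 0. jet_W22_0 (diff_quot U t h) (\<lambda>e. diff_quot (\<lambda>t. u1 t e) t h) (\<lambda>e' e. diff_quot (\<lambda>t. u2 t e' e) t h)"
      using eventually_near[OF t]
    proof eventually_elim
      case (elim h)
      from jet_W22_0_lincomb[OF j0[OF elim] j0[OF t], of "inverse h" "- inverse h"] show ?case
        by (simp add: diff_quot_def[abs_def] algebra_simps)
    qed
  qed simp
  have jW0: "jet_W22_0 (U'' 0) (w1 0) (w2 0)"
  proof (rule jet_W22_0_closed[OF jw[OF z] _ _ limV(1)[OF z]])
    show "\<forall>\<^sub>F h in at 0. jet_W22_0 (diff_quot U' 0 h) (\<lambda>e. diff_quot (\<lambda>t. v1 t e) 0 h) (\<lambda>e' e. diff_quot (\<lambda>t. v2 t e' e) 0 h)"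
      using eventually_near[OF z]
    proof eventually_elim
      case (elim h)
      from jet_W22_0_lincomb[OF jV0[OF elim] jV0[OF z], of "inverse h" "- inverse h"] show ?case
        unfolding diff_quot_lincomb .
    qed
  qed simp
  \<comment> \<open>\<open>a\<close> is the Laplacian along the curve and \<open>b\<close> equals minus its energy density; primes are derivatives in time.\<close>
  define a where "a t x = (\<Sum>e\<in>Basis. u2 t e e x)" for t x
  define a' where "a' t x = (\<Sum>e\<in>Basis. v2 t e e x)" for t x
  define a'' where "a'' t x = (\<Sum>e\<in>Basis. w2 t e e x)" for t x
  have La: "L2 UB (a t)" "L2 UB (a' t)" "L2 UB (a'' t)" if t: "\<bar>t\<bar> < \<epsilon>" for t
    unfolding a_def[abs_def] a'_def[abs_def] a''_def[abs_def]
    using jet_L2_D(3)[OF ju[OF t]] jet_L2_D(3)[OF jv[OF t]] jet_L2_D(3)[OF jw[OF t]]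
    by (auto intro!: L2_sum)
  have qsum: "diff_quot (\<lambda>t x. \<Sum>e\<in>Basis. F t e x) t h = (\<lambda>x. \<Sum>e\<in>Basis. diff_quot (\<lambda>t. F t e) t h x)"
    for F :: "real \<Rightarrow> 'a \<Rightarrow> 'a \<Rightarrow> 'b" and t h
    by (simp add: fun_eq_iff diff_quot_def sum_subtractf scaleR_sum_right[symmetric])
  have da: "L2_lim UB (diff_quot a t) (a' t) (at 0)" if t: "\<bar>t\<bar> < \<epsilon>" for t
    unfolding a_def[abs_def] a'_def[abs_def] qsum[abs_def]
    by (rule L2_lim_sum[OF finite_Basis]) (use limU(1)[OF t] in \<open>simp add: jet_lim_def\<close>)
  have da': "L2_lim UB (diff_quot a' t) (a'' t) (at 0)" if t: "\<bar>t\<bar> < \<epsilon>" for t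
    unfolding a'_def[abs_def] a''_def[abs_def] qsum[abs_def]
    by (rule L2_lim_sum[OF finite_Basis]) (use limV(1)[OF t] in \<open>simp add: jet_lim_def\<close>)
  define b where "b t x = U t x \<bullet> a t x" for t x
  define b' where "b' t x = U' t x \<bullet> a t x + U t x \<bullet> a' t x" for t x
  define b'' where "b'' t x = (U'' t x \<bullet> a t x + U' t x \<bullet> a' t x) + (U' t x \<bullet> a' t x + U t x \<bullet> a'' t x)" for t x
  have Lb: "L2 UB (b t)" "L2 UB (b' t)" "L2 UB (b'' t)" if t: "\<bar>t\<bar> < \<epsilon>" for t
    unfolding b_def[abs_def] b'_def[abs_def] b''_def[abs_def]
    by (intro L2_add L2_bdd_inner bU La t)+
  have db: "L2_lim UB (diff_quot b t) (b' t) (at 0)" if t: "\<bar>t\<bar> < \<epsilon>" for t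
    unfolding b_def[abs_def] b'_def[abs_def]
    by (rule diff_quot_inner_lim[OF limU(2)[OF t] bU(1)[OF t] da[OF t] La(1)[OF t]])
  have db': "L2_lim UB (diff_quot b' t) (b'' t) (at 0)" if t: "\<bar>t\<bar> < \<epsilon>" for t
  proof -
    have eq: "diff_quot b' t = (\<lambda>h x. diff_quot (\<lambda>s x. U' s x \<bullet> a s x) t h x + diff_quot (\<lambda>s x. U s x \<bullet> a' s x) t h x)"
      by (simp add: fun_eq_iff diff_quot_def b'_def algebra_simps)
    show ?thesis
      unfolding b''_def[abs_def] eq
      by (rule L2_lim_add[OF diff_quot_inner_lim[OF limV(2)[OF t] bU(2)[OF t] da[OF t] La(1)[OF t]]
          diff_quot_inner_lim[OF limU(2)[OF t] bU(1)[OF t] da'[OF t] La(2)[OF t]]])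
  qed
  \<comment> \<open>Differentiating the constraint twice in time and applying the Laplacian determines \<open>b\<close> and its derivatives.\<close>
  have unit: "AE x in lebesgue_on UB. U t x \<bullet> U t x = 1" if t: "\<bar>t\<bar> < \<epsilon>" for t
  proof -
    have "AE x in lebesgue_on UB. U t x \<in> sphere 0 1" using sph[OF t] by (simp add: W22_sphere_def)
    then show ?thesis by eventually_elim (simp add: norm_eq_1)
  qed
  have tang: "AE x in lebesgue_on UB. U' t x \<bullet> U t x = 0" if t: "\<bar>t\<bar> < \<epsilon>" for t
  proof -
    have "AE x in lebesgue_on UB. U' t x \<bullet> U t x + U t x \<bullet> U' t x = 0"
      by (rule constraint_deriv[OF limU(2)[OF t] limU(2)[OF t] t unit])
    then show ?thesis by eventually_elim (simp add: inner_commute)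
  qed
  have tang2: "AE x in lebesgue_on UB. U'' 0 x \<bullet> U 0 x + U' 0 x \<bullet> U' 0 x = 0"
    by (rule constraint_deriv[OF limV(2)[OF z] limU(2)[OF z] z tang])
  have sz: "smooth_jet (\<lambda>x::'a. 0::'b) (\<lambda>e x. 0) (\<lambda>e' e x. 0)"
    using smooth_jet_lincomb[OF smooth_jet_q smooth_jet_q, of 0 0] by simp
  note sV = smooth_jet_W22_0[OF jV0[OF z]] and sW = smooth_jet_W22_0[OF jW0]
  have gradU: "AE x in lebesgue_on UB. (\<Sum>e\<in>Basis. (norm (u1 t e x))\<^sup>2) = - b t x" if t: "\<bar>t\<bar> < \<epsilon>" for t
  proof -
    have "AE x in lebesgue_on UB. U t x \<bullet> U t x + 0 \<bullet> (0::'b) = 1"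
      using unit[OF t] by simp
    from laplacian_constant_products[OF sU[OF t] sU[OF t] sz sz this] show ?thesis
      by eventually_elim (simp add: b_def a_def power2_norm_eq_inner inner_commute)
  qed
  have B1: "AE x in lebesgue_on UB. b' 0 x = - 2 * (\<Sum>e\<in>Basis. u1 0 e x \<bullet> v1 0 e x)"
  proof -
    have "AE x in lebesgue_on UB. U' 0 x \<bullet> U 0 x + 0 \<bullet> (0::'b) = 0"
      using tang[OF z] by simp
    from laplacian_constant_products[OF sV sU[OF z] sz sz this] show ?thesis
      by eventually_elim (simp add: b'_def a_def a'_def inner_commute)
  qed
  have B2: "AE x in lebesgue_on UB. b'' 0 x = - 2 * (\<Sum>e\<in>Basis. u1 0 e x \<bullet> w1 0 e x) - 2 * (\<Sum>e\<in>Basis. (norm (v1 0 e x))\<^sup>2)"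
    using laplacian_constant_products[OF sW sU[OF z] sV sV tang2]
    by eventually_elim (simp add: b''_def a_def a'_def a''_def inner_commute power2_norm_eq_inner)
  have E: "bienergy UB (U t) = 1/2 * ((LINT x|lebesgue_on UB. a t x \<bullet> a t x) - (LINT x|lebesgue_on UB. b t x \<bullet> b t x))"
    if t: "\<bar>t\<bar> < \<epsilon>" for t
  proof -
    have wj: "weak_jet UB (U t) (u1 t) (u2 t)" using ju[OF t] by (simp add: jet_L2_def)
    have "(LINT x|lebesgue_on UB. (norm (weak_laplacian UB (U t) x))\<^sup>2 - (grad_sq UB (U t) x)\<^sup>2)
       = (LINT x|lebesgue_on UB. a t x \<bullet> a t x - b t x \<bullet> b t x)"
    proof (rule LINT_cong_AE)
      show "(\<lambda>x. a t x \<bullet> a t x - b t x \<bullet> b t x) \<in> borel_measurable (lebesgue_on UB)"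
        by (intro borel_measurable_integrable Bochner_Integration.integrable_diff L2_inner_integrable La Lb t)
      show "AE x in lebesgue_on UB. (norm (weak_laplacian UB (U t) x))\<^sup>2 - (grad_sq UB (U t) x)\<^sup>2 = a t x \<bullet> a t x - b t x \<bullet> b t x"
        using weak_jet_AE(3,4)[OF open_ball wj] gradU[OF t]
        by eventually_elim (simp add: a_def dot_square_norm del: inner_real_def)
    qed simp
    also have "\<dots> = (LINT x|lebesgue_on UB. a t x \<bullet> a t x) - (LINT x|lebesgue_on UB. b t x \<bullet> b t x)"
      by (intro Bochner_Integration.integral_diff L2_inner_integrable La Lb t)
    finally show ?thesis by (simp add: bienergy_def)
  qed
  define E' where "E' t = (LINT x|lebesgue_on UB. a' t x \<bullet> a t x) - (LINT x|lebesgue_on UB. b' t x \<bullet> b t x)" for t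
  define Dd where "Dd = ((LINT x|lebesgue_on UB. a'' 0 x \<bullet> a 0 x) + (LINT x|lebesgue_on UB. a' 0 x \<bullet> a' 0 x))
     - ((LINT x|lebesgue_on UB. b'' 0 x \<bullet> b 0 x) + (LINT x|lebesgue_on UB. b' 0 x \<bullet> b' 0 x))"
  have near: "\<forall>\<^sub>F s in nhds t. \<bar>s\<bar> < \<epsilon>" if "\<bar>t\<bar> < \<epsilon>" for t
    using that by (intro eventually_nhds_in_open[of "{s. \<bar>s\<bar> < \<epsilon>}" t, simplified] open_Collect_less continuous_intros)
  have d1: "((\<lambda>t. bienergy UB (U t)) has_real_derivative E' t) (at t)" if t: "\<bar>t\<bar> < \<epsilon>" for t
  proof -
    have "((\<lambda>t. 1/2 * ((LINT x|lebesgue_on UB. a t x \<bullet> a t x) - (LINT x|lebesgue_on UB. b t x \<bullet> b t x))) has_real_derivative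
      1/2 * (((LINT x|lebesgue_on UB. a' t x \<bullet> a t x) + (LINT x|lebesgue_on UB. a t x \<bullet> a' t x))
        - ((LINT x|lebesgue_on UB. b' t x \<bullet> b t x) + (LINT x|lebesgue_on UB. b t x \<bullet> b' t x)))) (at t)"
      by (intro DERIV_cmult DERIV_diff inner_integral_deriv da db La Lb t)
    moreover have "1/2 * (((LINT x|lebesgue_on UB. a' t x \<bullet> a t x) + (LINT x|lebesgue_on UB. a t x \<bullet> a' t x))
        - ((LINT x|lebesgue_on UB. b' t x \<bullet> b t x) + (LINT x|lebesgue_on UB. b t x \<bullet> b' t x))) = E' t"
      by (simp add: E'_def inner_commute[of "a t _"] mult.commute[of "b t _"])
    ultimately have "((\<lambda>t. 1/2 * ((LINT x|lebesgue_on UB. a t x \<bullet> a t x) - (LINT x|lebesgue_on UB. b t x \<bullet> b t x))) has_real_derivative E' t) (at t)"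
      by (simp only:)
    moreover have "\<forall>\<^sub>F s in nhds t. 1/2 * ((LINT x|lebesgue_on UB. a s x \<bullet> a s x) - (LINT x|lebesgue_on UB. b s x \<bullet> b s x)) = bienergy UB (U s)"
      using near[OF t] by eventually_elim (rule E[symmetric])
    ultimately show ?thesis by (subst (asm) DERIV_cong_ev[OF refl _ refl])
  qed
  have d2: "(E' has_real_derivative Dd) (at 0)"
    unfolding E'_def[abs_def] Dd_def
    by (intro DERIV_diff inner_integral_deriv da[OF z] db[OF z] da'[OF z] db'[OF z] La[OF z] Lb[OF z])
  have "has_second_deriv (\<lambda>t. bienergy UB (U t)) Dd 0"
    unfolding has_second_deriv_def
  proof (intro exI[of _ E'] conjI d2)
    show "\<forall>\<^sub>F s in nhds 0. ((\<lambda>t. bienergy UB (U t)) has_real_derivative E' s) (at s)"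
      using near[OF z] by eventually_elim (rule d1)
  qed
  moreover have "Dd > 0"
  proof -
    \<comment> \<open>At time 0 the curve equals \<open>q\<close> almost everywhere, so that its chosen jet can be replaced by the explicit one.\<close>
    have u1q: "AE x in lebesgue_on UB. \<forall>e\<in>Basis. u1 0 e x = q1 e x"
      and aq: "AE x in lebesgue_on UB. a 0 x = vec_ev 0 A x"
    proof -
      have wj: "weak_jet UB (U 0) (u1 0) (u2 0)" using ju[OF z] by (simp add: jet_L2_def)
      have lq: "locally_integrable UB q"
      proof -
        obtain e :: 'a where "e \<in> Basis" using nonempty_Basis by blast
        then show ?thesis using weak_jet_q by (auto simp: weak_jet_def has_weak_deriv_def)
      qed
      have lq1: "locally_integrable UB (q1 e)" if "e \<in> Basis" for e
        using weak_jet_q that by (auto simp: weak_jet_def has_weak_deriv_def)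
      have h1: "AE x in lebesgue_on UB. u1 0 e x = q1 e x" if e: "e \<in> Basis" for e
      proof (rule hwd_unique[OF open_ball e])
        show "has_weak_deriv UB e q (u1 0 e)"
          by (rule hwd_cong[OF open_ball e _ lq U0]) (use wj e in \<open>simp add: weak_jet_def\<close>)
        show "has_weak_deriv UB e q (q1 e)" using weak_jet_q e by (simp add: weak_jet_def)
      qed
      then show "AE x in lebesgue_on UB. \<forall>e\<in>Basis. u1 0 e x = q1 e x" by (intro AE_finite_allI) auto
      have h2: "AE x in lebesgue_on UB. u2 0 e e x = q2 e e x" if e: "e \<in> Basis" for e
      proof (rule hwd_unique[OF open_ball e])
        show "has_weak_deriv UB e (q1 e) (u2 0 e e)"
          by (rule hwd_cong[OF open_ball e _ lq1[OF e] h1[OF e]]) (use wj e in \<open>simp add: weak_jet_def\<close>)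
        show "has_weak_deriv UB e (q1 e) (q2 e e)" using weak_jet_q e by (simp add: weak_jet_def)
      qed
      have "AE x in lebesgue_on UB. \<forall>e\<in>Basis. u2 0 e e x = q2 e e x" by (intro AE_finite_allI h2) auto
      then show "AE x in lebesgue_on UB. a 0 x = vec_ev 0 A x"
        using AE_UB_nonzero by eventually_elim (simp add: a_def lap_q[symmetric])
    qed
    define G where "G x = g * rinv x ^ 2" for x :: 'a
    define c where "c x = (\<Sum>e\<in>Basis. q1 e x \<bullet> v1 0 e x)" for x
    define d where "d x = (\<Sum>e\<in>Basis. q1 e x \<bullet> w1 0 e x)" for x
    define N where "N x = (\<Sum>e\<in>Basis. (norm (v1 0 e x))\<^sup>2)" for x
    have bG: "AE x in lebesgue_on UB. b 0 x = - G x"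
      using gradU[OF z] u1q AE_UB_nonzero
    proof eventually_elim
      case (elim x)
      then show ?case using grad_q[of x] by (simp add: G_def del: ev.simps)
    qed
    have b'c: "AE x in lebesgue_on UB. b' 0 x = - 2 * c x"
      using B1 u1q by eventually_elim (simp add: c_def)
    have b''d: "AE x in lebesgue_on UB. b'' 0 x = - 2 * d x - 2 * N x"
      using B2 u1q by eventually_elim (simp add: d_def N_def)
    have m0: "L2_norm_sq UB (a' 0) = (LINT x|lebesgue_on UB. a' 0 x \<bullet> a' 0 x)"
      by (simp add: L2_norm_sq_def power2_norm_eq_inner)
    have i1: "integrable (lebesgue_on UB) (\<lambda>x. G x * d x)"
      unfolding G_def d_def by (rule linear_equation_W22_0(2)[OF jW0])
    note hardy = hardy_rellich[OF jV0[OF z] n8]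
    have i2: "integrable (lebesgue_on UB) (\<lambda>x. G x * N x)"
      using integrable_mult_right[OF hardy(1), of g] by (simp add: G_def N_def mult.assoc del: ev.simps)
    have i3: "integrable (lebesgue_on UB) (\<lambda>x. b' 0 x \<bullet> b' 0 x)" by (intro L2_inner_integrable Lb z)
    have e1: "(LINT x|lebesgue_on UB. a'' 0 x \<bullet> a 0 x) = 2 * (LINT x|lebesgue_on UB. G x * d x)"
    proof -
      have "(LINT x|lebesgue_on UB. a 0 x \<bullet> a'' 0 x) = (LINT x|lebesgue_on UB. vec_ev 0 A x \<bullet> a'' 0 x)"
        by (rule LINT_cong_AE)
           (use aq in \<open>auto intro!: borel_measurable_inner measurable_vec_ev L2_measurable[OF La(3)[OF z]] elim: eventually_mono\<close>)
      also have "\<dots> = 2 * (LINT x|lebesgue_on UB. G x * d x)"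
        unfolding a''_def G_def d_def by (rule linear_equation_W22_0(1)[OF jW0])
      finally show ?thesis by (simp add: inner_commute)
    qed
    have e2: "(LINT x|lebesgue_on UB. b'' 0 x \<bullet> b 0 x) = (LINT x|lebesgue_on UB. 2 * (G x * d x) + 2 * (G x * N x))"
    proof (rule LINT_cong_AE)
      show "AE x in lebesgue_on UB. b'' 0 x \<bullet> b 0 x = 2 * (G x * d x) + 2 * (G x * N x)"
        using bG b''d
      proof eventually_elim
        case (elim x)
        show ?case unfolding elim inner_real_def by (simp add: algebra_simps)
      qed
    qed (use i1 i2 in \<open>auto intro!: borel_measurable_integrable\<close>)
    then have e2': "(LINT x|lebesgue_on UB. b'' 0 x \<bullet> b 0 x) = 2 * (LINT x|lebesgue_on UB. G x * d x) + 2 * (LINT x|lebesgue_on UB. G x * N x)"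
      using i1 i2 by simp
    have e3: "(LINT x|lebesgue_on UB. b' 0 x \<bullet> b' 0 x) \<le> (LINT x|lebesgue_on UB. 4 * (G x * N x))"
    proof (rule integral_mono_AE[OF i3])
      show "integrable (lebesgue_on UB) (\<lambda>x. 4 * (G x * N x))" using i2 by simp
      show "AE x in lebesgue_on UB. b' 0 x \<bullet> b' 0 x \<le> 4 * (G x * N x)"
        using b'c AE_UB_nonzero
      proof eventually_elim
        case (elim x)
        have "(c x)\<^sup>2 \<le> (\<Sum>e\<in>Basis. (norm (q1 e x))\<^sup>2) * N x"
          unfolding c_def N_def by (rule grad_inner_le) simp
        then have "(c x)\<^sup>2 \<le> G x * N x" using grad_q[of x] elim by (simp add: G_def del: ev.simps)
        then show ?case using elim by (simp add: power2_eq_square)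
      qed
    qed
    have h: "(LINT x|lebesgue_on UB. G x * N x) \<le> g * (4 / (real DIM('a))\<^sup>2 * L2_norm_sq UB (a' 0))"
    proof -
      have "(LINT x|lebesgue_on UB. G x * N x) = g * (LINT x|lebesgue_on UB. rinv x ^ 2 * N x)"
        by (simp add: G_def mult.assoc del: ev.simps)
      also have "\<dots> \<le> g * (4 / (real DIM('a))\<^sup>2 * L2_norm_sq UB (a' 0))"
        by (rule mult_left_mono[OF _ g_nonneg]) (use hardy(2) in \<open>simp add: N_def a'_def[abs_def] del: ev.simps\<close>)
      finally show ?thesis .
    qed
    have pos: "L2_norm_sq UB (a' 0) > 0"
    proof (rule ccontr)
      assume "\<not> ?thesis"
      then have z0: "L2_norm_sq UB (a' 0) = 0" using L2_norm_sq_nonneg[of UB "a' 0"] by linarith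
      let ?I = "\<lambda>x. rinv x ^ 2 * (\<Sum>e\<in>Basis. (norm (v1 0 e x))\<^sup>2)"
      have I0: "?I x \<ge> 0" for x by (intro mult_nonneg_nonneg sum_nonneg) auto
      have "0 \<le> (LINT x|lebesgue_on UB. ?I x)" by (rule Bochner_Integration.integral_nonneg) (rule I0)
      moreover have "(LINT x|lebesgue_on UB. ?I x) \<le> 0"
        using hardy(2) z0 by (simp add: a'_def[abs_def] del: ev.simps)
      ultimately have "(LINT x|lebesgue_on UB. ?I x) = 0" by linarith
      then have "AE x in lebesgue_on UB. ?I x = 0"
        using integral_nonneg_eq_0_iff_AE[OF hardy(1)] I0 by (simp del: ev.simps)
      then have v0: "AE x in lebesgue_on UB. \<forall>e\<in>Basis. v1 0 e x = 0"
        using AE_UB_nonzero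
      proof eventually_elim
        case (elim x)
        have "rinv x \<noteq> 0" using rinv_sq[of x] elim by auto
        then have "(\<Sum>e\<in>Basis. (norm (v1 0 e x))\<^sup>2) = 0" using elim by (simp del: ev.simps)
        then show ?case by (simp add: sum_nonneg_eq_0_iff)
      qed
      obtain e :: 'a where e: "e \<in> Basis" using nonempty_Basis by blast
      have "L2_norm_sq UB (v1 0 e) = L2_norm_sq UB (\<lambda>x::'a. 0 :: 'b)"
        by (rule L2norm_cong_AE) (use v0 e jet_L2_D(2)[OF jv[OF z] e] in \<open>auto intro: L2_measurable elim: eventually_mono\<close>)
      then have "L2norm UB (v1 0 e) = 0" by (simp add: L2norm_def L2_norm_sq_def)
      then have "L2norm UB (U' 0) \<le> 0" using poincare[OF jV0[OF z] e] by simp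
      then have "L2_norm_sq UB (U' 0) = 0" using L2norm_nonneg[of UB "U' 0"] L2norm_sq[of UB "U' 0"] by simp
      from L2_norm_sq_zero_AE[OF jet_L2_D(1)[OF jv[OF z]] this] show False using \<eta> by (simp add: \<eta>U)
    qed
    have "Dd \<ge> L2_norm_sq UB (a' 0) - 6 * (LINT x|lebesgue_on UB. G x * N x)"
      using e3 i2 unfolding Dd_def e1 e2' m0 by simp
    then have "Dd \<ge> L2_norm_sq UB (a' 0) - 6 * (g * (4 / (real DIM('a))\<^sup>2 * L2_norm_sq UB (a' 0)))"
      using h by linarith
    also have "L2_norm_sq UB (a' 0) - 6 * (g * (4 / (real DIM('a))\<^sup>2 * L2_norm_sq UB (a' 0)))
       = (1 - 24 * g / (real DIM('a))\<^sup>2) * L2_norm_sq UB (a' 0)" by (simp add: field_simps)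
    finally have "Dd \<ge> (1 - 24 * g / (real DIM('a))\<^sup>2) * L2_norm_sq UB (a' 0)" .
    moreover have "(1 - 24 * g / (real DIM('a))\<^sup>2) * L2_norm_sq UB (a' 0) > 0"
      using gap n8 pos by (intro mult_pos_pos) (simp_all add: field_simps)
    ultimately show "Dd > 0" by linarith
  qed
  ultimately show ?thesis by blast
qed

theorem strictly_stable_q:
  assumes "DIM('a) \<ge> 8" "24 * g < (real DIM('a))\<^sup>2"
  shows "strictly_stable UB q"
  unfolding strictly_stable_def using weak_biharmonic_q second_variation_positive assms by blast

end

section \<open>The generalized radial projection\<close>

text \<open>The recursion of \<open>radial_proj\<close> on the level of expressions, with $r=r^2\cdot\frac1r$.\<close>

fun radial_expr :: "nat \<Rightarrow> (nat \<Rightarrow> 'm::finite) \<Rightarrow> (real^'m) rexpr" where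
  "radial_expr 0 i = Cst 1"
| "radial_expr (Suc 0) i = Times (Crd (axis (i 1) 1)) Winv"
| "radial_expr (Suc (Suc k)) i = (let l = real (Suc (Suc k)); m = real CARD('m); e = axis (i (Suc (Suc k))) 1 in
     Times (Cst (sqrt ((l + m - 3) / (2 * l + m - 4))))
       (Plus (Times (Times (Crd e) Winv) (radial_expr (Suc k) i))
             (Times (Cst (- (1 / (l + m - 3)))) (Times (Times Rsq Winv) (D e (radial_expr (Suc k) i))))))"

text \<open>At the origin both sides are 0, because division by zero yields 0; the equality therefore holds
  everywhere and not merely almost everywhere.\<close>

lemma radial_proj_radial_expr: "l \<ge> 1 \<Longrightarrow> radial_proj l i x = ev 0 x (radial_expr l i)"
proof (induction l arbitrary: x rule: nat_induct_at_least)
  case base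
  show ?case by (simp add: norm_eq_sqrt_inner divide_inverse inner_axis)
next
  case (Suc l)
  then obtain k where l: "l = Suc k" by (cases l) auto
  show ?case
  proof (cases "x = 0")
    case True
    then show ?thesis unfolding l by (simp add: Let_def)
  next
    case False
    let ?e = "axis (i (Suc l)) (1::real)"
    have p: "x \<bullet> x + 0 > 0" using False by simp
    have "(\<lambda>x. radial_proj l i x) = (\<lambda>x. ev 0 x (radial_expr l i))" using Suc.IH by auto
    then have pd: "partial_deriv ?e (radial_proj l i) x = ev 0 x (D ?e (radial_expr l i))"
      using partial_deriv_ev[OF p, of ?e "radial_expr l i"] by simp
    have nx: "norm x = (x \<bullet> x) * inverse (sqrt (x \<bullet> x + 0))"
      using False by (simp add: norm_eq_sqrt_inner[symmetric] power2_norm_eq_inner[symmetric] power2_eq_square)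
    have nx': "x $ j / norm x = (x \<bullet> axis j 1) * inverse (sqrt (x \<bullet> x + 0))" for j
      by (simp add: norm_eq_sqrt_inner divide_inverse inner_axis)
    show ?thesis
      using pd Suc.IH[of x] unfolding l radial_proj.simps radial_expr.simps Let_def ev.simps nx'
      by (simp only: nx mult.assoc) (simp add: algebra_simps)
  qed
qed

lemma radial_expr_step_homog:
  assumes t: "homog 0 t"
  shows "homog 0 (Plus (Times (Times (Crd e) Winv) t) (Times (Cst c) (Times (Times Rsq Winv) (D e t))))"
proof (rule homog_Plus)
  show "homog 0 (Times (Times (Crd e) Winv) t)"
    using homog_Times[OF homog_Times[OF homog_simps(2) homog_Winv] t, of e] by simp
  show "homog 0 (Times (Cst c) (Times (Times Rsq Winv) (D e t)))"
    using homog_Times[OF homog_simps(1) homog_Times[OF homog_Times[OF homog_simps(3) homog_Winv] homog_D[OF t, of e]], of c] by simp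
qed

text \<open>One step of the recursion, $f\mapsto yf-c\,r\,\partial_ef$ with $y=x_e/r$, maps eigenfunctions to eigenfunctions:
  \[ \Delta(yf)=-(n-1+L)r^{-2}yf+2r^{-1}\partial_ef, \qquad
     \Delta(r\,\partial_ef)=(n-3-L)r^{-1}\partial_ef+2L\,r^{-2}yf, \]
  and the two conditions on \<open>\<mu>\<close> compare coefficients.\<close>

lemma radial_expr_step_Lap:
  fixes t :: "'a::euclidean_space rexpr"
  assumes h: "homog 0 t" and L: "\<And>x. x \<noteq> 0 \<Longrightarrow> lap t x = - L * rinv x ^ 2 * ev 0 x t" and x: "x \<noteq> 0"
    and \<mu>: "\<mu> = real DIM('a) - 1 + L + 2 * c * L" "\<mu> * c = 2 - c * (real DIM('a) - 3 - L)"
  shows "lap (Plus (Times (Times (Crd e) Winv) t) (Times (Cst (- c)) (Times (Times Rsq Winv) (D e t)))) x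
     = - \<mu> * rinv x ^ 2 * ev 0 x (Plus (Times (Times (Crd e) Winv) t) (Times (Cst (- c)) (Times (Times Rsq Winv) (D e t))))"
proof -
  define w where "w = rinv x"
  define y where "y = x \<bullet> e"
  define T where "T = ev 0 x t"
  define E where "E = ev 0 x (D e t)"
  define r where "r = x \<bullet> x"
  define n where "n = real DIM('a)"
  have rw: "r * w * w = 1" unfolding r_def w_def by (rule rinv_sq[OF x])
  have xt: "ev 0 x (D x t) = 0" using h x by (simp add: homog_def)
  have xE: "ev 0 x (D x (D e t)) = - E" using homog_D[OF h, of e] x by (simp add: homog_def E_def)
  have xW: "ev 0 x (D x Winv) = - w" using homog_Winv[unfolded homog_def, rule_format, OF x] by (simp add: w_def)
  have eW: "ev 0 x (D e Winv) = - y * w ^ 3" by (simp add: y_def w_def power3_eq_cube)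
  have LW: "lap Winv x = (3 - n) * w ^ 3" unfolding n_def w_def by (rule lap_Winv[OF x])
  have LDE: "lap (D e t) x = - L * (- 2 * y * w ^ 4 * T + w ^ 2 * E)"
  proof -
    have "lap (D e t) x = ev 0 x (D e (Times (Cst (- L)) (Times (Times Winv Winv) t)))"
      by (rule lap_D[OF _ x]) (simp add: L power2_eq_square del: ev.simps(4))
    then show ?thesis
      using eW by (simp add: T_def E_def w_def[symmetric] power_numeral_reduce algebra_simps del: ev.simps(4) D.simps(4))
  qed
  have 1: "lap (Times (Crd e) Winv) x = (1 - n) * y * w ^ 3"
    unfolding lap_Times lap_Crd grad_prod_Crd[OF x] eW LW by (simp add: y_def[symmetric] algebra_simps del: ev.simps(4))
  have 2: "grad_prod (Times (Crd e) Winv) t x = w * E"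
    unfolding grad_prod_Times grad_prod_Crd[OF x] grad_prod_Winv[OF x] xt by (simp add: E_def w_def del: ev.simps(4))
  have 3: "lap (Times (Times (Crd e) Winv) t) x = - (n - 1 + L) * y * w ^ 3 * T + 2 * w * E"
    unfolding lap_Times[of "Times (Crd e) Winv"] 1 2 L[OF x]
    by (simp add: T_def[symmetric] w_def[symmetric] y_def[symmetric] power_numeral_reduce algebra_simps del: ev.simps(4))
  have 4: "lap (Times Rsq Winv) x = (n - 1) * w"
  proof -
    have "lap (Times Rsq Winv) x = 2 * n * w + 2 * (2 * (- w)) + r * ((3 - n) * w ^ 3)"
      unfolding lap_Times lap_Rsq grad_prod_Rsq[OF x] xW LW by (simp add: n_def w_def[symmetric] r_def del: ev.simps(4))
    also have "r * ((3 - n) * w ^ 3) = (3 - n) * w * (r * w * w)" by (simp add: power3_eq_cube)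
    finally show ?thesis unfolding rw by (simp add: algebra_simps)
  qed
  have 5: "grad_prod (Times Rsq Winv) (D e t) x = - w * E"
  proof -
    have "grad_prod (Times Rsq Winv) (D e t) x = r * (- (w ^ 3) * (- E)) + w * (2 * (- E))"
      unfolding grad_prod_Times grad_prod_Rsq[OF x] grad_prod_Winv[OF x] xE by (simp add: r_def w_def[symmetric] del: ev.simps(4))
    also have "r * (- (w ^ 3) * (- E)) = w * E * (r * w * w)" by (simp add: power3_eq_cube)
    finally show ?thesis unfolding rw by (simp add: algebra_simps)
  qed
  have 6: "lap (Times (Times Rsq Winv) (D e t)) x = (n - 3 - L) * w * E + 2 * L * y * w ^ 3 * T"
  proof -
    have "lap (Times (Times Rsq Winv) (D e t)) x = (n - 1) * w * E + 2 * (- w * E) + (r * w) * (- L * (- 2 * y * w ^ 4 * T + w ^ 2 * E))"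
      unfolding lap_Times[of "Times Rsq Winv"] 4 5 LDE by (simp add: E_def r_def w_def del: ev.simps(4))
    also have "(r * w) * (- L * (- 2 * y * w ^ 4 * T + w ^ 2 * E)) = - L * (- 2 * y * w ^ 3 * T + w * E) * (r * w * w)"
      by (simp add: power_numeral_reduce algebra_simps)
    finally show ?thesis unfolding rw by (simp add: algebra_simps)
  qed
  have "lap (Plus (Times (Times (Crd e) Winv) t) (Times (Cst (- c)) (Times (Times Rsq Winv) (D e t)))) x
     = - (n - 1 + L) * y * w ^ 3 * T + 2 * w * E + - c * ((n - 3 - L) * w * E + 2 * L * y * w ^ 3 * T)"
    unfolding lap_Plus 3 lap_Times[of "Cst _"] lap_Cst 6 by simp
  also have "\<dots> = - \<mu> * y * w ^ 3 * T + (\<mu> * c) * w * E"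
    unfolding \<mu>(2) unfolding \<mu>(1) n_def by (simp add: algebra_simps)
  also have "\<dots> = - \<mu> * w ^ 2 * (y * w * T + - c * (r * w * E))"
  proof -
    have "- \<mu> * w ^ 2 * (y * w * T + - c * (r * w * E)) = - \<mu> * y * w ^ 3 * T + \<mu> * c * w * E * (r * w * w)"
      by (simp add: power_numeral_reduce algebra_simps)
    then show ?thesis unfolding rw by simp
  qed
  finally show ?thesis by (simp add: w_def y_def T_def E_def r_def)
qed

lemma homog_scale: "homog 0 t \<Longrightarrow> homog 0 (Times (Cst c) t)"
  using homog_Times[OF homog_simps(1), of 0 t c] by simp

lemma lap_scale: "lap (Times (Cst c) t) x = c * lap t x"
  by (simp add: lap_Times lap_Cst)

text \<open>The components of $u^{(\ell)}$ are spherical harmonics of degree $\ell$. In the step from $\ell$ to $\ell+1$ the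
  constant is $c=1/(\ell+m-2)$, so that $cL=\ell$.\<close>

lemma radial_expr_properties:
  fixes i :: "nat \<Rightarrow> 'm::finite"
  assumes m: "CARD('m) \<ge> 3" and l: "l \<ge> 1"
  shows "homog 0 (radial_expr l i)" "deg (radial_expr l i) \<ge> 0"
    "x \<noteq> 0 \<Longrightarrow> lap (radial_expr l i) x = - (real l * (real l + real CARD('m) - 2)) * rinv x ^ 2 * ev 0 x (radial_expr l i)"
proof -
  have "homog 0 (radial_expr l i) \<and> deg (radial_expr l i) \<ge> 0 \<and>
    (\<forall>x. x \<noteq> 0 \<longrightarrow> lap (radial_expr l i) x = - (real l * (real l + real CARD('m) - 2)) * rinv x ^ 2 * ev 0 x (radial_expr l i))"
    using l
  proof (induction l rule: nat_induct_at_least)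
    case base
    have "homog 0 (radial_expr 1 i)"
      unfolding One_nat_def radial_expr.simps using homog_Times[OF homog_simps(2) homog_Winv, of "axis (i 1) 1"] by simp
    moreover have "lap (radial_expr 1 i) x = - (real 1 * (real 1 + real CARD('m) - 2)) * rinv x ^ 2 * ev 0 x (radial_expr 1 i)" if x: "x \<noteq> 0" for x
      unfolding One_nat_def radial_expr.simps lap_Times lap_Crd grad_prod_Crd[OF x] lap_Winv[OF x]
      by (simp add: power3_eq_cube power2_eq_square algebra_simps)
    ultimately show ?case by simp
  next
    case (Suc l)
    then obtain k where lk: "l = Suc k" by (cases l) auto
    let ?L = "real l * (real l + real CARD('m) - 2)"
    let ?c = "1 / (real (Suc l) + real CARD('m) - 3)"
    let ?\<mu> = "real (Suc l) * (real (Suc l) + real CARD('m) - 2)"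
    let ?e = "axis (i (Suc l)) (1::real)"
    let ?s = "Plus (Times (Times (Crd ?e) Winv) (radial_expr l i)) (Times (Cst (- ?c)) (Times (Times Rsq Winv) (D ?e (radial_expr l i))))"
    obtain C where u: "radial_expr (Suc l) i = Times (Cst C) ?s" unfolding lk by (simp add: Let_def)
    have IH: "homog 0 (radial_expr l i)" "deg (radial_expr l i) \<ge> 0"
      "\<And>x. x \<noteq> 0 \<Longrightarrow> lap (radial_expr l i) x = - ?L * rinv x ^ 2 * ev 0 x (radial_expr l i)" using Suc by auto
    have den: "real (Suc l) + real CARD('m) - 3 = real l + real CARD('m) - 2" by simp
    have dpos: "real l + real CARD('m) - 2 > 0" using Suc m by simp
    have cL: "?c * ?L = real l" unfolding den using dpos by simp
    have \<mu>1: "?\<mu> = real DIM(real^'m) - 1 + ?L + 2 * ?c * ?L"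
    proof -
      have "2 * ?c * ?L = 2 * real l" using cL by (simp only: mult.assoc)
      then show ?thesis by (simp add: algebra_simps)
    qed
    have \<mu>2: "?\<mu> * ?c = 2 - ?c * (real DIM(real^'m) - 3 - ?L)"
      unfolding den using dpos by (simp add: field_simps)
    have "lap (radial_expr (Suc l) i) x = - ?\<mu> * rinv x ^ 2 * ev 0 x (radial_expr (Suc l) i)" if x: "x \<noteq> 0" for x
    proof -
      have S: "lap ?s x = - ?\<mu> * rinv x ^ 2 * ev 0 x ?s"
        by (rule radial_expr_step_Lap[OF IH(1) IH(3) x \<mu>1 \<mu>2])
      show ?thesis unfolding u lap_scale S by (simp only: ev.simps(6)[of 0 x "Cst C"] ev.simps(1)) (simp only: mult_ac)
    qed
    moreover have "homog 0 (radial_expr (Suc l) i)" unfolding u by (intro homog_scale radial_expr_step_homog IH)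
    moreover have "deg (radial_expr (Suc l) i) \<ge> 0" unfolding u using IH(2) deg_D[of "radial_expr l i" ?e] by simp
    ultimately show ?case by blast
  qed
  then show "homog 0 (radial_expr l i)" "deg (radial_expr l i) \<ge> 0"
    "x \<noteq> 0 \<Longrightarrow> lap (radial_expr l i) x = - (real l * (real l + real CARD('m) - 2)) * rinv x ^ 2 * ev 0 x (radial_expr l i)"
    by auto
qed

lemma radial_expr_cong: "(\<And>k. k \<in> {1..l} \<Longrightarrow> i k = j k) \<Longrightarrow> radial_expr l i = radial_expr l j"
proof (induction l i rule: radial_expr.induct)
  case (3 k i)
  have "radial_expr (Suc k) i = radial_expr (Suc k) j" by (rule "3.IH") (use 3 in auto)
  moreover have "i (Suc (Suc k)) = j (Suc (Suc k))" using 3 by simp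
  ultimately show ?case by (simp add: Let_def)
qed auto

lemma sum_Basis_vec: "(\<Sum>b\<in>(Basis::(real^'m::finite) set). f b) = (\<Sum>j\<in>UNIV. f (axis j 1))"
proof -
  have B: "(Basis::(real^'m) set) = range (\<lambda>j. axis j 1)" by (auto simp: Basis_vec_def)
  have I: "inj (\<lambda>j::'m. axis j (1::real))" by (auto simp: inj_def axis_eq_axis)
  show ?thesis unfolding B by (subst sum.reindex[OF I]) (simp add: o_def)
qed

lemma sum_PiE_Suc:
  fixes f :: "(nat \<Rightarrow> 'm::finite) \<Rightarrow> real"
  shows "(\<Sum>i\<in>{1..Suc l} \<rightarrow>\<^sub>E UNIV. f i) = (\<Sum>i\<in>{1..l} \<rightarrow>\<^sub>E UNIV. \<Sum>j\<in>UNIV. f (i(Suc l := j)))"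
proof -
  have "(\<Sum>i\<in>{1..l} \<rightarrow>\<^sub>E UNIV. \<Sum>j\<in>UNIV. f (i(Suc l := j))) = (\<Sum>(i, j)\<in>({1..l} \<rightarrow>\<^sub>E UNIV) \<times> UNIV. f (i(Suc l := j)))"
    by (rule sum.cartesian_product)
  also have "\<dots> = (\<Sum>i\<in>{1..Suc l} \<rightarrow>\<^sub>E UNIV. f i)"
    by (rule sum.reindex_bij_witness[where j="\<lambda>(i, j). i(Suc l := j)" and i="\<lambda>i. (restrict i {1..l}, i (Suc l))"])
       (auto simp: PiE_def extensional_def restrict_def fun_eq_iff)
  finally show ?thesis by simp
qed

text \<open>In the recursion the cross terms vanish since $x\cdot\nabla u=0$, which leaves
  $C^2\,(|u|^2+c^2r^2|\nabla u|^2)$. Here $r^2|\nabla u|^2=\ell(\ell+m-2)$ follows from $\Delta|u|^2=0$, and $C_{\ell+1,m}$ is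
  the matching normalization.\<close>

lemma radial_expr_unit:
  fixes x :: "real^'m::finite"
  assumes m: "CARD('m) \<ge> 3" and l: "l \<ge> 1"
  shows "x \<noteq> 0 \<Longrightarrow> (\<Sum>i\<in>{1..l} \<rightarrow>\<^sub>E (UNIV::'m set). (ev 0 x (radial_expr l i))\<^sup>2) = 1"
  using l
proof (induction l arbitrary: x rule: nat_induct_at_least)
  case base
  have "(\<Sum>i\<in>{1..1} \<rightarrow>\<^sub>E (UNIV::'m set). (ev 0 x (radial_expr 1 i))\<^sup>2) = (\<Sum>i\<in>{1..0} \<rightarrow>\<^sub>E (UNIV::'m set). \<Sum>j\<in>UNIV. (ev 0 x (radial_expr 1 (i(Suc 0 := j))))\<^sup>2)"
    using sum_PiE_Suc[of "\<lambda>i. (ev 0 x (radial_expr 1 i))\<^sup>2" 0] by simp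
  also have "\<dots> = (\<Sum>j\<in>UNIV. (x \<bullet> axis j 1) * (x \<bullet> axis j 1)) * rinv x * rinv x"
    by (simp add: power2_eq_square sum_distrib_left sum_distrib_right algebra_simps)
  also have "(\<Sum>j\<in>UNIV. (x \<bullet> axis j 1) * (x \<bullet> axis j 1)) = x \<bullet> x"
    unfolding euclidean_inner[of x x] by (simp only: sum_Basis_vec)
  also have "(x \<bullet> x) * rinv x * rinv x = 1" by (rule rinv_sq[OF base])
  finally show ?case .
next
  case (Suc l)
  then obtain k where lk: "l = Suc k" by (cases l) auto
  let ?I = "{1..l} \<rightarrow>\<^sub>E (UNIV::'m set)"
  let ?m = "real CARD('m)"
  let ?c = "1 / (real l + ?m - 2)"
  let ?C2 = "(real l + ?m - 2) / (2 * real l + ?m - 2)"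
  let ?L = "real l * (real l + ?m - 2)"
  let ?u = "\<lambda>i. ev 0 x (radial_expr l i)" and ?d = "\<lambda>i j. ev 0 x (D (axis j 1) (radial_expr l i))"
  have x: "x \<noteq> 0" by (rule Suc.prems)
  have dpos: "real l + ?m - 2 > 0" "2 * real l + ?m - 2 > 0" using Suc.hyps m by simp_all
  have fin: "finite ?I" by (rule finite_PiE) auto
  note P = radial_expr_properties[OF m Suc.hyps]
  define w where "w = rinv x"
  define r where "r = x \<bullet> x"
  have rw: "r * w * w = 1" unfolding r_def w_def by (rule rinv_sq[OF x])
  have cross: "(\<Sum>j\<in>UNIV. (x \<bullet> axis j 1) * ?d i j) = 0" for i
    using ev_direction_0[OF x, of x "radial_expr l i"] P(1)[of i] x by (simp add: homog_def sum_Basis_vec)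
  have xx: "(\<Sum>j\<in>UNIV. (x \<bullet> axis j 1) * (x \<bullet> axis j 1)) = r"
    unfolding r_def euclidean_inner[of x x] by (simp only: sum_Basis_vec)
  have one: "(\<Sum>i\<in>?I. (?u i)\<^sup>2) = 1" by (rule Suc.IH[OF x])
  have grad: "(\<Sum>i\<in>?I. \<Sum>j\<in>UNIV. (?d i j)\<^sup>2) = ?L * w\<^sup>2"
  proof -
    have d1: "(\<Sum>i\<in>?I. ev 0 x (D e (Times (radial_expr l i) (radial_expr l i)))) = 0" if "x \<noteq> 0" for e and x :: "real^'m"
      using sum_ev_eq_D[OF fin, of "\<lambda>i. Times (radial_expr l i) (radial_expr l i)" "Cst 1" x e] Suc.IH that
      by (simp add: power2_eq_square)
    have "(\<Sum>i\<in>?I. ev 0 x (D e (D e (Times (radial_expr l i) (radial_expr l i))))) = 0" for e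
      using sum_ev_eq_D[OF fin, of "\<lambda>i. D e (Times (radial_expr l i) (radial_expr l i))" "Cst 0" x e] d1 x by simp
    then have "(\<Sum>i\<in>?I. lap (Times (radial_expr l i) (radial_expr l i)) x) = 0"
      unfolding lap_def by (subst sum.swap) simp
    then have "(\<Sum>i\<in>?I. 2 * grad_prod (radial_expr l i) (radial_expr l i) x) = (\<Sum>i\<in>?I. 2 * ?L * w ^ 2 * (?u i)\<^sup>2)"
      unfolding lap_Times w_def
      by (simp add: P(3)[OF x] sum.distrib sum_negf sum_subtractf power2_eq_square algebra_simps del: ev.simps(4))
    then have "(\<Sum>i\<in>?I. grad_prod (radial_expr l i) (radial_expr l i) x) = ?L * w\<^sup>2"
      by (simp only: sum_distrib_left[symmetric] one)
    then show ?thesis by (simp add: grad_prod_def sum_Basis_vec power2_eq_square)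
  qed
  have step: "ev 0 x (radial_expr (Suc l) (i(Suc l := j))) = sqrt ?C2 * ((x \<bullet> axis j 1) * w * ?u i - ?c * (r * w * ?d i j))" for i j
  proof -
    have ul: "radial_expr l (i(Suc l := j)) = radial_expr l i" by (rule radial_expr_cong) auto
    have ul': "radial_expr (Suc k) (i(Suc (Suc k) := j)) = radial_expr (Suc k) i" using ul unfolding lk .
    show ?thesis unfolding lk radial_expr.simps Let_def ul' by (simp add: w_def r_def algebra_simps)
  qed
  have sq: "(\<Sum>j\<in>UNIV. (ev 0 x (radial_expr (Suc l) (i(Suc l := j))))\<^sup>2) = ?C2 * ((?u i)\<^sup>2 + ?c\<^sup>2 * r * (\<Sum>j\<in>UNIV. (?d i j)\<^sup>2))" for i
  proof -
    have "(ev 0 x (radial_expr (Suc l) (i(Suc l := j))))\<^sup>2 = ?C2 * ((w * w * (?u i)\<^sup>2) * ((x \<bullet> axis j 1) * (x \<bullet> axis j 1))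
       - (2 * ?c * r * w * w * ?u i) * ((x \<bullet> axis j 1) * ?d i j) + (?c\<^sup>2 * r * (r * w * w)) * (?d i j)\<^sup>2)" for j
      unfolding step power_mult_distrib using dpos by (simp add: power2_eq_square algebra_simps)
    then have "(\<Sum>j\<in>UNIV. (ev 0 x (radial_expr (Suc l) (i(Suc l := j))))\<^sup>2) = ?C2 * ((w * w * (?u i)\<^sup>2) * r
       - (2 * ?c * r * w * w * ?u i) * 0 + (?c\<^sup>2 * r * (r * w * w)) * (\<Sum>j\<in>UNIV. (?d i j)\<^sup>2))"
      by (simp only: sum_distrib_left[symmetric] sum.distrib sum_subtractf xx cross)
    also have "(w * w * (?u i)\<^sup>2) * r = (?u i)\<^sup>2 * (r * w * w)" by simp
    finally show ?thesis unfolding rw by (simp add: fun_upd_def)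
  qed
  have "(\<Sum>i\<in>{1..Suc l} \<rightarrow>\<^sub>E (UNIV::'m set). (ev 0 x (radial_expr (Suc l) i))\<^sup>2) = ?C2 * (1 + ?c\<^sup>2 * r * (?L * w\<^sup>2))"
    unfolding sum_PiE_Suc sq by (simp only: sum_distrib_left[symmetric] sum.distrib one grad)
  also have "?c\<^sup>2 * r * (?L * w\<^sup>2) = ?c\<^sup>2 * ?L * (r * w * w)" by (simp add: power2_eq_square)
  also have "?C2 * (1 + ?c\<^sup>2 * ?L * (r * w * w)) = 1"
  proof -
    have gen: "a / (a + b) * (1 + (1 / a)\<^sup>2 * (b * a) * 1) = 1" if "a > 0" "a + b > 0" for a b :: real
    proof -
      have 1: "(1 / a)\<^sup>2 * (b * a) * 1 = b / a" using that by (simp add: power2_eq_square)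
      have 2: "1 + b / a = (a + b) / a" using that by (simp add: add_divide_distrib)
      show ?thesis unfolding 1 2 using that by simp
    qed
    have "2 * real l + ?m - 2 = (real l + ?m - 2) + real l" by simp
    then show ?thesis unfolding rw using gen[of "real l + ?m - 2" "real l"] dpos by simp
  qed
  finally show ?case .
qed

section \<open>The map \<open>q\<close>\<close>

text \<open>The components of \<open>q_map\<close> with respect to the standard basis of $\mathbb{R}^{m^\ell}\times\mathbb{R}$; the basis
  vectors with vanishing first part belong to the constant component.\<close>

definition q_expr :: "nat \<Rightarrow> ('k::finite \<Rightarrow> nat \<Rightarrow> 'm::finite) \<Rightarrow> real \<Rightarrow> (real^'k) \<times> real \<Rightarrow> (real^'m) rexpr" where
  "q_expr l \<iota> \<alpha> b = (if fst b = 0 then Cst (cos \<alpha>) else Times (Cst (sin \<alpha>)) (radial_expr l (\<iota> (THE k. fst b = axis k 1))))"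

lemma q_expr_simps: "q_expr l \<iota> \<alpha> (axis k 1, 0) = Times (Cst (sin \<alpha>)) (radial_expr l (\<iota> k))" "q_expr l \<iota> \<alpha> (0, 1) = Cst (cos \<alpha>)"
proof -
  have "(THE j. axis k (1::real) = axis j 1) = k" by (rule the_equality) (auto simp: axis_eq_axis)
  then show "q_expr l \<iota> \<alpha> (axis k 1, 0) = Times (Cst (sin \<alpha>)) (radial_expr l (\<iota> k))"
    by (simp add: q_expr_def)
qed (simp add: q_expr_def)

lemma sum_Basis_q: "(\<Sum>b\<in>(Basis::((real^'k::finite) \<times> real) set). f b) = (\<Sum>k\<in>UNIV. f (axis k 1, 0)) + f (0, 1)"
proof -
  have B: "(Basis::((real^'k) \<times> real) set) = range (\<lambda>k. (axis k 1, 0)) \<union> {(0, 1)}"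
    by (auto simp: Basis_prod_def Basis_vec_def)
  have I: "inj (\<lambda>k::'k. (axis k (1::real), 0::real))" by (auto simp: inj_def axis_eq_axis)
  show ?thesis unfolding B by (subst sum.union_disjoint) (auto simp: sum.reindex[OF I] o_def)
qed

lemma Basis_q_cases:
  assumes "b \<in> (Basis::((real^'k::finite) \<times> real) set)"
  obtains k where "b = (axis k 1, 0)" | "b = (0, 1)"
  using assms by (auto simp: Basis_prod_def Basis_vec_def)

lemma q_map_vec_ev:
  fixes \<iota> :: "'k::finite \<Rightarrow> nat \<Rightarrow> 'm::finite"
  assumes l: "l \<ge> 1"
  shows "q_map l \<iota> \<alpha> = vec_ev 0 (q_expr l \<iota> \<alpha>)"
proof
  fix x :: "real^'m"
  have "vec_ev 0 (q_expr l \<iota> \<alpha>) x = (\<Sum>k\<in>UNIV. (sin \<alpha> * radial_proj l (\<iota> k) x) *\<^sub>R (axis k 1, 0)) + cos \<alpha> *\<^sub>R (0, 1)"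
    unfolding vec_ev_def sum_Basis_q q_expr_simps by (simp add: radial_proj_radial_expr[OF l])
  also have "\<dots> = (\<Sum>k\<in>UNIV. (sin \<alpha> * radial_proj l (\<iota> k) x) *\<^sub>R axis k 1, cos \<alpha>)"
    by (simp add: prod_eq_iff fst_sum snd_sum)
  also have "(\<Sum>k\<in>UNIV. (sin \<alpha> * radial_proj l (\<iota> k) x) *\<^sub>R axis k 1) = sin \<alpha> *\<^sub>R radial_proj_vec l \<iota> x"
    by (simp add: vec_eq_iff radial_proj_vec_def axis_def if_distrib sum.delta cong: if_cong)
  finally show "q_map l \<iota> \<alpha> x = vec_ev 0 (q_expr l \<iota> \<alpha>) x" by (simp add: q_map_def)
qed

lemma cone_map_q_expr:
  fixes \<iota> :: "'k::finite \<Rightarrow> nat \<Rightarrow> 'm::finite"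
  assumes m: "CARD('m) \<ge> 7" and l: "l \<ge> 1" and \<iota>: "multi_index_enum l \<iota>"
    and lam: "lam = real l * (real l + real CARD('m) - 2)" and g: "g = (sin \<alpha>)\<^sup>2 * lam"
    and b: "lam + 2 * real CARD('m) - 8 = 2 * g"
  shows "cone_map (q_expr l \<iota> \<alpha>) (\<lambda>b. if fst b = 0 then 0 else lam) g"
proof -
  have m3: "CARD('m) \<ge> 3" using m by simp
  note P = radial_expr_properties[OF m3 l]
  have unit: "(\<Sum>k\<in>UNIV. (ev 0 x (radial_expr l (\<iota> k)))\<^sup>2) = 1" if "x \<noteq> 0" for x
  proof -
    have "(\<Sum>k\<in>UNIV. (ev 0 x (radial_expr l (\<iota> k)))\<^sup>2) = (\<Sum>i\<in>{1..l} \<rightarrow>\<^sub>E UNIV. (ev 0 x (radial_expr l i))\<^sup>2)"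
      by (rule sum.reindex_bij_betw) (use \<iota> in \<open>simp add: multi_index_enum_def\<close>)
    then show ?thesis using radial_expr_unit[OF m3 l that] by simp
  qed
  have ax: "axis k (1::real) \<noteq> 0" for k :: 'k by (simp add: axis_eq_0_iff)
  show ?thesis
  proof
    fix b :: "(real^'k) \<times> real" assume b: "b \<in> Basis"
    show "homog 0 (q_expr l \<iota> \<alpha> b)"
      using b by (cases rule: Basis_q_cases) (auto simp: q_expr_simps intro: homog_scale P homog_simps)
    show "deg (q_expr l \<iota> \<alpha> b) \<ge> 0"
      using b by (cases rule: Basis_q_cases) (auto simp: q_expr_simps P)
    show "lap (q_expr l \<iota> \<alpha> b) x = - (if fst b = 0 then 0 else lam) * rinv x ^ 2 * ev 0 x (q_expr l \<iota> \<alpha> b)" if "x \<noteq> 0" for x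
      using b by (cases rule: Basis_q_cases) (simp_all add: q_expr_simps lap_scale lap_Cst P(3)[OF that] lam ax del: ev.simps(4))
    show "(if fst b = 0 then 0 else lam) = 0 \<or> (if fst b = 0 then 0 else lam) + 2 * real DIM(real^'m) - 8 = 2 * g"
      using assms(6) by simp
  next
    fix x :: "real^'m" assume x: "x \<noteq> 0"
    show "(\<Sum>b\<in>Basis. (ev 0 x (q_expr l \<iota> \<alpha> b))\<^sup>2) = 1"
      unfolding sum_Basis_q q_expr_simps ev.simps power_mult_distrib sum_distrib_left[symmetric] unit[OF x] by simp
    show "(\<Sum>b\<in>Basis. (if fst b = 0 then 0 else lam) * (ev 0 x (q_expr l \<iota> \<alpha> b))\<^sup>2) = g"
      unfolding sum_Basis_q q_expr_simps using unit[OF x]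
      by (simp add: ax power_mult_distrib sum_distrib_left[symmetric] g mult.commute del: ev.simps(4))
  qed (use m in simp)
qed

text \<open>The right-hand side of the hypothesis is the larger root of the quadratic polynomial
  $m^2-12(\ell(\ell+m-2)+2m-8)$ in $m$.\<close>

lemma dimension_bound:
  fixes m l :: real
  assumes l: "l \<ge> 1" and h: "m > 2 * (sqrt (12 * l\<^sup>2 + 30 * l + 12) + 3 * l + 6)"
  shows "m > 18" "12 * (l * (l + m - 2) + 2 * m - 8) < m\<^sup>2"
proof -
  define s where "s = sqrt (12 * l\<^sup>2 + 30 * l + 12)"
  have p: "0 \<le> 12 * l\<^sup>2 + 30 * l + 12" using l by simp
  have s: "s \<ge> 0" "s\<^sup>2 = 12 * l\<^sup>2 + 30 * l + 12" unfolding s_def using p by auto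
  have d: "m - 6 * l - 12 > 2 * s" using h by (simp add: s_def)
  show "m > 18" using d s l by linarith
  have "(2 * s)\<^sup>2 < (m - 6 * l - 12)\<^sup>2" by (rule power_strict_mono[OF d]) (use s in auto)
  then have "4 * (12 * l\<^sup>2 + 30 * l + 12) < (m - 6 * l - 12)\<^sup>2" by (simp add: power_mult_distrib s)
  then show "12 * (l * (l + m - 2) + 2 * m - 8) < m\<^sup>2" by (simp add: power2_eq_square algebra_simps)
qed

theorem theorem1p1:
  fixes m l :: nat
    and \<alpha> :: real
    and \<iota> :: "'k::finite \<Rightarrow> nat \<Rightarrow> 'm::finite"
  assumes "m = CARD('m)"
    and "m \<ge> 5"
    and "1 \<le> l" and "l \<le> m"
    and "multi_index_enum l \<iota>"
    and "0 < \<alpha>" and "\<alpha> < pi / 2"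
    and "(sin \<alpha>)\<^sup>2 = (real l * (real l + real m - 2) + 2 * real m - 8)
                       / (2 * real l * (real l + real m - 2))"
    and "real m > 2 * (sqrt (12 * (real l)\<^sup>2 + 30 * real l + 12) + 3 * real l + 6)"
  shows "proper_weak_biharmonic_map (ball 0 1) (q_map l \<iota> \<alpha>)
       \<and> strictly_stable (ball 0 1) (q_map l \<iota> \<alpha>)"
proof -
  define lam where "lam = real l * (real l + real m - 2)"
  define g where "g = (sin \<alpha>)\<^sup>2 * lam"
  have l1: "real l \<ge> 1" using assms(3) by simp
  note bd = dimension_bound[OF l1 assms(9)]
  have lam_pos: "lam > 0" unfolding lam_def using l1 bd(1) by (intro mult_pos_pos) auto
  have g2: "2 * g = lam + 2 * real m - 8"
  proof -
    have "(sin \<alpha>)\<^sup>2 = (lam + 2 * real m - 8) / (2 * lam)" using assms(8) by (simp add: lam_def mult.assoc)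
    then show ?thesis unfolding g_def using lam_pos by simp
  qed
  interpret q: cone_map "q_expr l \<iota> \<alpha>" "\<lambda>b. if fst b = 0 then 0 else lam" g
    by (rule cone_map_q_expr) (use assms bd(1) g2 in \<open>simp_all add: lam_def g_def\<close>)
  have q: "q_map l \<iota> \<alpha> = vec_ev 0 (q_expr l \<iota> \<alpha>)" by (rule q_map_vec_ev[OF assms(3)])
  have "\<not> harmonic_map (ball 0 1) (q_map l \<iota> \<alpha>)"
    unfolding q
  proof (rule q.not_harmonic_q[of "(0, 1)"])
    show "(0, 1) \<in> (Basis :: ((real^'k) \<times> real) set)" by (simp add: Basis_prod_def)
    show "g \<noteq> 0" using g2 lam_pos bd(1) by linarith
    have "cos \<alpha> > 0" using assms(6,7) by (intro cos_gt_zero_pi) auto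
    then show "ev 0 x (q_expr l \<iota> \<alpha> (0, 1)) \<noteq> 0" for x by (simp add: q_expr_simps)
  qed simp
  moreover have "strictly_stable (ball 0 1) (q_map l \<iota> \<alpha>)"
    unfolding q
  proof (rule q.strictly_stable_q)
    show "8 \<le> DIM(real^'m)" using bd(1) assms(1) by simp
    show "24 * g < (real DIM(real^'m))\<^sup>2" using bd(2) g2 assms(1) by (simp add: lam_def)
  qed
  ultimately show ?thesis
    using q.weak_biharmonic_q unfolding proper_weak_biharmonic_map_def q by blast
qed

end
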